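(* Let $B=(G,H)$ be a pseudo-Laman bigraph with set of biedges $\mathcal{E}$, without self-loops (i.e. neither $G$ nor $H$ has a self-loop). Let $\bar e\in\mathcal{E}$ be a fixed biedge. Then $$\operatorname{Lam}(B)=\operatorname{Lam}\bigl({}^{\{\bar e\}}B\bigr)+\operatorname{Lam}\bigl(B^{\{\bar e\}}\bigr)+\sum_{(\mathcal{M},\mathcal{N})}\operatorname{Lam}\bigl({}^{\mathcal{M}}B\bigr)\cdot\operatorname{Lam}\bigl(B^{\mathcal{N}}\bigr),$$ where the sum runs over all pairs $(\mathcal{M},\mathcal{N})$ of subsets of $\mathcal{E}$ satisfying: (i) $\mathcal{M}\cup\mathcal{N}=\mathcal{E}$; (ii) $\mathcal{M}\cap\mathcal{N}=\{\bar e\}$; (iii) $|\mathcal{M}|\ge 2$ and $|\mathcal{N}|\ge 2$; (iv) both ${}^{\mathcal{M}}B$ and $B^{\mathcal{N}}$ are pseudo-Laman.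
   Context: Graphs are finite and undirected, possibly disconnected, with multiple edges and self-loops allowed. A bigraph is a pair $B=(G,H)$ of graphs $G=(V,\mathcal{E})$, $H=(W,\mathcal{E})$ with the same set $\mathcal{E}$ of edges (called biedges), with maps $\tau_G\colon\mathcal{E}\to\mathcal{P}(V)$, $\tau_H\colon\mathcal{E}\to\mathcal{P}(W)$ assigning to each edge its set of endpoints (two elements, or one for a self-loop), together with total orders $\prec$ on $V$ and $W$. The dimension of a graph $G=(V,E)$ is $\dim(G)=|V|-|\{\text{connected components of }G\}|$. A bigraph is pseudo-Laman if $\dim(G)+\dim(H)=|\mathcal{E}|+1$. Let $L_G\subseteq\mathbb{C}^V$ be the subspace of vectors constant on each connected component of $G$, similarly $L_H\subseteq\mathbb{C}^W$; put $\mathbb{P}_{\mathbb{C}}^{\dim(G)-1}=\mathbb{P}(\mathbb{C}^V/L_G)$, $\mathbb{P}_{\mathbb{C}}^{\dim(H)-1}=\mathbb{P}(\mathbb{C}^W/L_H)$. The rational map associated to $B$ is $$f_B\colon\mathbb{P}_{\mathbb{C}}^{\dim(G)-1}\times\mathbb{P}_{\mathbb{C}}^{\dim(H)-1}\dashrightarrow\mathbb{P}_{\mathbb{C}}^{|\mathcal{E}|-1},\quad [(x_v)_{v\in V}],[(y_w)_{w\in W}]\mapsto\bigl((x_u-x_v)(y_t-y_w)\bigr)_{e\in\mathcal{E}},$$ where $\{u,v\}=\tau_G(e)$, $u\prec v$, $\{t,w\}=\tau_H(e)$, $t\prec w$; if $e$ is a self-loop in $G$ or $H$ the corresponding factor is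 $0$. The Laman number $\operatorname{Lam}(B)$ is $\deg(f_B)$ (the cardinality of a general fiber, a positive integer or $\infty$) if $f_B$ is dominant, and $0$ otherwise. For a graph $G=(V,E)$ and $E'\subseteq E$: the quotient $G/E'$ has as vertices the classes of vertices of $G$ under the relation "connected by a path with edges in $E'$", and as edges those of $E\setminus E'$, each $e$ with $\tau_G(e)=\{u,v\}$ joining the classes of $u$ and $v$ (possibly becoming a self-loop). The graph $G\setminus E'$ has edge set $E\setminus E'$ and as vertices exactly the endpoints of edges in $E\setminus E'$. For $\mathcal{M}\subseteq\mathcal{E}$ set ${}^{\mathcal{M}}B=(G/\mathcal{M},\,H\setminus\mathcal{M})$ and $B^{\mathcal{M}}=(G\setminus\mathcal{M},\,H/\mathcal{M})$, both with biedges $\mathcal{E}\setminus\mathcal{M}$ and with any fixed total orders on vertices.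
   Formalization: The bigraph is assumed to have at least two biedges: with a single biedge, Lam(B) = 1, the sum is empty, and the two remaining terms, both for bigraphs without biedges, are equal, so the formula would read 1 = a + a. *)

theory Defs
  imports "HOL-Analysis.Analysis" "HOL-Library.Extended_Nat"
begin

section \<open>Multigraphs\<close>

record ('v, 'e) mgraph =
  verts :: "'v set"
  edges :: "'e set"
  ends :: "'e \<Rightarrow> 'v set"

definition wf_mgraph :: "('v, 'e) mgraph \<Rightarrow> bool" where
  "wf_mgraph G \<longleftrightarrow> finite (verts G) \<and> finite (edges G) \<and>
     (\<forall>e\<in>edges G. ends G e \<subseteq> verts G \<and> card (ends G e) \<in> {1, 2})"

definition self_loop :: "('v, 'e) mgraph \<Rightarrow> 'e \<Rightarrow> bool" where
  "self_loop G e \<longleftrightarrow> card (ends G e) = 1"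

definition path_rel :: "('v, 'e) mgraph \<Rightarrow> 'e set \<Rightarrow> 'v rel" where
  "path_rel G F = {(u, v). \<exists>e\<in>F. ends G e = {u, v}}\<^sup>* \<inter> verts G \<times> verts G"

definition components :: "('v, 'e) mgraph \<Rightarrow> 'v set set" where
  "components G = verts G // path_rel G (edges G)"

definition gdim :: "('v, 'e) mgraph \<Rightarrow> nat" where
  "gdim G = card (verts G) - card (components G)"

definition quot_graph :: "('v, 'e) mgraph \<Rightarrow> 'e set \<Rightarrow> ('v set, 'e) mgraph" where
  "quot_graph G F =
     \<lparr>verts = verts G // path_rel G F,
      edges = edges G - F,
      ends = (\<lambda>e. (\<lambda>u. path_rel G F `` {u}) ` ends G e)\<rparr>"

definition del_graph :: "('v, 'e) mgraph \<Rightarrow> 'e set \<Rightarrow> ('v, 'e) mgraph" where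
  "del_graph G F =
     \<lparr>verts = (\<Union>e\<in>edges G - F. ends G e),
      edges = edges G - F,
      ends = ends G\<rparr>"


section \<open>Bigraphs\<close>

text \<open>A membership \<open>(u, v) \<in> lord B\<close> stands for \<open>u \<prec> v\<close>; the orders are strict.\<close>

record ('v, 'w, 'e) bigraph =
  lgraph :: "('v, 'e) mgraph"
  rgraph :: "('w, 'e) mgraph"
  lord :: "'v rel"
  rord :: "'w rel"

definition wf_bigraph :: "('v, 'w, 'e) bigraph \<Rightarrow> bool" where
  "wf_bigraph B \<longleftrightarrow>
     wf_mgraph (lgraph B) \<and> wf_mgraph (rgraph B) \<and>
     edges (lgraph B) = edges (rgraph B) \<and>
     strict_linear_order_on (verts (lgraph B)) (lord B) \<and>
     strict_linear_order_on (verts (rgraph B)) (rord B)"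

definition biedges :: "('v, 'w, 'e) bigraph \<Rightarrow> 'e set" where
  "biedges B = edges (lgraph B)"

definition pseudo_Laman :: "('v, 'w, 'e) bigraph \<Rightarrow> bool" where
  "pseudo_Laman B \<longleftrightarrow> gdim (lgraph B) + gdim (rgraph B) = card (biedges B) + 1"

text \<open>
  \<open>left_quot B M\<close> is the bigraph \<open>(G/M, H - M)\<close> and \<open>right_quot B M\<close> is \<open>(G - M, H/M)\<close>,
  where \<open>G - M\<close> drops the vertices that are not endpoints of a remaining edge.
  The last two arguments are the total orders chosen on the new sets of vertices.
\<close>

definition left_quot ::
  "('v, 'w, 'e) bigraph \<Rightarrow> 'e set \<Rightarrow> 'v set rel \<Rightarrow> 'w rel \<Rightarrow> ('v set, 'w, 'e) bigraph" where
  "left_quot B M r s =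
     \<lparr>lgraph = quot_graph (lgraph B) M, rgraph = del_graph (rgraph B) M, lord = r, rord = s\<rparr>"

definition right_quot ::
  "('v, 'w, 'e) bigraph \<Rightarrow> 'e set \<Rightarrow> 'v rel \<Rightarrow> 'w set rel \<Rightarrow> ('v, 'w set, 'e) bigraph" where
  "right_quot B M r s =
     \<lparr>lgraph = del_graph (lgraph B) M, rgraph = quot_graph (rgraph B) M, lord = r, rord = s\<rparr>"


section \<open>Projective spaces\<close>

text \<open>Vectors indexed by a finite set \<open>A\<close> are functions vanishing outside \<open>A\<close>.\<close>

definition cvec :: "'a set \<Rightarrow> ('a \<Rightarrow> complex) set" where
  "cvec A = {x. \<forall>a. a \<notin> A \<longrightarrow> x a = 0}"

text \<open>
  For a linear subspace \<open>L\<close> of \<open>cvec A\<close>, \<open>proj_space A L\<close> is the projective space of the quotient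
  vector space \<open>cvec A / L\<close>: two vectors outside \<open>L\<close> give the same point iff their classes modulo
  \<open>L\<close> are proportional.
\<close>

definition proj_rel :: "'a set \<Rightarrow> ('a \<Rightarrow> complex) set \<Rightarrow> ('a \<Rightarrow> complex) rel" where
  "proj_rel A L = {(x, x'). x \<in> cvec A - L \<and> x' \<in> cvec A - L \<and>
     (\<exists>c. c \<noteq> 0 \<and> (\<lambda>a. x' a - c * x a) \<in> L)}"

definition proj_space :: "'a set \<Rightarrow> ('a \<Rightarrow> complex) set \<Rightarrow> ('a \<Rightarrow> complex) set set" where
  "proj_space A L = (cvec A - L) // proj_rel A L"

definition proj_point ::
  "'a set \<Rightarrow> ('a \<Rightarrow> complex) set \<Rightarrow> ('a \<Rightarrow> complex) \<Rightarrow> ('a \<Rightarrow> complex) set" where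
  "proj_point A L x = proj_rel A L `` {x}"

definition zero_space :: "('a \<Rightarrow> complex) set" where
  "zero_space = {\<lambda>_. 0}"

text \<open>
  The homogeneous polynomial of degree \<open>d\<close> in variables indexed by \<open>A\<close> with coefficients \<open>c\<close>,
  evaluated at \<open>z\<close>. A monomial is given by its function of exponents.
\<close>

definition form :: "'a set \<Rightarrow> nat \<Rightarrow> (('a \<Rightarrow> nat) \<Rightarrow> complex) \<Rightarrow> ('a \<Rightarrow> complex) \<Rightarrow> complex" where
  "form A d c z =
     (\<Sum>m | (\<forall>a. a \<notin> A \<longrightarrow> m a = 0) \<and> (\<Sum>a\<in>A. m a) = d. c m * (\<Prod>a\<in>A. z a ^ m a))"

text \<open>
  The Zariski topology on the projective space with homogeneous coordinates indexed by the finite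
  set \<open>A\<close>, generated by the complements of the projective hypersurfaces.
\<close>

definition zariski :: "'a set \<Rightarrow> ('a \<Rightarrow> complex) set topology" where
  "zariski A = topology_generated_by
     {{p \<in> proj_space A zero_space. \<forall>z\<in>p. form A d c z \<noteq> 0} | d c. True}"


section \<open>The rational map of a bigraph and the Laman number\<close>

definition const_space :: "('v, 'e) mgraph \<Rightarrow> ('v \<Rightarrow> complex) set" where
  "const_space G = {x \<in> cvec (verts G). \<forall>(u, v)\<in>path_rel G (edges G). x u = x v}"

definition edge_diff :: "('v, 'e) mgraph \<Rightarrow> 'v rel \<Rightarrow> ('v \<Rightarrow> complex) \<Rightarrow> 'e \<Rightarrow> complex" where
  "edge_diff G r x e =
     (if self_loop G e then 0
      else (case THE (u, v). ends G e = {u, v} \<and> (u, v) \<in> r of (u, v) \<Rightarrow> x u - x v))"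

definition edge_products ::
  "('v, 'w, 'e) bigraph \<Rightarrow> ('v \<Rightarrow> complex) \<Rightarrow> ('w \<Rightarrow> complex) \<Rightarrow> 'e \<Rightarrow> complex" where
  "edge_products B x y e =
     (if e \<in> biedges B
      then edge_diff (lgraph B) (lord B) x e * edge_diff (rgraph B) (rord B) y e
      else 0)"

text \<open>
  The graph of the rational map \<open>f\<^sub>B\<close>, as a single-valued relation. Its domain consists of the
  pairs of points at which not all the coordinates \<open>edge_products\<close> vanish; neither dominance
  nor the cardinality of a general fiber depends on the choice of a dense open domain.
\<close>

definition laman_map ::
  "('v, 'w, 'e) bigraph \<Rightarrow>
     ((('v \<Rightarrow> complex) set \<times> ('w \<Rightarrow> complex) set) \<times> ('e \<Rightarrow> complex) set) set" where
  "laman_map B =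
     {((proj_point (verts (lgraph B)) (const_space (lgraph B)) x,
        proj_point (verts (rgraph B)) (const_space (rgraph B)) y),
       proj_point (biedges B) zero_space (edge_products B x y)) | x y.
        x \<in> cvec (verts (lgraph B)) - const_space (lgraph B) \<and>
        y \<in> cvec (verts (rgraph B)) - const_space (rgraph B) \<and>
        edge_products B x y \<notin> zero_space}"

definition fiber :: "('p \<times> 'q) set \<Rightarrow> 'q \<Rightarrow> 'p set" where
  "fiber f q = {p. (p, q) \<in> f}"

definition ecard :: "'a set \<Rightarrow> enat" where
  "ecard A = (if finite A then enat (card A) else \<infinity>)"

text \<open>
  A rational map has a nonempty domain of definition, so a map that is nowhere defined is not
  dominant. This only matters if there are no biedges, when source and target are both empty.
\<close>

definition dominant :: "('v, 'w, 'e) bigraph \<Rightarrow> bool" where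
  "dominant B \<longleftrightarrow> laman_map B \<noteq> {} \<and>
     zariski (biedges B) closure_of Range (laman_map B) = topspace (zariski (biedges B))"

definition map_degree :: "('v, 'w, 'e) bigraph \<Rightarrow> enat" where
  "map_degree B = (THE n. \<exists>U. openin (zariski (biedges B)) U \<and> U \<noteq> {} \<and>
     (\<forall>q\<in>U. ecard (fiber (laman_map B) q) = n))"

definition Lam :: "('v, 'w, 'e) bigraph \<Rightarrow> enat" where
  "Lam B = (if dominant B then map_degree B else 0)"

end

theory Submission
  imports Defs "HOL-Computational_Algebra.Polynomial"
begin

text \<open>
  A graph enters \<open>f\<^sub>B\<close> only through its cut space, the space of coboundaries of potentials, whose
  rank is the dimension of the graph; quotients and deletions of edges become contractions and
  restrictions. For subspaces \<open>U\<close> and \<open>W\<close> of \<open>cvec E\<close> with \<open>rk U + rk W = card E + 1\<close> one counts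
  the solutions of \<open>u f * w f = l f\<close> for all \<open>f \<in> E\<close>, normalised by \<open>u g = 1\<close>. For generic \<open>l\<close> this
  number is constant: the coordinates are algebraic over the components of the map, which makes it
  proper with invertible differential over generic points, so the solutions deform locally
  uniquely, and the count is a degree.

  The recursion comes from letting \<open>l\<close> tend to \<open>0\<close> at the distinguished edge \<open>e\<close> only, with generic
  values elsewhere. Solutions that stay bounded tend to solutions with \<open>u e = 0\<close> or \<open>w e = 0\<close>,
  counted by the two single terms. For the others, group the edges by the order of growth of \<open>u\<close>.
  Each group carries a solution of the equations in a minor of \<open>U\<close> and \<open>W\<close>, which for generic \<open>l\<close>
  requires a rank of at least the number of edges plus one; as the ranks of the minors add up, there are
  exactly two groups \<open>A\<close> and \<open>B\<close>, both of exact rank. Conversely, each pair of solutions in the two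
  minors is the limit of exactly one branch of solutions, whence the products. In the theorem,
  \<open>\<M> = B \<union> {e}\<close> and \<open>\<N> = A \<union> {e}\<close>.
\<close>

section \<open>Linear subspaces of coordinate spaces\<close>

text \<open>Orders of growth replace valuations: along a subsequence any two coordinates of
  \<open>u\<close> have a ratio tending to 0, to a nonzero limit or to infinity. There are finitely
  many minors, so one \<open>l\<close> off \<open>e\<close> is generic for all of them, and the
  exceptional values at \<open>e\<close> over it are finite in number and can be avoided on the way
  to 0.

  The obstacle is \<open>e\<close> itself, since no fixed equation controls \<open>u e\<close> and
  \<open>w e\<close>. In the case of two groups, let \<open>u\<close> be large on \<open>A\<close>
  and small on \<open>B\<close>. Exact ranks force \<open>e\<close> into the closure of
  \<open>B\<close> for \<open>U\<close> and into the closure of \<open>A\<close> for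
  \<open>W\<close>: a vector of \<open>U\<close> that vanishes on \<open>B\<close> vanishes at
  \<open>e\<close>, and likewise for \<open>W\<close> and \<open>A\<close>. This is why
  \<open>e\<close> belongs to both \<M> and \<N>. Consequently \<open>u e\<close> has the size of
  \<open>u\<close> on \<open>B\<close> and \<open>w e\<close> the size of \<open>w\<close> on
  \<open>A\<close>, so if \<open>s\<close> is the ratio of the two sizes of \<open>u\<close>, the
  product at \<open>e\<close> is a nonzero multiple of \<open>s\<close> up to higher order. The
  equation at \<open>e\<close> therefore determines \<open>s\<close> simply, and each pair of limits
  counts once.\<close>

definition subsp :: "('a \<Rightarrow> complex) set \<Rightarrow> bool" where
  "subsp U \<longleftrightarrow> (\<lambda>_. 0) \<in> U \<and> (\<forall>u\<in>U. \<forall>v\<in>U. (\<lambda>a. u a + v a) \<in> U) \<and>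
     (\<forall>c. \<forall>u\<in>U. (\<lambda>a. c * u a) \<in> U)"

lemma subsp_zero: "subsp U \<Longrightarrow> (\<lambda>_. 0) \<in> U"
  and subsp_add: "subsp U \<Longrightarrow> u \<in> U \<Longrightarrow> v \<in> U \<Longrightarrow> (\<lambda>a. u a + v a) \<in> U"
  and subsp_scale: "subsp U \<Longrightarrow> u \<in> U \<Longrightarrow> (\<lambda>a. c * u a) \<in> U"
  by (auto simp: subsp_def)

lemma subsp_diff:
  assumes "subsp U" "u \<in> U" "v \<in> U"
  shows "(\<lambda>a. u a - v a) \<in> U"
  using subsp_add[OF assms(1,2) subsp_scale[OF assms(1,3), of "-1"]] by simp

lemma subsp_sum:
  assumes "subsp U" "\<And>j. j \<in> J \<Longrightarrow> v j \<in> U"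
  shows "(\<lambda>a. \<Sum>j\<in>J. c j * v j a) \<in> U"
proof (cases "finite J")
  case True
  then show ?thesis using assms(2)
  proof (induction J rule: finite_induct)
    case empty
    then show ?case using subsp_zero[OF assms(1)] by simp
  next
    case (insert j J)
    have "(\<lambda>a. c j * v j a + (\<Sum>j\<in>J. c j * v j a)) \<in> U"
      by (rule subsp_add[OF assms(1)]) (use insert subsp_scale[OF assms(1)] in auto)
    then show ?case using insert by simp
  qed
qed (use subsp_zero[OF assms(1)] in simp)

lemma subsp_cvec: "subsp (cvec A)"
  by (auto simp: subsp_def cvec_def)

text \<open>Gaussian elimination, by induction on the equations: one with a nonzero coefficient at
  \<open>p\<close> is used to remove the unknown \<open>p\<close> from the others.\<close>

lemma homogeneous_system:
  fixes a :: "'k \<Rightarrow> 'i \<Rightarrow> 'f::field"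
  assumes "finite K" "finite I" "card K < card I"
  shows "\<exists>c. (\<exists>i\<in>I. c i \<noteq> 0) \<and> (\<forall>k\<in>K. (\<Sum>i\<in>I. a k i * c i) = 0)"
  using assms
proof (induction K arbitrary: I a rule: finite_induct)
  case empty
  then obtain i where "i \<in> I" by fastforce
  then show ?case by (intro exI[of _ "\<lambda>_. 1"]) auto
next
  case (insert k K)
  show ?case
  proof (cases "\<forall>i\<in>I. a k i = 0")
    case True
    obtain c where c: "\<exists>i\<in>I. c i \<noteq> 0" "\<forall>k\<in>K. (\<Sum>i\<in>I. a k i * c i) = 0"
      using insert.IH[OF \<open>finite I\<close>, of a] insert.prems insert.hyps by (metis card_insert_disjoint Suc_lessD)
    then show ?thesis using True by (intro exI[of _ c]) auto
  next
    case False
    then obtain p where p: "p \<in> I" "a k p \<noteq> 0" by blast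
    \<comment> \<open>Row \<open>l\<close> minus the multiple of row \<open>k\<close> that cancels
      its entry in column \<open>p\<close>.\<close>
    define a' where "a' l i = a l i - a l p * a k i / a k p" for l i
    have "card K < card (I - {p})" using insert p by simp
    then obtain c where c: "\<exists>i\<in>I-{p}. c i \<noteq> 0" "\<forall>l\<in>K. (\<Sum>i\<in>I-{p}. a' l i * c i) = 0"
      using insert.IH[of "I - {p}" a'] insert.prems(1) by (metis finite_Diff)
    define cp where "cp = - (\<Sum>i\<in>I-{p}. a k i * c i) / a k p"
    have *: "(\<Sum>i\<in>I. a l i * (c(p := cp)) i) = a l p * cp + (\<Sum>i\<in>I-{p}. a l i * c i)" for l
      using p \<open>finite I\<close> by (subst sum.remove[of _ p]) auto
    have "(\<Sum>i\<in>I. a l i * (c(p := cp)) i) = 0" if "l \<in> insert k K" for l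
    proof (cases "l = k")
      case True
      then show ?thesis unfolding * using p by (simp add: cp_def)
    next
      case False
      then have "(\<Sum>i\<in>I-{p}. a' l i * c i) = 0" using c that by auto
      also have "(\<Sum>i\<in>I-{p}. a' l i * c i) =
          (\<Sum>i\<in>I-{p}. a l i * c i) - (\<Sum>i\<in>I-{p}. a l p / a k p * (a k i * c i))"
        unfolding a'_def sum_subtractf[symmetric] by (intro sum.cong) (auto simp: field_simps)
      also have "(\<Sum>i\<in>I-{p}. a l p / a k p * (a k i * c i)) = a l p / a k p * (\<Sum>i\<in>I-{p}. a k i * c i)"
        by (rule sum_distrib_left[symmetric])
      finally show ?thesis unfolding * by (simp add: cp_def)
    qed
    moreover have "\<exists>i\<in>I. (c(p := cp)) i \<noteq> 0" using c by auto
    ultimately show ?thesis by blast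
  qed
qed

text \<open>A basis in the matroid sense: a set of coordinates that parametrizes the subspace.\<close>

definition is_basis :: "('a \<Rightarrow> complex) set \<Rightarrow> 'a set \<Rightarrow> bool" where
  "is_basis U I \<longleftrightarrow> finite I \<and> (\<forall>x. \<exists>u\<in>U. \<forall>i\<in>I. u i = x i) \<and>
     (\<forall>u\<in>U. (\<forall>i\<in>I. u i = 0) \<longrightarrow> u = (\<lambda>_. 0))"

text \<open>The dimension of \<open>U\<close>: every basis has the same cardinality by
  \<open>rk_eq_card\<close>.\<close>

definition rk :: "('a \<Rightarrow> complex) set \<Rightarrow> nat" where
  "rk U = card (SOME I. is_basis U I)"

text \<open>If \<open>I\<close> is a basis, these vectors for \<open>i\<close> in \<open>I\<close>
  form the linear basis of \<open>U\<close> dual to the coordinates in \<open>I\<close>; they turn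
  the coordinate condition \<open>is_basis\<close> into linear algebra.\<close>

definition dualb :: "('a \<Rightarrow> complex) set \<Rightarrow> 'a set \<Rightarrow> 'a \<Rightarrow> 'a \<Rightarrow> complex" where
  "dualb U I i = (SOME u. u \<in> U \<and> (\<forall>j\<in>I. u j = (if j = i then 1 else 0)))"

lemma is_basis_zero: "is_basis U I \<Longrightarrow> u \<in> U \<Longrightarrow> (\<And>i. i \<in> I \<Longrightarrow> u i = 0) \<Longrightarrow> u = (\<lambda>_. 0)"
  by (auto simp: is_basis_def)

lemma is_basis_finite: "is_basis U I \<Longrightarrow> finite I"
  by (auto simp: is_basis_def)

lemma dualb:
  assumes "is_basis U I"
  shows "dualb U I i \<in> U" "j \<in> I \<Longrightarrow> dualb U I i j = (if j = i then 1 else 0)"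
proof -
  have "\<exists>u. u \<in> U \<and> (\<forall>j\<in>I. u j = (if j = i then 1 else 0))"
    using assms[unfolded is_basis_def, THEN conjunct2, THEN conjunct1, rule_format, of "\<lambda>j. if j = i then 1 else 0"]
    by blast
  from someI_ex[OF this] show "dualb U I i \<in> U" "j \<in> I \<Longrightarrow> dualb U I i j = (if j = i then 1 else 0)"
    by (auto simp: dualb_def)
qed

lemma is_basis_eqI:
  assumes "subsp U" "is_basis U I" "u \<in> U" "v \<in> U" "\<And>i. i \<in> I \<Longrightarrow> u i = v i"
  shows "u = v"
proof -
  have "(\<lambda>a. u a - v a) = (\<lambda>_. 0)"
    by (rule is_basis_zero[OF assms(2) subsp_diff[OF assms(1,3,4)]]) (use assms(5) in auto)
  then show ?thesis by (simp add: fun_eq_iff)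
qed

lemma dualb_sum_coord:
  assumes "is_basis U I" "j \<in> I"
  shows "(\<Sum>i\<in>I. x i * dualb U I i j) = x j"
proof -
  have "(\<Sum>i\<in>I. x i * dualb U I i j) = (\<Sum>i\<in>I. if i = j then x i else 0)"
    using assms by (intro sum.cong) (auto simp: dualb(2)[OF assms(1)])
  then show ?thesis using assms by (simp add: is_basis_finite)
qed

lemma dualb_expand:
  assumes "subsp U" "is_basis U I" "u \<in> U"
  shows "u a = (\<Sum>i\<in>I. u i * dualb U I i a)"
proof -
  have "u = (\<lambda>a. \<Sum>i\<in>I. u i * dualb U I i a)"
    by (rule is_basis_eqI[OF assms(1,2,3)])
       (use assms dualb_sum_coord[OF assms(2)] dualb[OF assms(2)] in \<open>auto intro!: subsp_sum\<close>)
  then show ?thesis by (rule fun_cong)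
qed

lemma dualb_sum_in:
  assumes "subsp U" "is_basis U I"
  shows "(\<lambda>a. \<Sum>i\<in>I. x i * dualb U I i a) \<in> U"
  by (rule subsp_sum[OF assms(1)]) (rule dualb(1)[OF assms(2)])

text \<open>A combination vanishes as soon as it vanishes on the coordinates in \<open>I\<close>:
  these are \<open>card I\<close> linear equations in \<open>card J\<close> unknowns.\<close>

lemma dependent_family:
  assumes "subsp U" "is_basis U I" "finite J" "card I < card J" "\<And>j. j \<in> J \<Longrightarrow> v j \<in> U"
  shows "\<exists>c. (\<exists>j\<in>J. c j \<noteq> 0) \<and> (\<lambda>a. \<Sum>j\<in>J. c j * v j a) = (\<lambda>_. 0)"
proof -
  obtain c where c: "\<exists>j\<in>J. c j \<noteq> 0" "\<forall>i\<in>I. (\<Sum>j\<in>J. v j i * c j) = 0"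
    using homogeneous_system[of I J "\<lambda>i j. v j i"] assms is_basis_finite[OF assms(2)] by blast
  have "(\<lambda>a. \<Sum>j\<in>J. c j * v j a) = (\<lambda>_. 0)"
    by (rule is_basis_zero[OF assms(2) subsp_sum[OF assms(1)]])
       (use c assms in \<open>auto simp: mult.commute\<close>)
  with c show ?thesis by blast
qed

definition lin :: "(('a \<Rightarrow> complex) \<Rightarrow> ('b \<Rightarrow> complex)) \<Rightarrow> bool" where
  "lin T \<longleftrightarrow> (\<forall>u v. T (\<lambda>a. u a + v a) = (\<lambda>b. T u b + T v b)) \<and> (\<forall>c u. T (\<lambda>a. c * u a) = (\<lambda>b. c * T u b))"

lemma lin_zero: "lin T \<Longrightarrow> T (\<lambda>_. 0) = (\<lambda>_. 0)"
proof -
  assume "lin T"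
  then have "\<And>u. T (\<lambda>a. 0 * u a) = (\<lambda>b. 0 * T u b)" unfolding lin_def by blast
  from this[of "\<lambda>_. 0"] show ?thesis by simp
qed

lemma lin_sum:
  assumes "lin T"
  shows "T (\<lambda>a. \<Sum>j\<in>J. c j * v j a) = (\<lambda>b. \<Sum>j\<in>J. c j * T (v j) b)"
proof (cases "finite J")
  case True
  then show ?thesis
  proof (induction J rule: finite_induct)
    case empty
    then show ?case using lin_zero[OF assms] by simp
  next
    case (insert j J)
    then have "T (\<lambda>a. c j * v j a + (\<Sum>j\<in>J. c j * v j a)) = (\<lambda>b. c j * T (v j) b + (\<Sum>j\<in>J. c j * T (v j) b))"
      using assms unfolding lin_def by auto
    then show ?case using insert by simp
  qed
qed (use lin_zero[OF assms] in simp)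

lemma lin_inj_card_le:
  assumes "lin T" "subsp U" "is_basis U I" "subsp V" "is_basis V J"
    "T ` U \<subseteq> V" "\<And>u. u \<in> U \<Longrightarrow> T u = (\<lambda>_. 0) \<Longrightarrow> u = (\<lambda>_. 0)"
  shows "card I \<le> card J"
proof (rule ccontr)
  assume "\<not> card I \<le> card J"
  then obtain c where c: "\<exists>i\<in>I. c i \<noteq> 0" "(\<lambda>a. \<Sum>i\<in>I. c i * T (dualb U I i) a) = (\<lambda>_. 0)"
    using dependent_family[OF assms(4,5) is_basis_finite[OF assms(3)], of "\<lambda>i. T (dualb U I i)"]
      assms(6) dualb(1)[OF assms(3)] by fastforce
  have "T (\<lambda>a. \<Sum>i\<in>I. c i * dualb U I i a) = (\<lambda>_. 0)"
    unfolding lin_sum[OF assms(1)] by (rule c(2))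
  then have "(\<lambda>a. \<Sum>i\<in>I. c i * dualb U I i a) = (\<lambda>_. 0)"
    by (intro assms(7) dualb_sum_in[OF assms(2,3)])
  then have "c j = 0" if "j \<in> I" for j
    using dualb_sum_coord[OF assms(3) that, of c] by (metis)
  then show False using c(1) by blast
qed

text \<open>A dependence between preimages of the dual basis of \<open>V\<close> would map to a
  dependence of the dual basis itself.\<close>

lemma lin_surj_card_le:
  assumes "lin T" "subsp U" "is_basis U I" "is_basis V J" "V \<subseteq> T ` U"
  shows "card J \<le> card I"
proof (rule ccontr)
  assume less: "\<not> card J \<le> card I"
  have "\<exists>v. \<forall>j. v j \<in> U \<and> T (v j) = dualb V J j"
    using assms(5) dualb(1)[OF assms(4)] by (intro choice allI) (metis subsetD imageE)
  then obtain v where v: "\<And>j. v j \<in> U" "\<And>j. T (v j) = dualb V J j" by blast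
  obtain c where c: "\<exists>j\<in>J. c j \<noteq> 0" "(\<lambda>a. \<Sum>j\<in>J. c j * v j a) = (\<lambda>_. 0)"
    using dependent_family[OF assms(2,3) is_basis_finite[OF assms(4)], of v] v(1) less by force
  have "(\<lambda>b. \<Sum>j\<in>J. c j * dualb V J j b) = (\<lambda>_. 0)"
    using lin_sum[OF assms(1), of c v J] unfolding c(2) lin_zero[OF assms(1)] v(2) by simp
  then have "c j = 0" if "j \<in> J" for j
    using dualb_sum_coord[OF assms(4) that, of c] by metis
  then show False using c(1) by blast
qed

lemma rk_eq_card:
  assumes "subsp U" "is_basis U I"
  shows "rk U = card I"
proof -
  have *: "is_basis U (SOME I. is_basis U I)" using assms(2) by (rule someI)
  have "lin (\<lambda>u::'a \<Rightarrow> complex. u)" by (simp add: lin_def)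
  then show ?thesis
    unfolding rk_def
    using lin_inj_card_le[OF _ assms(1) * assms] lin_inj_card_le[OF _ assms assms(1) *]
    by (intro antisym) auto
qed

section \<open>Restriction and contraction\<close>

definition rst :: "'a set \<Rightarrow> ('a \<Rightarrow> complex) \<Rightarrow> 'a \<Rightarrow> complex" where
  "rst Y u = (\<lambda>a. if a \<in> Y then u a else 0)"

text \<open>Contraction by \<open>Z\<close> followed by restriction to \<open>Y\<close>.\<close>

definition minr :: "('a \<Rightarrow> complex) set \<Rightarrow> 'a set \<Rightarrow> 'a set \<Rightarrow> ('a \<Rightarrow> complex) set" where
  "minr U Z Y = rst Y ` {u \<in> U. \<forall>f\<in>Z. u f = 0}"

lemma rst_in [simp]: "a \<in> Y \<Longrightarrow> rst Y u a = u a"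
  and rst_notin [simp]: "a \<notin> Y \<Longrightarrow> rst Y u a = 0"
  by (auto simp: rst_def)

lemma rst_cvec: "u \<in> cvec Y \<Longrightarrow> rst Y u = u"
  by (auto simp: rst_def cvec_def)

lemma rst_in_cvec: "rst Y u \<in> cvec Y"
  by (auto simp: rst_def cvec_def)

lemma lin_rst: "lin (rst Y)"
  by (auto simp: lin_def rst_def)

lemma minr_cvec: "minr U Z Y \<subseteq> cvec Y"
  by (auto simp: minr_def rst_in_cvec)

lemma minrI: "u \<in> U \<Longrightarrow> (\<And>f. f \<in> Z \<Longrightarrow> u f = 0) \<Longrightarrow> rst Y u \<in> minr U Z Y"
  by (auto simp: minr_def)

lemma minr_self: "U \<subseteq> cvec E \<Longrightarrow> minr U {} E = U"
  by (force simp: minr_def rst_cvec subset_iff)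

lemma subsp_minr:
  assumes "subsp U"
  shows "subsp (minr U Z Y)"
proof -
  have "rst Y (\<lambda>_. 0) \<in> minr U Z Y"
    using subsp_zero[OF assms] by (intro minrI) auto
  moreover have "(\<lambda>a. u a + v a) \<in> minr U Z Y" if uv: "u \<in> minr U Z Y" "v \<in> minr U Z Y" for u v
  proof -
    obtain u' v' where "u = rst Y u'" "v = rst Y v'" "u' \<in> U" "v' \<in> U" "\<forall>f\<in>Z. u' f = 0" "\<forall>f\<in>Z. v' f = 0"
      using uv by (auto simp: minr_def)
    then show ?thesis using minrI[OF subsp_add[OF assms, of u' v'], of Z Y] lin_rst[of Y]
      by (auto simp: lin_def)
  qed
  moreover have "(\<lambda>a. c * u a) \<in> minr U Z Y" if u: "u \<in> minr U Z Y" for c u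
  proof -
    obtain u' where "u = rst Y u'" "u' \<in> U" "\<forall>f\<in>Z. u' f = 0"
      using u by (auto simp: minr_def)
    then show ?thesis using minrI[OF subsp_scale[OF assms, of u' c], of Z Y] lin_rst[of Y]
      by (auto simp: lin_def)
  qed
  ultimately show ?thesis by (auto simp: subsp_def lin_zero[OF lin_rst])
qed

text \<open>A basis of the restriction to \<open>Y2\<close> and one of the contraction by
  \<open>Y2\<close> combine. Values on \<open>K\<close> are prescribed first; the values on
  \<open>J\<close> are then corrected by a vector that vanishes on \<open>Y2\<close>, which leaves
  \<open>K\<close> untouched.\<close>

lemma is_basis_union:
  assumes "subsp U"
    and J: "is_basis (minr U (Z \<union> Y2) Y1) J" "J \<subseteq> Y1"
    and K: "is_basis (minr U Z Y2) K" "K \<subseteq> Y2"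
    and disj: "Y1 \<inter> Y2 = {}"
  shows "is_basis (minr U Z (Y1 \<union> Y2)) (J \<union> K)"
  unfolding is_basis_def
proof (intro conjI allI ballI impI)
  show "finite (J \<union> K)" using J K by (simp add: is_basis_finite)
next
  fix x :: "'a \<Rightarrow> complex"
  obtain u0 where "u0 \<in> minr U Z Y2" "\<forall>i\<in>K. u0 i = x i"
    using K(1) unfolding is_basis_def by meson
  then obtain u where u: "u \<in> U" "\<forall>f\<in>Z. u f = 0" "\<forall>i\<in>K. u i = x i"
    using K(2) by (auto simp: minr_def subset_iff)
  have "\<exists>v\<in>minr U (Z \<union> Y2) Y1. \<forall>i\<in>J. v i = x i - u i"
    using J(1)[unfolded is_basis_def, THEN conjunct2, THEN conjunct1, rule_format, of "\<lambda>i. x i - u i"] .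
  then obtain v0 where "v0 \<in> minr U (Z \<union> Y2) Y1" "\<forall>i\<in>J. v0 i = x i - u i"
    by blast
  then obtain v where v: "v \<in> U" "\<forall>f\<in>Z \<union> Y2. v f = 0" "\<forall>i\<in>J. v i = x i - u i"
    using J(2) by (auto simp: minr_def subset_iff)
  have "rst (Y1 \<union> Y2) (\<lambda>a. u a + v a) \<in> minr U Z (Y1 \<union> Y2)"
    using u v by (intro minrI subsp_add[OF assms(1)]) auto
  moreover have "rst (Y1 \<union> Y2) (\<lambda>a. u a + v a) i = x i" if "i \<in> J \<union> K" for i
    using that u v J(2) K(2) by auto
  ultimately show "\<exists>w\<in>minr U Z (Y1 \<union> Y2). \<forall>i\<in>J \<union> K. w i = x i" by blast
next
  fix w assume "w \<in> minr U Z (Y1 \<union> Y2)" and w0: "\<forall>i\<in>J \<union> K. w i = 0"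
  then obtain u where u: "w = rst (Y1 \<union> Y2) u" "u \<in> U" "\<forall>f\<in>Z. u f = 0"
    by (auto simp: minr_def)
  have u0: "u i = 0" if "i \<in> J \<union> K" for i
    using w0 that J(2) K(2) unfolding u(1) by (metis Un_iff rst_in subsetD)
  have "rst Y2 u = (\<lambda>_. 0)"
    by (rule is_basis_zero[OF K(1)]) (use u u0 K(2) in \<open>auto intro!: minrI simp: subset_iff\<close>)
  then have u2: "\<forall>f\<in>Y2. u f = 0" by (metis rst_in)
  have "rst Y1 u = (\<lambda>_. 0)"
    by (rule is_basis_zero[OF J(1)]) (use u u2 u0 J(2) in \<open>auto intro!: minrI simp: subset_iff\<close>)
  then have "\<forall>f\<in>Y1. u f = 0" by (metis rst_in)
  with u2 u(1) show "w = (\<lambda>_. 0)" by (auto simp: rst_def fun_eq_iff)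
qed

lemma is_basis_singleton:
  assumes "subsp U" "U \<subseteq> cvec {a}"
  shows "if \<exists>u\<in>U. u a \<noteq> 0 then is_basis U {a} else is_basis U {}"
proof (cases "\<exists>u\<in>U. u a \<noteq> 0")
  case True
  then obtain u where u: "u \<in> U" "u a \<noteq> 0" by blast
  have "\<exists>v\<in>U. v a = x a" for x :: "'a \<Rightarrow> complex"
    using subsp_scale[OF assms(1) u(1), of "x a / u a"] u(2)
    by (intro bexI[of _ "\<lambda>b. x a / u a * u b"]) auto
  moreover have "v = (\<lambda>_. 0)" if "v \<in> U" "v a = 0" for v
    using that assms(2) by (force simp: cvec_def fun_eq_iff)
  ultimately show ?thesis using True by (auto simp: is_basis_def)
next
  case False
  then have "u = (\<lambda>_. 0)" if "u \<in> U" for u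
    using that assms(2) by (force simp: cvec_def fun_eq_iff)
  then show ?thesis using False subsp_zero[OF assms(1)] by (auto simp: is_basis_def)
qed

lemma minr_empty: "minr U Z {} \<subseteq> {\<lambda>_. 0}"
  by (auto simp: minr_def rst_def)

lemma is_basis_empty:
  assumes "subsp U" "U \<subseteq> {\<lambda>_. 0}"
  shows "is_basis U {}"
  using assms subsp_zero[OF assms(1)] by (auto simp: is_basis_def)

text \<open>Coordinates are added one at a time: \<open>a\<close> joins the basis exactly when some
  vector that vanishes on \<open>Z\<close> and \<open>Y\<close> does not vanish at
  \<open>a\<close>.\<close>

lemma basis_exists:
  assumes "finite Y" "subsp U"
  shows "\<exists>I\<subseteq>Y. is_basis (minr U Z Y) I"
  using assms
proof (induction Y arbitrary: Z rule: finite_induct)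
  case empty
  then show ?case using is_basis_empty[OF subsp_minr minr_empty] by auto
next
  case (insert a Y)
  obtain K where K: "K \<subseteq> Y" "is_basis (minr U Z Y) K" using insert by blast
  have "\<exists>J\<subseteq>{a}. is_basis (minr U (Z \<union> Y) {a}) J"
    using is_basis_singleton[OF subsp_minr[OF insert.prems] minr_cvec]
    by (metis empty_subsetI subset_refl)
  then obtain J where J: "J \<subseteq> {a}" "is_basis (minr U (Z \<union> Y) {a}) J" by blast
  have "is_basis (minr U Z ({a} \<union> Y)) (J \<union> K)"
    by (rule is_basis_union) (use insert J K in auto)
  then show ?case using J K by (intro exI[of _ "J \<union> K"]) auto
qed

lemma basis_existsE:
  assumes "finite E" "subsp U" "U \<subseteq> cvec E"
  obtains I where "I \<subseteq> E" "is_basis U I"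
  using basis_exists[OF assms(1,2), of "{}"] minr_self[OF assms(3)] by auto

text \<open>The rank of a matroid is the rank of a restriction plus that of the complementary
  contraction. The rank counts below come from this identity and
  \<open>rk_minr_single\<close>.\<close>

lemma rk_minr_add:
  assumes "finite Y1" "finite Y2" "Y1 \<inter> Y2 = {}" "subsp U"
  shows "rk (minr U Z (Y1 \<union> Y2)) = rk (minr U (Z \<union> Y2) Y1) + rk (minr U Z Y2)"
proof -
  obtain J where J: "J \<subseteq> Y1" "is_basis (minr U (Z \<union> Y2) Y1) J" using basis_exists assms by meson
  obtain K where K: "K \<subseteq> Y2" "is_basis (minr U Z Y2) K" using basis_exists assms by meson
  have "is_basis (minr U Z (Y1 \<union> Y2)) (J \<union> K)"
    by (rule is_basis_union) (use assms J K in auto)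
  moreover have "card (J \<union> K) = card J + card K"
    using J K assms by (intro card_Un_disjoint) (auto dest: finite_subset)
  ultimately show ?thesis
    using J K assms by (simp add: rk_eq_card subsp_minr)
qed

lemma rk_minr_single:
  assumes "subsp U"
  shows "rk (minr U Z {a}) = (if \<exists>u\<in>U. (\<forall>f\<in>Z. u f = 0) \<and> u a \<noteq> 0 then 1 else 0)"
proof -
  have eq: "(\<exists>u\<in>minr U Z {a}. u a \<noteq> 0) \<longleftrightarrow> (\<exists>u\<in>U. (\<forall>f\<in>Z. u f = 0) \<and> u a \<noteq> 0)"
    by (auto simp: minr_def)
  show ?thesis
    using is_basis_singleton[OF subsp_minr[OF assms, of Z "{a}"] minr_cvec]
      rk_eq_card[OF subsp_minr[OF assms, of Z "{a}"]]
    unfolding eq by (auto split: if_splits)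
qed

text \<open>The normalisation \<open>u g = 1\<close> needs a parametrisation in which
  \<open>g\<close> is one of the coordinates.\<close>

lemma basis_containing:
  assumes "finite Y" "subsp U" "g \<in> Y" "u \<in> U" "\<And>f. f \<in> Z \<Longrightarrow> u f = 0" "u g \<noteq> 0"
  shows "\<exists>I\<subseteq>Y. g \<in> I \<and> is_basis (minr U Z Y) I"
proof -
  have "(\<exists>u\<in>minr U Z {g}. u g \<noteq> 0)"
    using assms by (auto simp: minr_def)
  then have K: "is_basis (minr U Z {g}) {g}"
    using is_basis_singleton[OF subsp_minr[OF assms(2)] minr_cvec, of Z g] by auto
  obtain J where J: "J \<subseteq> Y - {g}" "is_basis (minr U (Z \<union> {g}) (Y - {g})) J"
    using basis_exists[of "Y - {g}"] assms by (meson finite_Diff)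
  have "is_basis (minr U Z ((Y - {g}) \<union> {g})) (J \<union> {g})"
    by (rule is_basis_union) (use assms J K in auto)
  moreover have "(Y - {g}) \<union> {g} = Y" using assms by auto
  ultimately show ?thesis using J assms by (intro exI[of _ "J \<union> {g}"]) auto
qed

text \<open>Finite-dimensional subspaces are closed: the expansion in the dual vectors passes to the
  pointwise limit.\<close>

lemma subsp_limit:
  assumes "finite I" "subsp U" "is_basis U I" "\<And>n. u n \<in> U" "\<And>a. (\<lambda>n. u n a) \<longlonglongrightarrow> l a"
  shows "l \<in> U"
proof -
  have "l = (\<lambda>a. \<Sum>i\<in>I. l i * dualb U I i a)"
  proof
    fix a
    have "(\<lambda>n. \<Sum>i\<in>I. u n i * dualb U I i a) \<longlonglongrightarrow> (\<Sum>i\<in>I. l i * dualb U I i a)"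
      by (intro tendsto_intros assms(5))
    moreover have "(\<lambda>n. \<Sum>i\<in>I. u n i * dualb U I i a) = (\<lambda>n. u n a)"
      using dualb_expand[OF assms(2,3,4), of _ a] by presburger
    ultimately show "l a = (\<Sum>i\<in>I. l i * dualb U I i a)"
      using LIMSEQ_unique[OF assms(5)[of a]] by simp
  qed
  then show ?thesis using dualb_sum_in[OF assms(2,3), of l] by simp
qed

section \<open>Polynomial functions in finitely many variables\<close>

text \<open>Polynomials as functions, which over an infinite field loses nothing; substitution then
  becomes a plain induction.\<close>

inductive polyf :: "'i set \<Rightarrow> (('i \<Rightarrow> complex) \<Rightarrow> complex) \<Rightarrow> bool" for I where
  polyf_const: "polyf I (\<lambda>_. c)"
| polyf_var: "i \<in> I \<Longrightarrow> polyf I (\<lambda>x. x i)"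
| polyf_add: "polyf I f \<Longrightarrow> polyf I g \<Longrightarrow> polyf I (\<lambda>x. f x + g x)"
| polyf_mult: "polyf I f \<Longrightarrow> polyf I g \<Longrightarrow> polyf I (\<lambda>x. f x * g x)"

lemma polyf_sum: "(\<And>j. j \<in> J \<Longrightarrow> polyf I (f j)) \<Longrightarrow> polyf I (\<lambda>x. \<Sum>j\<in>J. f j x)"
  by (induction J rule: infinite_finite_induct) (auto intro: polyf_const polyf_add)

lemma polyf_prod: "(\<And>j. j \<in> J \<Longrightarrow> polyf I (f j)) \<Longrightarrow> polyf I (\<lambda>x. \<Prod>j\<in>J. f j x)"
  by (induction J rule: infinite_finite_induct) (auto intro: polyf_const polyf_mult)

lemma polyf_power: "polyf I f \<Longrightarrow> polyf I (\<lambda>x. f x ^ n)"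
  by (induction n) (auto intro: polyf_const polyf_mult)

lemma polyf_compose:
  assumes "polyf J Q" "\<And>j. j \<in> J \<Longrightarrow> polyf I (\<lambda>x. g x j)"
  shows "polyf I (\<lambda>x. Q (g x))"
  using assms(1) by induction (auto intro: polyf_const polyf_add polyf_mult assms(2))

lemma polyf_mono: "polyf I f \<Longrightarrow> I \<subseteq> I' \<Longrightarrow> polyf I' f"
  by (induction rule: polyf.induct) (auto intro: polyf.intros)

lemma polyf_cong:
  assumes "polyf I f" "\<And>i. i \<in> I \<Longrightarrow> x i = y i"
  shows "f x = f y"
  using assms(1) by induction (auto simp: assms(2))

text \<open>Restriction to a complex line brings in univariate polynomials and the finiteness of
  their roots.\<close>

lemma polyf_line:
  assumes "polyf I f"
  shows "\<exists>p. \<forall>s. f (\<lambda>a. x a + s * v a) = poly p s"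
  using assms
proof induction
  case (polyf_const c)
  show ?case by (rule exI[of _ "[:c:]"]) simp
next
  case (polyf_var i)
  show ?case by (rule exI[of _ "[:x i, v i:]"]) simp
next
  case (polyf_add f g)
  then obtain p q where "\<forall>s. f (\<lambda>a. x a + s * v a) = poly p s" "\<forall>s. g (\<lambda>a. x a + s * v a) = poly q s"
    by blast
  then show ?case by (intro exI[of _ "p + q"]) simp
next
  case (polyf_mult f g)
  then obtain p q where "\<forall>s. f (\<lambda>a. x a + s * v a) = poly p s" "\<forall>s. g (\<lambda>a. x a + s * v a) = poly q s"
    by blast
  then show ?case by (intro exI[of _ "p * q"]) simp
qed

lemma polyf_line_finite_zeros:
  assumes "polyf I f" "f (\<lambda>a. x a + s0 * v a) \<noteq> 0"
  shows "finite {s. f (\<lambda>a. x a + s * v a) = 0}"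
proof -
  obtain p where p: "\<And>s. f (\<lambda>a. x a + s * v a) = poly p s"
    using polyf_line[OF assms(1)] by blast
  then have "p \<noteq> 0" using assms(2) by auto
  then show ?thesis unfolding p by (rule poly_roots_finite)
qed

text \<open>Irreducibility of affine space: on the line through \<open>x\<close> and
  \<open>y\<close> both functions have finitely many zeros, and the line is infinite.\<close>

lemma polyf_nonzero_mult:
  assumes "polyf I f" "polyf I g" "f x \<noteq> 0" "g y \<noteq> 0"
  shows "\<exists>z. f z \<noteq> 0 \<and> g z \<noteq> 0"
proof -
  define l where "l s = (\<lambda>a. x a + s * (y a - x a))" for s :: complex
  have "l 0 = x" "l 1 = y" by (auto simp: l_def)
  then have "finite {s. f (l s) = 0}" "finite {s. g (l s) = 0}"
    using polyf_line_finite_zeros[OF assms(1), of x 0 "\<lambda>a. y a - x a"]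
      polyf_line_finite_zeros[OF assms(2), of x 1 "\<lambda>a. y a - x a"] assms(3,4)
    by (auto simp: l_def)
  then have "finite ({s. f (l s) = 0} \<union> {s. g (l s) = 0})" by simp
  then obtain s where "s \<notin> {s. f (l s) = 0} \<union> {s. g (l s) = 0}"
    using ex_new_if_finite[OF infinite_UNIV_char_0[where 'a=complex]] by blast
  then show ?thesis by auto
qed

lemma polyf_nonzero_prod:
  assumes "finite J" "\<And>j. j \<in> J \<Longrightarrow> polyf I (f j)" "\<And>j. j \<in> J \<Longrightarrow> \<exists>x. f j x \<noteq> 0"
  shows "\<exists>x. \<forall>j\<in>J. f j x \<noteq> 0"
  using assms
proof (induction J rule: finite_induct)
  case (insert j J)
  then obtain x where "\<forall>j\<in>J. f j x \<noteq> 0" by auto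
  then have "(\<Prod>j\<in>J. f j x) \<noteq> 0" using insert by simp
  moreover obtain y where "f j y \<noteq> 0" using insert by blast
  ultimately obtain z where "(\<Prod>j\<in>J. f j z) \<noteq> 0" "f j z \<noteq> 0"
    using polyf_nonzero_mult[OF polyf_prod[of J I f], of "f j"] insert by blast
  then show ?case using insert by auto
qed auto

subsection \<open>Monomials\<close>

definition pmono :: "'i set \<Rightarrow> ('i \<Rightarrow> nat) \<Rightarrow> ('i \<Rightarrow> complex) \<Rightarrow> complex" where
  "pmono K m x = (\<Prod>k\<in>K. x k ^ m k)"

abbreviation expo :: "'i set \<Rightarrow> nat \<Rightarrow> ('i \<Rightarrow> nat) set" where
  "expo K d \<equiv> PiE K (\<lambda>_. {..d})"

text \<open>The bound \<open>d\<close> applies to the exponent of each variable separately, which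
  makes the number of monomials a pure power. Exponents are extensional functions, so
  \<open>expo K d\<close> is finite.\<close>

definition has_rep :: "'i set \<Rightarrow> nat \<Rightarrow> (('i \<Rightarrow> complex) \<Rightarrow> complex) \<Rightarrow> bool" where
  "has_rep K d f \<longleftrightarrow> (\<exists>c. \<forall>x. f x = (\<Sum>m\<in>expo K d. c m * pmono K m x))"

lemma finite_expo [simp]: "finite K \<Longrightarrow> finite (expo K d)"
  by (intro finite_PiE) auto

lemma has_rep_mono:
  assumes "finite K" "\<And>k. k \<in> K \<Longrightarrow> m k \<le> d"
  shows "has_rep K d (pmono K m)"
proof -
  have r: "restrict m K \<in> expo K d" using assms(2) by auto
  have "pmono K m x = (\<Sum>m'\<in>expo K d. (if m' = restrict m K then 1 else 0) * pmono K m' x)" for x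
  proof -
    have "(\<Sum>m'\<in>expo K d. (if m' = restrict m K then 1 else 0) * pmono K m' x)
        = (\<Sum>m'\<in>expo K d. if m' = restrict m K then pmono K m' x else 0)"
      by (intro sum.cong) auto
    also have "\<dots> = pmono K (restrict m K) x" using assms(1) r by simp
    also have "\<dots> = pmono K m x" by (auto simp: pmono_def intro!: prod.cong)
    finally show ?thesis by simp
  qed
  then show ?thesis unfolding has_rep_def by (intro exI[of _ "\<lambda>m'. if m' = restrict m K then 1 else 0"]) auto
qed

lemma has_rep_add: 
  assumes "has_rep K d f" "has_rep K d g"
  shows "has_rep K d (\<lambda>x. f x + g x)"
proof -
  obtain c c' where "\<forall>x. f x = (\<Sum>m\<in>expo K d. c m * pmono K m x)" "\<forall>x. g x = (\<Sum>m\<in>expo K d. c' m * pmono K m x)"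
    using assms unfolding has_rep_def by blast
  then show ?thesis unfolding has_rep_def
    by (intro exI[of _ "\<lambda>m. c m + c' m"]) (simp add: sum.distrib distrib_right)
qed

lemma has_rep_scale: 
  assumes "has_rep K d f"
  shows "has_rep K d (\<lambda>x. a * f x)"
proof -
  obtain c where "\<forall>x. f x = (\<Sum>m\<in>expo K d. c m * pmono K m x)"
    using assms unfolding has_rep_def by blast
  then show ?thesis unfolding has_rep_def
    by (intro exI[of _ "\<lambda>m. a * c m"]) (simp add: sum_distrib_left mult.assoc)
qed

lemma has_rep_zero: "has_rep K d (\<lambda>_. 0)"
  unfolding has_rep_def by (intro exI[of _ "\<lambda>_. 0"]) simp

lemma has_rep_sum: "(\<And>j. j \<in> J \<Longrightarrow> has_rep K d (f j)) \<Longrightarrow> has_rep K d (\<lambda>x. \<Sum>j\<in>J. f j x)"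
  by (induction J rule: infinite_finite_induct) (auto intro: has_rep_zero has_rep_add)

lemma has_rep_mult:
  assumes "finite K" "has_rep K d f" "has_rep K d' g"
  shows "has_rep K (d + d') (\<lambda>x. f x * g x)"
proof -
  obtain c c' where c: "\<And>x. f x = (\<Sum>m\<in>expo K d. c m * pmono K m x)" "\<And>x. g x = (\<Sum>m\<in>expo K d'. c' m * pmono K m x)"
    using assms unfolding has_rep_def by blast
  have "f x * g x = (\<Sum>m\<in>expo K d. \<Sum>m'\<in>expo K d'. (c m * c' m') * pmono K (\<lambda>k. m k + m' k) x)" for x
    unfolding c sum_product by (intro sum.cong) (auto simp: pmono_def power_add prod.distrib)
  moreover have "has_rep K (d + d') (\<lambda>x. \<Sum>m\<in>expo K d. \<Sum>m'\<in>expo K d'. (c m * c' m') * pmono K (\<lambda>k. m k + m' k) x)"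
    using assms(1) by (intro has_rep_sum has_rep_scale has_rep_mono) (auto intro!: add_mono simp: PiE_iff)
  ultimately show ?thesis by simp
qed

lemma has_rep_le:
  assumes "finite K" "has_rep K d f" "d \<le> d'"
  shows "has_rep K d' f"
proof -
  obtain c where c: "\<And>x. f x = (\<Sum>m\<in>expo K d. c m * pmono K m x)"
    using assms unfolding has_rep_def by blast
  have "has_rep K d' (\<lambda>x. \<Sum>m\<in>expo K d. c m * pmono K m x)"
    using assms by (intro has_rep_sum has_rep_scale has_rep_mono) (auto simp: PiE_iff intro: order_trans)
  then show ?thesis by (simp add: c[abs_def])
qed

lemma has_rep_const: "finite K \<Longrightarrow> has_rep K d (\<lambda>_. a)"
  using has_rep_scale[OF has_rep_mono[of K "\<lambda>_. 0" d], of a] by (simp add: pmono_def)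

lemma polyf_has_rep:
  assumes "finite K" "polyf K f"
  shows "\<exists>d. has_rep K d f"
  using assms(2)
proof induction
  case (polyf_const c)
  then show ?case using has_rep_const[OF assms(1)] by blast
next
  case (polyf_var i)
  have "pmono K (\<lambda>k. if k = i then 1 else 0) x = x i" for x
  proof -
    have "pmono K (\<lambda>k. if k = i then 1 else 0) x = (\<Prod>k\<in>K. if k = i then x k else 1)"
      unfolding pmono_def by (intro prod.cong) auto
    then show ?thesis using polyf_var assms by simp
  qed
  then have "(\<lambda>x. x i) = pmono K (\<lambda>k. if k = i then 1 else 0)" by auto
  moreover have "has_rep K 1 (pmono K (\<lambda>k. if k = i then 1 else 0))"
    by (rule has_rep_mono[OF assms(1)]) simp
  ultimately show ?case by auto
next
  case (polyf_add f g)
  then obtain d d' where "has_rep K d f" "has_rep K d' g" by blast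
  then have "has_rep K (d + d') f" "has_rep K (d + d') g" using has_rep_le assms(1) by (metis le_add1 le_add2)+
  then show ?case using has_rep_add by blast
next
  case (polyf_mult f g)
  then show ?case using has_rep_mult[OF assms(1)] by blast
qed

lemma has_rep_power:
  assumes "finite K" "has_rep K d f"
  shows "has_rep K (n * d) (\<lambda>x. f x ^ n)"
proof (induction n)
  case 0
  then show ?case using has_rep_const[OF assms(1)] by simp
next
  case (Suc n)
  then show ?case using has_rep_mult[OF assms(1,2) Suc] by simp
qed

lemma has_rep_prod:
  assumes "finite K" "finite J" "\<And>j. j \<in> J \<Longrightarrow> has_rep K d (f j)"
  shows "has_rep K (card J * d) (\<lambda>x. \<Prod>j\<in>J. f j x)"
  using assms(2,3)
proof (induction J rule: finite_induct)
  case empty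
  then show ?case using has_rep_const[OF assms(1)] by simp
next
  case (insert j J)
  then show ?case using has_rep_mult[OF assms(1), of d "f j" "card J * d"] by simp
qed

text \<open>Sorting by powers of \<open>x j\<close> prepares the induction on the variables in
  \<open>mono_independent\<close>.\<close>

lemma sum_mono_insert:
  assumes "finite J" "j \<notin> J"
  shows "(\<Sum>m\<in>expo (insert j J) D. c m * pmono (insert j J) m x) =
    (\<Sum>k\<le>D. (\<Sum>m\<in>expo J D. c (m(j := k)) * pmono J m x) * x j ^ k)"
proof -
  have m: "pmono (insert j J) (m(j := k)) x = pmono J m x * x j ^ k" if "m \<in> expo J D" for m k
  proof -
    have "(\<Prod>i\<in>J. x i ^ (m(j := k)) i) = (\<Prod>i\<in>J. x i ^ m i)"
      using assms by (intro prod.cong) auto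
    then show ?thesis using assms by (simp add: pmono_def)
  qed
  have "(\<Sum>m\<in>expo (insert j J) D. c m * pmono (insert j J) m x) =
      (\<Sum>(k, m)\<in>{..D} \<times> expo J D. c (m(j := k)) * pmono (insert j J) (m(j := k)) x)"
    unfolding PiE_insert_eq using assms
    by (subst sum.reindex[OF inj_combinator]) (auto simp: case_prod_beta o_def)
  also have "\<dots> = (\<Sum>k\<le>D. \<Sum>m\<in>expo J D. c (m(j := k)) * (pmono J m x * x j ^ k))"
    unfolding sum.cartesian_product[symmetric] using m by (intro sum.cong) auto
  finally show ?thesis by (simp add: sum_distrib_right mult.assoc)
qed

text \<open>For fixed values of the other variables, a polynomial in \<open>x j\<close> that
  vanishes everywhere has vanishing coefficients; these are sums over fewer variables.\<close>

lemma mono_independent: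
  assumes "finite J" "\<And>x. (\<Sum>m\<in>expo J D. c m * pmono J m x) = 0" "m \<in> expo J D"
  shows "c m = 0"
  using assms
proof (induction J arbitrary: c m rule: finite_induct)
  case empty
  then show ?case by (simp add: pmono_def)
next
  case (insert j J)
  obtain k m' where m: "m = m'(j := k)" "k \<le> D" "m' \<in> expo J D"
    using insert.prems(2) unfolding PiE_insert_eq by auto
  have "(\<Sum>m\<in>expo J D. c (m(j := k)) * pmono J m x) = 0" for x
  proof (rule zero_polynom_imp_zero_coeffs[where n = D and k = k
        and c = "\<lambda>k. \<Sum>m\<in>expo J D. c (m(j := k)) * pmono J m x"])
    fix w
    have "pmono J m (x(j := w)) = pmono J m x" for m
      using insert by (auto simp: pmono_def intro!: prod.cong)
    then show "(\<Sum>k\<le>D. (\<Sum>m\<in>expo J D. c (m(j := k)) * pmono J m x) * w ^ k) = 0"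
      using insert.prems(1)[of "x(j := w)"] unfolding sum_mono_insert[OF insert.hyps] by simp
  qed (use m in auto)
  from insert.IH[OF this m(3)] show ?case using m by simp
qed

lemma polyf_mono_sum: "polyf K (\<lambda>x. \<Sum>m\<in>M. c m * pmono K m x)"
  unfolding pmono_def by (intro polyf_sum polyf_mult polyf_const polyf_prod polyf_power polyf_var) auto

text \<open>Compare the numbers of monomials of bounded degree in the \<open>g j\<close> and in the variables.\<close>

lemma algebraic_dependence:
  assumes "finite K" "finite J" "card K < card J" "\<And>j. j \<in> J \<Longrightarrow> polyf K (g j)"
  shows "\<exists>Q. polyf J Q \<and> (\<exists>y. Q y \<noteq> 0) \<and> (\<forall>x. Q (\<lambda>j. g j x) = 0)"
proof -
  have "\<exists>d. \<forall>j\<in>J. has_rep K (d j) (g j)"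
    using polyf_has_rep[OF assms(1) assms(4)] by (intro bchoice) auto
  then obtain dj where dj: "\<And>j. j \<in> J \<Longrightarrow> has_rep K (dj j) (g j)" by blast
  define d where "d = Max (dj ` J)"
  have d: "has_rep K d (g j)" if "j \<in> J" for j
    using dj[OF that] assms(1,2) that by (auto intro: has_rep_le simp: d_def)
  define n where "n = card J * d"
  \<comment> \<open>The products of the \<open>g j\<close> with exponents up to \<open>D\<close>
    number \<open>(D + 1) ^ card J\<close> and lie in the span of
    \<open>(n * D + 1) ^ card K\<close> monomials. This choice of \<open>D\<close> bounds the latter
    number by \<open>D * (D + 1) ^ card K\<close>, which is smaller.\<close>
  define D where "D = (n + 1) ^ card K"
  have rep: "has_rep K (n * D) (\<lambda>x. \<Prod>j\<in>J. g j x ^ m j)" if "m \<in> expo J D" for m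
  proof -
    have "has_rep K (D * d) (\<lambda>x. g j x ^ m j)" if "j \<in> J" for j
      by (rule has_rep_le[OF assms(1) has_rep_power[OF assms(1) d[OF that]]])
         (use \<open>m \<in> expo J D\<close> that in auto)
    from has_rep_prod[OF assms(1,2) this] show ?thesis by (simp add: n_def algebra_simps)
  qed
  then have "\<exists>a. \<forall>m\<in>expo J D. \<forall>x. (\<Prod>j\<in>J. g j x ^ m j) = (\<Sum>l\<in>expo K (n * D). a m l * pmono K l x)"
    unfolding has_rep_def by (intro bchoice) auto
  then obtain a where a: "\<And>m x. m \<in> expo J D \<Longrightarrow> (\<Prod>j\<in>J. g j x ^ m j) = (\<Sum>l\<in>expo K (n * D). a m l * pmono K l x)"
    by blast
  have "n * D + 1 \<le> (n + 1) * (D + 1)" by simp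
  then have "(n * D + 1) ^ card K \<le> ((n + 1) * (D + 1)) ^ card K" by (rule power_mono) simp
  also have "\<dots> = D * (D + 1) ^ card K" by (simp only: D_def power_mult_distrib)
  also have "\<dots> < (D + 1) * (D + 1) ^ card K" by simp
  also have "\<dots> \<le> (D + 1) ^ card J"
    using assms(3) power_increasing[of "Suc (card K)" "card J" "D + 1"] by simp
  finally have "card (expo K (n * D)) < card (expo J D)"
    using assms(1,2) by (simp add: card_PiE)
  then obtain c where c: "\<exists>m\<in>expo J D. c m \<noteq> 0"
      "\<forall>l\<in>expo K (n * D). (\<Sum>m\<in>expo J D. a m l * c m) = 0"
    using homogeneous_system[of "expo K (n * D)" "expo J D" "\<lambda>l m. a m l"] assms(1,2) by auto
  define Q where "Q = (\<lambda>y. \<Sum>m\<in>expo J D. c m * pmono J m y)"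
  have "Q (\<lambda>j. g j x) = 0" for x
  proof -
    have "Q (\<lambda>j. g j x) = (\<Sum>m\<in>expo J D. c m * (\<Sum>l\<in>expo K (n * D). a m l * pmono K l x))"
      unfolding Q_def using a by (intro sum.cong) (auto simp: pmono_def)
    also have "\<dots> = (\<Sum>l\<in>expo K (n * D). \<Sum>m\<in>expo J D. a m l * c m * pmono K l x)"
      unfolding sum_distrib_left by (subst sum.swap) (simp add: mult_ac)
    also have "\<dots> = (\<Sum>l\<in>expo K (n * D). (\<Sum>m\<in>expo J D. a m l * c m) * pmono K l x)"
      by (simp add: sum_distrib_right)
    finally show ?thesis using c by simp
  qed
  moreover have "\<exists>y. Q y \<noteq> 0" using mono_independent[OF assms(2), of c D] c(1) unfolding Q_def by blast
  moreover have "polyf J Q" unfolding Q_def by (rule polyf_mono_sum)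
  ultimately show ?thesis by blast
qed

section \<open>Generic fibers of polynomial maps: algebra\<close>

text \<open>An element of the polynomial ring in one variable over the polynomial functions of
  \<open>l\<close>; the uniform degree bound makes it a single polynomial and not merely a
  family.\<close>

definition ppoly :: "'e set \<Rightarrow> (('e \<Rightarrow> complex) \<Rightarrow> complex poly) \<Rightarrow> bool" where
  "ppoly E P \<longleftrightarrow> (\<forall>j. polyf E (\<lambda>l. coeff (P l) j)) \<and> (\<exists>d. \<forall>l. degree (P l) \<le> d)"

text \<open>\<open>None\<close> is the distinguished variable by whose powers \<open>Q\<close> is
  sorted; the variables \<open>Some e\<close> go into the coefficients.\<close>

lemma polyf_as_ppoly:
  assumes "polyf (insert None (Some ` E)) Q"
  shows "\<exists>P. ppoly E P \<and> (\<forall>y. Q y = poly (P (\<lambda>e. y (Some e))) (y None))"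
  using assms
proof induction
  case (polyf_const c)
  have "polyf E (\<lambda>l. coeff [:c:] j)" for j by (rule polyf.polyf_const)
  then show ?case by (intro exI[of _ "\<lambda>_. [:c:]"]) (auto simp: ppoly_def)
next
  case (polyf_var i)
  show ?case
  proof (cases i)
    case None
    have "polyf E (\<lambda>l. coeff [:0, 1:] j)" for j by (rule polyf.polyf_const)
    then show ?thesis using None by (intro exI[of _ "\<lambda>_. [:0, 1:]"]) (auto simp: ppoly_def)
  next
    case (Some e)
    then have e: "e \<in> E" using polyf_var by auto
    have "polyf E (\<lambda>l. coeff [:l e:] j)" for j
      by (cases j) (auto intro: polyf.polyf_const polyf.polyf_var[OF e])
    then show ?thesis using Some by (intro exI[of _ "\<lambda>l. [:l e:]"]) (auto simp: ppoly_def)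
  qed
next
  case (polyf_add f g)
  then obtain P R where *: "ppoly E P" "\<forall>y. f y = poly (P (\<lambda>e. y (Some e))) (y None)"
    "ppoly E R" "\<forall>y. g y = poly (R (\<lambda>e. y (Some e))) (y None)" by blast
  then obtain d d' where "\<And>l. degree (P l) \<le> d" "\<And>l. degree (R l) \<le> d'"
    unfolding ppoly_def by blast
  then have "degree (P l + R l) \<le> d + d'" for l
    by (meson degree_add_le le_add1 le_add2 order_trans)
  moreover have "polyf E (\<lambda>l. coeff (P l + R l) j)" for j
    using * unfolding ppoly_def by (auto intro: polyf.polyf_add)
  ultimately have "ppoly E (\<lambda>l. P l + R l)" unfolding ppoly_def by blast
  then show ?case using * by (intro exI[of _ "\<lambda>l. P l + R l"]) auto
next
  case (polyf_mult f g)
  then obtain P R where *: "ppoly E P" "\<forall>y. f y = poly (P (\<lambda>e. y (Some e))) (y None)"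
    "ppoly E R" "\<forall>y. g y = poly (R (\<lambda>e. y (Some e))) (y None)" by blast
  then obtain d d' where "\<And>l. degree (P l) \<le> d" "\<And>l. degree (R l) \<le> d'"
    unfolding ppoly_def by blast
  then have "degree (P l * R l) \<le> d + d'" for l
    by (meson degree_mult_le add_mono order_trans)
  moreover have "polyf E (\<lambda>l. coeff (P l * R l) j)" for j
    using * unfolding ppoly_def coeff_mult by (auto intro!: polyf_sum polyf.polyf_mult)
  ultimately have "ppoly E (\<lambda>l. P l * R l)" unfolding ppoly_def by blast
  then show ?case using * by (intro exI[of _ "\<lambda>l. P l * R l"]) auto
qed

lemma poly_bounded_degree:
  fixes p :: "complex poly"
  assumes "degree p \<le> d"
  shows "poly p x = (\<Sum>j\<le>d. coeff p j * x ^ j)"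
  unfolding poly_altdef using assms
  by (intro sum.mono_neutral_left) (auto intro: coeff_eq_0)

lemma polyf_poly_ppoly:
  assumes "ppoly E P" "\<And>e. e \<in> E \<Longrightarrow> polyf K (f e)" "polyf K h"
  shows "polyf K (\<lambda>x. poly (P (\<lambda>e. f e x)) (h x))"
proof -
  obtain d where "\<And>l. degree (P l) \<le> d" using assms unfolding ppoly_def by blast
  then have eq: "(\<lambda>x. poly (P (\<lambda>e. f e x)) (h x)) = (\<lambda>x. \<Sum>j\<le>d. coeff (P (\<lambda>e. f e x)) j * h x ^ j)"
    using poly_bounded_degree by blast
  show ?thesis unfolding eq using assms unfolding ppoly_def
    by (intro polyf_sum polyf_mult polyf_power) (auto intro: polyf_compose[of E])
qed

text \<open>The \<open>card E + 1\<close> functions \<open>f e\<close> and \<open>h\<close> depend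
  on at most \<open>card E\<close> variables, hence are algebraically dependent; the relation is
  read as an equation for \<open>h\<close> over the \<open>f e\<close>.\<close>

lemma relation_exists:
  assumes "finite K" "finite E" "card K \<le> card E" "\<And>e. e \<in> E \<Longrightarrow> polyf K (f e)" "polyf K h"
  shows "\<exists>P. ppoly E P \<and> (\<exists>l. P l \<noteq> 0) \<and> (\<forall>x. poly (P (\<lambda>e. f e x)) (h x) = 0)"
proof -
  define g where "g = (\<lambda>o'. case o' of None \<Rightarrow> h | Some e \<Rightarrow> f e)"
  have "card K < card (insert None (Some ` E))"
    using assms(2,3) by (simp add: card_image)
  moreover have "polyf K (g j)" if "j \<in> insert None (Some ` E)" for j
    using that assms(4,5) by (auto simp: g_def)
  ultimately obtain Q where Q: "polyf (insert None (Some ` E)) Q" "\<exists>y. Q y \<noteq> 0" "\<And>x. Q (\<lambda>j. g j x) = 0"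
    using algebraic_dependence[of K "insert None (Some ` E)" g] assms(1,2) by blast
  obtain P where P: "ppoly E P" "\<And>y. Q y = poly (P (\<lambda>e. y (Some e))) (y None)"
    using polyf_as_ppoly[OF Q(1)] by blast
  have "\<exists>l. P l \<noteq> 0" using Q(2) unfolding P(2) by (metis poly_0)
  moreover have "poly (P (\<lambda>e. f e x)) (h x) = 0" for x
    using Q(3)[of x] unfolding P(2) by (simp add: g_def)
  ultimately show ?thesis using P(1) by blast
qed

lemma poly_shift_mult:
  fixes p :: "complex poly"
  assumes "\<And>j. j < n \<Longrightarrow> coeff p j = 0"
  shows "p = monom 1 n * poly_shift n p"
  using assms by (intro poly_eqI) (auto simp: coeff_monom_mult coeff_poly_shift)

text \<open>In a relation for \<open>h\<close> over the \<open>f e\<close>, powers of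
  \<open>h\<close> are cancelled until the constant coefficient is not identically zero. Where
  \<open>h\<close> vanishes, the relation says that this coefficient vanishes, so it is the required
  \<open>q\<close>.\<close>

lemma zero_set_in_hypersurface:
  assumes "finite K" "finite E" "card K \<le> card E" "\<And>e. e \<in> E \<Longrightarrow> polyf K (f e)" "polyf K h" "h z \<noteq> 0"
  shows "\<exists>q. polyf E q \<and> (\<exists>l. q l \<noteq> 0) \<and> (\<forall>x. h x = 0 \<longrightarrow> q (\<lambda>e. f e x) = 0)"
proof -
  obtain P where P: "ppoly E P" "\<exists>l. P l \<noteq> 0" "\<And>x. poly (P (\<lambda>e. f e x)) (h x) = 0"
    using relation_exists[of K E f h] assms(1-5) by blast
  then have "\<exists>j l. coeff (P l) j \<noteq> 0" by (metis leading_coeff_0_iff)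
  \<comment> \<open>All coefficients below \<open>n\<close> vanish identically, so \<open>P\<close>
    is divisible by the \<open>n\<close>-th power of its variable.\<close>
  define n where "n = (LEAST j. \<exists>l. coeff (P l) j \<noteq> 0)"
  have n: "\<exists>l. coeff (P l) n \<noteq> 0" "\<And>j l. j < n \<Longrightarrow> coeff (P l) j = 0"
    using LeastI_ex[OF \<open>\<exists>j l. coeff (P l) j \<noteq> 0\<close>] not_less_Least unfolding n_def by blast+
  define R where "R l = poly_shift n (P l)" for l
  have PR: "P l = monom 1 n * R l" for l
    unfolding R_def by (rule poly_shift_mult) (rule n(2))
  obtain d where d: "\<And>l. degree (P l) \<le> d" using P(1) by (auto simp: ppoly_def)
  have "degree (R l) \<le> d" for l
    by (rule degree_le) (use d in \<open>auto simp: R_def coeff_poly_shift intro!: coeff_eq_0 le_less_trans[OF d]\<close>)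
  then have "ppoly E R"
    using P(1) by (auto simp: ppoly_def R_def coeff_poly_shift)
  then have pR: "polyf K (\<lambda>x. poly (R (\<lambda>e. f e x)) (h x))"
    by (rule polyf_poly_ppoly[OF _ assms(4,5)])
  have prod0: "h x ^ n * poly (R (\<lambda>e. f e x)) (h x) = 0" for x
    using P(3)[of x] by (simp add: PR poly_monom)
  \<comment> \<open>Polynomial functions have no zero divisors and \<open>h\<close> is not
    identically 0, so \<open>h x ^ n\<close> cancels even at zeros of \<open>h\<close>.\<close>
  have R0: "poly (R (\<lambda>e. f e x)) (h x) = 0" for x
  proof (rule ccontr)
    assume "poly (R (\<lambda>e. f e x)) (h x) \<noteq> 0"
    then obtain w where "h w \<noteq> 0" "poly (R (\<lambda>e. f e w)) (h w) \<noteq> 0"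
      using polyf_nonzero_mult[OF assms(5) pR, of z x] assms(6) by blast
    with prod0[of w] show False by simp
  qed
  have "coeff (P (\<lambda>e. f e x)) n = 0" if "h x = 0" for x
    using R0[of x] that by (simp add: poly_0_coeff_0 R_def coeff_poly_shift)
  moreover have "polyf E (\<lambda>l. coeff (P l) n)" using P(1) by (simp add: ppoly_def)
  ultimately show ?thesis using n(1) by (intro exI[of _ "\<lambda>l. coeff (P l) n"]) auto
qed

text \<open>Geometrically, the image of \<open>f\<close> lies in no proper hypersurface.\<close>

definition alg_indep :: "'e set \<Rightarrow> ('e \<Rightarrow> ('i \<Rightarrow> complex) \<Rightarrow> complex) \<Rightarrow> bool" where
  "alg_indep E f \<longleftrightarrow> (\<forall>Q. polyf E Q \<longrightarrow> (\<forall>x. Q (\<lambda>e. f e x) = 0) \<longrightarrow> (\<forall>y. Q y = 0))"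

definition rel_deg :: "'e set \<Rightarrow> ('e \<Rightarrow> ('i \<Rightarrow> complex) \<Rightarrow> complex) \<Rightarrow> (('i \<Rightarrow> complex) \<Rightarrow> complex) \<Rightarrow> nat
    \<Rightarrow> (('e \<Rightarrow> complex) \<Rightarrow> complex poly) \<Rightarrow> bool" where
  "rel_deg E f h d P \<longleftrightarrow> ppoly E P \<and> (\<forall>l. degree (P l) \<le> d) \<and> (\<exists>l. P l \<noteq> 0) \<and>
     (\<forall>x. poly (P (\<lambda>e. f e x)) (h x) = 0)"

text \<open>The degree bound is taken minimal. It is not 0 because the \<open>f e\<close> are
  independent; the top coefficient does not vanish identically, or the bound could be lowered; and
  the derivative, nonzero in characteristic 0 and of smaller degree, cannot be a relation for
  \<open>h\<close>.\<close>

lemma minimal_relation: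
  assumes "finite K" "finite E" "card K \<le> card E" "\<And>e. e \<in> E \<Longrightarrow> polyf K (f e)" "polyf K h"
    and indep: "alg_indep E f"
  shows "\<exists>d P. rel_deg E f h (Suc d) P \<and> (\<exists>l. coeff (P l) (Suc d) \<noteq> 0) \<and>
    (\<exists>x. poly (pderiv (P (\<lambda>e. f e x))) (h x) \<noteq> 0)"
proof -
  obtain P0 where P0: "ppoly E P0" "\<exists>l. P0 l \<noteq> 0" "\<forall>x. poly (P0 (\<lambda>e. f e x)) (h x) = 0"
    using relation_exists[of K E f h] assms(1-5) by blast
  then have ex: "\<exists>d P. rel_deg E f h d P" unfolding rel_deg_def ppoly_def by blast
  define m where "m = (LEAST d. \<exists>P. rel_deg E f h d P)"
  obtain P where P: "rel_deg E f h m P" using LeastI_ex[OF ex] unfolding m_def by blast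
  have min: "\<not> rel_deg E f h d R" if "d < m" for d R
    using not_less_Least that unfolding m_def by blast
  have "m \<noteq> 0"
  proof
    assume "m = 0"
    then have const: "P l = [:coeff (P l) 0:]" for l
      using P unfolding rel_deg_def by (metis degree_0_id le_zero_eq)
    have "coeff (P (\<lambda>e. f e x)) 0 = 0" for x
    proof -
      have "poly [:coeff (P (\<lambda>e. f e x)) 0:] (h x) = 0"
        using P const[of "\<lambda>e. f e x"] unfolding rel_deg_def by metis
      then show ?thesis by simp
    qed
    moreover have "polyf E (\<lambda>l. coeff (P l) 0)" using P by (simp add: rel_deg_def ppoly_def)
    ultimately have "\<And>l. coeff (P l) 0 = 0" using indep unfolding alg_indep_def by blast
    then have "\<And>l. P l = 0" using const by (metis pCons_0_0)
    then show False using P by (simp add: rel_deg_def)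
  qed
  then obtain d where m: "m = Suc d" by (cases m) auto
  have lead: "\<exists>l. coeff (P l) m \<noteq> 0"
  proof (rule ccontr)
    assume z: "\<not> ?thesis"
    have "degree (P l) \<le> d" for l
    proof (rule degree_le, intro allI impI)
      fix i assume "d < i"
      then show "coeff (P l) i = 0"
      proof (cases "i = m")
        case False
        then have "degree (P l) < i" using P m \<open>d < i\<close> unfolding rel_deg_def
          by (metis Suc_leI le_less_trans nat_less_le)
        then show ?thesis by (rule coeff_eq_0)
      qed (use z in auto)
    qed
    then have "rel_deg E f h d P" using P unfolding rel_deg_def by auto
    then show False using min m by blast
  qed
  have "\<exists>x. poly (pderiv (P (\<lambda>e. f e x))) (h x) \<noteq> 0"
  proof (rule ccontr)
    assume "\<not> ?thesis"
    then have z: "\<forall>x. poly (pderiv (P (\<lambda>e. f e x))) (h x) = 0" by simp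
    have dle: "degree (pderiv (P l)) \<le> d" for l
      using P m unfolding rel_deg_def by (metis degree_pderiv diff_Suc_1 diff_le_mono)
    moreover have "polyf E (\<lambda>l. coeff (pderiv (P l)) j)" for j
      using P unfolding rel_deg_def ppoly_def coeff_pderiv
      by (intro polyf_mult polyf_const) auto
    moreover obtain l where "coeff (P l) m \<noteq> 0" using lead by blast
    then have "coeff (pderiv (P l)) d \<noteq> 0" by (simp add: coeff_pderiv m del: of_nat_Suc)
    then have "pderiv (P l) \<noteq> 0" by auto
    ultimately have "rel_deg E f h d (\<lambda>l. pderiv (P l))"
      using z unfolding rel_deg_def ppoly_def by blast
    then show False using min m by blast
  qed
  then show ?thesis using P lead m by blast
qed

lemma polyf_tendsto:
  assumes "polyf I f" "\<And>i. i \<in> I \<Longrightarrow> ((\<lambda>n. xs n i) \<longlongrightarrow> x i) F"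
  shows "((\<lambda>n. f (xs n)) \<longlongrightarrow> f x) F"
  using assms(1) by induction (auto intro!: tendsto_intros assms(2))

text \<open>A root of modulus above 1 is at most the sum of the moduli of the lower coefficients
  divided by that of the leading one. This quotient converges because the leading coefficient has a
  nonzero limit.\<close>

lemma ppoly_roots_bounded:
  assumes P: "ppoly E P" "\<And>l. degree (P l) \<le> Suc d" and lead: "coeff (P l) (Suc d) \<noteq> 0"
    and lim: "\<And>e. e \<in> E \<Longrightarrow> (\<lambda>n. ls n e) \<longlonglongrightarrow> l e"
    and root: "\<And>n::nat. poly (P (ls n)) (xs n) = 0"
  shows "Bseq xs"
proof -
  have cl: "(\<lambda>n. coeff (P (ls n)) j) \<longlonglongrightarrow> coeff (P l) j" for j
    by (rule polyf_tendsto[of E]) (use P lim in \<open>auto simp: ppoly_def\<close>)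
  define b where "b n = (\<Sum>j\<le>d. cmod (coeff (P (ls n)) j)) / cmod (coeff (P (ls n)) (Suc d))" for n
  have "b \<longlonglongrightarrow> (\<Sum>j\<le>d. cmod (coeff (P l) j)) / cmod (coeff (P l) (Suc d))"
    unfolding b_def by (intro tendsto_intros cl) (use lead in auto)
  then have "Bseq b" by (rule convergent_imp_Bseq[OF convergentI])
  then obtain C where C: "\<And>n. \<bar>b n\<bar> \<le> C" unfolding Bseq_def by auto
  have "eventually (\<lambda>n. coeff (P (ls n)) (Suc d) \<noteq> 0) sequentially"
    using tendsto_imp_eventually_ne[OF cl lead] .
  then have "eventually (\<lambda>n. norm (xs n) \<le> max 1 C) sequentially"
  proof eventually_elim
    case (elim n)
    let ?c = "coeff (P (ls n))" and ?x = "xs n"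
    show ?case
    proof (cases "norm ?x \<le> 1")
      case False
      then have x: "norm ?x > 1" by simp
      have "(\<Sum>j\<le>d. ?c j * ?x ^ j) + ?c (Suc d) * ?x ^ Suc d = 0"
        using root[of n] unfolding poly_bounded_degree[OF P(2)[of "ls n"]] sum.atMost_Suc .
      then have "?c (Suc d) * ?x ^ Suc d = - (\<Sum>j\<le>d. ?c j * ?x ^ j)"
        by (simp only: eq_neg_iff_add_eq_0 add.commute)
      then have "cmod (?c (Suc d) * ?x ^ Suc d) = cmod (\<Sum>j\<le>d. ?c j * ?x ^ j)"
        by (simp only: norm_minus_cancel)
      then have "cmod (?c (Suc d)) * cmod ?x ^ Suc d = cmod (\<Sum>j\<le>d. ?c j * ?x ^ j)"
        by (simp only: norm_mult norm_power)
      also have "\<dots> \<le> (\<Sum>j\<le>d. cmod (?c j) * cmod ?x ^ j)"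
        by (rule sum_norm_le) (simp add: norm_mult norm_power)
      also have "\<dots> \<le> (\<Sum>j\<le>d. cmod (?c j) * cmod ?x ^ d)"
        using x by (intro sum_mono mult_left_mono power_increasing) auto
      also have "\<dots> = (\<Sum>j\<le>d. cmod (?c j)) * cmod ?x ^ d" by (simp add: sum_distrib_right)
      finally have "(cmod (?c (Suc d)) * cmod ?x) * cmod ?x ^ d \<le> (\<Sum>j\<le>d. cmod (?c j)) * cmod ?x ^ d"
        by (simp add: mult_ac)
      then have "cmod (?c (Suc d)) * cmod ?x \<le> (\<Sum>j\<le>d. cmod (?c j))"
        by (rule mult_right_le_imp_le) (rule zero_less_power, use x in linarith)
      then have "cmod ?x \<le> b n"
        unfolding b_def using elim by (simp add: field_simps)
      also have "\<dots> \<le> C" using C[of n] by simp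
      finally show ?thesis by simp
    qed simp
  qed
  then show ?thesis by (rule BfunI)
qed

text \<open>The first half is the chain rule along complex curves, the second is strict
  differentiability in terms of sequences. The form with two moving points \<open>xs\<close>,
  \<open>ys\<close> is what makes the map in \<open>local_inverse\<close> a contraction. Where the
  denominator is 0, the quotient is 0 by convention.\<close>

definition grad :: "'i set \<Rightarrow> (('i \<Rightarrow> complex) \<Rightarrow> complex) \<Rightarrow> ('i \<Rightarrow> ('i \<Rightarrow> complex) \<Rightarrow> complex) \<Rightarrow> bool" where
  "grad I f D \<longleftrightarrow>
     (\<forall>\<phi> \<phi>' z. (\<forall>i\<in>I. ((\<lambda>s. \<phi> s i) has_field_derivative \<phi>' i) (at z)) \<longrightarrow>
        ((\<lambda>s. f (\<phi> s)) has_field_derivative (\<Sum>i\<in>I. D i (\<phi> z) * \<phi>' i)) (at z)) \<and>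
     (\<forall>x xs ys. (\<forall>i\<in>I. (\<lambda>n. xs n i) \<longlonglongrightarrow> x i) \<longrightarrow> (\<forall>i\<in>I. (\<lambda>n. ys n i) \<longlonglongrightarrow> x i) \<longrightarrow>
        (\<lambda>n::nat. (f (xs n) - f (ys n) - (\<Sum>i\<in>I. D i x * (xs n i - ys n i))) /
           of_real (\<Sum>i\<in>I. cmod (xs n i - ys n i))) \<longlonglongrightarrow> 0)"

text \<open>If the denominator vanishes, the quotient is 0, so no case distinction is left to the
  users of the bound.\<close>

lemma bounded_quotient:
  fixes D d :: "'i \<Rightarrow> complex"
  shows "cmod ((\<Sum>i\<in>I. D i * d i) / of_real (\<Sum>i\<in>I. cmod (d i))) \<le> (\<Sum>i\<in>I. cmod (D i))"
proof (cases "finite I")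
  case fin: True
  have "cmod (\<Sum>i\<in>I. D i * d i) \<le> (\<Sum>i\<in>I. cmod (D i) * cmod (d i))"
    by (rule sum_norm_le) (simp add: norm_mult)
  also have "\<dots> \<le> (\<Sum>i\<in>I. cmod (D i) * (\<Sum>i\<in>I. cmod (d i)))"
    using fin by (intro sum_mono mult_left_mono member_le_sum) auto
  also have "\<dots> = (\<Sum>i\<in>I. cmod (D i)) * (\<Sum>i\<in>I. cmod (d i))" by (simp add: sum_distrib_right)
  finally have *: "cmod (\<Sum>i\<in>I. D i * d i) \<le> (\<Sum>i\<in>I. cmod (D i)) * (\<Sum>i\<in>I. cmod (d i))" .
  have nn: "(\<Sum>i\<in>I. cmod (d i)) \<ge> 0" "(\<Sum>i\<in>I. cmod (D i)) \<ge> 0" by (simp_all add: sum_nonneg)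
  show ?thesis
  proof (cases "(\<Sum>i\<in>I. cmod (d i)) = 0")
    case True
    then show ?thesis using nn by simp
  next
    case False
    then have "(\<Sum>i\<in>I. cmod (d i)) > 0" using nn by simp
    then show ?thesis using * by (simp add: norm_divide divide_le_eq del: of_real_sum)
  qed
qed simp

text \<open>The remainder of \<open>f x * g x\<close> splits into the remainders of \<open>f\<close>
  and \<open>g\<close> times convergent factors, and the null sequences
  \<open>f (xs n) - f x\<close> and \<open>g (ys n) - g x\<close> times bounded difference
  quotients.\<close>

lemma grad_mult:
  assumes I: "finite I" and f: "polyf I f" "grad I f D" and g: "polyf I g" "grad I g D'"
  shows "grad I (\<lambda>x. f x * g x) (\<lambda>i x. f x * D' i x + g x * D i x)"
  unfolding grad_def
proof (intro conjI allI impI)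
  fix \<phi> :: "complex \<Rightarrow> 'a \<Rightarrow> complex" and \<phi>' z assume "\<forall>i\<in>I. ((\<lambda>s. \<phi> s i) has_field_derivative \<phi>' i) (at z)"
  then have "((\<lambda>s. f (\<phi> s)) has_field_derivative (\<Sum>i\<in>I. D i (\<phi> z) * \<phi>' i)) (at z)"
    "((\<lambda>s. g (\<phi> s)) has_field_derivative (\<Sum>i\<in>I. D' i (\<phi> z) * \<phi>' i)) (at z)"
    using f g unfolding grad_def by blast+
  from DERIV_mult[OF this]
  show "((\<lambda>s. f (\<phi> s) * g (\<phi> s)) has_field_derivative
      (\<Sum>i\<in>I. (f (\<phi> z) * D' i (\<phi> z) + g (\<phi> z) * D i (\<phi> z)) * \<phi>' i)) (at z)"
    by (rule DERIV_cong) (simp add: sum.distrib sum_distrib_left distrib_left mult_ac)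
next
  fix x :: "'a \<Rightarrow> complex" and xs ys assume x: "\<forall>i\<in>I. (\<lambda>n. xs n i) \<longlonglongrightarrow> x i" and y: "\<forall>i\<in>I. (\<lambda>n. ys n i) \<longlonglongrightarrow> x i"
  let ?N = "\<lambda>n::nat. complex_of_real (\<Sum>i\<in>I. cmod (xs n i - ys n i))"
  let ?Df = "\<lambda>n. \<Sum>i\<in>I. D i x * (xs n i - ys n i)" and ?Dg = "\<lambda>n. \<Sum>i\<in>I. D' i x * (xs n i - ys n i)"
  have lf: "(\<lambda>n. f (xs n)) \<longlonglongrightarrow> f x" and lg: "(\<lambda>n. g (ys n)) \<longlonglongrightarrow> g x"
    using polyf_tendsto f g x y by blast+
  have ef: "(\<lambda>n. (f (xs n) - f (ys n) - ?Df n) / ?N n) \<longlonglongrightarrow> 0"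
    and eg: "(\<lambda>n. (g (xs n) - g (ys n) - ?Dg n) / ?N n) \<longlonglongrightarrow> 0"
    using f g x y unfolding grad_def by blast+
  have z1: "(\<lambda>n. (f (xs n) - f x) * (?Dg n / ?N n)) \<longlonglongrightarrow> 0"
  proof (rule Lim_null_comparison)
    show "\<forall>\<^sub>F n in sequentially. norm ((f (xs n) - f x) * (?Dg n / ?N n)) \<le> cmod (f (xs n) - f x) * (\<Sum>i\<in>I. cmod (D' i x))"
      unfolding norm_mult by (intro always_eventually allI mult_left_mono bounded_quotient) auto
    show "(\<lambda>n. cmod (f (xs n) - f x) * (\<Sum>i\<in>I. cmod (D' i x))) \<longlonglongrightarrow> 0"
      using lf by (intro tendsto_mult_left_zero tendsto_norm_zero) (simp add: LIM_zero_iff)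
  qed
  have z2: "(\<lambda>n. (g (ys n) - g x) * (?Df n / ?N n)) \<longlonglongrightarrow> 0"
  proof (rule Lim_null_comparison)
    show "\<forall>\<^sub>F n in sequentially. norm ((g (ys n) - g x) * (?Df n / ?N n)) \<le> cmod (g (ys n) - g x) * (\<Sum>i\<in>I. cmod (D i x))"
      unfolding norm_mult by (intro always_eventually allI mult_left_mono bounded_quotient) auto
    show "(\<lambda>n. cmod (g (ys n) - g x) * (\<Sum>i\<in>I. cmod (D i x))) \<longlonglongrightarrow> 0"
      using lg by (intro tendsto_mult_left_zero tendsto_norm_zero) (simp add: LIM_zero_iff)
  qed
  have "(\<lambda>n. f (xs n) * ((g (xs n) - g (ys n) - ?Dg n) / ?N n) + g (ys n) * ((f (xs n) - f (ys n) - ?Df n) / ?N n)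
      + (f (xs n) - f x) * (?Dg n / ?N n) + (g (ys n) - g x) * (?Df n / ?N n)) \<longlonglongrightarrow> f x * 0 + g x * 0 + 0 + 0"
    by (intro tendsto_add tendsto_mult lf lg ef eg z1 z2)
  moreover have "f (xs n) * g (xs n) - f (ys n) * g (ys n) - (\<Sum>i\<in>I. (f x * D' i x + g x * D i x) * (xs n i - ys n i)) =
      f (xs n) * (g (xs n) - g (ys n) - ?Dg n) + g (ys n) * (f (xs n) - f (ys n) - ?Df n)
      + (f (xs n) - f x) * ?Dg n + (g (ys n) - g x) * ?Df n" for n
  proof -
    have "(\<Sum>i\<in>I. (f x * D' i x + g x * D i x) * (xs n i - ys n i)) = f x * ?Dg n + g x * ?Df n"
      by (simp add: sum.distrib sum_distrib_left distrib_right mult.assoc)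
    moreover have "fx * gx - fy * gy - (f0 * A + g0 * C) =
        fx * (gx - gy - A) + gy * (fx - fy - C) + (fx - f0) * A + (gy - g0) * C"
      for fx gx fy gy f0 g0 A C :: complex by (simp add: algebra_simps)
    ultimately show ?thesis by presburger
  qed
  ultimately show "(\<lambda>n. (f (xs n) * g (xs n) - f (ys n) * g (ys n) -
      (\<Sum>i\<in>I. (f x * D' i x + g x * D i x) * (xs n i - ys n i))) / ?N n) \<longlonglongrightarrow> 0"
    by (simp add: add_divide_distrib)
qed

lemma grad_exists:
  assumes "finite I" "polyf I f"
  shows "\<exists>D. grad I f D"
  using assms(2)
proof induction
  case (polyf_const c)
  show ?case by (intro exI[of _ "\<lambda>_ _. 0"]) (simp add: grad_def)
next
  case (polyf_var i)
  have s: "(\<Sum>j\<in>I. (if j = i then 1 else 0) * (h j :: complex)) = h i" for h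
  proof -
    have "(\<Sum>j\<in>I. (if j = i then 1 else 0) * h j) = (\<Sum>j\<in>I. if j = i then h j else 0)"
      by (intro sum.cong) auto
    then show ?thesis using polyf_var assms(1) by simp
  qed
  show ?case
    by (intro exI[of _ "\<lambda>j _. if j = i then 1 else 0"]) (use polyf_var in \<open>simp add: grad_def s\<close>)
next
  case (polyf_add f g)
  then obtain D D' where D: "grad I f D" "grad I g D'" by blast
  have "grad I (\<lambda>x. f x + g x) (\<lambda>i x. D i x + D' i x)"
    unfolding grad_def
  proof (intro conjI allI impI)
    fix \<phi> :: "complex \<Rightarrow> 'a \<Rightarrow> complex" and \<phi>' z assume "\<forall>i\<in>I. ((\<lambda>s. \<phi> s i) has_field_derivative \<phi>' i) (at z)"
    then have "((\<lambda>s. f (\<phi> s)) has_field_derivative (\<Sum>i\<in>I. D i (\<phi> z) * \<phi>' i)) (at z)"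
      "((\<lambda>s. g (\<phi> s)) has_field_derivative (\<Sum>i\<in>I. D' i (\<phi> z) * \<phi>' i)) (at z)"
      using D unfolding grad_def by blast+
    from DERIV_add[OF this]
    show "((\<lambda>s. f (\<phi> s) + g (\<phi> s)) has_field_derivative (\<Sum>i\<in>I. (D i (\<phi> z) + D' i (\<phi> z)) * \<phi>' i)) (at z)"
      by (simp add: sum.distrib distrib_right)
  next
    fix x :: "'a \<Rightarrow> complex" and xs ys assume x: "\<forall>i\<in>I. (\<lambda>n. xs n i) \<longlonglongrightarrow> x i" and y: "\<forall>i\<in>I. (\<lambda>n. ys n i) \<longlonglongrightarrow> x i"
    let ?N = "\<lambda>n::nat. complex_of_real (\<Sum>i\<in>I. cmod (xs n i - ys n i))"
    have "(\<lambda>n. (f (xs n) - f (ys n) - (\<Sum>i\<in>I. D i x * (xs n i - ys n i))) / ?N n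
        + (g (xs n) - g (ys n) - (\<Sum>i\<in>I. D' i x * (xs n i - ys n i))) / ?N n) \<longlonglongrightarrow> 0 + 0"
      using D x y unfolding grad_def by (intro tendsto_add) blast+
    moreover have "(a - b - A) / N + (c - d - A') / N = (a + c - (b + d) - (A + A')) / N"
      for a b c d A A' N :: complex by (simp add: add_divide_distrib diff_divide_distrib)
    moreover have "(\<Sum>i\<in>I. (D i x + D' i x) * (xs n i - ys n i)) =
        (\<Sum>i\<in>I. D i x * (xs n i - ys n i)) + (\<Sum>i\<in>I. D' i x * (xs n i - ys n i))" for n
      by (simp add: sum.distrib distrib_right)
    ultimately show "(\<lambda>n. (f (xs n) + g (xs n) - (f (ys n) + g (ys n)) -
        (\<Sum>i\<in>I. (D i x + D' i x) * (xs n i - ys n i))) / ?N n) \<longlonglongrightarrow> 0"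
      by (simp only: add_0_left)
  qed
  then show ?case by blast
next
  case (polyf_mult f g)
  then show ?case using grad_mult[OF assms(1)] by blast
qed

text \<open>Injectivity of the Jacobian in the variables \<open>K\<close>, expressed by directional
  derivatives instead of a matrix.\<close>

definition nondeg :: "'i set \<Rightarrow> 'e set \<Rightarrow> ('e \<Rightarrow> ('i \<Rightarrow> complex) \<Rightarrow> complex) \<Rightarrow> ('i \<Rightarrow> complex) \<Rightarrow> bool" where
  "nondeg K E f x \<longleftrightarrow> (\<forall>v. (\<forall>e\<in>E. ((\<lambda>s. f e (\<lambda>a. x a + s * v a)) has_field_derivative 0) (at 0)) \<longrightarrow>
     (\<forall>k\<in>K. v k = 0))"

text \<open>The relation is differentiated along \<open>v\<close>. Its coefficients are functions of
  the \<open>f e\<close> and have derivative 0, which leaves the derivative of the relation at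
  \<open>x k\<close> times \<open>v k\<close>.\<close>

lemma relation_deriv:
  assumes E: "finite E" and P: "rel_deg E f (\<lambda>x. x k) d P"
    and pd: "poly (pderiv (P (\<lambda>e. f e x))) (x k) \<noteq> 0"
    and v: "\<And>e. e \<in> E \<Longrightarrow> ((\<lambda>s. f e (\<lambda>a. x a + s * v a)) has_field_derivative 0) (at 0)"
  shows "v k = 0"
proof -
  let ?\<phi> = "\<lambda>s a. x a + s * v a"
  have c0: "((\<lambda>s. coeff (P (\<lambda>e. f e (?\<phi> s))) j) has_field_derivative 0) (at 0)" for j
  proof -
    have "polyf E (\<lambda>l. coeff (P l) j)" using P by (simp add: rel_deg_def ppoly_def)
    then obtain D where D: "grad E (\<lambda>l. coeff (P l) j) D" using grad_exists[OF E] by blast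
    have "((\<lambda>s. (\<lambda>l. coeff (P l) j) (\<lambda>e. f e (?\<phi> s))) has_field_derivative
        (\<Sum>e\<in>E. D e (\<lambda>e. f e (?\<phi> 0)) * 0)) (at 0)"
      using D[unfolded grad_def, THEN conjunct1, rule_format, of "\<lambda>s e. f e (?\<phi> s)" "\<lambda>_. 0" 0] v by blast
    then show ?thesis by simp
  qed
  have lin: "((\<lambda>s. (x k + s * v k) ^ j) has_field_derivative (of_nat j * x k ^ (j - 1) * v k)) (at 0)" for j
    by (rule derivative_eq_intros refl | simp)+
  have "((\<lambda>s. \<Sum>j\<le>d. coeff (P (\<lambda>e. f e (?\<phi> s))) j * (x k + s * v k) ^ j) has_field_derivative
      (\<Sum>j\<le>d. coeff (P (\<lambda>e. f e x)) j * (of_nat j * x k ^ (j - 1) * v k))) (at 0)"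
    by (rule DERIV_sum) (rule DERIV_cong[OF DERIV_mult[OF c0 lin]], simp)
  moreover have "(\<lambda>s. \<Sum>j\<le>d. coeff (P (\<lambda>e. f e (?\<phi> s))) j * (x k + s * v k) ^ j) = (\<lambda>s. 0)"
  proof
    fix s
    have r: "poly (P (\<lambda>e. f e (?\<phi> s))) (x k + s * v k) = 0" using P unfolding rel_deg_def by blast
    have "degree (P (\<lambda>e. f e (?\<phi> s))) \<le> d" using P unfolding rel_deg_def by blast
    from poly_bounded_degree[OF this, of "x k + s * v k"] r
    show "(\<Sum>j\<le>d. coeff (P (\<lambda>e. f e (?\<phi> s))) j * (x k + s * v k) ^ j) = 0"
      by (rule trans[OF sym])
  qed
  ultimately have "((\<lambda>s. 0) has_field_derivative
      (\<Sum>j\<le>d. coeff (P (\<lambda>e. f e x)) j * (of_nat j * x k ^ (j - 1) * v k))) (at (0::complex))"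
    by (simp only:)
  then have "(\<Sum>j\<le>d. coeff (P (\<lambda>e. f e x)) j * (of_nat j * x k ^ (j - 1) * v k)) = 0"
    by (rule DERIV_unique) (rule DERIV_const)
  moreover have "poly (pderiv p) z = (\<Sum>j\<le>d. coeff p j * (of_nat j * z ^ (j - 1)))"
    if "degree p \<le> d" for p :: "complex poly" and z
  proof -
    have "((\<lambda>z. \<Sum>j\<le>d. coeff p j * z ^ j) has_field_derivative (\<Sum>j\<le>d. coeff p j * (of_nat j * z ^ (j - 1)))) (at z)"
      by (rule DERIV_sum) (rule derivative_eq_intros refl | simp)+
    moreover have "(\<lambda>z. \<Sum>j\<le>d. coeff p j * z ^ j) = poly p"
      using poly_bounded_degree[OF that] by auto
    ultimately have "(poly p has_field_derivative (\<Sum>j\<le>d. coeff p j * (of_nat j * z ^ (j - 1)))) (at z)"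
      by (simp only:)
    then show ?thesis using DERIV_unique[OF poly_DERIV] by blast
  qed
  ultimately have "poly (pderiv (P (\<lambda>e. f e x))) (x k) * v k = 0"
    using P unfolding rel_deg_def by (simp add: sum_distrib_right mult.assoc)
  with pd show ?thesis by simp
qed

text \<open>Each coordinate is algebraic over the components of an independent map. The leading
  coefficients of minimal relations control properness, their derivatives control the Jacobian.\<close>

lemma generic_proper_nondeg:
  assumes K: "finite K" and E: "finite E" "card K \<le> card E" and f: "\<And>e. e \<in> E \<Longrightarrow> polyf K (f e)"
    and indep: "alg_indep E f"
  shows "\<exists>P. polyf E P \<and> (\<exists>l. P l \<noteq> 0) \<and>
    (\<forall>l. P l \<noteq> 0 \<longrightarrow>
      (\<forall>x. (\<forall>e\<in>E. f e x = l e) \<longrightarrow> nondeg K E f x) \<and>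
      (\<forall>ls xs. (\<forall>e\<in>E. (\<lambda>n. ls n e) \<longlonglongrightarrow> l e) \<longrightarrow> (\<forall>n. \<forall>e\<in>E. f e (xs n) = ls n e) \<longrightarrow>
         (\<forall>k\<in>K. Bseq (\<lambda>n. xs n k))))"
proof -
  have "\<forall>k\<in>K. \<exists>P. \<exists>d. rel_deg E f (\<lambda>x. x k) (Suc d) P \<and> (\<exists>l. coeff (P l) (Suc d) \<noteq> 0) \<and>
    (\<exists>x. poly (pderiv (P (\<lambda>e. f e x))) (x k) \<noteq> 0)"
    using minimal_relation[OF K E f polyf_var indep] by blast
  from bchoice[OF this] obtain P where "\<forall>k\<in>K. \<exists>d. rel_deg E f (\<lambda>x. x k) (Suc d) (P k) \<and>
    (\<exists>l. coeff (P k l) (Suc d) \<noteq> 0) \<and> (\<exists>x. poly (pderiv (P k (\<lambda>e. f e x))) (x k) \<noteq> 0)" ..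
  from bchoice[OF this] obtain d where P: "\<And>k. k \<in> K \<Longrightarrow> rel_deg E f (\<lambda>x. x k) (Suc (d k)) (P k)"
    and lead: "\<And>k. k \<in> K \<Longrightarrow> \<exists>l. coeff (P k l) (Suc (d k)) \<noteq> 0"
    and pd: "\<And>k. k \<in> K \<Longrightarrow> \<exists>x. poly (pderiv (P k (\<lambda>e. f e x))) (x k) \<noteq> 0" by blast
  have pP: "ppoly E (P k)" if "k \<in> K" for k using P[OF that] by (simp add: rel_deg_def)
  have pderP: "ppoly E (\<lambda>l. pderiv (P k l))" if "k \<in> K" for k
  proof -
    have "\<forall>l. degree (pderiv (P k l)) \<le> d k"
      using P[OF that] unfolding rel_deg_def by (metis degree_pderiv diff_Suc_1 diff_le_mono)
    moreover have "polyf E (\<lambda>l. coeff (pderiv (P k l)) j)" for j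
      using pP[OF that] unfolding ppoly_def coeff_pderiv by (intro polyf_mult polyf_const) auto
    ultimately show ?thesis unfolding ppoly_def by blast
  qed
  define h where "h k x = poly (pderiv (P k (\<lambda>e. f e x))) (x k)" for k x
  have hp: "polyf K (h k)" if "k \<in> K" for k
    unfolding h_def by (rule polyf_poly_ppoly[OF pderP[OF that] f polyf_var[OF that]])
  have "\<forall>k\<in>K. \<exists>q. polyf E q \<and> (\<exists>l. q l \<noteq> 0) \<and> (\<forall>x. h k x = 0 \<longrightarrow> q (\<lambda>e. f e x) = 0)"
  proof
    fix k assume k: "k \<in> K"
    obtain z where "h k z \<noteq> 0" using pd[OF k] unfolding h_def by blast
    from zero_set_in_hypersurface[OF K E f hp[OF k] this]
    show "\<exists>q. polyf E q \<and> (\<exists>l. q l \<noteq> 0) \<and> (\<forall>x. h k x = 0 \<longrightarrow> q (\<lambda>e. f e x) = 0)" .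
  qed
  from bchoice[OF this] obtain q where q: "\<And>k. k \<in> K \<Longrightarrow> polyf E (q k)"
    "\<And>k. k \<in> K \<Longrightarrow> \<exists>l. q k l \<noteq> 0" "\<And>k x. k \<in> K \<Longrightarrow> h k x = 0 \<Longrightarrow> q k (\<lambda>e. f e x) = 0" by blast
  \<comment> \<open>Where \<open>R\<close> does not vanish, the factors \<open>q k\<close> keep
    \<open>h k\<close> nonzero on the fiber, and the leading coefficients bound the points of nearby
    fibers.\<close>
  define R where "R l = (\<Prod>k\<in>K. q k l * coeff (P k l) (Suc (d k)))" for l
  have pc: "polyf E (\<lambda>l. coeff (P k l) (Suc (d k)))" if "k \<in> K" for k
    using pP[OF that] by (simp add: ppoly_def)
  have ne: "\<exists>l. q k l * coeff (P k l) (Suc (d k)) \<noteq> 0" if k: "k \<in> K" for k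
    using polyf_nonzero_mult[OF q(1)[OF k] pc[OF k]] q(2)[OF k] lead[OF k] by fastforce
  have pf: "polyf E (\<lambda>l. q k l * coeff (P k l) (Suc (d k)))" if "k \<in> K" for k
    by (intro polyf_mult q pc that)
  have "\<exists>l. R l \<noteq> 0"
    using polyf_nonzero_prod[OF K, of E "\<lambda>k l. q k l * coeff (P k l) (Suc (d k))"] pf ne K
    unfolding R_def by fastforce
  moreover have "polyf E R" unfolding R_def by (intro polyf_prod pf)
  moreover have "(\<forall>x. (\<forall>e\<in>E. f e x = l e) \<longrightarrow> nondeg K E f x) \<and>
      (\<forall>ls xs. (\<forall>e\<in>E. (\<lambda>n. ls n e) \<longlonglongrightarrow> l e) \<longrightarrow> (\<forall>n. \<forall>e\<in>E. f e (xs n) = ls n e) \<longrightarrow>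
         (\<forall>k\<in>K. Bseq (\<lambda>n. xs n k)))" if "R l \<noteq> 0" for l
  proof (intro conjI allI impI ballI)
    fix x assume x: "\<forall>e\<in>E. f e x = l e"
    have "h k x \<noteq> 0" if "k \<in> K" for k
    proof
      assume "h k x = 0"
      then have "q k (\<lambda>e. f e x) = 0" using q(3) that by blast
      then have "q k l = 0" using polyf_cong[OF q(1)[OF that], of "\<lambda>e. f e x" l] x by simp
      then show False using \<open>R l \<noteq> 0\<close> that K unfolding R_def by auto
    qed
    then show "nondeg K E f x"
      unfolding nondeg_def h_def using relation_deriv[OF E(1) P] by blast
  next
    fix ls xs k
    assume ls: "\<forall>e\<in>E. (\<lambda>n. ls n e) \<longlonglongrightarrow> l e" and xs: "\<forall>n. \<forall>e\<in>E. f e (xs n) = ls n e" and k: "k \<in> K"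
    show "Bseq (\<lambda>n. xs n k)"
    proof (rule ppoly_roots_bounded[OF pP[OF k], where d = "d k" and l = l and ls = "\<lambda>n e. f e (xs n)"])
      show "coeff (P k l) (Suc (d k)) \<noteq> 0" using \<open>R l \<noteq> 0\<close> k K unfolding R_def by auto
      show "degree (P k l) \<le> Suc (d k)" for l using P[OF k] by (simp add: rel_deg_def)
      show "(\<lambda>n. f e (xs n)) \<longlonglongrightarrow> l e" if "e \<in> E" for e
        using ls xs that by simp
      show "poly (P k (\<lambda>e. f e (xs n))) (xs n k) = 0" for n
        using P[OF k] by (simp add: rel_deg_def)
    qed
  qed
  ultimately show ?thesis by blast
qed

section \<open>Generic fibers of polynomial maps: local analysis\<close>

lemma subseq_of_bounded:
  fixes xs :: "nat \<Rightarrow> 'i \<Rightarrow> complex"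
  assumes "finite K" "\<And>k. k \<in> K \<Longrightarrow> Bseq (\<lambda>n. xs n k)"
  shows "\<exists>r l. strict_mono (r :: nat \<Rightarrow> nat) \<and> (\<forall>k\<in>K. (\<lambda>n. xs (r n) k) \<longlonglongrightarrow> l k)"
  using assms
proof (induction K rule: finite_induct)
  case empty
  show ?case by (rule exI[of _ id]) (simp add: strict_mono_def)
next
  case (insert k K)
  then obtain r l where r: "strict_mono (r :: nat \<Rightarrow> nat)" "\<forall>k\<in>K. (\<lambda>n. xs (r n) k) \<longlonglongrightarrow> l k" by auto
  have "bounded (range (\<lambda>n. xs n k))" using insert.prems[of k] by (simp add: Bseq_eq_bounded)
  then have "bounded (range (\<lambda>n. xs (r n) k))" by (rule bounded_subset) auto
  then obtain a r' where r': "strict_mono (r' :: nat \<Rightarrow> nat)" "((\<lambda>n. xs (r n) k) \<circ> r') \<longlonglongrightarrow> a"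
    using bounded_imp_convergent_subsequence by blast
  have "(\<lambda>n. xs ((r \<circ> r') n) j) \<longlonglongrightarrow> (l(k := a)) j" if "j \<in> insert k K" for j
  proof (cases "j = k")
    case True
    then show ?thesis using r'(2) by (simp add: o_def)
  next
    case False
    then have "(\<lambda>n. xs (r n) j) \<longlonglongrightarrow> l j" using r that by auto
    from LIMSEQ_subseq_LIMSEQ[OF this r'(1)] show ?thesis using False by (simp add: o_def)
  qed
  then show ?case using strict_mono_o[OF r(1) r'(1)] by blast
qed

text \<open>Injectivity gives solvability by counting unknowns, hence a right inverse; this is also
  a left inverse because \<open>A\<close> is injective.\<close>

lemma injective_square_inverse:
  fixes A :: "'e \<Rightarrow> 'k \<Rightarrow> complex"
  assumes "finite K" "finite E" "card K = card E"
    and inj: "\<And>v. (\<And>e. e \<in> E \<Longrightarrow> (\<Sum>k\<in>K. A e k * v k) = 0) \<Longrightarrow> \<forall>k\<in>K. v k = 0"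
  shows "\<exists>C. (\<forall>e\<in>E. \<forall>e'\<in>E. (\<Sum>k\<in>K. A e k * C k e') = (if e = e' then 1 else 0)) \<and>
    (\<forall>k\<in>K. \<forall>k'\<in>K. (\<Sum>e\<in>E. C k e * A e k') = (if k = k' then 1 else 0))"
proof -
  have "\<exists>v. \<forall>e\<in>E. (\<Sum>k\<in>K. A e k * v k) = (y e :: complex)" for y
  proof -
    \<comment> \<open>The right-hand side \<open>y\<close> becomes an additional column, so there
      are more unknowns than equations; injectivity of \<open>A\<close> keeps the coefficient of
      this column from vanishing.\<close>
    define A' where "A' e o' = (case o' of None \<Rightarrow> y e | Some k \<Rightarrow> A e k)" for e o'
    have "card E < card (insert None (Some ` K))" using assms by (simp add: card_image)
    then obtain c where c: "\<exists>i\<in>insert None (Some ` K). c i \<noteq> 0"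
        "\<forall>e\<in>E. (\<Sum>i\<in>insert None (Some ` K). A' e i * c i) = 0"
      using homogeneous_system[of E "insert None (Some ` K)" A'] assms(1,2) by blast
    have s: "y e * c None + (\<Sum>k\<in>K. A e k * c (Some k)) = 0" if "e \<in> E" for e
      using c(2) that assms(1) by (simp add: sum.reindex A'_def)
    have "c None \<noteq> 0"
    proof
      assume z: "c None = 0"
      then have "\<forall>k\<in>K. c (Some k) = 0" using s by (intro inj) auto
      then show False using c(1) z by auto
    qed
    have "(\<Sum>k\<in>K. A e k * (- c (Some k) / c None)) = y e" if "e \<in> E" for e
    proof -
      have "(\<Sum>k\<in>K. A e k * (- c (Some k) / c None)) = - (\<Sum>k\<in>K. A e k * c (Some k)) / c None"
        by (simp add: sum_divide_distrib sum_negf)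
      also have "\<dots> = y e" using s[OF that] \<open>c None \<noteq> 0\<close> by (simp add: field_simps add_eq_0_iff)
      finally show ?thesis .
    qed
    then show ?thesis by (intro exI[of _ "\<lambda>k. - c (Some k) / c None"]) auto
  qed
  then have "\<exists>v. \<forall>e'. \<forall>e\<in>E. (\<Sum>k\<in>K. A e k * v e' k) = (if e = e' then 1 else 0)"
    by (intro choice allI)
  then obtain C where C: "\<And>e e'. e \<in> E \<Longrightarrow> (\<Sum>k\<in>K. A e k * C e' k) = (if e = e' then 1 else 0)"
    by blast
  have "(\<Sum>e\<in>E. C e k * A e k') = (if k = k' then 1 else 0)" if "k \<in> K" "k' \<in> K" for k k'
  proof -
    \<comment> \<open>In matrix terms, \<open>A (C A - 1) = (A C) A - A = 0\<close>.\<close>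
    have "\<forall>k\<in>K. (\<Sum>e\<in>E. C e k * A e k') - (if k = k' then 1 else 0) = 0"
    proof (rule inj)
      fix e assume e: "e \<in> E"
      have "(\<Sum>k\<in>K. A e k * (\<Sum>e'\<in>E. C e' k * A e' k')) = (\<Sum>e'\<in>E. (\<Sum>k\<in>K. A e k * C e' k) * A e' k')"
        unfolding sum_distrib_left sum_distrib_right by (subst sum.swap) (simp add: mult.assoc)
      also have "\<dots> = (\<Sum>e'\<in>E. if e = e' then A e' k' else 0)"
        using C[OF e] by (intro sum.cong) auto
      also have "\<dots> = A e k'" using e assms(2) by simp
      finally have "(\<Sum>k\<in>K. A e k * (\<Sum>e'\<in>E. C e' k * A e' k')) = A e k'" .
      moreover have "(\<Sum>k\<in>K. A e k * (if k = k' then 1 else 0)) = A e k'"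
        using that(2) assms(1) by (simp add: if_distrib[of "(*) _"] cong: if_cong)
      ultimately show "(\<Sum>k\<in>K. A e k * ((\<Sum>e\<in>E. C e k * A e k') - (if k = k' then 1 else 0))) = 0"
        by (simp add: right_diff_distrib sum_subtractf)
    qed
    then show ?thesis using that by auto
  qed
  then show ?thesis using C by (intro exI[of _ "\<lambda>k e. C e k"]) auto
qed

section \<open>Local inversion near nondegenerate points\<close>

definition nrm :: "'i set \<Rightarrow> ('i \<Rightarrow> complex) \<Rightarrow> ('i \<Rightarrow> complex) \<Rightarrow> real" where
  "nrm K x y = (\<Sum>k\<in>K. cmod (x k - y k))"

lemma nrm_nonneg: "nrm K x y \<ge> 0"
  by (simp add: nrm_def sum_nonneg)

lemma nrm_zero: "finite K \<Longrightarrow> nrm K x y = 0 \<longleftrightarrow> (\<forall>k\<in>K. x k = y k)"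
  by (auto simp: nrm_def sum_nonneg_eq_0_iff)

lemma nrm_le: "finite K \<Longrightarrow> k \<in> K \<Longrightarrow> cmod (x k - y k) \<le> nrm K x y"
  unfolding nrm_def by (rule member_le_sum) auto

lemma nrm_triangle: "nrm K x z \<le> nrm K x y + nrm K y z"
  unfolding nrm_def sum.distrib[symmetric]
  by (intro sum_mono) (metis diff_add_cancel add_diff_eq norm_triangle_ineq)

lemma nrm_tendsto:
  assumes "\<And>k. k \<in> K \<Longrightarrow> (\<lambda>n. xs n k) \<longlonglongrightarrow> x k" "\<And>k. k \<in> K \<Longrightarrow> (\<lambda>n. ys n k) \<longlonglongrightarrow> y k"
  shows "(\<lambda>n. nrm K (xs n) (ys n)) \<longlonglongrightarrow> nrm K x y"
  unfolding nrm_def by (intro tendsto_sum tendsto_norm tendsto_diff assms)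

lemma nrm_tendsto_iff:
  assumes "finite K"
  shows "(\<lambda>n. nrm K (xs n) x) \<longlonglongrightarrow> 0 \<longleftrightarrow> (\<forall>k\<in>K. (\<lambda>n. xs n k) \<longlonglongrightarrow> x k)"
proof
  assume lim: "(\<lambda>n. nrm K (xs n) x) \<longlonglongrightarrow> 0"
  show "\<forall>k\<in>K. (\<lambda>n. xs n k) \<longlonglongrightarrow> x k"
  proof
    fix k assume "k \<in> K"
    then have "(\<lambda>n. xs n k - x k) \<longlonglongrightarrow> 0"
      using nrm_le[OF assms] by (intro Lim_null_comparison[OF always_eventually lim]) auto
    then show "(\<lambda>n. xs n k) \<longlonglongrightarrow> x k" by (simp add: LIM_zero_iff)
  qed
next
  assume "\<forall>k\<in>K. (\<lambda>n. xs n k) \<longlonglongrightarrow> x k"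
  then have "(\<lambda>n. nrm K (xs n) x) \<longlonglongrightarrow> nrm K x x" by (intro nrm_tendsto) auto
  then show "(\<lambda>n. nrm K (xs n) x) \<longlonglongrightarrow> 0" by (simp add: nrm_def)
qed

text \<open>Sequences violating the estimate on balls of radius \<open>1 / Suc n\<close> would
  contradict strict differentiability at \<open>x0\<close>.\<close>

lemma grad_uniform:
  assumes K: "finite K" and "polyf K f" "grad K f D" "\<epsilon> > 0"
  shows "\<exists>\<delta>>0. \<forall>x y. nrm K x x0 < \<delta> \<longrightarrow> nrm K y x0 < \<delta> \<longrightarrow>
    cmod (f x - f y - (\<Sum>i\<in>K. D i x0 * (x i - y i))) \<le> \<epsilon> * nrm K x y"
proof (rule ccontr)
  assume contra: "\<not> ?thesis"
  have "\<forall>n::nat. \<exists>p. nrm K (fst p) x0 < 1 / real (Suc n) \<and> nrm K (snd p) x0 < 1 / real (Suc n) \<and>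
      cmod (f (fst p) - f (snd p) - (\<Sum>i\<in>K. D i x0 * (fst p i - snd p i))) > \<epsilon> * nrm K (fst p) (snd p)"
  proof
    fix n :: nat
    have "1 / real (Suc n) > 0" by simp
    then show "\<exists>p. nrm K (fst p) x0 < 1 / real (Suc n) \<and> nrm K (snd p) x0 < 1 / real (Suc n) \<and>
      cmod (f (fst p) - f (snd p) - (\<Sum>i\<in>K. D i x0 * (fst p i - snd p i))) > \<epsilon> * nrm K (fst p) (snd p)"
      using contra by (auto simp: not_le)
  qed
  from choice[OF this] obtain p where p: "\<And>n. nrm K (fst (p n)) x0 < 1 / real (Suc n)"
    "\<And>n. nrm K (snd (p n)) x0 < 1 / real (Suc n)"
    "\<And>n. cmod (f (fst (p n)) - f (snd (p n)) - (\<Sum>i\<in>K. D i x0 * (fst (p n) i - snd (p n) i))) > \<epsilon> * nrm K (fst (p n)) (snd (p n))"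
    by blast
  have inv0: "(\<lambda>n. 1 / real (Suc n)) \<longlonglongrightarrow> 0" using LIMSEQ_inverse_real_of_nat by (simp add: inverse_eq_divide)
  have "(\<lambda>n. nrm K (fst (p n)) x0) \<longlonglongrightarrow> 0"
    by (rule Lim_null_comparison[OF always_eventually inv0]) (use p(1) nrm_nonneg[of K] in \<open>auto simp: less_imp_le\<close>)
  then have l1: "\<forall>k\<in>K. (\<lambda>n. fst (p n) k) \<longlonglongrightarrow> x0 k" by (simp add: nrm_tendsto_iff[OF K])
  have "(\<lambda>n. nrm K (snd (p n)) x0) \<longlonglongrightarrow> 0"
    by (rule Lim_null_comparison[OF always_eventually inv0]) (use p(2) nrm_nonneg[of K] in \<open>auto simp: less_imp_le\<close>)
  then have l2: "\<forall>k\<in>K. (\<lambda>n. snd (p n) k) \<longlonglongrightarrow> x0 k" by (simp add: nrm_tendsto_iff[OF K])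
  have "(\<lambda>n. (f (fst (p n)) - f (snd (p n)) - (\<Sum>i\<in>K. D i x0 * (fst (p n) i - snd (p n) i))) /
      of_real (nrm K (fst (p n)) (snd (p n)))) \<longlonglongrightarrow> 0"
    unfolding nrm_def
    by (rule assms(3)[unfolded grad_def, THEN conjunct2, rule_format]) (use l1 l2 in auto)
  from LIMSEQ_D[OF this assms(4)] obtain n where
    n: "cmod ((f (fst (p n)) - f (snd (p n)) - (\<Sum>i\<in>K. D i x0 * (fst (p n) i - snd (p n) i))) /
      of_real (nrm K (fst (p n)) (snd (p n)))) < \<epsilon>" by fastforce
  show False
  proof (cases "nrm K (fst (p n)) (snd (p n)) = 0")
    case True
    then have eq: "\<forall>k\<in>K. fst (p n) k = snd (p n) k" using nrm_zero[OF K] by blast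
    then have "f (fst (p n)) = f (snd (p n))" using polyf_cong[OF assms(2)] by blast
    then show False using p(3)[of n] eq True by simp
  next
    case False
    then have "nrm K (fst (p n)) (snd (p n)) > 0" using nrm_nonneg[of K] by (metis less_eq_real_def)
    then show False using n p(3)[of n] by (simp add: norm_divide divide_less_eq)
  qed
qed

lemma geometric_convergent:
  fixes x :: "nat \<Rightarrow> complex"
  assumes "\<And>m. cmod (x (Suc m) - x m) \<le> c * (1/2) ^ m"
  shows "convergent x"
proof -
  have "summable (\<lambda>m. c * (1/2::real) ^ m)" by (intro summable_mult summable_geometric) simp
  then have "summable (\<lambda>m. x (Suc m) - x m)"
    by (rule summable_comparison_test[rotated]) (use assms in auto)
  then have "convergent (\<lambda>n. \<Sum>m<n. x (Suc m) - x m)" by (simp add: summable_iff_convergent)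
  then have "convergent (\<lambda>n. x n - x 0)" by (simp add: sum_lessThan_telescope)
  then have "convergent (\<lambda>n. (x n - x 0) + x 0)" by (rule convergent_add) (rule convergent_const)
  then show ?thesis by simp
qed

text \<open>Banach iteration started at the centre of a closed ball.\<close>

lemma contraction_fixpoint:
  fixes T :: "('i \<Rightarrow> complex) \<Rightarrow> 'i \<Rightarrow> complex"
  assumes K: "finite K"
    and contr: "\<And>x y. nrm K x x0 \<le> r \<Longrightarrow> nrm K y x0 \<le> r \<Longrightarrow> nrm K (T x) (T y) \<le> nrm K x y / 2"
    and start: "nrm K (T x0) x0 \<le> r / 2"
    and cont: "\<And>xs x k. (\<And>j. j \<in> K \<Longrightarrow> (\<lambda>n::nat. xs n j) \<longlonglongrightarrow> x j) \<Longrightarrow> k \<in> K \<Longrightarrow> (\<lambda>n. T (xs n) k) \<longlonglongrightarrow> T x k"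
  shows "\<exists>x. nrm K x x0 \<le> r \<and> (\<forall>k\<in>K. T x k = x k)"
proof -
  define it where "it m = (T ^^ m) x0" for m
  have it_Suc: "it (Suc m) = T (it m)" for m by (simp add: it_def)
  have r: "r \<ge> 0" using start nrm_nonneg[of K "T x0" x0] by simp
  \<comment> \<open>The steps have length at most \<open>r/2\<close>, \<open>r/4\<close>, and so on;
    their sum \<open>r * (1 - (1/2) ^ m)\<close> keeps the iterates in the ball, where
    \<open>contr\<close> applies.\<close>
  have inv: "nrm K (it m) x0 \<le> r * (1 - (1/2) ^ m) \<and> nrm K (it (Suc m)) (it m) \<le> r / 2 * (1/2) ^ m" for m
  proof (induction m)
    case 0
    then show ?case using start by (simp add: it_def nrm_def)
  next
    case (Suc m)
    have pw: "r * (1 - (1/2) ^ m) \<le> r" for m using r by (simp add: mult_left_le)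
    have "nrm K (it (Suc m)) x0 \<le> nrm K (it (Suc m)) (it m) + nrm K (it m) x0" by (rule nrm_triangle)
    also have "\<dots> \<le> r / 2 * (1/2) ^ m + r * (1 - (1/2) ^ m)" using Suc by simp
    also have "\<dots> = r * (1 - (1/2) ^ Suc m)" by (simp add: algebra_simps)
    finally have 1: "nrm K (it (Suc m)) x0 \<le> r * (1 - (1/2) ^ Suc m)" .
    have "nrm K (it (Suc (Suc m))) (it (Suc m)) \<le> nrm K (it (Suc m)) (it m) / 2"
      unfolding it_Suc[of "Suc m"] unfolding it_Suc[of m]
      using contr[of "T (it m)" "it m"] 1 Suc pw[of "Suc m"] pw[of m] unfolding it_Suc by linarith
    also have "\<dots> \<le> r / 2 * (1/2) ^ Suc m" using Suc by simp
    finally show ?case using 1 by simp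
  qed
  have "\<exists>l. (\<lambda>m. it m k) \<longlonglongrightarrow> l" if "k \<in> K" for k
  proof -
    have "convergent (\<lambda>m. it m k)"
    proof (rule geometric_convergent[where c = "r / 2"])
      fix m
      have "cmod (it (Suc m) k - it m k) \<le> nrm K (it (Suc m)) (it m)" by (rule nrm_le[OF K that])
      then show "cmod (it (Suc m) k - it m k) \<le> r / 2 * (1/2) ^ m" using inv[of m] by linarith
    qed
    then show ?thesis by (simp add: convergent_def)
  qed
  then have "\<forall>k\<in>K. \<exists>l. (\<lambda>m. it m k) \<longlonglongrightarrow> l" by blast
  from bchoice[OF this] obtain x where x: "\<And>k. k \<in> K \<Longrightarrow> (\<lambda>m. it m k) \<longlonglongrightarrow> x k" by blast
  have "(\<lambda>m. nrm K (it m) x0) \<longlonglongrightarrow> nrm K x x0" by (intro nrm_tendsto x) auto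
  moreover have "nrm K (it m) x0 \<le> r" for m
    using inv[of m] r mult_left_le[of "1 - (1/2) ^ m" r] by force
  ultimately have "nrm K x x0 \<le> r" using LIMSEQ_le_const2 by blast
  moreover have "T x k = x k" if k: "k \<in> K" for k
  proof -
    have "(\<lambda>m. T (it m) k) \<longlonglongrightarrow> T x k" by (rule cont[OF x k])
    moreover have "(\<lambda>m. it (Suc m) k) \<longlonglongrightarrow> x k" using x[OF k] by (rule LIMSEQ_Suc)
    ultimately show ?thesis unfolding it_Suc using LIMSEQ_unique by blast
  qed
  ultimately show ?thesis by blast
qed

text \<open>Newton iteration with the derivative frozen at \<open>x0\<close>. Existence is stated
  for every radius \<open>r\<close> below \<rho>, so that preimages can be found arbitrarily close
  to \<open>x0\<close>.\<close>

lemma local_inverse: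
  assumes K: "finite K" and E: "finite E" "card K = card E" and f: "\<And>e. e \<in> E \<Longrightarrow> polyf K (f e)"
    and nd: "nondeg K E f x0"
  shows "\<exists>\<rho>>0. (\<forall>x y. nrm K x x0 \<le> \<rho> \<longrightarrow> nrm K y x0 \<le> \<rho> \<longrightarrow> (\<forall>e\<in>E. f e x = f e y) \<longrightarrow> (\<forall>k\<in>K. x k = y k)) \<and>
    (\<forall>r>0. r \<le> \<rho> \<longrightarrow> (\<exists>\<eta>>0. \<forall>l. (\<forall>e\<in>E. cmod (l e - f e x0) < \<eta>) \<longrightarrow> (\<exists>x. nrm K x x0 \<le> r \<and> (\<forall>e\<in>E. f e x = l e))))"
proof -
  have "\<forall>e\<in>E. \<exists>D. grad K (f e) D" using grad_exists[OF K f] by blast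
  from bchoice[OF this] obtain D where D: "\<And>e. e \<in> E \<Longrightarrow> grad K (f e) (D e)" by blast
  define A where "A e k = D e k x0" for e k
  have inj: "\<forall>k\<in>K. v k = 0" if "\<And>e. e \<in> E \<Longrightarrow> (\<Sum>k\<in>K. A e k * v k) = 0" for v
  proof -
    have "((\<lambda>s. f e (\<lambda>a. x0 a + s * v a)) has_field_derivative 0) (at 0)" if e: "e \<in> E" for e
    proof -
      have "((\<lambda>s. x0 i + s * v i) has_field_derivative v i) (at 0)" for i
        by (rule derivative_eq_intros refl | simp)+
      then have "((\<lambda>s. f e (\<lambda>a. x0 a + s * v a)) has_field_derivative
          (\<Sum>i\<in>K. D e i (\<lambda>a. x0 a + 0 * v a) * v i)) (at 0)"
        using D[OF e, unfolded grad_def, THEN conjunct1, rule_format, of "\<lambda>s a. x0 a + s * v a" v 0] by blast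
      then show ?thesis using \<open>\<And>e. e \<in> E \<Longrightarrow> (\<Sum>k\<in>K. A e k * v k) = 0\<close>[OF e] by (simp add: A_def)
    qed
    then show ?thesis using nd unfolding nondeg_def by blast
  qed
  have "\<exists>C. (\<forall>e\<in>E. \<forall>e'\<in>E. (\<Sum>k\<in>K. A e k * C k e') = (if e = e' then 1 else 0)) \<and>
    (\<forall>k\<in>K. \<forall>k'\<in>K. (\<Sum>e\<in>E. C k e * A e k') = (if k = k' then 1 else 0))"
    by (rule injective_square_inverse[OF K E inj])
  then obtain C where C: "\<forall>e\<in>E. \<forall>e'\<in>E. (\<Sum>k\<in>K. A e k * C k e') = (if e = e' then 1 else 0)"
    "\<forall>k\<in>K. \<forall>k'\<in>K. (\<Sum>e\<in>E. C k e * A e k') = (if k = k' then 1 else 0)" by (elim exE conjE)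
  have AC: "(\<Sum>k\<in>K. A e k * C k e') = (if e = e' then 1 else 0)" if "e \<in> E" "e' \<in> E" for e e'
    using C(1) that by blast
  have CA: "(\<Sum>e\<in>E. C k e * A e k') = (if k = k' then 1 else 0)" if "k \<in> K" "k' \<in> K" for k k'
    using C(2) that by blast
  define c where "c = (\<Sum>k\<in>K. \<Sum>e\<in>E. cmod (C k e))"
  have c: "c \<ge> 0" unfolding c_def by (intro sum_nonneg) auto
  \<comment> \<open>With \<open>c\<close> bounding the inverse Jacobian, this gives
    \<open>c * \<epsilon> \<le> 1/2\<close>, the contraction factor; the summand 1 guards against
    \<open>c = 0\<close>.\<close>
  define \<epsilon> where "\<epsilon> = 1 / (2 * (c + 1))"
  have \<epsilon>: "\<epsilon> > 0" "c * \<epsilon> \<le> 1 / 2" using c unfolding \<epsilon>_def by (auto simp: field_simps)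
  have "\<forall>e\<in>E. \<exists>\<delta>>0. \<forall>x y. nrm K x x0 < \<delta> \<longrightarrow> nrm K y x0 < \<delta> \<longrightarrow>
    cmod (f e x - f e y - (\<Sum>i\<in>K. D e i x0 * (x i - y i))) \<le> \<epsilon> * nrm K x y"
    using grad_uniform[OF K f D \<epsilon>(1)] by blast
  from bchoice[OF this] obtain \<delta> where \<delta>: "\<And>e. e \<in> E \<Longrightarrow> \<delta> e > 0"
    "\<And>e x y. e \<in> E \<Longrightarrow> nrm K x x0 < \<delta> e \<Longrightarrow> nrm K y x0 < \<delta> e \<Longrightarrow>
      cmod (f e x - f e y - (\<Sum>i\<in>K. A e i * (x i - y i))) \<le> \<epsilon> * nrm K x y"
    unfolding A_def by blast
  define \<rho> where "\<rho> = Min (insert 1 (\<delta> ` E)) / 2"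
  have "Min (insert 1 (\<delta> ` E)) > 0" using E \<delta>(1) by (subst Min_gr_iff) auto
  then have \<rho>0: "\<rho> > 0" by (simp add: \<rho>_def)
  have \<rho>: "\<rho> < \<delta> e" if "e \<in> E" for e
  proof -
    have "Min (insert 1 (\<delta> ` E)) \<le> \<delta> e" using that E by (intro Min_le) auto
    then show ?thesis using \<rho>0 unfolding \<rho>_def by linarith
  qed
  \<comment> \<open>\<open>C\<close> is the inverse of the Jacobian at \<open>x0\<close>, so fixed
    points of \<open>T l\<close> are the solutions of \<open>f x = l\<close>.\<close>
  define T where "T l x k = x k - (\<Sum>e\<in>E. C k e * (f e x - l e))" for l x k
  have bound: "nrm K (\<lambda>k. \<Sum>e\<in>E. C k e * g e) (\<lambda>_. 0) \<le> c * M" if "\<And>e. e \<in> E \<Longrightarrow> cmod (g e) \<le> M" for g M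
  proof -
    have "nrm K (\<lambda>k. \<Sum>e\<in>E. C k e * g e) (\<lambda>_. 0) \<le> (\<Sum>k\<in>K. \<Sum>e\<in>E. cmod (C k e) * M)"
      unfolding nrm_def using that
      by (intro sum_mono) (auto intro!: sum_norm_le simp: norm_mult mult_left_mono)
    then show ?thesis by (simp add: c_def sum_distrib_right)
  qed
  have contr: "nrm K (T l x) (T l y) \<le> nrm K x y / 2" if "nrm K x x0 \<le> \<rho>" "nrm K y x0 \<le> \<rho>" for l x y
  proof -
    have "T l x k - T l y k = - (\<Sum>e\<in>E. C k e * (f e x - f e y - (\<Sum>i\<in>K. A e i * (x i - y i))))" if "k \<in> K" for k
    proof -
      have "(\<Sum>e\<in>E. C k e * (\<Sum>i\<in>K. A e i * (x i - y i))) = (\<Sum>i\<in>K. (\<Sum>e\<in>E. C k e * A e i) * (x i - y i))"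
        unfolding sum_distrib_left sum_distrib_right by (subst sum.swap) (simp add: mult.assoc)
      also have "\<dots> = (\<Sum>i\<in>K. if k = i then x i - y i else 0)" using CA[OF that] by (intro sum.cong) auto
      also have "\<dots> = x k - y k" using that K by simp
      finally show ?thesis
        unfolding T_def by (simp add: right_diff_distrib sum_subtractf)
    qed
    then have "nrm K (T l x) (T l y) = nrm K (\<lambda>k. \<Sum>e\<in>E. C k e * (f e x - f e y - (\<Sum>i\<in>K. A e i * (x i - y i)))) (\<lambda>_. 0)"
      unfolding nrm_def by (intro sum.cong) auto
    also have "\<dots> \<le> c * (\<epsilon> * nrm K x y)"
      using \<delta>(2) \<rho> that by (intro bound) (meson le_less_trans)
    also have "\<dots> \<le> 1 / 2 * nrm K x y"
      using mult_right_mono[OF \<epsilon>(2) nrm_nonneg[of K x y]] by (simp add: mult.assoc)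
    finally show ?thesis by simp
  qed
  have sol: "f e x = l e" if "\<And>k. k \<in> K \<Longrightarrow> T l x k = x k" "e \<in> E" for l x e
  proof -
    have z: "(\<Sum>e\<in>E. C k e * (f e x - l e)) = 0" if "k \<in> K" for k
      using \<open>\<And>k. k \<in> K \<Longrightarrow> T l x k = x k\<close>[OF that] by (simp add: T_def)
    have "(\<Sum>k\<in>K. A e k * (\<Sum>e'\<in>E. C k e' * (f e' x - l e'))) = (\<Sum>e'\<in>E. (\<Sum>k\<in>K. A e k * C k e') * (f e' x - l e'))"
      unfolding sum_distrib_left sum_distrib_right by (subst sum.swap) (simp add: mult.assoc)
    also have "\<dots> = (\<Sum>e'\<in>E. if e = e' then f e' x - l e' else 0)"
      using AC[OF that(2)] by (intro sum.cong) auto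
    also have "\<dots> = f e x - l e" using that(2) E by simp
    finally show ?thesis using z by simp
  qed
  have "\<forall>k\<in>K. x k = y k" if "nrm K x x0 \<le> \<rho>" "nrm K y x0 \<le> \<rho>" "\<forall>e\<in>E. f e x = f e y" for x y
  proof -
    have "nrm K (T (\<lambda>e. f e x) x) (T (\<lambda>e. f e x) y) = nrm K x y"
      unfolding nrm_def T_def using that(3) by (intro sum.cong) auto
    then have "nrm K x y \<le> nrm K x y / 2" using contr[OF that(1,2)] by metis
    then have "nrm K x y = 0" using nrm_nonneg[of K x y] by linarith
    then show ?thesis using nrm_zero[OF K] by blast
  qed
  moreover have "\<exists>\<eta>>0. \<forall>l. (\<forall>e\<in>E. cmod (l e - f e x0) < \<eta>) \<longrightarrow> (\<exists>x. nrm K x x0 \<le> r \<and> (\<forall>e\<in>E. f e x = l e))"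
    if r: "r > 0" "r \<le> \<rho>" for r
  \<comment> \<open>This bound on \<open>l - f x0\<close> makes the first Newton step at most
    \<open>r / 2\<close>.\<close>
  proof (intro exI[of _ "r / (2 * (c + 1))"] conjI allI impI)
    show "r / (2 * (c + 1)) > 0" using r c by simp
    fix l assume l: "\<forall>e\<in>E. cmod (l e - f e x0) < r / (2 * (c + 1))"
    have "\<exists>x. nrm K x x0 \<le> r \<and> (\<forall>k\<in>K. T l x k = x k)"
    proof (rule contraction_fixpoint[OF K])
      show "nrm K (T l x) (T l y) \<le> nrm K x y / 2" if "nrm K x x0 \<le> r" "nrm K y x0 \<le> r" for x y
        using contr that r by force
      have "nrm K (T l x0) x0 = nrm K (\<lambda>k. \<Sum>e\<in>E. C k e * (f e x0 - l e)) (\<lambda>_. 0)"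
        unfolding nrm_def T_def by (intro sum.cong) auto
      also have "\<dots> \<le> c * (r / (2 * (c + 1)))"
        using l by (intro bound) (simp add: norm_minus_commute less_imp_le)
      also have "\<dots> = (c / (c + 1)) * (r / 2)" by simp
      also have "\<dots> \<le> 1 * (r / 2)" using c r by (intro mult_right_mono) auto
      finally show "nrm K (T l x0) x0 \<le> r / 2" by simp
      show "(\<lambda>n. T l (xs n) k) \<longlonglongrightarrow> T l x k" if "\<And>j. j \<in> K \<Longrightarrow> (\<lambda>n::nat. xs n j) \<longlonglongrightarrow> x j" "k \<in> K" for xs x k
      proof -
        have "(\<lambda>n. f e (xs n)) \<longlonglongrightarrow> f e x" if "e \<in> E" for e
          by (rule polyf_tendsto[OF f[OF that]]) fact
        then show ?thesis
          unfolding T_def by (intro tendsto_diff tendsto_sum tendsto_mult tendsto_const that) auto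
      qed
    qed
    then show "\<exists>x. nrm K x x0 \<le> r \<and> (\<forall>e\<in>E. f e x = l e)" using sol by blast
  qed
  ultimately show ?thesis using \<rho>0 by blast
qed

lemma nondeg_eventually_unique:
  assumes K: "finite K" and E: "finite E" "card K = card E" and f: "\<And>e. e \<in> E \<Longrightarrow> polyf K (f e)"
    and nd: "nondeg K E f x0"
    and "\<And>k. k \<in> K \<Longrightarrow> (\<lambda>n. xs n k) \<longlonglongrightarrow> x0 k" "\<And>k. k \<in> K \<Longrightarrow> (\<lambda>n. ys n k) \<longlonglongrightarrow> x0 k"
    and eq: "\<forall>\<^sub>F n in sequentially. \<forall>e\<in>E. f e (xs n) = f e (ys n)"
  shows "\<forall>\<^sub>F n in sequentially. \<forall>k\<in>K. xs n k = ys n k"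
proof -
  have "\<exists>\<rho>>0. (\<forall>x y. nrm K x x0 \<le> \<rho> \<longrightarrow> nrm K y x0 \<le> \<rho> \<longrightarrow> (\<forall>e\<in>E. f e x = f e y) \<longrightarrow> (\<forall>k\<in>K. x k = y k)) \<and>
    (\<forall>r>0. r \<le> \<rho> \<longrightarrow> (\<exists>\<eta>>0. \<forall>l. (\<forall>e\<in>E. cmod (l e - f e x0) < \<eta>) \<longrightarrow> (\<exists>x. nrm K x x0 \<le> r \<and> (\<forall>e\<in>E. f e x = l e))))" by (rule local_inverse[OF K E f nd])
  then obtain \<rho> where \<rho>: "\<rho> > 0" "\<And>x y. nrm K x x0 \<le> \<rho> \<Longrightarrow> nrm K y x0 \<le> \<rho> \<Longrightarrow> (\<forall>e\<in>E. f e x = f e y) \<Longrightarrow> (\<forall>k\<in>K. x k = y k)"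
    by blast
  have "(\<lambda>n. nrm K (xs n) x0) \<longlonglongrightarrow> 0" "(\<lambda>n. nrm K (ys n) x0) \<longlonglongrightarrow> 0"
    using assms(6,7) by (auto simp: nrm_tendsto_iff[OF K])
  then have "\<forall>\<^sub>F n in sequentially. nrm K (xs n) x0 < \<rho>" "\<forall>\<^sub>F n in sequentially. nrm K (ys n) x0 < \<rho>"
    using order_tendstoD(2)[OF _ \<rho>(1)] by blast+
  then show ?thesis using eq by eventually_elim (use \<rho>(2) in force)
qed

text \<open>Solutions are chosen in the fixed ball of radius \<rho>. Solutions also exist eventually
  in every smaller ball, and by uniqueness in the large ball they are the chosen ones; hence these
  converge to \<open>x0\<close>.\<close>

lemma nondeg_lift:
  assumes K: "finite K" and E: "finite E" "card K = card E" and f: "\<And>e. e \<in> E \<Longrightarrow> polyf K (f e)"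
    and nd: "nondeg K E f x0" and ls: "\<And>e. e \<in> E \<Longrightarrow> (\<lambda>n. ls n e) \<longlonglongrightarrow> f e x0"
  shows "\<exists>xs. (\<forall>n. xs n \<in> cvec K) \<and> (\<forall>k\<in>K. (\<lambda>n. xs n k) \<longlonglongrightarrow> x0 k) \<and> (\<forall>\<^sub>F n in sequentially. \<forall>e\<in>E. f e (xs n) = ls n e)"
proof -
  have "\<exists>\<rho>>0. (\<forall>x y. nrm K x x0 \<le> \<rho> \<longrightarrow> nrm K y x0 \<le> \<rho> \<longrightarrow> (\<forall>e\<in>E. f e x = f e y) \<longrightarrow> (\<forall>k\<in>K. x k = y k)) \<and>
    (\<forall>r>0. r \<le> \<rho> \<longrightarrow> (\<exists>\<eta>>0. \<forall>l. (\<forall>e\<in>E. cmod (l e - f e x0) < \<eta>) \<longrightarrow> (\<exists>x. nrm K x x0 \<le> r \<and> (\<forall>e\<in>E. f e x = l e))))" by (rule local_inverse[OF K E f nd])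
  then obtain \<rho> where \<rho>: "\<rho> > 0" "\<And>x y. nrm K x x0 \<le> \<rho> \<Longrightarrow> nrm K y x0 \<le> \<rho> \<Longrightarrow> (\<forall>e\<in>E. f e x = f e y) \<Longrightarrow> (\<forall>k\<in>K. x k = y k)"
    "\<And>r. r > 0 \<Longrightarrow> r \<le> \<rho> \<Longrightarrow> \<exists>\<eta>>0. \<forall>l. (\<forall>e\<in>E. cmod (l e - f e x0) < \<eta>) \<longrightarrow> (\<exists>x. nrm K x x0 \<le> r \<and> (\<forall>e\<in>E. f e x = l e))"
    by blast
  have ex: "\<forall>\<^sub>F n in sequentially. \<exists>x. nrm K x x0 \<le> r \<and> (\<forall>e\<in>E. f e x = ls n e)" if r: "r > 0" "r \<le> \<rho>" for r
  proof -
    obtain \<eta> where \<eta>: "\<eta> > 0" "\<And>l. (\<forall>e\<in>E. cmod (l e - f e x0) < \<eta>) \<Longrightarrow> (\<exists>x. nrm K x x0 \<le> r \<and> (\<forall>e\<in>E. f e x = l e))"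
      using \<rho>(3)[OF r] by blast
    have "\<forall>\<^sub>F n in sequentially. \<forall>e\<in>E. cmod (ls n e - f e x0) < \<eta>"
      using E(1) ls \<eta>(1) by (intro eventually_ball_finite) (auto simp: tendsto_iff dist_norm)
    then show ?thesis by eventually_elim (use \<eta>(2) in blast)
  qed
  define xs0 where "xs0 n = (SOME x. nrm K x x0 \<le> \<rho> \<and> (\<forall>e\<in>E. f e x = ls n e))" for n
  have xs0: "\<forall>\<^sub>F n in sequentially. nrm K (xs0 n) x0 \<le> \<rho> \<and> (\<forall>e\<in>E. f e (xs0 n) = ls n e)"
    using ex[OF \<rho>(1) order_refl]
  proof (rule eventually_mono)
    fix n assume "\<exists>x. nrm K x x0 \<le> \<rho> \<and> (\<forall>e\<in>E. f e x = ls n e)"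
    from someI_ex[OF this] show "nrm K (xs0 n) x0 \<le> \<rho> \<and> (\<forall>e\<in>E. f e (xs0 n) = ls n e)"
      unfolding xs0_def .
  qed
  have "(\<lambda>n. nrm K (xs0 n) x0) \<longlonglongrightarrow> 0"
  proof (rule LIMSEQ_I)
    fix r :: real assume "r > 0"
    define r' where "r' = min (r / 2) \<rho>"
    have "r' > 0" "r' \<le> \<rho>" "r' < r" using \<open>r > 0\<close> \<rho>(1) by (auto simp: r'_def)
    have "\<forall>\<^sub>F n in sequentially. norm (nrm K (xs0 n) x0 - 0) < r"
      using xs0 ex[OF \<open>r' > 0\<close> \<open>r' \<le> \<rho>\<close>]
    proof eventually_elim
      case (elim n)
      then obtain x where x: "nrm K x x0 \<le> r'" "\<forall>e\<in>E. f e x = ls n e" by blast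
      have "\<forall>k\<in>K. x k = xs0 n k"
        by (rule \<rho>(2)) (use x elim \<open>r' \<le> \<rho>\<close> in auto)
      then have "nrm K (xs0 n) x0 = nrm K x x0" unfolding nrm_def by (intro sum.cong) auto
      then show ?case using x \<open>r' < r\<close> nrm_nonneg[of K x x0] by simp
    qed
    then show "\<exists>no. \<forall>n\<ge>no. norm (nrm K (xs0 n) x0 - 0) < r" by (simp add: eventually_sequentially)
  qed
  then have lim: "\<forall>k\<in>K. (\<lambda>n. xs0 n k) \<longlonglongrightarrow> x0 k" by (simp add: nrm_tendsto_iff[OF K])
  have fr: "f e (rst K x) = f e x" if "e \<in> E" for e x by (rule polyf_cong[OF f[OF that]]) simp
  have "\<forall>\<^sub>F n in sequentially. \<forall>e\<in>E. f e (rst K (xs0 n)) = ls n e"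
    using xs0 by eventually_elim (simp add: fr)
  then show ?thesis using lim by (intro exI[of _ "\<lambda>n. rst K (xs0 n)"]) (auto simp: rst_in_cvec)
qed

text \<open>If the elements of \<open>S n\<close> converge to finitely many limits, and each limit is approached by
  exactly one branch, then \<open>S n\<close> eventually has as many elements as there are limits.\<close>

lemma count_limits:
  fixes S :: "nat \<Rightarrow> 'x set" and T :: "'t set" and conv :: "(nat \<Rightarrow> 'x) \<Rightarrow> 't \<Rightarrow> bool"
  assumes fin: "finite T"
    and ex: "\<And>\<tau>. \<tau> \<in> T \<Longrightarrow> \<exists>\<beta>. (\<forall>\<^sub>F n in sequentially. \<beta> n \<in> S n) \<and> conv \<beta> \<tau>"
    and uniq: "\<And>x \<tau> \<tau>' r. strict_mono r \<Longrightarrow> (\<And>n. x n \<in> S (r n)) \<Longrightarrow>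
      \<tau> \<in> T \<Longrightarrow> \<tau>' \<in> T \<Longrightarrow> conv x \<tau> \<Longrightarrow> conv x \<tau>' \<Longrightarrow> \<tau> = \<tau>'"
    and sub: "\<And>x \<tau> r. \<tau> \<in> T \<Longrightarrow> conv x \<tau> \<Longrightarrow> strict_mono r \<Longrightarrow> conv (\<lambda>n. x (r n)) \<tau>"
    and comp: "\<And>x r. strict_mono r \<Longrightarrow> (\<And>n. x n \<in> S (r n)) \<Longrightarrow>
      \<exists>r' \<tau>. strict_mono (r' :: nat \<Rightarrow> nat) \<and> \<tau> \<in> T \<and> conv (\<lambda>n. x (r' n)) \<tau>"
    and sep: "\<And>x y \<tau> r. strict_mono r \<Longrightarrow> \<tau> \<in> T \<Longrightarrow> conv x \<tau> \<Longrightarrow> conv y \<tau> \<Longrightarrow>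
      (\<And>n. x n \<in> S (r n)) \<Longrightarrow> (\<And>n. y n \<in> S (r n)) \<Longrightarrow> \<forall>\<^sub>F n in sequentially. x n = y n"
  shows "\<forall>\<^sub>F n in sequentially. finite (S n) \<and> card (S n) = card T"
proof -
  have "\<forall>\<tau>\<in>T. \<exists>\<beta>. (\<forall>\<^sub>F n in sequentially. \<beta> n \<in> S n) \<and> conv \<beta> \<tau>" using ex by blast
  from bchoice[OF this] obtain \<beta> where \<beta>: "\<And>\<tau>. \<tau> \<in> T \<Longrightarrow> \<forall>\<^sub>F n in sequentially. \<beta> \<tau> n \<in> S n"
    "\<And>\<tau>. \<tau> \<in> T \<Longrightarrow> conv (\<beta> \<tau>) \<tau>" by blast
  have mem: "\<forall>\<^sub>F n in sequentially. \<forall>\<tau>\<in>T. \<beta> \<tau> n \<in> S n"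
    using fin \<beta>(1) by (intro eventually_ball_finite) auto
  have "\<forall>\<^sub>F n in sequentially. \<beta> \<tau> n \<noteq> \<beta> \<tau>' n" if "\<tau> \<in> T" "\<tau>' \<in> T" "\<tau> \<noteq> \<tau>'" for \<tau> \<tau>'
  proof (rule ccontr)
    assume "\<not> ?thesis"
    moreover have "\<forall>\<^sub>F n in sequentially. \<beta> \<tau> n \<noteq> \<beta> \<tau>' n"
      if "\<forall>\<^sub>F n in sequentially. \<beta> \<tau> n \<in> S n \<longrightarrow> \<beta> \<tau> n \<noteq> \<beta> \<tau>' n"
      using that \<beta>(1)[OF \<open>\<tau> \<in> T\<close>] by eventually_elim blast
    ultimately have "\<not> (\<forall>\<^sub>F n in sequentially. \<beta> \<tau> n \<in> S n \<longrightarrow> \<beta> \<tau> n \<noteq> \<beta> \<tau>' n)" by blast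
    from not_eventually_sequentiallyD[OF this] obtain r :: "nat \<Rightarrow> nat"
      where r: "strict_mono r" "\<And>n. \<beta> \<tau> (r n) = \<beta> \<tau>' (r n)" "\<And>n. \<beta> \<tau> (r n) \<in> S (r n)" by blast
    have "conv (\<lambda>n. \<beta> \<tau> (r n)) \<tau>" by (rule sub[OF that(1) \<beta>(2)[OF that(1)] r(1)])
    moreover have "conv (\<lambda>n. \<beta> \<tau> (r n)) \<tau>'"
      using sub[OF that(2) \<beta>(2)[OF that(2)] r(1)] by (simp add: r(2))
    ultimately show False using uniq[OF r(1,3) that(1,2)] that(3) by blast
  qed
  then have "\<forall>\<^sub>F n in sequentially. \<forall>\<tau>\<in>T. \<forall>\<tau>'\<in>T. \<tau> \<noteq> \<tau>' \<longrightarrow> \<beta> \<tau> n \<noteq> \<beta> \<tau>' n"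
    using fin by (intro eventually_ball_finite ballI) (auto intro: eventually_mono)
  then have inj: "\<forall>\<^sub>F n in sequentially. inj_on (\<lambda>\<tau>. \<beta> \<tau> n) T"
    by eventually_elim (auto simp: inj_on_def)
  have "\<forall>\<^sub>F n in sequentially. S n \<subseteq> (\<lambda>\<tau>. \<beta> \<tau> n) ` T"
  proof (rule ccontr)
    assume "\<not> ?thesis"
    moreover have "\<forall>\<^sub>F n in sequentially. S n \<subseteq> (\<lambda>\<tau>. \<beta> \<tau> n) ` T"
      if "\<forall>\<^sub>F n in sequentially. (\<forall>\<tau>\<in>T. \<beta> \<tau> n \<in> S n) \<longrightarrow> S n \<subseteq> (\<lambda>\<tau>. \<beta> \<tau> n) ` T"
      using mem that by eventually_elim blast
    ultimately have "\<not> (\<forall>\<^sub>F n in sequentially. (\<forall>\<tau>\<in>T. \<beta> \<tau> n \<in> S n) \<longrightarrow> S n \<subseteq> (\<lambda>\<tau>. \<beta> \<tau> n) ` T)"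
      by blast
    from not_eventually_sequentiallyD[OF this] obtain r :: "nat \<Rightarrow> nat"
      where r: "strict_mono r" "\<And>n. (\<forall>\<tau>\<in>T. \<beta> \<tau> (r n) \<in> S (r n))" "\<And>n. \<not> S (r n) \<subseteq> (\<lambda>\<tau>. \<beta> \<tau> (r n)) ` T"
      by auto
    have "\<forall>n. \<exists>x. x \<in> S (r n) \<and> x \<notin> (\<lambda>\<tau>. \<beta> \<tau> (r n)) ` T" using r(3) by blast
    from choice[OF this] obtain x where x: "\<And>n. x n \<in> S (r n)" "\<And>n. x n \<notin> (\<lambda>\<tau>. \<beta> \<tau> (r n)) ` T" by blast
    obtain r' \<tau> where r': "strict_mono (r' :: nat \<Rightarrow> nat)" "\<tau> \<in> T" "conv (\<lambda>n. x (r' n)) \<tau>"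
      using comp[OF r(1) x(1)] by blast
    have "conv (\<lambda>n. \<beta> \<tau> (r (r' n))) \<tau>"
      using sub[OF r'(2) sub[OF r'(2) \<beta>(2)[OF r'(2)] r(1)] r'(1)] .
    then have "\<forall>\<^sub>F n in sequentially. x (r' n) = \<beta> \<tau> (r (r' n))"
      using sep[OF strict_mono_o[OF r(1) r'(1)] r'(2,3)] x(1) r(2) r'(2) by (simp add: o_def)
    then obtain n where "x (r' n) = \<beta> \<tau> (r (r' n))" using eventually_happens by force
    then show False using x(2) r'(2) by blast
  qed
  with mem inj show ?thesis
  proof eventually_elim
    case (elim n)
    then have "S n = (\<lambda>\<tau>. \<beta> \<tau> n) ` T" by blast
    then show ?case using elim fin by (simp add: card_image)
  qed
qed

section \<open>Cardinality of generic fibers\<close>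

definition fib :: "'i set \<Rightarrow> 'e set \<Rightarrow> ('e \<Rightarrow> ('i \<Rightarrow> complex) \<Rightarrow> complex) \<Rightarrow> ('e \<Rightarrow> complex) \<Rightarrow> ('i \<Rightarrow> complex) set" where
  "fib K E f l = {x \<in> cvec K. \<forall>e\<in>E. f e x = l e}"

lemma cvec_eqI: "x \<in> cvec K \<Longrightarrow> y \<in> cvec K \<Longrightarrow> (\<And>k. k \<in> K \<Longrightarrow> x k = y k) \<Longrightarrow> x = y"
  by (force simp: cvec_def)

text \<open>An injective sequence in the fiber would have a convergent subsequence, whose
  consecutive terms must eventually agree by local uniqueness at the limit.\<close>

lemma fib_finite:
  assumes K: "finite K" and E: "finite E" "card K = card E" and f: "\<And>e. e \<in> E \<Longrightarrow> polyf K (f e)"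
    and nd: "\<And>x. x \<in> fib K E f l \<Longrightarrow> nondeg K E f x"
    and bd: "\<And>xs k. (\<And>n. xs n \<in> fib K E f l) \<Longrightarrow> k \<in> K \<Longrightarrow> Bseq (\<lambda>n. xs n k)"
  shows "finite (fib K E f l)"
proof (rule ccontr)
  assume "infinite (fib K E f l)"
  then obtain xs :: "nat \<Rightarrow> _" where xs: "inj xs" "range xs \<subseteq> fib K E f l"
    using infinite_countable_subset by blast
  then obtain r x0 where r: "strict_mono (r :: nat \<Rightarrow> nat)" "\<forall>k\<in>K. (\<lambda>n. xs (r n) k) \<longlonglongrightarrow> x0 k"
    using subseq_of_bounded[OF K, of xs] bd[of xs] by (meson range_subsetD)
  have val: "f e (xs (r n)) = l e" if "e \<in> E" for e n
    using xs(2) that by (auto simp: fib_def)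
  have "f e (rst K x0) = l e" if e: "e \<in> E" for e
  proof -
    have "(\<lambda>n. f e (xs (r n))) \<longlonglongrightarrow> f e (rst K x0)"
      by (rule polyf_tendsto[OF f[OF e]]) (use r in auto)
    then show ?thesis using val[OF e] by (simp add: LIMSEQ_const_iff)
  qed
  then have nd0: "nondeg K E f (rst K x0)" by (intro nd) (simp add: fib_def rst_in_cvec)
  have "\<forall>\<^sub>F n in sequentially. \<forall>k\<in>K. xs (r n) k = xs (r (Suc n)) k"
  proof (rule nondeg_eventually_unique[OF K E f nd0])
    show "(\<lambda>n. xs (r n) k) \<longlonglongrightarrow> rst K x0 k" if "k \<in> K" for k using r that by simp
    show "(\<lambda>n. xs (r (Suc n)) k) \<longlonglongrightarrow> rst K x0 k" if "k \<in> K" for k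
      using r that by (auto intro: LIMSEQ_Suc[of "\<lambda>n. xs (r n) k"])
  qed (simp_all add: val)
  then obtain n where n: "\<forall>k\<in>K. xs (r n) k = xs (r (Suc n)) k" using eventually_happens by force
  have "xs (r n) = xs (r (Suc n))"
    by (rule cvec_eqI[of _ K]) (use xs(2) n in \<open>auto simp: fib_def\<close>)
  then have "r n = r (Suc n)" using xs(1) by (simp add: inj_eq)
  then show False using r(1) by (metis n_not_Suc_n strict_mono_eq)
qed

text \<open>Here the limits in \<open>count_limits\<close> are the points of the fiber over
  \<open>l\<close> itself: boundedness gives compactness, nondegeneracy gives exactly one branch
  through each point.\<close>

lemma fib_card_locally_constant:
  assumes K: "finite K" and E: "finite E" "card K = card E" and f: "\<And>e. e \<in> E \<Longrightarrow> polyf K (f e)"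
    and nd: "\<And>x. x \<in> fib K E f l \<Longrightarrow> nondeg K E f x"
    and bd: "\<And>ls xs k. (\<And>e. e \<in> E \<Longrightarrow> (\<lambda>n. ls n e) \<longlonglongrightarrow> l e) \<Longrightarrow> (\<And>n. xs n \<in> fib K E f (ls n)) \<Longrightarrow> k \<in> K \<Longrightarrow> Bseq (\<lambda>n. xs n k)"
    and ls: "\<And>e. e \<in> E \<Longrightarrow> (\<lambda>n. ls n e) \<longlonglongrightarrow> l e"
  shows "\<forall>\<^sub>F n in sequentially. finite (fib K E f (ls n)) \<and> card (fib K E f (ls n)) = card (fib K E f l)"
proof (rule count_limits[where conv = "\<lambda>xs x. \<forall>k\<in>K. (\<lambda>n. xs n k) \<longlonglongrightarrow> x k"])
  show "finite (fib K E f l)"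
    by (rule fib_finite[OF K E f nd]) (use bd[of "\<lambda>_. l"] in auto)
next
  fix x0 assume x0: "x0 \<in> fib K E f l"
  have "\<exists>xs. (\<forall>n. xs n \<in> cvec K) \<and> (\<forall>k\<in>K. (\<lambda>n. xs n k) \<longlonglongrightarrow> x0 k) \<and> (\<forall>\<^sub>F n in sequentially. \<forall>e\<in>E. f e (xs n) = ls n e)"
    by (rule nondeg_lift[OF K E f nd[OF x0]]) (use x0 ls in \<open>auto simp: fib_def\<close>)
  then obtain xs where xs: "\<And>n. xs n \<in> cvec K" "\<forall>k\<in>K. (\<lambda>n. xs n k) \<longlonglongrightarrow> x0 k" "\<forall>\<^sub>F n in sequentially. \<forall>e\<in>E. f e (xs n) = ls n e"
    by blast
  have "\<forall>\<^sub>F n in sequentially. xs n \<in> fib K E f (ls n)" using xs(3) by eventually_elim (simp add: fib_def xs(1))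
  then show "\<exists>\<beta>. (\<forall>\<^sub>F n in sequentially. \<beta> n \<in> fib K E f (ls n)) \<and> (\<forall>k\<in>K. (\<lambda>n. \<beta> n k) \<longlonglongrightarrow> x0 k)"
    using xs(2) by blast
next
  fix xs x y assume xy: "x \<in> fib K E f l" "y \<in> fib K E f l" and "\<forall>k\<in>K. (\<lambda>n. xs n k) \<longlonglongrightarrow> x k" "\<forall>k\<in>K. (\<lambda>n. xs n k) \<longlonglongrightarrow> y k"
  then have "\<forall>k\<in>K. x k = y k" using LIMSEQ_unique by blast
  then show "x = y" using xy by (intro cvec_eqI[of _ K]) (auto simp: fib_def)
next
  fix xs x and r :: "nat \<Rightarrow> nat" assume "\<forall>k\<in>K. (\<lambda>n. xs n k) \<longlonglongrightarrow> x k" "strict_mono r"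
  then show "\<forall>k\<in>K. (\<lambda>n. xs (r n) k) \<longlonglongrightarrow> x k"
    using LIMSEQ_subseq_LIMSEQ by (fastforce simp: o_def)
next
  fix xs and r :: "nat \<Rightarrow> nat" assume r: "strict_mono r" and xs: "\<And>n. xs n \<in> fib K E f (ls (r n))"
  have lsr: "(\<lambda>n. ls (r n) e) \<longlonglongrightarrow> l e" if "e \<in> E" for e
    using LIMSEQ_subseq_LIMSEQ[OF ls[OF that] r] by (simp add: o_def)
  have "Bseq (\<lambda>n. xs n k)" if "k \<in> K" for k by (rule bd[OF lsr xs that])
  then obtain r' x0 where r': "strict_mono (r' :: nat \<Rightarrow> nat)" "\<forall>k\<in>K. (\<lambda>n. xs (r' n) k) \<longlonglongrightarrow> x0 k"
    using subseq_of_bounded[OF K, of xs] by blast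
  have "f e (rst K x0) = l e" if e: "e \<in> E" for e
  proof -
    have "(\<lambda>n. f e (xs (r' n))) \<longlonglongrightarrow> f e (rst K x0)"
      by (rule polyf_tendsto[OF f[OF e]]) (use r' in auto)
    moreover have "(\<lambda>n. f e (xs (r' n))) = (\<lambda>n. ls (r (r' n)) e)" using xs e by (auto simp: fib_def)
    moreover have "(\<lambda>n. ls (r (r' n)) e) \<longlonglongrightarrow> l e"
      using LIMSEQ_subseq_LIMSEQ[OF lsr[OF e] r'(1)] by (simp add: o_def)
    ultimately show ?thesis using LIMSEQ_unique by metis
  qed
  then have "rst K x0 \<in> fib K E f l" by (simp add: fib_def rst_in_cvec)
  moreover have "\<forall>k\<in>K. (\<lambda>n. xs (r' n) k) \<longlonglongrightarrow> rst K x0 k" using r' by simp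
  ultimately show "\<exists>r' x. strict_mono (r' :: nat \<Rightarrow> nat) \<and> x \<in> fib K E f l \<and> (\<forall>k\<in>K. (\<lambda>n. xs (r' n) k) \<longlonglongrightarrow> x k)"
    using r'(1) by blast
next
  fix xs ys x and r :: "nat \<Rightarrow> nat"
  assume x: "x \<in> fib K E f l" and lim: "\<forall>k\<in>K. (\<lambda>n. xs n k) \<longlonglongrightarrow> x k" "\<forall>k\<in>K. (\<lambda>n. ys n k) \<longlonglongrightarrow> x k"
    and mem: "\<And>n. xs n \<in> fib K E f (ls (r n))" "\<And>n. ys n \<in> fib K E f (ls (r n))"
  have "\<forall>\<^sub>F n in sequentially. \<forall>k\<in>K. xs n k = ys n k"
    by (rule nondeg_eventually_unique[OF K E f nd[OF x]]) (use lim mem in \<open>auto simp: fib_def\<close>)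
  then show "\<forall>\<^sub>F n in sequentially. xs n = ys n"
    by eventually_elim (use mem in \<open>auto simp: fib_def intro: cvec_eqI[of _ K]\<close>)
qed

text \<open>If the components are algebraically dependent, generic fibers are empty. Otherwise the
  count is locally constant off a hypersurface, and any two points there lie on a complex line that
  meets the hypersurface in finitely many points.\<close>

theorem generic_fiber_count:
  assumes K: "finite K" and E: "finite E" "card K \<le> card E" and f: "\<And>e. e \<in> E \<Longrightarrow> polyf K (f e)"
  shows "\<exists>P N. polyf E P \<and> (\<exists>l. P l \<noteq> 0) \<and> (\<forall>l. P l \<noteq> 0 \<longrightarrow>
    finite (fib K E f l) \<and> card (fib K E f l) = N \<and> (\<forall>x\<in>fib K E f l. nondeg K E f x)) \<and>
    (card K < card E \<longrightarrow> N = 0)"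
proof (cases "alg_indep E f")
  case False
  then obtain Q where Q: "polyf E Q" "\<exists>l. Q l \<noteq> 0" "\<And>x. Q (\<lambda>e. f e x) = 0"
    unfolding alg_indep_def by blast
  have "fib K E f l = {}" if "Q l \<noteq> 0" for l
  proof -
    have "Q (\<lambda>e. f e x) = Q l" if "x \<in> fib K E f l" for x
      by (rule polyf_cong[OF Q(1)]) (use that in \<open>simp add: fib_def\<close>)
    then show ?thesis using Q(3) that by fastforce
  qed
  then show ?thesis using Q by (intro exI[of _ Q] exI[of _ 0]) auto
next
  case indep: True
  have "\<not> card K < card E"
  proof
    assume "card K < card E"
    then obtain Q where "polyf E Q" "\<exists>y. Q y \<noteq> 0" "\<forall>x. Q (\<lambda>j. f j x) = 0"
      using algebraic_dependence[of K E f] K E(1) f by blast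
    then show False using indep unfolding alg_indep_def by blast
  qed
  then have cKE: "card K = card E" using E(2) by simp
  have "\<exists>P. polyf E P \<and> (\<exists>l. P l \<noteq> 0) \<and>
    (\<forall>l. P l \<noteq> 0 \<longrightarrow>
      (\<forall>x. (\<forall>e\<in>E. f e x = l e) \<longrightarrow> nondeg K E f x) \<and>
      (\<forall>ls xs. (\<forall>e\<in>E. (\<lambda>n. ls n e) \<longlonglongrightarrow> l e) \<longrightarrow> (\<forall>n. \<forall>e\<in>E. f e (xs n) = ls n e) \<longrightarrow>
         (\<forall>k\<in>K. Bseq (\<lambda>n. xs n k))))" by (rule generic_proper_nondeg[OF K E f indep])
  then obtain P where P: "polyf E P" "\<exists>l. P l \<noteq> 0"
    "\<forall>l. P l \<noteq> 0 \<longrightarrow>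
      (\<forall>x. (\<forall>e\<in>E. f e x = l e) \<longrightarrow> nondeg K E f x) \<and>
      (\<forall>ls xs. (\<forall>e\<in>E. (\<lambda>n. ls n e) \<longlonglongrightarrow> l e) \<longrightarrow> (\<forall>n. \<forall>e\<in>E. f e (xs n) = ls n e) \<longrightarrow>
         (\<forall>k\<in>K. Bseq (\<lambda>n. xs n k)))" by (elim exE conjE, intro that) (assumption | rule exI)+
  have nd: "nondeg K E f x" if "P l \<noteq> 0" "x \<in> fib K E f l" for l x
    using P(3) that by (auto simp: fib_def)
  have bd: "Bseq (\<lambda>n. xs n k)" if "P l \<noteq> 0" "\<And>e. e \<in> E \<Longrightarrow> (\<lambda>n. ls n e) \<longlonglongrightarrow> l e" "\<And>n. xs n \<in> fib K E f (ls n)" "k \<in> K"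
    for l ls xs k
    using P(3)[rule_format, OF that(1), THEN conjunct2, rule_format, of ls xs k] that by (auto simp: fib_def)
  have loc: "\<forall>\<^sub>F n in sequentially. finite (fib K E f (ls n)) \<and> card (fib K E f (ls n)) = card (fib K E f l)"
    if "P l \<noteq> 0" "\<And>e. e \<in> E \<Longrightarrow> (\<lambda>n. ls n e) \<longlonglongrightarrow> l e" for l ls
  proof (rule fib_card_locally_constant[OF K E(1) cKE f])
    fix ls xs k assume "\<And>e. e \<in> E \<Longrightarrow> (\<lambda>n. ls n e) \<longlonglongrightarrow> l e" "\<And>n. xs n \<in> fib K E f (ls n)" "k \<in> K"
    then show "Bseq (\<lambda>n. xs n k)" by (rule bd[OF that(1)])
  qed (use nd that in auto)
  have fin: "finite (fib K E f l)" if "P l \<noteq> 0" for l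
    using loc[OF that, of "\<lambda>_. l"] by (auto simp: eventually_sequentially)
  obtain l0 where l0: "P l0 \<noteq> 0" using P(2) by blast
  have const: "card (fib K E f l) = card (fib K E f l0)" if l: "P l \<noteq> 0" for l
  proof -
    define L where "L z = (\<lambda>a. l0 a + z * (l a - l0 a))" for z
    define Z where "Z = {z. P (L z) = 0}"
    have L01: "L 0 = l0" "L 1 = l" by (auto simp: L_def)
    have "finite Z"
      using polyf_line_finite_zeros[OF P(1), of l0 0 "\<lambda>a. l a - l0 a"] l0 by (auto simp: Z_def L_def)
    \<comment> \<open>Finitely many points do not disconnect the complex plane, so local constancy
      of the count suffices.\<close>
    then have "connected (- Z)"
      by (intro path_connected_imp_connected path_connected_complement_countable)
         (auto intro: countable_finite)
    moreover have "0 \<in> - Z" "1 \<in> - Z" using l l0 by (auto simp: Z_def L01)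
    moreover have "\<forall>z\<in>-Z. eventually (\<lambda>w. card (fib K E f (L z)) = card (fib K E f (L w))) (at z within -Z)"
    proof
      fix z assume z: "z \<in> - Z"
      show "eventually (\<lambda>w. card (fib K E f (L z)) = card (fib K E f (L w))) (at z within -Z)"
      proof (rule sequentially_imp_eventually_within, intro allI impI)
        fix zs :: "nat \<Rightarrow> complex" assume zs: "(\<forall>n. zs n \<in> - Z \<and> zs n \<noteq> z) \<and> zs \<longlonglongrightarrow> z"
        have "(\<lambda>n. L (zs n) e) \<longlonglongrightarrow> L z e" for e
          unfolding L_def using zs by (intro tendsto_intros) auto
        from loc[OF _ this] have "\<forall>\<^sub>F n in sequentially. finite (fib K E f (L (zs n))) \<and>
            card (fib K E f (L (zs n))) = card (fib K E f (L z))"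
          using z by (simp add: Z_def)
        then show "\<forall>\<^sub>F n in sequentially. card (fib K E f (L z)) = card (fib K E f (L (zs n)))"
          by eventually_elim simp
      qed
    qed
    ultimately have "card (fib K E f (L 0)) = card (fib K E f (L 1))"
      by (rule connected_local_const)
    then show ?thesis by (simp add: L01)
  qed
  show ?thesis
    using P(1,2) fin const nd cKE by (intro exI[of _ P] exI[of _ "card (fib K E f l0)"]) auto
qed

section \<open>Products of vectors from two linear subspaces\<close>

definition gen :: "'e set \<Rightarrow> (('e \<Rightarrow> complex) \<Rightarrow> bool) \<Rightarrow> bool" where
  "gen Y Q \<longleftrightarrow> (\<exists>P. polyf Y P \<and> (\<exists>l. P l \<noteq> 0) \<and> (\<forall>l. P l \<noteq> 0 \<longrightarrow> Q l))"

lemma gen_mp: "gen Y Q \<Longrightarrow> (\<And>l. Q l \<Longrightarrow> R l) \<Longrightarrow> gen Y R"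
  unfolding gen_def by blast

lemma gen_superset: "gen Y Q \<Longrightarrow> Y \<subseteq> E \<Longrightarrow> gen E Q"
  unfolding gen_def using polyf_mono by blast

lemma gen_ex: "gen Y Q \<Longrightarrow> \<exists>l. Q l"
  unfolding gen_def by blast

lemma gen_ball:
  assumes "finite A" "\<And>a. a \<in> A \<Longrightarrow> gen Y (Q a)"
  shows "gen Y (\<lambda>l. \<forall>a\<in>A. Q a l)"
proof -
  have "\<forall>a\<in>A. \<exists>P. polyf Y P \<and> (\<exists>l. P l \<noteq> 0) \<and> (\<forall>l. P l \<noteq> 0 \<longrightarrow> Q a l)"
    using assms(2) unfolding gen_def by blast
  from bchoice[OF this] obtain P where P: "\<And>a. a \<in> A \<Longrightarrow> polyf Y (P a)"
    "\<And>a. a \<in> A \<Longrightarrow> \<exists>l. P a l \<noteq> 0" "\<And>a l. a \<in> A \<Longrightarrow> P a l \<noteq> 0 \<Longrightarrow> Q a l" by blast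
  have "\<exists>l. \<forall>a\<in>A. P a l \<noteq> 0" using polyf_nonzero_prod[OF assms(1) P(1,2)] .
  then have "\<exists>l. (\<Prod>a\<in>A. P a l) \<noteq> 0" using assms(1) by auto
  moreover have "polyf Y (\<lambda>l. \<Prod>a\<in>A. P a l)" by (intro polyf_prod P)
  moreover have "\<forall>a\<in>A. Q a l" if "(\<Prod>a\<in>A. P a l) \<noteq> 0" for l using that P(3) assms(1) by auto
  ultimately show ?thesis unfolding gen_def by blast
qed

lemma gen_conj:
  assumes "gen Y Q" "gen Y R"
  shows "gen Y (\<lambda>l. Q l \<and> R l)"
proof -
  have "gen Y (\<lambda>l. \<forall>b\<in>UNIV::bool set. (if b then Q l else R l))"
  proof (rule gen_ball)
    show "gen Y (\<lambda>l. if b then Q l else R l)" for b using assms by (cases b) auto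
  qed simp
  then show ?thesis by (rule gen_mp) (metis UNIV_I)
qed

lemma gen_nonzero: "finite Y \<Longrightarrow> gen Y (\<lambda>l. \<forall>f\<in>Y. l f \<noteq> 0)"
proof (rule gen_ball)
  fix f assume "f \<in> Y"
  then show "gen Y (\<lambda>l. l f \<noteq> 0)"
    unfolding gen_def by (intro exI[of _ "\<lambda>l. l f"]) (auto intro!: polyf_var exI[of _ "\<lambda>_. 1"])
qed

text \<open>The value at \<open>e\<close> is frozen where the polynomial is nonzero somewhere; for
  generic remaining coordinates it is then a nonzero polynomial in the value at \<open>e\<close>.
  This allows \<open>l\<close> off \<open>e\<close> to be fixed before the value at \<open>e\<close>
  is moved to 0.\<close>

lemma gen_remove:
  assumes "gen E Q"
  shows "gen (E - {e}) (\<lambda>l. finite {t. \<not> Q (l(e := t))})"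
proof -
  obtain P l0 where P: "polyf E P" "P l0 \<noteq> 0" "\<And>l. P l \<noteq> 0 \<Longrightarrow> Q l"
    using assms unfolding gen_def by blast
  have "polyf (E - {e}) (\<lambda>l. (l(e := l0 e)) j)" if "j \<in> E" for j
    using that by (cases "j = e") (auto intro: polyf_const polyf_var)
  then have "polyf (E - {e}) (\<lambda>l. P (l(e := l0 e)))" by (rule polyf_compose[OF P(1)])
  moreover have "P (l0(e := l0 e)) \<noteq> 0" using P(2) by simp
  moreover have "finite {t. \<not> Q (l(e := t))}" if "P (l(e := l0 e)) \<noteq> 0" for l
  proof -
    define v where "v a = (if a = e then 1 else 0 :: complex)" for a
    have eq: "(\<lambda>a. (l(e := 0)) a + t * v a) = l(e := t)" for t by (auto simp: v_def)
    have "finite {t. P (\<lambda>a. (l(e := 0)) a + t * v a) = 0}"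
      by (rule polyf_line_finite_zeros[OF P(1), where ?s0.0 = "l0 e"]) (unfold eq, rule that)
    then have "finite {t. P (l(e := t)) = 0}" by (simp only: eq)
    then show ?thesis by (rule finite_subset[rotated]) (use P(3) in blast)
  qed
  ultimately show ?thesis unfolding gen_def by blast
qed

text \<open>The condition \<open>u g = 1\<close> picks one representative from each orbit of the
  scaling \<open>(c * u, w / c)\<close> of solutions with nonzero \<open>u g\<close>.\<close>

definition sol :: "'e set \<Rightarrow> ('e \<Rightarrow> complex) set \<Rightarrow> ('e \<Rightarrow> complex) set \<Rightarrow> 'e \<Rightarrow> ('e \<Rightarrow> complex)
    \<Rightarrow> (('e \<Rightarrow> complex) \<times> ('e \<Rightarrow> complex)) set" where
  "sol Y U W g l = {(u, w). u \<in> U \<and> w \<in> W \<and> u g = 1 \<and> (\<forall>f\<in>Y. u f * w f = l f)}"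

text \<open>The differential of the product map has only the tangent direction
  \<open>(u, -w)\<close> of the scaling orbit in its kernel.\<close>

definition nd :: "'e set \<Rightarrow> ('e \<Rightarrow> complex) set \<Rightarrow> ('e \<Rightarrow> complex) set \<Rightarrow> ('e \<Rightarrow> complex) \<Rightarrow> ('e \<Rightarrow> complex) \<Rightarrow> bool" where
  "nd Y U W u w \<longleftrightarrow> (\<forall>du\<in>U. \<forall>dw\<in>W. (\<forall>f\<in>Y. u f * dw f + w f * du f = 0) \<longrightarrow>
     (\<exists>c. du = (\<lambda>a. c * u a) \<and> dw = (\<lambda>a. - c * w a)))"

definition good :: "'e set \<Rightarrow> ('e \<Rightarrow> complex) set \<Rightarrow> ('e \<Rightarrow> complex) set \<Rightarrow> nat \<Rightarrow> ('e \<Rightarrow> complex) \<Rightarrow> bool" where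
  "good Y U W N l \<longleftrightarrow> (\<forall>f\<in>Y. l f \<noteq> 0) \<and>
     (\<forall>g\<in>Y. finite (sol Y U W g l) \<and> card (sol Y U W g l) = N \<and> (\<forall>(u, w)\<in>sol Y U W g l. nd Y U W u w))"

text \<open>Each scaling orbit meets both normalisations exactly once, as \<open>u\<close> has no
  zero on \<open>Y\<close> when \<open>l\<close> has none.\<close>

lemma sol_rescale:
  assumes "subsp U" "subsp W" "g \<in> Y" "g' \<in> Y" "\<forall>f\<in>Y. l f \<noteq> 0"
  shows "bij_betw (\<lambda>(u, w). (\<lambda>a. (1 / u g') * u a, \<lambda>a. u g' * w a)) (sol Y U W g l) (sol Y U W g' l)"
proof (rule bij_betw_byWitness[where f' = "\<lambda>(u, w). (\<lambda>a. (1 / u g) * u a, \<lambda>a. u g * w a)"])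
  have nz: "u f \<noteq> 0" if "(u, w) \<in> sol Y U W h l" "f \<in> Y" for u w f h
    using that assms(5) by (auto simp: sol_def)
  have "(\<lambda>a. (1 / u h') * u a, \<lambda>a. u h' * w a) \<in> sol Y U W h' l" if "(u, w) \<in> sol Y U W h l" "h' \<in> Y" for u w h h'
    using nz[OF that] that(1) subsp_scale[OF assms(1), of u "1 / u h'"] subsp_scale[OF assms(2)]
    by (auto simp: sol_def)
  then show "(\<lambda>(u, w). (\<lambda>a. (1 / u g') * u a, \<lambda>a. u g' * w a)) ` sol Y U W g l \<subseteq> sol Y U W g' l"
    "(\<lambda>(u, w). (\<lambda>a. (1 / u g) * u a, \<lambda>a. u g * w a)) ` sol Y U W g' l \<subseteq> sol Y U W g l"
    using assms(3,4) by fastforce+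
  have "(\<lambda>(u, w). (\<lambda>a. (1 / u h) * u a, \<lambda>a. u h * w a)) ((\<lambda>(u, w). (\<lambda>a. (1 / u h') * u a, \<lambda>a. u h' * w a)) (u, w)) = (u, w)"
    if "(u, w) \<in> sol Y U W h l" "h' \<in> Y" for u w h h'
    using nz[OF that] that(1) by (auto simp: sol_def fun_eq_iff)
  then show "\<forall>p\<in>sol Y U W g l. (\<lambda>(u, w). (\<lambda>a. (1 / u g) * u a, \<lambda>a. u g * w a)) ((\<lambda>(u, w). (\<lambda>a. (1 / u g') * u a, \<lambda>a. u g' * w a)) p) = p"
    "\<forall>p\<in>sol Y U W g' l. (\<lambda>(u, w). (\<lambda>a. (1 / u g') * u a, \<lambda>a. u g' * w a)) ((\<lambda>(u, w). (\<lambda>a. (1 / u g) * u a, \<lambda>a. u g * w a)) p) = p"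
    using assms(3,4) by fastforce+
qed

text \<open>Coordinates in which the equations \<open>u f * w f = l f\<close>, \<open>u g = 1\<close> become a polynomial map.\<close>

definition uvec :: "('e \<Rightarrow> complex) set \<Rightarrow> 'e set \<Rightarrow> 'e \<Rightarrow> ('e + 'e \<Rightarrow> complex) \<Rightarrow> 'e \<Rightarrow> complex" where
  "uvec U I g x f = dualb U I g f + (\<Sum>i\<in>I-{g}. x (Inl i) * dualb U I i f)"

definition wvec :: "('e \<Rightarrow> complex) set \<Rightarrow> 'e set \<Rightarrow> ('e + 'e \<Rightarrow> complex) \<Rightarrow> 'e \<Rightarrow> complex" where
  "wvec W J x f = (\<Sum>j\<in>J. x (Inr j) * dualb W J j f)"

lemma uvec_in:
  assumes "subsp U" "is_basis U I"
  shows "uvec U I g x \<in> U"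
proof -
  have "(\<lambda>f. dualb U I g f + (\<Sum>i\<in>I-{g}. x (Inl i) * dualb U I i f)) \<in> U"
    by (intro subsp_add subsp_sum assms(1) dualb(1) assms(2))
  then show ?thesis by (simp add: uvec_def[abs_def])
qed

lemma wvec_in:
  assumes "subsp W" "is_basis W J"
  shows "wvec W J x \<in> W"
  using dualb_sum_in[OF assms, of "\<lambda>j. x (Inr j)"] by (simp add: wvec_def[abs_def])

lemma wvec_coord: "is_basis W J \<Longrightarrow> j \<in> J \<Longrightarrow> wvec W J x j = x (Inr j)"
  unfolding wvec_def by (rule dualb_sum_coord)

lemma uvec_expand:
  assumes "is_basis U I" "g \<in> I"
  shows "uvec U I g x f = (\<Sum>i\<in>I. (if i = g then 1 else x (Inl i)) * dualb U I i f)"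
proof -
  have "(\<Sum>i\<in>I. (if i = g then 1 else x (Inl i)) * dualb U I i f) =
      dualb U I g f + (\<Sum>i\<in>I-{g}. (if i = g then 1 else x (Inl i)) * dualb U I i f)"
    using assms is_basis_finite[OF assms(1)] by (subst sum.remove[of _ g]) auto
  also have "(\<Sum>i\<in>I-{g}. (if i = g then 1 else x (Inl i)) * dualb U I i f) = (\<Sum>i\<in>I-{g}. x (Inl i) * dualb U I i f)"
    by (intro sum.cong) auto
  finally show ?thesis by (simp add: uvec_def)
qed

lemma uvec_coord:
  assumes "is_basis U I" "g \<in> I" "i \<in> I"
  shows "uvec U I g x i = (if i = g then 1 else x (Inl i))"
  unfolding uvec_expand[OF assms(1,2)] using dualb_sum_coord[OF assms(1,3), of "\<lambda>i. if i = g then 1 else x (Inl i)"] .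

lemma polyf_uvec: "Inl ` (I - {g}) \<subseteq> K \<Longrightarrow> polyf K (\<lambda>x. uvec U I g x f)"
  unfolding uvec_def by (intro polyf_add polyf_sum polyf_mult polyf_const polyf_var) auto

lemma polyf_wvec: "Inr ` J \<subseteq> K \<Longrightarrow> polyf K (\<lambda>x. wvec W J x f)"
  unfolding wvec_def by (intro polyf_sum polyf_mult polyf_const polyf_var) auto

text \<open>\<open>Inl\<close> indexes the coordinates of \<open>u\<close>, with \<open>g\<close>
  omitted because \<open>u g = 1\<close>, and \<open>Inr\<close> those of \<open>w\<close>. There
  are \<open>rk U - 1 + rk W\<close> variables, as many as equations when the ranks are
  exact.\<close>

definition pvars :: "'e set \<Rightarrow> 'e \<Rightarrow> 'e set \<Rightarrow> ('e + 'e) set" where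
  "pvars I g J = Inl ` (I - {g}) \<union> Inr ` J"

definition pmap :: "('e \<Rightarrow> complex) set \<Rightarrow> ('e \<Rightarrow> complex) set \<Rightarrow> 'e set \<Rightarrow> 'e \<Rightarrow> 'e set \<Rightarrow> 'e \<Rightarrow> ('e + 'e \<Rightarrow> complex) \<Rightarrow> complex" where
  "pmap U W I g J f x = uvec U I g x f * wvec W J x f"

definition pcoord :: "'e set \<Rightarrow> 'e \<Rightarrow> 'e set \<Rightarrow> ('e \<Rightarrow> complex) \<times> ('e \<Rightarrow> complex) \<Rightarrow> 'e + 'e \<Rightarrow> complex" where
  "pcoord I g J p = (\<lambda>k. case k of Inl i \<Rightarrow> if i \<in> I - {g} then fst p i else 0
    | Inr j \<Rightarrow> if j \<in> J then snd p j else 0)"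

lemma polyf_pmap: "polyf (pvars I g J) (pmap U W I g J f)"
proof -
  have "polyf (pvars I g J) (\<lambda>x. uvec U I g x f * wvec W J x f)"
    by (intro polyf_mult polyf_uvec polyf_wvec) (auto simp: pvars_def)
  then show ?thesis by (simp add: pmap_def[abs_def])
qed

lemma finite_pvars: "finite I \<Longrightarrow> finite J \<Longrightarrow> finite (pvars I g J)"
  by (simp add: pvars_def)

lemma card_pvars: "finite I \<Longrightarrow> finite J \<Longrightarrow> g \<in> I \<Longrightarrow> card (pvars I g J) = card I - 1 + card J"
  unfolding pvars_def by (subst card_Un_disjoint) (auto simp: card_image)

lemma uvec_pcoord:
  assumes "subsp U" "is_basis U I" "g \<in> I" "u \<in> U" "u g = 1"
  shows "uvec U I g (pcoord I g J (u, w)) = u"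
  by (rule is_basis_eqI[OF assms(1,2) uvec_in[OF assms(1,2)] assms(4)])
     (use assms in \<open>auto simp: uvec_coord pcoord_def\<close>)

lemma wvec_pcoord:
  assumes "subsp W" "is_basis W J" "w \<in> W"
  shows "wvec W J (pcoord I g J (u, w)) = w"
  by (rule is_basis_eqI[OF assms(1,2) wvec_in[OF assms(1,2)] assms(3)])
     (use assms in \<open>auto simp: wvec_coord pcoord_def\<close>)

lemma pcoord_cvec: "pcoord I g J p \<in> cvec (pvars I g J)"
  by (auto simp: pcoord_def cvec_def pvars_def split: sum.splits)

lemma pmap_bij:
  assumes U: "subsp U" "is_basis U I" "g \<in> I" and W: "subsp W" "is_basis W J"
  shows "bij_betw (\<lambda>x. (uvec U I g x, wvec W J x)) (fib (pvars I g J) Y (pmap U W I g J) l) (sol Y U W g l)"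
proof (rule bij_betw_byWitness[where f' = "pcoord I g J"])
  show "\<forall>x\<in>fib (pvars I g J) Y (pmap U W I g J) l. pcoord I g J (uvec U I g x, wvec W J x) = x"
  proof
    fix x assume x: "x \<in> fib (pvars I g J) Y (pmap U W I g J) l"
    then have "x k = 0" if "k \<notin> pvars I g J" for k using that by (auto simp: fib_def cvec_def)
    then show "pcoord I g J (uvec U I g x, wvec W J x) = x"
      using U W by (auto simp: pcoord_def fun_eq_iff uvec_coord wvec_coord pvars_def image_iff split: sum.splits)
  qed
  have inv: "uvec U I g (pcoord I g J (u, w)) = u" "wvec W J (pcoord I g J (u, w)) = w"
    if "(u, w) \<in> sol Y U W g l" for u w
    using that uvec_pcoord[OF U] wvec_pcoord[OF W] by (auto simp: sol_def)
  show "\<forall>p\<in>sol Y U W g l. (uvec U I g (pcoord I g J p), wvec W J (pcoord I g J p)) = p" using inv by auto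
  show "(\<lambda>x. (uvec U I g x, wvec W J x)) ` fib (pvars I g J) Y (pmap U W I g J) l \<subseteq> sol Y U W g l"
    using U W by (auto simp: sol_def fib_def pmap_def uvec_in wvec_in uvec_coord)
  have "pmap U W I g J f (pcoord I g J (u, w)) = l f" if "(u, w) \<in> sol Y U W g l" "f \<in> Y" for u w f
    unfolding pmap_def inv[OF that(1)] using that by (auto simp: sol_def)
  then show "pcoord I g J ` sol Y U W g l \<subseteq> fib (pvars I g J) Y (pmap U W I g J) l"
    using pcoord_cvec by (auto simp: fib_def)
qed

text \<open>Directions in the chart are the pairs with \<open>du g = 0\<close>. Every pair of
  directions takes this form after a multiple of the scaling direction \<open>(u, -w)\<close> is
  subtracted.\<close>

lemma pmap_nondeg_iff:
  assumes U: "subsp U" "is_basis U I" "g \<in> I" and W: "subsp W" "is_basis W J"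
  shows "nondeg (pvars I g J) Y (pmap U W I g J) x \<longleftrightarrow> nd Y U W (uvec U I g x) (wvec W J x)"
proof -
  define u w where "u = uvec U I g x" and "w = wvec W J x"
  have uw: "u \<in> U" "w \<in> W" "u g = 1" using U W by (auto simp: u_def w_def uvec_in wvec_in uvec_coord)
  have deriv: "((\<lambda>s. pmap U W I g J f (\<lambda>a. x a + s * v a)) has_field_derivative u f * dw f + w f * du f) (at 0)"
    if d: "du \<in> U" "dw \<in> W" "du g = 0" "\<And>i. i \<in> I - {g} \<Longrightarrow> du i = v (Inl i)" "\<And>j. j \<in> J \<Longrightarrow> dw j = v (Inr j)"
    for v du dw f
  proof -
    have "uvec U I g (\<lambda>a. x a + s * v a) = (\<lambda>f. u f + s * du f)" for s
      by (rule is_basis_eqI[OF U(1,2) uvec_in[OF U(1,2)] subsp_add[OF U(1) uw(1) subsp_scale[OF U(1) d(1)]]])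
         (use U uw d in \<open>auto simp: uvec_coord u_def\<close>)
    moreover have "wvec W J (\<lambda>a. x a + s * v a) = (\<lambda>f. w f + s * dw f)" for s
      by (rule is_basis_eqI[OF W wvec_in[OF W] subsp_add[OF W(1) uw(2) subsp_scale[OF W(1) d(2)]]])
         (use W d in \<open>auto simp: wvec_coord w_def\<close>)
    ultimately show ?thesis unfolding pmap_def by (auto intro!: derivative_eq_intros simp: mult.commute add.commute)
  qed
  have "nondeg (pvars I g J) Y (pmap U W I g J) x \<longleftrightarrow> nd Y U W u w"
  proof
    assume nx: "nondeg (pvars I g J) Y (pmap U W I g J) x"
    show "nd Y U W u w"
      unfolding nd_def
    proof (intro ballI impI)
      fix du dw assume d: "du \<in> U" "dw \<in> W" and z: "\<forall>f\<in>Y. u f * dw f + w f * du f = 0"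
      \<comment> \<open>Since \<open>u g = 1\<close>, this multiple of \<open>(u, -w)\<close> is the
        one whose removal makes \<open>du\<close> vanish at \<open>g\<close>.\<close>
      define c where "c = du g"
      define du' where "du' = (\<lambda>a. du a - c * u a)"
      define dw' where "dw' = (\<lambda>a. dw a + c * w a)"
      have d': "du' \<in> U" "dw' \<in> W" unfolding du'_def dw'_def
        by (intro subsp_diff subsp_add subsp_scale U W d uw)+
      have z': "u f * dw' f + w f * du' f = 0" if "f \<in> Y" for f
        using z that by (simp add: du'_def dw'_def algebra_simps)
      have gd: "du' g = 0" using uw by (simp add: du'_def c_def)
      define v where "v = pcoord I g J (du', dw')"
      have "((\<lambda>s. pmap U W I g J f (\<lambda>a. x a + s * v a)) has_field_derivative 0) (at 0)" if "f \<in> Y" for f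
        using deriv[OF d' gd, of v f] z'[OF that] by (simp add: v_def pcoord_def)
      then have v0: "\<forall>k\<in>pvars I g J. v k = 0" using nx unfolding nondeg_def by blast
      have "du' = (\<lambda>_. 0)"
      proof (rule is_basis_zero[OF U(2) d'(1)])
        fix i assume "i \<in> I"
        then show "du' i = 0" using v0[rule_format, of "Inl i"] gd by (cases "i = g") (auto simp: v_def pcoord_def pvars_def)
      qed
      moreover have "dw' = (\<lambda>_. 0)"
      proof (rule is_basis_zero[OF W(2) d'(2)])
        fix j assume "j \<in> J"
        then show "dw' j = 0" using v0[rule_format, of "Inr j"] by (auto simp: v_def pcoord_def pvars_def)
      qed
      ultimately have "du a = c * u a" "dw a = - c * w a" for a
        unfolding du'_def dw'_def by (metis eq_iff_diff_eq_0, metis add_eq_0_iff2 mult_minus_left)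
      then show "\<exists>c. du = (\<lambda>a. c * u a) \<and> dw = (\<lambda>a. - c * w a)" by blast
    qed
  next
    assume nd: "nd Y U W u w"
    show "nondeg (pvars I g J) Y (pmap U W I g J) x"
      unfolding nondeg_def
    proof (intro allI impI)
      fix v assume z: "\<forall>f\<in>Y. ((\<lambda>s. pmap U W I g J f (\<lambda>a. x a + s * v a)) has_field_derivative 0) (at 0)"
      define du where "du = (\<lambda>f. \<Sum>i\<in>I. (if i = g then 0 else v (Inl i)) * dualb U I i f)"
      define dw where "dw = wvec W J v"
      have d: "du \<in> U" "dw \<in> W" unfolding du_def dw_def
        by (rule dualb_sum_in[OF U(1,2)], rule wvec_in[OF W])
      have dui: "du i = (if i = g then 0 else v (Inl i))" if "i \<in> I" for i
        unfolding du_def using dualb_sum_coord[OF U(2) that, of "\<lambda>i. if i = g then 0 else v (Inl i)"] .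
      have dwj: "dw j = v (Inr j)" if "j \<in> J" for j unfolding dw_def by (rule wvec_coord[OF W(2) that])
      have "u f * dw f + w f * du f = 0" if "f \<in> Y" for f
      proof -
        have "((\<lambda>s. pmap U W I g J f (\<lambda>a. x a + s * v a)) has_field_derivative u f * dw f + w f * du f) (at 0)"
          by (rule deriv[OF d]) (use dui U(3) dwj in auto)
        then show ?thesis using z that DERIV_unique by blast
      qed
      then obtain c where c: "du = (\<lambda>a. c * u a)" "dw = (\<lambda>a. - c * w a)" using nd d unfolding nd_def by blast
      have "c = 0" using fun_cong[OF c(1), of g] dui[OF U(3)] uw(3) by simp
      then have "du i = 0" "dw i = 0" for i using c by auto
      have "v (Inl i) = 0" if "i \<in> I - {g}" for i using dui[of i] \<open>du i = 0\<close> that by simp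
      moreover have "v (Inr j) = 0" if "j \<in> J" for j using dwj[OF that] \<open>dw j = 0\<close> by simp
      ultimately show "\<forall>k\<in>pvars I g J. v k = 0" by (auto simp: pvars_def)
    qed
  qed
  then show ?thesis by (simp only: u_def w_def)
qed

lemma nd_rescale:
  assumes "nd Y U W u w" "c \<noteq> 0" "subsp U" "subsp W"
  shows "nd Y U W (\<lambda>a. 1 / c * u a) (\<lambda>a. c * w a)"
  unfolding nd_def
proof (intro ballI impI)
  fix du dw assume d: "du \<in> U" "dw \<in> W" "\<forall>f\<in>Y. 1 / c * u f * dw f + c * w f * du f = 0"
  have "\<forall>f\<in>Y. u f * (1 / c * dw f) + w f * (c * du f) = 0"
    using d(3) by (simp add: algebra_simps)
  then obtain k where "(\<lambda>a. c * du a) = (\<lambda>a. k * u a)" "(\<lambda>a. 1 / c * dw a) = (\<lambda>a. - k * w a)"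
    using assms(1) subsp_scale[OF assms(3) d(1), of c] subsp_scale[OF assms(4) d(2), of "1 / c"]
    unfolding nd_def by meson
  then have "c * du a = k * u a" "1 / c * dw a = - k * w a" for a by (auto dest: fun_cong)
  then have "du a = k * (1 / c * u a)" "dw a = - k * (c * w a)" for a
    using assms(2) by (auto simp: field_simps)
  then show "\<exists>k. du = (\<lambda>a. k * (1 / c * u a)) \<and> dw = (\<lambda>a. - k * (c * w a))" by blast
qed

text \<open>If all vectors of \<open>U\<close> vanish at \<open>g\<close>, nonzero \<open>l\<close>
  has no solutions. Otherwise solutions are the points of a fiber of \<open>pmap\<close>, with at
  most as many variables as equations, and fewer if the ranks are deficient.\<close>

theorem pair_count:
  assumes Y: "finite Y" "Y \<noteq> {}" and U: "subsp U" "U \<subseteq> cvec Y" and W: "subsp W" "W \<subseteq> cvec Y"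
    and rk: "rk U + rk W \<le> card Y + 1"
  shows "\<exists>N. gen Y (good Y U W N) \<and> (rk U + rk W \<le> card Y \<longrightarrow> N = 0)"
proof -
  obtain g where g: "g \<in> Y" using Y by blast
  show ?thesis
  proof (cases "\<exists>u\<in>U. u g \<noteq> 0")
    case False
    have "sol Y U W h l = {}" if "\<forall>f\<in>Y. l f \<noteq> 0" for h l
      using False g that by (auto simp: sol_def) (metis mult_zero_left)
    then have "gen Y (good Y U W 0)"
      by (intro gen_mp[OF gen_nonzero[OF Y(1)]]) (simp add: good_def)
    then show ?thesis by blast
  next
    case True
    then obtain I where I: "I \<subseteq> Y" "g \<in> I" "is_basis U I"
      using basis_containing[OF Y(1) U(1) g, of _ "{}"] minr_self[OF U(2)] by (metis empty_iff)
    obtain J where J: "J \<subseteq> Y" "is_basis W J" using basis_existsE[OF Y(1) W] .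
    have fin: "finite I" "finite J" using I J by (auto simp: is_basis_finite)
    let ?K = "pvars I g J" and ?F = "pmap U W I g J"
    have cK: "card ?K = rk U - 1 + rk W"
      using card_pvars[OF fin I(2)] I J U W by (simp add: rk_eq_card)
    have rU: "rk U > 0" using I(2) fin by (auto simp: rk_eq_card[OF U(1) I(3)] card_gt_0_iff)
    have "card ?K \<le> card Y" using cK rk rU by simp
    from generic_fiber_count[OF finite_pvars[OF fin] Y(1) this, of ?F, OF polyf_pmap]
    obtain P N where P: "polyf Y P" "\<exists>l. P l \<noteq> 0" "\<forall>l. P l \<noteq> 0 \<longrightarrow>
        finite (fib ?K Y ?F l) \<and> card (fib ?K Y ?F l) = N \<and> (\<forall>x\<in>fib ?K Y ?F l. nondeg ?K Y ?F x)"
      "card ?K < card Y \<longrightarrow> N = 0" by blast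
    note bij = pmap_bij[OF U(1) I(3,2) W(1) J(2), of Y]
    have nd: "nd Y U W u w" if l: "P l \<noteq> 0" and uw: "(u, w) \<in> sol Y U W g l" for l u w
    proof -
      obtain x where x: "x \<in> fib ?K Y ?F l" "u = uvec U I g x" "w = wvec W J x"
        using uw bij[of l] unfolding bij_betw_def by blast
      then show ?thesis using P(3) l pmap_nondeg_iff[OF U(1) I(3,2) W(1) J(2)] by blast
    qed
    have "good Y U W N l" if P0: "P l \<noteq> 0" and l: "\<forall>f\<in>Y. l f \<noteq> 0" for l
      unfolding good_def
    proof (intro conjI ballI)
      fix h assume h: "h \<in> Y"
      have b: "bij_betw (\<lambda>(u, w). (\<lambda>a. (1 / u h) * u a, \<lambda>a. u h * w a)) (sol Y U W g l) (sol Y U W h l)"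
        by (rule sol_rescale[OF U(1) W(1) g h l])
      have *: "finite (sol Y U W g l)" "card (sol Y U W g l) = N"
        using P(3) P0 bij_betw_finite[OF bij[of l]] bij_betw_same_card[OF bij[of l]] by auto
      show "finite (sol Y U W h l)" "card (sol Y U W h l) = N"
        using * bij_betw_finite[OF b] bij_betw_same_card[OF b] by auto
      fix p assume "p \<in> sol Y U W h l"
      then have "p \<in> (\<lambda>(u, w). (\<lambda>a. (1 / u h) * u a, \<lambda>a. u h * w a)) ` sol Y U W g l"
        unfolding bij_betw_imp_surj_on[OF b] .
      then obtain q where "p = (\<lambda>(u, w). (\<lambda>a. (1 / u h) * u a, \<lambda>a. u h * w a)) q" "q \<in> sol Y U W g l"
        by (rule imageE)
      then obtain u w where uw: "(u, w) \<in> sol Y U W g l" "p = (\<lambda>a. (1 / u h) * u a, \<lambda>a. u h * w a)"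
        by (cases q) auto
      have "u h \<noteq> 0" using uw(1) h l by (auto simp: sol_def)
      then show "case p of (u, w) \<Rightarrow> nd Y U W u w"
        using nd_rescale[OF nd[OF P0 uw(1)] _ U(1) W(1)] uw(2) by simp
    qed (use l in auto)
    moreover have "gen Y (\<lambda>l. P l \<noteq> 0)" using P(1,2) unfolding gen_def by blast
    ultimately have "gen Y (good Y U W N)"
      using gen_mp[OF gen_conj[OF _ gen_nonzero[OF Y(1)]]] by blast
    moreover have "N = 0" if "rk U + rk W \<le> card Y" using P(4) that cK rU by simp
    ultimately show ?thesis by blast
  qed
qed

text \<open>The generic number of solutions; for nonempty \<open>Y\<close> it is unique by
  \<open>good_unique\<close>.\<close>

definition pcnt :: "'e set \<Rightarrow> ('e \<Rightarrow> complex) set \<Rightarrow> ('e \<Rightarrow> complex) set \<Rightarrow> nat" where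
  "pcnt Y U W = (SOME N. gen Y (good Y U W N))"

lemma good_unique: 
  assumes "Y \<noteq> {}" "gen Y (good Y U W N)" "gen Y (good Y U W M)"
  shows "N = M"
proof -
  obtain l where "good Y U W N l" "good Y U W M l" using gen_ex[OF gen_conj[OF assms(2,3)]] by blast
  then show ?thesis using assms(1) by (auto simp: good_def)
qed

lemma gen_pcnt:
  assumes "finite Y" "Y \<noteq> {}" "subsp U" "U \<subseteq> cvec Y" "subsp W" "W \<subseteq> cvec Y" "rk U + rk W \<le> card Y + 1"
  shows "gen Y (good Y U W (pcnt Y U W))" "rk U + rk W \<le> card Y \<Longrightarrow> pcnt Y U W = 0"
proof -
  obtain N where N: "gen Y (good Y U W N)" "rk U + rk W \<le> card Y \<Longrightarrow> N = 0"
    using pair_count[OF assms] by blast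
  then show *: "gen Y (good Y U W (pcnt Y U W))" unfolding pcnt_def by (metis someI)
  then show "rk U + rk W \<le> card Y \<Longrightarrow> pcnt Y U W = 0" using good_unique[OF assms(2) N(1) *] N(2) by simp
qed

section \<open>Degenerating solutions\<close>

text \<open>Both sides compute the rank of \<open>minr U Z (Y \<union> {e})\<close>, splitting off
  \<open>e\<close> and \<open>Y\<close> in the two possible orders.\<close>

lemma rk_contract_elem:
  assumes "finite Y" "subsp U" "e \<notin> Y"
  shows "rk (minr U (insert e Z) Y) + (if \<exists>u\<in>U. (\<forall>f\<in>Z. u f = 0) \<and> u e \<noteq> 0 then 1 else 0) =
    (if \<exists>u\<in>U. (\<forall>f\<in>Z \<union> Y. u f = 0) \<and> u e \<noteq> 0 then 1 else 0) + rk (minr U Z Y)"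
  using rk_minr_add[of Y "{e}" U Z] rk_minr_add[of "{e}" Y U Z] rk_minr_single[OF assms(2)] assms
  by (simp add: Un_commute)

section \<open>Orders of growth along a sequence\<close>

definition lt :: "(nat \<Rightarrow> 'e \<Rightarrow> complex) \<Rightarrow> 'e \<Rightarrow> 'e \<Rightarrow> bool" where
  "lt a f g \<longleftrightarrow> (\<lambda>n. a n f / a n g) \<longlonglongrightarrow> 0"

text \<open>With \<open>lt\<close> this is a comparison of valuations for sequences; the ratio must
  have a nonzero limit, so that \<open>lt\<close> and \<open>eqv\<close> exclude each other.\<close>

definition eqv :: "(nat \<Rightarrow> 'e \<Rightarrow> complex) \<Rightarrow> 'e \<Rightarrow> 'e \<Rightarrow> bool" where
  "eqv a f g \<longleftrightarrow> (\<exists>c. c \<noteq> 0 \<and> (\<lambda>n. a n f / a n g) \<longlonglongrightarrow> c)"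

lemma ratio_trans:
  fixes a :: "nat \<Rightarrow> 'e \<Rightarrow> complex"
  assumes "\<And>n. a n g \<noteq> 0" "(\<lambda>n. a n f / a n g) \<longlonglongrightarrow> c" "(\<lambda>n. a n g / a n h) \<longlonglongrightarrow> d"
  shows "(\<lambda>n. a n f / a n h) \<longlonglongrightarrow> c * d"
proof -
  have "(\<lambda>n. (a n f / a n g) * (a n g / a n h)) \<longlonglongrightarrow> c * d" by (intro tendsto_mult assms)
  then show ?thesis using assms(1) by simp
qed

lemma lt_trans: "(\<And>n. a n g \<noteq> 0) \<Longrightarrow> lt a f g \<Longrightarrow> lt a g h \<Longrightarrow> lt a f h"
  unfolding lt_def using ratio_trans[of a g f 0 h 0] by simp

lemma lt_eqv_trans: "(\<And>n. a n g \<noteq> 0) \<Longrightarrow> lt a f g \<Longrightarrow> eqv a g h \<Longrightarrow> lt a f h"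
  unfolding lt_def eqv_def using ratio_trans[of a g f 0 h] by auto

lemma eqv_lt_trans: "(\<And>n. a n g \<noteq> 0) \<Longrightarrow> eqv a f g \<Longrightarrow> lt a g h \<Longrightarrow> lt a f h"
  unfolding lt_def eqv_def using ratio_trans[of a g f _ h 0] by auto

lemma eqv_trans: "(\<And>n. a n g \<noteq> 0) \<Longrightarrow> eqv a f g \<Longrightarrow> eqv a g h \<Longrightarrow> eqv a f h"
proof -
  assume nz: "\<And>n. a n g \<noteq> 0" and "eqv a f g" "eqv a g h"
  then obtain c d where "c \<noteq> 0" "(\<lambda>n. a n f / a n g) \<longlonglongrightarrow> c" "d \<noteq> 0" "(\<lambda>n. a n g / a n h) \<longlonglongrightarrow> d"
    unfolding eqv_def by blast
  then show ?thesis using ratio_trans[of a g f c h d] nz unfolding eqv_def by (metis mult_eq_0_iff)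
qed

lemma eqv_sym: "eqv a f g \<Longrightarrow> eqv a g f"
proof -
  assume "eqv a f g"
  then obtain c where "c \<noteq> 0" "(\<lambda>n. a n f / a n g) \<longlonglongrightarrow> c" unfolding eqv_def by blast
  then have "(\<lambda>n. inverse (a n f / a n g)) \<longlonglongrightarrow> inverse c" by (intro tendsto_inverse)
  then show ?thesis unfolding eqv_def using \<open>c \<noteq> 0\<close> by (intro exI[of _ "inverse c"]) simp
qed

lemma eqv_refl: "(\<And>n. a n f \<noteq> 0) \<Longrightarrow> eqv a f f"
  unfolding eqv_def by (intro exI[of _ 1]) simp

lemma not_lt_eqv: "lt a f g \<Longrightarrow> \<not> eqv a f g"
  unfolding lt_def eqv_def using LIMSEQ_unique by blast

lemma lt_asym:
  assumes "\<And>n. a n f \<noteq> 0" "\<And>n. a n g \<noteq> 0" "lt a f g" "lt a g f"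
  shows False
  using not_lt_eqv[of a f f] eqv_refl[of a f] lt_trans[of a g f f] assms by blast

text \<open>\<open>us n * ws n\<close> is fixed outside \<open>e\<close> and tends to \<open>0\<close> at \<open>e\<close>. Genericity enters through
  \<open>nosol\<close>: a limit can only exist in minors of sufficiently large rank.\<close>

locale degeneration =
  fixes E :: "'e set" and e :: 'e and U W :: "('e \<Rightarrow> complex) set" and l :: "'e \<Rightarrow> complex"
    and us ws :: "nat \<Rightarrow> 'e \<Rightarrow> complex" and ts :: "nat \<Rightarrow> complex"
  assumes finE: "finite E" and eE: "e \<in> E" and E': "E - {e} \<noteq> {}"
    and U: "subsp U" "U \<subseteq> cvec E" and W: "subsp W" "W \<subseteq> cvec E"
    and rkUW: "rk U + rk W = card E + 1"
    and nlU: "\<exists>u\<in>U. u e \<noteq> 0" and nlW: "\<exists>w\<in>W. w e \<noteq> 0"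
    and l0: "\<And>f. f \<in> E - {e} \<Longrightarrow> l f \<noteq> 0"
    and nosol: "\<And>Y Z X u w. Y \<subseteq> E - {e} \<Longrightarrow> Y \<noteq> {} \<Longrightarrow> Z \<subseteq> E \<Longrightarrow> X \<subseteq> E \<Longrightarrow>
      u \<in> minr U Z Y \<Longrightarrow> w \<in> minr W X Y \<Longrightarrow> (\<And>f. f \<in> Y \<Longrightarrow> u f * w f = l f) \<Longrightarrow>
      card Y < rk (minr U Z Y) + rk (minr W X Y)"
    and us: "\<And>n. us n \<in> U" and ws: "\<And>n. ws n \<in> W"
    and prod: "\<And>n f. f \<in> E - {e} \<Longrightarrow> us n f * ws n f = l f"
    and prode: "\<And>n. us n e * ws n e = ts n" and ts: "ts \<longlonglongrightarrow> 0" and ts0: "\<And>n. ts n \<noteq> 0"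
    and triu: "\<And>f g. f \<in> E \<Longrightarrow> g \<in> E \<Longrightarrow> lt us f g \<or> eqv us f g \<or> lt us g f"
    and triw: "\<And>f g. f \<in> E \<Longrightarrow> g \<in> E \<Longrightarrow> lt ws f g \<or> eqv ws f g \<or> lt ws g f"

text \<open>The two factors play symmetric roles; interpreting the locale with them exchanged gives
  each result for \<open>W\<close> as well.\<close>

lemma degeneration_swap:
  assumes "degeneration E e U W l us ws ts"
  shows "degeneration E e W U l ws us ts"
proof -
  interpret degeneration E e U W l us ws ts by fact
  show ?thesis
  proof
    show "card Y < rk (minr W Z Y) + rk (minr U X Y)"
      if "Y \<subseteq> E - {e}" "Y \<noteq> {}" "Z \<subseteq> E" "X \<subseteq> E" "u \<in> minr W Z Y" "w \<in> minr U X Y"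
        "\<And>f. f \<in> Y \<Longrightarrow> u f * w f = l f" for Y Z X u w
      using nosol[OF that(1,2,4,3,6,5)] that(7) by (simp add: mult.commute add.commute)
  qed (use finE eE E' U W rkUW nlU nlW l0 us ws prod prode ts ts0 triu triw in
      \<open>auto simp: mult.commute add.commute\<close>)
qed

context degeneration
begin

lemma usn0: "f \<in> E \<Longrightarrow> us n f \<noteq> 0"
  using prod[of f n] prode[of n] l0[of f] ts0[of n] by (cases "f = e") auto

lemma wsn0: "f \<in> E \<Longrightarrow> ws n f \<noteq> 0"
  using prod[of f n] prode[of n] l0[of f] ts0[of n] by (cases "f = e") auto

lemma ws_eq: "f \<in> E - {e} \<Longrightarrow> ws n f = l f / us n f"
  using prod[of f n] usn0[of f n] by (auto simp: field_simps)

lemma ws_eqe: "ws n e = ts n / us n e"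
  using prode[of n] usn0[OF eE, of n] by (auto simp: field_simps)

text \<open>Off \<open>e\<close> the products are nonzero constants, so the growth of
  \<open>w\<close> is inverse to that of \<open>u\<close>.\<close>

lemma lt_w: "f \<in> E - {e} \<Longrightarrow> g \<in> E - {e} \<Longrightarrow> lt us f g \<Longrightarrow> lt ws g f"
  unfolding lt_def
proof -
  assume fg: "f \<in> E - {e}" "g \<in> E - {e}" and "(\<lambda>n. us n f / us n g) \<longlonglongrightarrow> 0"
  then have "(\<lambda>n. (l g / l f) * (us n f / us n g)) \<longlonglongrightarrow> (l g / l f) * 0" by (intro tendsto_mult tendsto_const)
  moreover have "(l g / l f) * (us n f / us n g) = ws n g / ws n f" for n
    using fg usn0[of f n] usn0[of g n] by (simp add: ws_eq)
  ultimately show "(\<lambda>n. ws n g / ws n f) \<longlonglongrightarrow> 0" by simp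
qed

lemma eqv_w: "f \<in> E - {e} \<Longrightarrow> g \<in> E - {e} \<Longrightarrow> eqv us f g \<Longrightarrow> eqv ws f g"
proof -
  assume fg: "f \<in> E - {e}" "g \<in> E - {e}" and "eqv us f g"
  from eqv_sym[OF this(3)] obtain c where c: "c \<noteq> 0" "(\<lambda>n. us n g / us n f) \<longlonglongrightarrow> c"
    unfolding eqv_def by blast
  then have "(\<lambda>n. (l f / l g) * (us n g / us n f)) \<longlonglongrightarrow> (l f / l g) * c" by (intro tendsto_mult tendsto_const)
  moreover have "(l f / l g) * (us n g / us n f) = ws n f / ws n g" for n
    using fg usn0[of f n] usn0[of g n] by (simp add: ws_eq)
  moreover have "(l f / l g) * c \<noteq> 0" using c(1) l0[OF fg(1)] l0[OF fg(2)] by simp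
  ultimately show "eqv ws f g" unfolding eqv_def by (intro exI[of _ "(l f / l g) * c"]) simp
qed

text \<open>At \<open>e\<close> the product tends to 0. Hence \<open>w e\<close> is negligible
  against \<open>w g\<close> as soon as \<open>u e\<close> grows at least like
  \<open>u g\<close>.\<close>

lemma lt_we: "g \<in> E - {e} \<Longrightarrow> eqv us e g \<or> lt us g e \<Longrightarrow> lt ws e g"
proof -
  assume g: "g \<in> E - {e}" and "eqv us e g \<or> lt us g e"
  then have "eqv us g e \<or> lt us g e" using eqv_sym[of us e g] by blast
  then obtain c where "(\<lambda>n. us n g / us n e) \<longlonglongrightarrow> c"
    unfolding eqv_def lt_def by blast
  then have "(\<lambda>n. (ts n / l g) * (us n g / us n e)) \<longlonglongrightarrow> (0 / l g) * c"
    by (intro tendsto_mult tendsto_divide tendsto_const ts l0 g)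
  moreover have "(ts n / l g) * (us n g / us n e) = ws n e / ws n g" for n
    using g usn0[of e n] usn0[of g n] eE by (simp add: ws_eq ws_eqe)
  ultimately show "lt ws e g" unfolding lt_def by simp
qed

text \<open>After division by \<open>us n g\<close>, the coordinates in \<open>Z\<close> tend to 0.
  Restriction to \<open>Y \<union> Z\<close> discards the coordinates at which the quotient may
  diverge, and the restricted subspace is closed.\<close>

lemma ratio_limit:
  assumes "Y \<subseteq> E" "Z \<subseteq> E" "\<And>f. f \<in> Y \<Longrightarrow> (\<lambda>n. us n f / us n g) \<longlonglongrightarrow> c f" "\<And>f. f \<in> Z \<Longrightarrow> lt us f g"
  shows "\<exists>u\<in>minr U Z Y. \<forall>f\<in>Y. u f = c f"
proof -
  define c' where "c' f = (if f \<in> Z then 0 else if f \<in> Y then c f else 0)" for f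
  have lim: "(\<lambda>n. rst (Y \<union> Z) (\<lambda>f. (1 / us n g) * us n f) f) \<longlonglongrightarrow> c' f" for f
    using assms(3,4) unfolding c'_def lt_def rst_def by (cases "f \<in> Z"; cases "f \<in> Y") auto
  have fin: "finite (Y \<union> Z)" using assms(1,2) finE finite_subset by blast
  then obtain I where I: "is_basis (minr U {} (Y \<union> Z)) I"
    using basis_exists[OF fin U(1)] by blast
  have "c' \<in> minr U {} (Y \<union> Z)"
    by (rule subsp_limit[OF is_basis_finite[OF I] subsp_minr[OF U(1)] I _ lim])
       (intro minrI subsp_scale U us, auto)
  then obtain u where u: "u \<in> U" "c' = rst (Y \<union> Z) u" by (auto simp: minr_def)
  have "u f = 0" if "f \<in> Z" for f using fun_cong[OF u(2), of f] that by (simp add: c'_def)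
  then have "rst Y u \<in> minr U Z Y" using u(1) by (intro minrI)
  moreover have "rst Y u f = c f" if "f \<in> Y" for f
  proof (cases "f \<in> Z")
    case True
    then have "c f = 0" using assms(3)[OF that] assms(4)[OF True] LIMSEQ_unique unfolding lt_def by blast
    then show ?thesis using fun_cong[OF u(2), of f] that True by (simp add: c'_def)
  next
    case False
    then show ?thesis using fun_cong[OF u(2), of f] that by (simp add: c'_def)
  qed
  ultimately show ?thesis by blast
qed

lemma ratio_limit_eqv:
  assumes "Y \<subseteq> E" "Z \<subseteq> E" "\<And>f. f \<in> Y \<Longrightarrow> eqv us f g" "\<And>f. f \<in> Z \<Longrightarrow> lt us f g"
  shows "\<exists>u\<in>minr U Z Y. \<forall>f\<in>Y. (\<lambda>n. us n f / us n g) \<longlonglongrightarrow> u f"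
proof -
  have "\<forall>f\<in>Y. \<exists>c. (\<lambda>n. us n f / us n g) \<longlonglongrightarrow> c" using assms(3) unfolding eqv_def by blast
  from bchoice[OF this] obtain c where c: "\<And>f. f \<in> Y \<Longrightarrow> (\<lambda>n. us n f / us n g) \<longlonglongrightarrow> c f" by blast
  have "\<exists>u\<in>minr U Z Y. \<forall>f\<in>Y. u f = c f" by (rule ratio_limit[OF assms(1,2) c assms(4)])
  then obtain u where "u \<in> minr U Z Y" "\<forall>f\<in>Y. u f = c f" by blast
  then show ?thesis using c by (intro bexI[of _ u]) auto
qed

end

sublocale degeneration \<subseteq> sw: degeneration E e W U l ws us ts
  by (rule degeneration_swap) unfold_locales

context degeneration
begin

text \<open>Dividing \<open>us\<close> and multiplying \<open>ws\<close> by \<open>us n g\<close>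
  preserves the products. In the limit \<open>u\<close> vanishes on the sets of smaller growth of
  \<open>us\<close>, \<open>w\<close> on those of smaller growth of \<open>ws\<close>, which
  accounts for the contractions.\<close>

lemma level_solution:
  assumes Y: "Y \<subseteq> E - {e}" "g \<in> Y" "\<And>f. f \<in> Y \<Longrightarrow> eqv us f g"
    and Z: "Z \<subseteq> E" "\<And>f. f \<in> Z \<Longrightarrow> lt us f g" and X: "X \<subseteq> E" "\<And>f. f \<in> X \<Longrightarrow> lt ws f g"
  shows "\<exists>(u, w)\<in>sol Y (minr U Z Y) (minr W X Y) g l.
    \<forall>f\<in>Y. (\<lambda>n. us n f / us n g) \<longlonglongrightarrow> u f \<and> (\<lambda>n. ws n f * us n g) \<longlonglongrightarrow> w f"
proof -
  have YE: "Y \<subseteq> E" and g: "g \<in> E - {e}" using Y by auto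
  obtain u where u: "u \<in> minr U Z Y" "\<forall>f\<in>Y. (\<lambda>n. us n f / us n g) \<longlonglongrightarrow> u f"
    using ratio_limit_eqv[OF YE Z(1) Y(3) Z(2)] by blast
  have "eqv ws f g" if "f \<in> Y" for f using eqv_w[of f g] Y that g by blast
  then obtain w where w: "w \<in> minr W X Y" "\<forall>f\<in>Y. (\<lambda>n. ws n f / ws n g) \<longlonglongrightarrow> w f"
    using sw.ratio_limit_eqv[OF YE X(1) _ X(2)] by blast
  have wl: "(\<lambda>n. ws n f * us n g) \<longlonglongrightarrow> l g * w f" if f: "f \<in> Y" for f
  proof -
    have "(\<lambda>n. l g * (ws n f / ws n g)) \<longlonglongrightarrow> l g * w f" using w f by (intro tendsto_mult) auto
    moreover have "l g * (ws n f / ws n g) = ws n f * us n g" for n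
      using prod[OF g, of n] wsn0[of g n] g by (auto simp: field_simps)
    ultimately show ?thesis by simp
  qed
  have "u f * (l g * w f) = l f" if f: "f \<in> Y" for f
  proof -
    have "(\<lambda>n. (us n f / us n g) * (ws n f * us n g)) \<longlonglongrightarrow> u f * (l g * w f)"
      by (rule tendsto_mult[OF u(2)[rule_format, OF f] wl[OF f]])
    moreover have "(us n f / us n g) * (ws n f * us n g) = l f" for n
      using prod[of f n] f Y usn0[of g n] g by auto
    ultimately show ?thesis by (simp add: LIMSEQ_const_iff)
  qed
  moreover have "u g = 1"
    using u(2)[rule_format, OF Y(2)] usn0[of g] g by (simp add: LIMSEQ_const_iff)
  ultimately have "(u, \<lambda>f. l g * w f) \<in> sol Y (minr U Z Y) (minr W X Y) g l"
    using u(1) subsp_scale[OF subsp_minr[OF W(1)] w(1)] by (simp add: sol_def)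
  then show ?thesis using u(2) wl by (intro bexI[of _ "(u, \<lambda>f. l g * w f)"]) auto
qed

lemma single_level:
  assumes Y: "Y \<subseteq> E - {e}" "g \<in> Y" "\<And>f. f \<in> Y \<Longrightarrow> eqv us f g"
    and Z: "Z \<subseteq> E" "\<And>f. f \<in> Z \<Longrightarrow> lt us f g" and X: "X \<subseteq> E" "\<And>f. f \<in> X \<Longrightarrow> lt ws f g"
  shows "card Y < rk (minr U Z Y) + rk (minr W X Y)"
proof -
  have "\<exists>(u, w)\<in>sol Y (minr U Z Y) (minr W X Y) g l.
    \<forall>f\<in>Y. (\<lambda>n. us n f / us n g) \<longlonglongrightarrow> u f \<and> (\<lambda>n. ws n f * us n g) \<longlonglongrightarrow> w f"
    by (rule level_solution[OF assms])
  then obtain u w where "(u, w) \<in> sol Y (minr U Z Y) (minr W X Y) g l" by blast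
  then show ?thesis using nosol[OF Y(1) _ Z(1) X(1), of u w] Y(2) by (auto simp: sol_def)
qed

lemma max_level:
  assumes "finite Y" "Y \<noteq> {}" "Y \<subseteq> E"
  shows "\<exists>g\<in>Y. \<forall>f\<in>Y. eqv us f g \<or> lt us f g"
  using assms
proof (induction Y rule: finite_ne_induct)
  case (singleton x)
  then show ?case using eqv_refl[of us x] usn0 by auto
next
  case (insert x Y)
  then obtain g where g: "g \<in> Y" "\<forall>f\<in>Y. eqv us f g \<or> lt us f g" by auto
  have gE: "g \<in> E" "x \<in> E" using insert g by auto
  consider "eqv us x g \<or> lt us x g" | "lt us g x" using triu[OF gE] eqv_sym[of us g x] by blast
  then show ?case
  proof cases
    case 1
    then show ?thesis using g by blast
  next
    case 2
    have "lt us f x" if "f \<in> Y" for f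
      using g(2) that 2 lt_trans[of us g f x] eqv_lt_trans[of us g f x] usn0[OF gE(1)] by blast
    then show ?thesis using eqv_refl[of us x] usn0[OF gE(2)] by blast
  qed
qed

text \<open>\<open>A\<close> is the group of fastest growth and \<open>B\<close> the rest.\<close>

lemma split_level:
  assumes "Y \<subseteq> E - {e}" "Y \<noteq> {}"
  obtains g A B where "g \<in> A" "A \<union> B = Y" "A \<inter> B = {}" "\<And>f. f \<in> A \<Longrightarrow> eqv us f g"
    "\<And>f a. f \<in> B \<Longrightarrow> a \<in> A \<Longrightarrow> lt us f a"
proof -
  have "finite Y" using assms finE finite_subset by blast
  then obtain g where g: "g \<in> Y" "\<forall>f\<in>Y. eqv us f g \<or> lt us f g" using max_level assms by blast
  have "g \<in> E" using g assms by auto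
  define A where "A = {f \<in> Y. eqv us f g}"
  show ?thesis
  proof (rule that[of g A "Y - A"])
    show "g \<in> A" using g eqv_refl[of us g] usn0[OF \<open>g \<in> E\<close>] by (simp add: A_def)
    show "lt us f a" if "f \<in> Y - A" "a \<in> A" for f a
      using that g lt_eqv_trans[of us g f a] eqv_sym[of us a g] usn0[OF \<open>g \<in> E\<close>] unfolding A_def by blast
  qed (auto simp: A_def)
qed

text \<open>The two spaces are split in opposite orders, because the edges with small
  \<open>u\<close> are those with large \<open>w\<close>: in the minor on \<open>A\<close>,
  \<open>B\<close> is contracted for \<open>U\<close> and deleted for \<open>W\<close>, and the
  reverse holds on \<open>B\<close>.\<close>

lemma rk_split:
  assumes "A \<inter> B = {}" "A \<union> B \<subseteq> E"
  shows "rk (minr U Z (A \<union> B)) + rk (minr W X (A \<union> B)) =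
    (rk (minr U (Z \<union> B) A) + rk (minr W X A)) + (rk (minr U Z B) + rk (minr W (X \<union> A) B))"
proof -
  have fin: "finite A" "finite B" using assms finE finite_subset by (metis Un_subset_iff)+
  show ?thesis
    using rk_minr_add[OF fin assms(1) U(1), of Z] rk_minr_add[OF fin(2,1) _ W(1), of X] assms(1)
    by (simp add: Un_commute Int_commute)
qed

text \<open>Groups are peeled off from the top. Each one has an excess of rank over cardinality by
  \<open>single_level\<close>, and these excesses add up by \<open>rk_split\<close>.\<close>

lemma interval_rank:
  assumes "Y \<subseteq> E - {e}" "Y \<noteq> {}" "Z \<subseteq> E - {e}" "X \<subseteq> E - {e}"
    "\<And>f z. f \<in> Y \<Longrightarrow> z \<in> Z \<Longrightarrow> lt us z f" "\<And>f x. f \<in> Y \<Longrightarrow> x \<in> X \<Longrightarrow> lt us f x"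
  shows "card Y < rk (minr U Z Y) + rk (minr W X Y)"
proof -
  have "finite Y" using assms finE finite_subset by blast
  then show ?thesis using assms
  proof (induction Y arbitrary: Z X rule: finite_psubset_induct)
    case (psubset Y)
    obtain g A B where AB: "g \<in> A" "A \<union> B = Y" "A \<inter> B = {}" "\<And>f. f \<in> A \<Longrightarrow> eqv us f g"
      "\<And>f a. f \<in> B \<Longrightarrow> a \<in> A \<Longrightarrow> lt us f a" by (rule split_level[OF psubset.prems(1,2)], rule that)
    have fin: "finite A" "finite B" using psubset.hyps AB(2) by auto
    have A: "card A < rk (minr U (Z \<union> B) A) + rk (minr W X A)"
    proof (rule single_level)
      show "lt us f g" if "f \<in> Z \<union> B" for f using that AB psubset.prems(5)[of g f] by blast
      show "lt ws f g" if "f \<in> X" for f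
        using that AB psubset.prems(6)[of g f] lt_w[of g f] psubset.prems(1,4) by blast
    qed (use AB psubset.prems in auto)
    show ?case
    proof (cases "B = {}")
      case True
      then show ?thesis using A AB(2) by simp
    next
      case False
      have "card B < rk (minr U Z B) + rk (minr W (X \<union> A) B)"
      proof (rule psubset.IH)
        show "B \<subset> Y" using AB by blast
        show "lt us z f" if "f \<in> B" "z \<in> Z" for f z using psubset.prems(5)[of f z] AB(2) that by blast
        show "lt us f x" if "f \<in> B" "x \<in> X \<union> A" for f x
          using psubset.prems(6)[of f x] AB(2) AB(5)[of f x] that by blast
      qed (use AB psubset.prems False in auto)
      moreover have "rk (minr U Z Y) + rk (minr W X Y) =
          (rk (minr U (Z \<union> B) A) + rk (minr W X A)) + (rk (minr U Z B) + rk (minr W (X \<union> A) B))"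
        using rk_split[of A B Z X] AB(2,3) psubset.prems(1) by blast
      moreover have "card Y = card A + card B" using card_Un_disjoint[OF fin AB(3)] AB(2) by simp
      ultimately show ?thesis using A by linarith
    qed
  qed
qed

text \<open>If \<open>u\<close> grew fastest at \<open>e\<close>, the limit of
  \<open>us / us e\<close> would be a vector of \<open>U\<close> supported at \<open>e\<close>, so
  deletion of \<open>e\<close> lowers the rank of \<open>U\<close>. As \<open>w e\<close> is
  negligible, \<open>e\<close> is contracted in \<open>W\<close>. The remaining ranks then add up to
  \<open>card (E - {e})\<close> only, too little for a solution.\<close>

lemma not_above_single:
  assumes g: "g \<in> E - {e}" and same: "\<And>f. f \<in> E - {e} \<Longrightarrow> eqv us f g"
  shows "\<not> lt us g e"
proof
  assume lt: "lt us g e"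
  have fin: "finite (E - {e})" using finE by simp
  have "lt us f e" if "f \<in> E - {e}" for f
    using eqv_lt_trans[of us g f e] same[OF that] lt usn0[of g] g by blast
  then obtain u where u: "u \<in> minr U (E - {e}) {e}" "u e = 1"
    using ratio_limit[of "{e}" "E - {e}" e "\<lambda>_. 1"] usn0[OF eE] eE by auto
  then have col: "\<exists>u\<in>U. (\<forall>f\<in>{} \<union> (E - {e}). u f = 0) \<and> u e \<noteq> 0" by (auto simp: minr_def)
  have "card (E - {e}) < rk (minr U {} (E - {e})) + rk (minr W {e} (E - {e}))"
    by (rule single_level[OF _ g same]) (use lt_we[OF g] lt eE in auto)
  moreover have "rk (minr U {} (E - {e})) + 1 = rk U"
    using rk_minr_add[of "{e}" "E - {e}" U "{}"] fin U minr_self[OF U(2)] rk_minr_single[OF U(1), of "E - {e}" e] col eE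
    by (simp add: insert_absorb)
  moreover have "rk (minr W {e} (E - {e})) + 1 = rk W"
    using rk_minr_add[of "E - {e}" "{e}" W "{}"] fin W minr_self[OF W(2)] rk_minr_single[OF W(1), of "{}" e] nlW eE
    by (simp add: insert_absorb)
  ultimately show False using rkUW finE eE by (simp add: card_Diff_singleton)
qed

end

text \<open>The degenerate case: \<open>us\<close> is large on \<open>A\<close> and small on
  \<open>B\<close>, and both minors have exact rank. \<open>ncU\<close> and \<open>ncW\<close> say
  that neither space contains a nonzero vector supported at \<open>e\<close>.\<close>

locale two_levels = degeneration +
  fixes A B :: "'a set" and g h :: 'a
  assumes AB: "A \<union> B = E - {e}" "A \<inter> B = {}" and gA: "g \<in> A" and hB: "h \<in> B"
    and lA: "\<And>f. f \<in> A \<Longrightarrow> eqv us f g" and lB: "\<And>f. f \<in> B \<Longrightarrow> eqv us f h" and hg: "lt us h g"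
    and rA: "rk (minr U B A) + rk (minr W {} A) = card A + 1"
    and rB: "rk (minr U {} B) + rk (minr W A B) = card B + 1"
    and ncU: "\<And>u. u \<in> U \<Longrightarrow> (\<And>f. f \<in> E - {e} \<Longrightarrow> u f = 0) \<Longrightarrow> u e = 0"
    and ncW: "\<And>w. w \<in> W \<Longrightarrow> (\<And>f. f \<in> E - {e} \<Longrightarrow> w f = 0) \<Longrightarrow> w e = 0"
begin

text \<open>Assume that \<open>e\<close> is not in the closure of \<open>B\<close>. By
  \<open>ncU\<close>, \<open>u e\<close> cannot dominate the values on \<open>A\<close>. Nor can it
  be negligible against them, for then \<open>e\<close> could also be contracted in the minor on
  \<open>A\<close>, at the cost of one rank. So \<open>u e\<close> grows like \<open>u g\<close>,
  and \<open>w e\<close> is negligible on both groups. Contraction of \<open>e\<close> in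
  \<open>W\<close> now costs one rank either in the minor on \<open>A\<close> or in the one on
  \<open>B\<close>, against \<open>rA\<close> or \<open>rB\<close>.\<close>

lemma closedU:
  assumes "u0 \<in> U" "\<And>f. f \<in> B \<Longrightarrow> u0 f = 0"
  shows "u0 e = 0"
proof (rule ccontr)
  assume ne: "u0 e \<noteq> 0"
  have sub: "A \<subseteq> E - {e}" "B \<subseteq> E - {e}" "A \<subseteq> E" "B \<subseteq> E" using AB by auto
  have gE: "g \<in> E - {e}" "g \<in> E" and hE: "h \<in> E - {e}" "h \<in> E" using sub gA hB by auto
  have fin: "finite A" "finite B" using sub finE finite_subset by blast+
  have eAB: "e \<notin> A" "e \<notin> B" using sub by auto
  have Blt: "lt us f g" if "f \<in> B" for f
    using eqv_lt_trans[of us h f g] usn0[OF hE(2)] lB[OF that] hg by blast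
  have "\<not> lt us g e"
  proof
    assume ge: "lt us g e"
    have "lt us f e" if "f \<in> E - {e}" for f
      using that AB(1) eqv_lt_trans[of us g f e] lt_trans[of us g f e] usn0[OF gE(2)] ge lA[of f] Blt[of f] by blast
    then obtain u where "u \<in> minr U (E - {e}) {e}" "u e = 1"
      using ratio_limit[of "{e}" "E - {e}" e "\<lambda>_. 1"] usn0[OF eE] eE by auto
    then obtain u' where "u' \<in> U" "\<forall>f\<in>E-{e}. u' f = 0" "u' e = 1" by (auto simp: minr_def)
    then show False using ncU[of u'] by auto
  qed
  moreover have "\<not> lt us e g"
  proof
    assume eg: "lt us e g"
    have "card A < rk (minr U (insert e B) A) + rk (minr W {} A)"
      by (rule single_level[OF sub(1) gA lA]) (use eg Blt sub eE in auto)
    moreover have "rk (minr U (insert e B) A) + 1 = rk (minr U B A)"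
    proof -
      have "\<exists>u\<in>U. (\<forall>f\<in>B. u f = 0) \<and> u e \<noteq> 0" using assms ne by blast
      moreover have "\<not> (\<exists>u\<in>U. (\<forall>f\<in>B \<union> A. u f = 0) \<and> u e \<noteq> 0)" using ncU AB(1) by (metis Un_commute)
      ultimately show ?thesis using rk_contract_elem[OF fin(1) U(1) eAB(1), of B] by (simp only: if_True if_False add_0)
    qed
    ultimately show False using rA by linarith
  qed
  ultimately have eg: "eqv us e g" using triu[OF eE gE(2)] by blast
  have weg: "lt ws e g" using lt_we[OF gE(1)] eg by blast
  have wgh: "lt ws g h" by (rule lt_w[OF hE(1) gE(1) hg])
  show False
  proof (cases "\<exists>w\<in>W. (\<forall>f\<in>A. w f = 0) \<and> w e \<noteq> 0")
    case False
    have "card A < rk (minr U B A) + rk (minr W {e} A)"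
      by (rule single_level[OF sub(1) gA lA]) (use Blt weg sub eE in auto)
    moreover have "rk (minr W {e} A) + 1 = rk (minr W {} A)"
      using rk_contract_elem[OF fin(1) W(1) eAB(1), of "{}"] nlW False by (auto split: if_splits)
    ultimately show False using rA by linarith
  next
    case True
    have weh: "lt ws e h" using lt_trans[of ws g e h] wsn0[OF gE(2)] weg wgh by blast
    have wfh: "lt ws f h" if "f \<in> A" for f
      using eqv_lt_trans[of ws g f h] wsn0[OF gE(2)] eqv_w[of f g] lA[OF that] that sub gE wgh by blast
    have "card B < rk (minr U {} B) + rk (minr W (insert e A) B)"
      by (rule single_level[OF sub(2) hB lB]) (use weh wfh sub eE in auto)
    moreover have "rk (minr W (insert e A) B) + 1 = rk (minr W A B)"
    proof -
      have "\<not> (\<exists>w\<in>W. (\<forall>f\<in>A \<union> B. w f = 0) \<and> w e \<noteq> 0)" using ncW AB(1) by metis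
      with True show ?thesis using rk_contract_elem[OF fin(2) W(1) eAB(2), of A] by (simp only: if_True if_False add_0)
    qed
    ultimately show False using rB by linarith
  qed
qed

end

sublocale two_levels \<subseteq> swt: two_levels E e W U l ws us ts B A h g
proof -
  have sub: "A \<subseteq> E - {e}" "B \<subseteq> E - {e}" using AB by auto
  show "two_levels E e W U l ws us ts B A h g"
  proof
    show "eqv ws f h" if "f \<in> B" for f using eqv_w[of f h] lB[OF that] that sub hB by blast
    show "eqv ws f g" if "f \<in> A" for f using eqv_w[of f g] lA[OF that] that sub gA by blast
    show "lt ws g h" by (rule lt_w) (use sub gA hB hg in auto)
  qed (use AB gA hB rA rB ncU ncW in auto)
qed

context two_levels
begin

lemma contract_eq: "minr U (insert e B) A = minr U B A" "minr W (insert e A) B = minr W A B"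
proof -
  have "{u \<in> U. \<forall>f\<in>insert e B. u f = 0} = {u \<in> U. \<forall>f\<in>B. u f = 0}" using closedU by auto
  then show "minr U (insert e B) A = minr U B A" by (simp add: minr_def)
  have "{u \<in> W. \<forall>f\<in>insert e A. u f = 0} = {u \<in> W. \<forall>f\<in>A. u f = 0}" using swt.closedU by auto
  then show "minr W (insert e A) B = minr W A B" by (simp add: minr_def)
qed

end

context degeneration
begin

text \<open>With one group, scaling by \<open>us n g0\<close> gives a limit on all of
  \<open>E\<close>; \<open>not_above_single\<close>, used for both factors, bounds the coordinates
  at \<open>e\<close>. With several groups, the total excess of 2 is used up by \<open>A\<close> and
  the rest.\<close>

lemma dichotomy:
  assumes g0: "g0 \<in> E - {e}"
  shows "(\<exists>u\<in>U. \<exists>w\<in>W. \<forall>f\<in>E. (\<lambda>n. us n f / us n g0) \<longlonglongrightarrow> u f \<and> (\<lambda>n. us n g0 * ws n f) \<longlonglongrightarrow> w f) \<or>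
    (\<exists>A B g h. two_levels E e U W l us ws ts A B g h)"
proof (cases "\<forall>f\<in>E-{e}. eqv us f g0")
  case True
  have "\<not> lt us g0 e" using not_above_single[OF g0] True by blast
  then have "\<exists>c. (\<lambda>n. us n e / us n g0) \<longlonglongrightarrow> c" using triu[OF eE, of g0] g0 unfolding lt_def eqv_def by blast
  then have "\<forall>f\<in>E. \<exists>c. (\<lambda>n. us n f / us n g0) \<longlonglongrightarrow> c" using True unfolding eqv_def by blast
  from bchoice[OF this] obtain c where c: "\<And>f. f \<in> E \<Longrightarrow> (\<lambda>n. us n f / us n g0) \<longlonglongrightarrow> c f" by blast
  obtain u where u: "u \<in> U" "\<forall>f\<in>E. u f = c f"
    using ratio_limit[OF order_refl empty_subsetI, of g0 c] c by (auto simp: minr_self[OF U(2)])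
  have "\<not> lt ws g0 e" by (rule sw.not_above_single[OF g0]) (use eqv_w g0 True in blast)
  then have "\<exists>c. (\<lambda>n. ws n e / ws n g0) \<longlonglongrightarrow> c" using triw[OF eE, of g0] g0 unfolding lt_def eqv_def by blast
  moreover have "\<exists>c. (\<lambda>n. ws n f / ws n g0) \<longlonglongrightarrow> c" if "f \<in> E - {e}" for f
    using eqv_w[OF that g0] True that unfolding eqv_def by blast
  ultimately have "\<forall>f\<in>E. \<exists>c. (\<lambda>n. ws n f / ws n g0) \<longlonglongrightarrow> c" by blast
  from bchoice[OF this] obtain d where d: "\<And>f. f \<in> E \<Longrightarrow> (\<lambda>n. ws n f / ws n g0) \<longlonglongrightarrow> d f" by blast
  obtain w where w: "w \<in> W" "\<forall>f\<in>E. w f = d f"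
    using sw.ratio_limit[OF order_refl empty_subsetI, of g0 d] d by (auto simp: minr_self[OF W(2)])
  have "(\<lambda>n. us n g0 * ws n f) \<longlonglongrightarrow> l g0 * w f" if "f \<in> E" for f
  proof -
    have "(\<lambda>n. l g0 * (ws n f / ws n g0)) \<longlonglongrightarrow> l g0 * w f" using d[OF that] w that by (intro tendsto_mult) auto
    moreover have "l g0 * (ws n f / ws n g0) = us n g0 * ws n f" for n
      using prod[OF g0, of n] wsn0[of g0 n] g0 by (auto simp: field_simps)
    ultimately show ?thesis by simp
  qed
  moreover have "(\<lambda>n. us n f / us n g0) \<longlonglongrightarrow> u f" if "f \<in> E" for f using u(2) c[OF that] that by simp
  moreover have "(\<lambda>f. l g0 * w f) \<in> W" by (rule subsp_scale[OF W(1) w(1)])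
  ultimately have "\<exists>w\<in>W. \<forall>f\<in>E. (\<lambda>n. us n f / us n g0) \<longlonglongrightarrow> u f \<and> (\<lambda>n. us n g0 * ws n f) \<longlonglongrightarrow> w f"
    by (intro bexI[of _ "\<lambda>f. l g0 * w f"]) auto
  then show ?thesis using u(1) by blast
next
  case False
  obtain g A B where AB: "g \<in> A" "A \<union> B = E - {e}" "A \<inter> B = {}" "\<And>f. f \<in> A \<Longrightarrow> eqv us f g"
    "\<And>f a. f \<in> B \<Longrightarrow> a \<in> A \<Longrightarrow> lt us f a" by (rule split_level[OF order_refl E'], rule that)
  have sub: "A \<subseteq> E - {e}" "B \<subseteq> E - {e}" using AB by auto
  have fin: "finite A" "finite B" using sub finE by (auto intro: finite_subset)
  have Bne: "B \<noteq> {}"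
  proof
    assume "B = {}"
    then have "\<forall>f\<in>E-{e}. eqv us f g0"
      using AB g0 eqv_trans[of us g _ g0] eqv_sym[of us g0 g] usn0[of g] sub by (metis DiffD1 Un_empty_right)
    then show False using False by blast
  qed
  have cE: "card E = card A + card B + 1"
    using card_Un_disjoint[OF fin AB(3)] AB(2) finE eE by (metis card_Suc_Diff1 Suc_eq_plus1)
  have rAge: "card A < rk (minr U B A) + rk (minr W {} A)"
    using interval_rank[OF sub(1) _ sub(2), of "{}"] AB by blast
  have rBge: "card B < rk (minr U {} B) + rk (minr W A B)"
    using interval_rank[OF sub(2) Bne _ sub(1), of "{}"] AB by blast
  have tot: "rk (minr U {} (E - {e})) + rk (minr W {} (E - {e})) =
      (rk (minr U B A) + rk (minr W {} A)) + (rk (minr U {} B) + rk (minr W A B))"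
    using rk_split[OF AB(3), of "{}" "{}"] AB(2) by auto
  have drop: "rk V = rk (minr V (E - {e}) {e}) + rk (minr V {} (E - {e}))" if "subsp V" "V \<subseteq> cvec E" for V
    using rk_minr_add[of "{e}" "E - {e}" V "{}"] finE that minr_self[OF that(2)] eE by (simp add: insert_absorb)
  note dU = drop[OF U] and dW = drop[OF W]
  \<comment> \<open>\<open>rk U + rk W = card A + card B + 2\<close>, and each of the two minors
    needs an excess of at least 1. So both have excess exactly 1, and deletion of \<open>e\<close>
    costs no rank.\<close>
  have z: "rk (minr U (E - {e}) {e}) = 0" "rk (minr W (E - {e}) {e}) = 0"
    and rA: "rk (minr U B A) + rk (minr W {} A) = card A + 1"
    and rB: "rk (minr U {} B) + rk (minr W A B) = card B + 1"
    using tot rAge rBge dU dW rkUW cE by linarith+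
  obtain h C D where CD: "h \<in> C" "C \<union> D = B" "C \<inter> D = {}" "\<And>f. f \<in> C \<Longrightarrow> eqv us f h"
    "\<And>f a. f \<in> D \<Longrightarrow> a \<in> C \<Longrightarrow> lt us f a" by (rule split_level[OF sub(2) Bne], rule that)
  \<comment> \<open>A further group inside \<open>B\<close> would give the minor on \<open>B\<close>
    an excess of at least 2.\<close>
  have "D = {}"
  proof (rule ccontr)
    assume "D \<noteq> {}"
    have finCD: "finite C" "finite D" using fin CD by auto
    have "card C < rk (minr U D C) + rk (minr W A C)"
      by (rule interval_rank) (use CD AB sub in auto)
    moreover have "card D < rk (minr U {} D) + rk (minr W (A \<union> C) D)"
    proof (rule interval_rank)
      show "lt us f x" if "f \<in> D" "x \<in> A \<union> C" for f x using AB(5)[of f x] CD that by blast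
    qed (use CD sub \<open>D \<noteq> {}\<close> in auto)
    moreover have "card B = card C + card D" using card_Un_disjoint[OF finCD CD(3)] CD(2) by simp
    ultimately show False using rk_split[OF CD(3), of "{}" A] CD(2) sub rB by auto
  qed
  then have CB: "C = B" using CD by simp
  have "two_levels E e U W l us ws ts A B g h"
  proof
    show "u e = 0" if "u \<in> U" "\<And>f. f \<in> E - {e} \<Longrightarrow> u f = 0" for u
      using z(1) rk_minr_single[OF U(1), of "E - {e}" e] that by (auto split: if_splits)
    show "w e = 0" if "w \<in> W" "\<And>f. f \<in> E - {e} \<Longrightarrow> w f = 0" for w
      using z(2) rk_minr_single[OF W(1), of "E - {e}" e] that by (auto split: if_splits)
  qed (use AB CB CD rA rB in auto)
  then show ?thesis by blast
qed

end

text \<open>One \<open>l\<close> serves all pairs of minors of admissible rank on sets that avoid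
  \<open>e\<close>; the value at \<open>e\<close> is varied separately through
  \<open>l(e := t)\<close>.\<close>

locale generic_pair =
  fixes E :: "'e set" and e :: 'e and U W :: "('e \<Rightarrow> complex) set" and l :: "'e \<Rightarrow> complex"
  assumes finE: "finite E" and eE: "e \<in> E" and E': "E - {e} \<noteq> {}"
    and U: "subsp U" "U \<subseteq> cvec E" and W: "subsp W" "W \<subseteq> cvec E"
    and rkUW: "rk U + rk W = card E + 1"
    and nlU: "\<exists>u\<in>U. u e \<noteq> 0" and nlW: "\<exists>w\<in>W. w e \<noteq> 0"
    and l0: "\<And>f. f \<in> E - {e} \<Longrightarrow> l f \<noteq> 0"
    and lgood: "\<And>Y Z X. Y \<subseteq> E - {e} \<Longrightarrow> Y \<noteq> {} \<Longrightarrow> Z \<subseteq> E \<Longrightarrow> X \<subseteq> E \<Longrightarrow>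
      rk (minr U Z Y) + rk (minr W X Y) \<le> card Y + 1 \<Longrightarrow>
      good Y (minr U Z Y) (minr W X Y) (pcnt Y (minr U Z Y) (minr W X Y)) l"
begin

lemma fin_sub: "Y \<subseteq> E - {e} \<Longrightarrow> finite Y"
  using finE finite_subset by blast

lemma sol_norm:
  assumes "Y \<subseteq> E - {e}" "g \<in> Y" "u \<in> minr U Z Y" "w \<in> minr W X Y" "\<And>f. f \<in> Y \<Longrightarrow> u f * w f = l f"
  shows "u g \<noteq> 0" "(\<lambda>a. 1 / u g * u a, \<lambda>a. u g * w a) \<in> sol Y (minr U Z Y) (minr W X Y) g l"
proof -
  have "g \<in> E - {e}" using assms(1,2) by blast
  then show ug: "u g \<noteq> 0" using assms(5)[OF assms(2)] l0[of g] by auto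
  show "(\<lambda>a. 1 / u g * u a, \<lambda>a. u g * w a) \<in> sol Y (minr U Z Y) (minr W X Y) g l"
    using ug assms(5) subsp_scale[OF subsp_minr[OF U(1)] assms(3), of "1 / u g"]
      subsp_scale[OF subsp_minr[OF W(1)] assms(4), of "u g"] by (auto simp: sol_def)
qed

lemma pnd:
  assumes "Y \<subseteq> E - {e}" "Y \<noteq> {}" "Z \<subseteq> E" "X \<subseteq> E" "rk (minr U Z Y) + rk (minr W X Y) \<le> card Y + 1"
    "u \<in> minr U Z Y" "w \<in> minr W X Y" "\<And>f. f \<in> Y \<Longrightarrow> u f * w f = l f"
  shows "nd Y (minr U Z Y) (minr W X Y) u w"
proof -
  obtain g where g: "g \<in> Y" using assms(2) by blast
  note n = sol_norm[OF assms(1) g assms(6-8)]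
  have "nd Y (minr U Z Y) (minr W X Y) (\<lambda>a. 1 / u g * u a) (\<lambda>a. u g * w a)"
    using lgood[OF assms(1-5)] n(2) g unfolding good_def by fast
  from nd_rescale[OF this, of "1 / u g"] n(1) show ?thesis
    by (simp add: subsp_minr U W)
qed

text \<open>With deficient rank the generic count is 0, whereas a solution could be normalised to an
  element of \<open>sol\<close>.\<close>

lemma nosol:
  assumes "Y \<subseteq> E - {e}" "Y \<noteq> {}" "Z \<subseteq> E" "X \<subseteq> E"
    "u \<in> minr U Z Y" "w \<in> minr W X Y" "\<And>f. f \<in> Y \<Longrightarrow> u f * w f = l f"
  shows "card Y < rk (minr U Z Y) + rk (minr W X Y)"
proof (rule ccontr)
  assume c: "\<not> ?thesis"
  obtain g where g: "g \<in> Y" using assms(2) by blast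
  note n = sol_norm[OF assms(1) g assms(5-7)]
  have le: "rk (minr U Z Y) + rk (minr W X Y) \<le> card Y" using c by simp
  then have "pcnt Y (minr U Z Y) (minr W X Y) = 0"
    using gen_pcnt(2)[OF fin_sub[OF assms(1)] assms(2) subsp_minr[OF U(1)] minr_cvec subsp_minr[OF W(1)] minr_cvec]
    by simp
  then have "sol Y (minr U Z Y) (minr W X Y) g l = {}"
    using lgood[OF assms(1-4)] le g unfolding good_def by fastforce
  then show False using n(2) by blast
qed

text \<open>Solutions at \<open>t = 0\<close>: one of the two factors vanishes at \<open>e\<close>.\<close>

abbreviation sol0 :: "'e \<Rightarrow> (('e \<Rightarrow> complex) \<times> ('e \<Rightarrow> complex)) set" where
  "sol0 g \<equiv> sol E U W g (l(e := 0))"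

lemma rk_contract:
  "rk (minr U {e} (E - {e})) + 1 = rk U" "rk (minr W {e} (E - {e})) + 1 = rk W"
  using rk_minr_add[of "E - {e}" "{e}" U "{}"] rk_minr_add[of "E - {e}" "{e}" W "{}"] finE U W
    minr_self[OF U(2)] minr_self[OF W(2)] rk_minr_single[OF U(1), of "{}" e] rk_minr_single[OF W(1), of "{}" e] nlU nlW eE
  by (simp_all add: insert_absorb)

lemma rk_delete:
  assumes "subsp V" "V \<subseteq> cvec E"
  shows "rk (minr V {} (E - {e})) + (if \<exists>v\<in>V. (\<forall>f\<in>E-{e}. v f = 0) \<and> v e \<noteq> 0 then 1 else 0) = rk V"
  using rk_minr_add[of "{e}" "E - {e}" V "{}"] finE assms
    minr_self[OF assms(2)] rk_minr_single[OF assms(1), of "E - {e}" e] eE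
  by (simp add: insert_absorb)

lemma card_E': "card (E - {e}) + 1 = card E"
  using finE eE by (metis Suc_eq_plus1 card_Suc_Diff1)

text \<open>In each excluded case the restriction to \<open>E - {e}\<close> solves the equations in
  a pair of minors where both spaces have lost one dimension, so that the ranks add up to
  \<open>card (E - {e})\<close>, against \<open>nosol\<close>.\<close>

lemma sol_e: 
  assumes "u \<in> U" "w \<in> W" "\<And>f. f \<in> E - {e} \<Longrightarrow> u f * w f = l f"
  shows "\<not> (u e = 0 \<and> w e = 0)"
    "u e = 0 \<Longrightarrow> \<not> (\<exists>v\<in>W. (\<forall>f\<in>E-{e}. v f = 0) \<and> v e \<noteq> 0)"
    "w e = 0 \<Longrightarrow> \<not> (\<exists>v\<in>U. (\<forall>f\<in>E-{e}. v f = 0) \<and> v e \<noteq> 0)"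
proof -
  let ?r = "rst (E - {e})"
  have eqs: "?r u f * ?r w f = l f" if "f \<in> E - {e}" for f using assms(3)[OF that] that by simp
  have m: "?r v \<in> minr V {} (E - {e})" if "v \<in> V" for v V using that by (auto intro: minrI)
  have me: "?r v \<in> minr V {e} (E - {e})" if "v \<in> V" "v e = 0" for v V using that by (auto intro: minrI)
  have eE': "{e} \<subseteq> E" using eE by simp
  show "\<not> (u e = 0 \<and> w e = 0)"
  proof
    assume "u e = 0 \<and> w e = 0"
    then have "card (E - {e}) < rk (minr U {e} (E - {e})) + rk (minr W {e} (E - {e}))"
      using assms by (intro nosol[OF order_refl E' eE' eE' me me eqs]) auto
    then show False using rk_contract rkUW card_E' by linarith
  qed
  show "\<not> (\<exists>v\<in>W. (\<forall>f\<in>E-{e}. v f = 0) \<and> v e \<noteq> 0)" if "u e = 0"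
  proof
    assume "\<exists>v\<in>W. (\<forall>f\<in>E-{e}. v f = 0) \<and> v e \<noteq> 0"
    then have "rk (minr W {} (E - {e})) + 1 = rk W" using rk_delete[OF W] by presburger
    moreover have "card (E - {e}) < rk (minr U {e} (E - {e})) + rk (minr W {} (E - {e}))"
      using assms that by (intro nosol[OF order_refl E' eE' empty_subsetI me m eqs]) auto
    ultimately show False using rk_contract rkUW card_E' by linarith
  qed
  show "\<not> (\<exists>v\<in>U. (\<forall>f\<in>E-{e}. v f = 0) \<and> v e \<noteq> 0)" if "w e = 0"
  proof
    assume "\<exists>v\<in>U. (\<forall>f\<in>E-{e}. v f = 0) \<and> v e \<noteq> 0"
    then have "rk (minr U {} (E - {e})) + 1 = rk U" using rk_delete[OF U] by presburger
    moreover have "card (E - {e}) < rk (minr U {} (E - {e})) + rk (minr W {e} (E - {e}))"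
      using assms that by (intro nosol[OF order_refl E' empty_subsetI eE' m me eqs]) auto
    ultimately show False using rk_contract rkUW card_E' by linarith
  qed
qed

lemma rk_minor_le:
  "rk (minr U {e} (E - {e})) + rk (minr W {} (E - {e})) \<le> card (E - {e}) + 1"
  "rk (minr U {} (E - {e})) + rk (minr W {e} (E - {e})) \<le> card (E - {e}) + 1"
  using rk_contract rk_delete[OF U] rk_delete[OF W] rkUW card_E' by (auto split: if_splits)

lemma cvec_zeroI: "v \<in> cvec E \<Longrightarrow> (\<And>f. f \<in> E - {e} \<Longrightarrow> v f = 0) \<Longrightarrow> v e = 0 \<Longrightarrow> v a = 0"
  by (cases "a \<in> E"; cases "a = e") (auto simp: cvec_def)

text \<open>Off \<open>e\<close>, nondegeneracy is inherited from the minors in which the factor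
  vanishing at \<open>e\<close> is contracted. The derivative of the equation at \<open>e\<close>
  shows that this factor stays 0 there to first order, and by \<open>sol_e\<close> the values off
  \<open>e\<close> determine the other factor at \<open>e\<close>.\<close>

lemma sol0_nd:
  assumes "(u, w) \<in> sol0 g"
  shows "nd E U W u w"
  unfolding nd_def
proof (intro ballI impI)
  fix du dw assume d: "du \<in> U" "dw \<in> W" and z: "\<forall>f\<in>E. u f * dw f + w f * du f = 0"
  let ?r = "rst (E - {e})"
  have uw: "u \<in> U" "w \<in> W" "u e * w e = 0" "\<And>f. f \<in> E - {e} \<Longrightarrow> u f * w f = l f"
    using assms eE by (auto simp: sol_def)
  have eqs: "?r u f * ?r w f = l f" if "f \<in> E - {e}" for f using uw(4)[OF that] that by simp
  have m: "?r v \<in> minr V {} (E - {e})" if "v \<in> V" for v V using that by (auto intro: minrI)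
  have me: "?r v \<in> minr V {e} (E - {e})" if "v \<in> V" "v e = 0" for v V using that by (auto intro: minrI)
  have eE': "{e} \<subseteq> E" using eE by simp
  have zz: "\<forall>f\<in>E-{e}. ?r u f * ?r dw f + ?r w f * ?r du f = 0" using z by simp
  have ze: "u e * dw e + w e * du e = 0" using z eE by blast
  have "\<exists>c. (\<forall>f\<in>E-{e}. du f = c * u f) \<and> (\<forall>f\<in>E-{e}. dw f = - c * w f) \<and>
     du e = c * u e \<and> dw e = - c * w e"
  proof (cases "u e = 0")
    case True
    then have "w e \<noteq> 0" using sol_e(1)[OF uw(1,2,4)] by blast
    then have due: "du e = 0" using ze True by simp
    have nc: "\<not> (\<exists>v\<in>W. (\<forall>f\<in>E-{e}. v f = 0) \<and> v e \<noteq> 0)" using sol_e(2)[OF uw(1,2,4) True] .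
    have "nd (E - {e}) (minr U {e} (E - {e})) (minr W {} (E - {e})) (?r u) (?r w)"
      by (rule pnd[OF order_refl E' eE' empty_subsetI rk_minor_le(1) me[OF uw(1) True] m[OF uw(2)] eqs])
    then obtain c where "?r du = (\<lambda>a. c * ?r u a)" "?r dw = (\<lambda>a. - c * ?r w a)"
      using zz me[OF d(1) due] m[OF d(2)] unfolding nd_def by meson
    then have c: "du f = c * u f" "dw f = - c * w f" if "f \<in> E - {e}" for f
      using that by (metis rst_in)+
    have "(\<lambda>a. dw a + c * w a) \<in> W" by (intro subsp_add subsp_scale W d uw)
    then have "dw e + c * w e = 0" using nc c by fastforce
    then show ?thesis using c due True by (intro exI[of _ c]) (auto simp: eq_neg_iff_add_eq_0)
  next
    case False
    then have we: "w e = 0" using uw(3) by simp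
    then have dwe: "dw e = 0" using ze False by simp
    have nc: "\<not> (\<exists>v\<in>U. (\<forall>f\<in>E-{e}. v f = 0) \<and> v e \<noteq> 0)" using sol_e(3)[OF uw(1,2,4) we] .
    have "nd (E - {e}) (minr U {} (E - {e})) (minr W {e} (E - {e})) (?r u) (?r w)"
      by (rule pnd[OF order_refl E' empty_subsetI eE' rk_minor_le(2) m[OF uw(1)] me[OF uw(2) we] eqs])
    then obtain c where "?r du = (\<lambda>a. c * ?r u a)" "?r dw = (\<lambda>a. - c * ?r w a)"
      using zz m[OF d(1)] me[OF d(2) dwe] unfolding nd_def by meson
    then have c: "du f = c * u f" "dw f = - c * w f" if "f \<in> E - {e}" for f
      using that by (metis rst_in)+
    have "(\<lambda>a. du a - c * u a) \<in> U" by (intro subsp_diff subsp_scale U d uw)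
    then have "du e - c * u e = 0" using nc c by fastforce
    then show ?thesis using c dwe we by (intro exI[of _ c]) auto
  qed
  then obtain c where "\<And>f. f \<in> E \<Longrightarrow> du f = c * u f" "\<And>f. f \<in> E \<Longrightarrow> dw f = - c * w f"
    using eE by (metis DiffI singletonD)
  moreover have "du f = 0" "dw f = 0" "u f = 0" "w f = 0" if "f \<notin> E" for f
    using that d uw U W by (auto simp: cvec_def)
  ultimately have "du f = c * u f" "dw f = - c * w f" for f
    by (cases "f \<in> E"; simp)+
  then show "\<exists>c. du = (\<lambda>a. c * u a) \<and> dw = (\<lambda>a. - c * w a)" by blast
qed

text \<open>The solutions with \<open>u e = 0\<close> and those with \<open>w e = 0\<close> are
  disjoint by \<open>sol_e\<close>, and restriction to \<open>E - {e}\<close> maps each kind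
  bijectively to the solutions in the corresponding minors.\<close>

lemma card_sol0:
  assumes g: "g \<in> E - {e}"
  shows "finite (sol0 g)" "card (sol0 g) =
    pcnt (E - {e}) (minr U {e} (E - {e})) (minr W {} (E - {e})) +
    pcnt (E - {e}) (minr U {} (E - {e})) (minr W {e} (E - {e}))"
proof -
  let ?r = "rst (E - {e})"
  define T1 where "T1 = {(u, w) \<in> sol0 g. u e = 0}"
  define T2 where "T2 = {(u, w) \<in> sol0 g. w e = 0}"
  have eE': "{e} \<subseteq> E" using eE by simp
  have split: "sol0 g = T1 \<union> T2" unfolding T1_def T2_def using eE by (auto simp: sol_def)
  have disj: "T1 \<inter> T2 = {}"
  proof -
    have "\<not> (u e = 0 \<and> w e = 0)" if "(u, w) \<in> sol0 g" for u w
      by (rule sol_e(1)) (use that in \<open>auto simp: sol_def\<close>)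
    then show ?thesis unfolding T1_def T2_def by auto
  qed
  \<comment> \<open>A vector is recovered from its restriction if its value at \<open>e\<close> is
    known or if no nonzero vector of the space is supported at \<open>e\<close>.\<close>
  have ext: "u = u'" if "u \<in> V" "u' \<in> V" "subsp V" "V \<subseteq> cvec E" "?r u = ?r u'"
      "u e = u' e \<or> \<not> (\<exists>v\<in>V. (\<forall>f\<in>E-{e}. v f = 0) \<and> v e \<noteq> 0)" for u u' V
  proof -
    have eq: "u f = u' f" if "f \<in> E - {e}" for f using \<open>?r u = ?r u'\<close> that by (metis rst_in)
    have "(\<lambda>a. u a - u' a) \<in> V" by (intro subsp_diff that)
    then have "u e - u' e = 0" using that(6) eq by fastforce
    moreover have "u f = 0" "u' f = 0" if "f \<notin> E" for f
      using that \<open>u \<in> V\<close> \<open>u' \<in> V\<close> \<open>V \<subseteq> cvec E\<close> by (auto simp: cvec_def)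
    ultimately show ?thesis using eq by (metis (no_types) DiffI eq_iff_diff_eq_0 ext singletonD)
  qed
  have "bij_betw (\<lambda>(u, w). (?r u, ?r w)) T1 (sol (E - {e}) (minr U {e} (E - {e})) (minr W {} (E - {e})) g l)"
    unfolding bij_betw_def
  proof (intro conjI)
    show "inj_on (\<lambda>(u, w). (?r u, ?r w)) T1"
    proof (rule inj_onI)
      fix p q assume p: "p \<in> T1" "q \<in> T1" and eq: "(\<lambda>(u, w). (?r u, ?r w)) p = (\<lambda>(u, w). (?r u, ?r w)) q"
      obtain u w u' w' where pq: "p = (u, w)" "q = (u', w')" by (cases p, cases q)
      have m: "u \<in> U" "w \<in> W" "u' \<in> U" "w' \<in> W" "u e = 0" "u' e = 0" "\<And>f. f \<in> E - {e} \<Longrightarrow> u f * w f = l f"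
        using p by (auto simp: pq T1_def sol_def)
      have "u = u'" by (rule ext[OF m(1,3) U]) (use eq m in \<open>auto simp: pq\<close>)
      moreover have "w = w'"
        by (rule ext[OF m(2,4) W]) (use eq sol_e(2)[OF m(1,2,7,5)] in \<open>auto simp: pq\<close>)
      ultimately show "p = q" by (simp add: pq)
    qed
    show "(\<lambda>(u, w). (?r u, ?r w)) ` T1 = sol (E - {e}) (minr U {e} (E - {e})) (minr W {} (E - {e})) g l"
    proof (intro equalityI subsetI)
      fix p assume "p \<in> (\<lambda>(u, w). (?r u, ?r w)) ` T1"
      then show "p \<in> sol (E - {e}) (minr U {e} (E - {e})) (minr W {} (E - {e})) g l"
        using g by (auto simp: T1_def sol_def intro!: minrI) (auto simp: rst_def split: if_splits)
    next
      fix p assume "p \<in> sol (E - {e}) (minr U {e} (E - {e})) (minr W {} (E - {e})) g l"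
      then obtain u w where "p = (?r u, ?r w)" "u \<in> U" "w \<in> W" "u e = 0" "(?r u, ?r w) \<in> sol (E - {e}) (minr U {e} (E - {e})) (minr W {} (E - {e})) g l"
        by (cases p) (auto simp: sol_def minr_def)
      then show "p \<in> (\<lambda>(u, w). (?r u, ?r w)) ` T1"
        using g by (intro image_eqI[of _ _ "(u, w)"]) (auto simp: T1_def sol_def)
    qed
  qed
  then have 1: "finite T1 \<and> card T1 = pcnt (E - {e}) (minr U {e} (E - {e})) (minr W {} (E - {e}))"
    using lgood[OF order_refl E' eE' empty_subsetI rk_minor_le(1)] g bij_betw_finite bij_betw_same_card
    unfolding good_def by metis
  have "bij_betw (\<lambda>(u, w). (?r u, ?r w)) T2 (sol (E - {e}) (minr U {} (E - {e})) (minr W {e} (E - {e})) g l)"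
    unfolding bij_betw_def
  proof (intro conjI)
    show "inj_on (\<lambda>(u, w). (?r u, ?r w)) T2"
    proof (rule inj_onI)
      fix p q assume p: "p \<in> T2" "q \<in> T2" and eq: "(\<lambda>(u, w). (?r u, ?r w)) p = (\<lambda>(u, w). (?r u, ?r w)) q"
      obtain u w u' w' where pq: "p = (u, w)" "q = (u', w')" by (cases p, cases q)
      have m: "u \<in> U" "w \<in> W" "u' \<in> U" "w' \<in> W" "w e = 0" "w' e = 0" "\<And>f. f \<in> E - {e} \<Longrightarrow> u f * w f = l f"
        using p by (auto simp: pq T2_def sol_def)
      have "w = w'" by (rule ext[OF m(2,4) W]) (use eq m in \<open>auto simp: pq\<close>)
      moreover have "u = u'"
        by (rule ext[OF m(1,3) U]) (use eq sol_e(3)[OF m(1,2,7,5)] in \<open>auto simp: pq\<close>)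
      ultimately show "p = q" by (simp add: pq)
    qed
    show "(\<lambda>(u, w). (?r u, ?r w)) ` T2 = sol (E - {e}) (minr U {} (E - {e})) (minr W {e} (E - {e})) g l"
    proof (intro equalityI subsetI)
      fix p assume "p \<in> (\<lambda>(u, w). (?r u, ?r w)) ` T2"
      then show "p \<in> sol (E - {e}) (minr U {} (E - {e})) (minr W {e} (E - {e})) g l"
        using g by (auto simp: T2_def sol_def intro!: minrI) (auto simp: rst_def split: if_splits)
    next
      fix p assume "p \<in> sol (E - {e}) (minr U {} (E - {e})) (minr W {e} (E - {e})) g l"
      then obtain u w where "p = (?r u, ?r w)" "u \<in> U" "w \<in> W" "w e = 0" "(?r u, ?r w) \<in> sol (E - {e}) (minr U {} (E - {e})) (minr W {e} (E - {e})) g l"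
        by (cases p) (auto simp: sol_def minr_def)
      then show "p \<in> (\<lambda>(u, w). (?r u, ?r w)) ` T2"
        using g by (intro image_eqI[of _ _ "(u, w)"]) (auto simp: T2_def sol_def)
    qed
  qed
  then have 2: "finite T2 \<and> card T2 = pcnt (E - {e}) (minr U {} (E - {e})) (minr W {e} (E - {e}))"
    using lgood[OF order_refl E' empty_subsetI eE' rk_minor_le(2)] g bij_betw_finite bij_betw_same_card
    unfolding good_def by metis
  show "finite (sol0 g)" using 1 2 split by simp
  show "card (sol0 g) =
    pcnt (E - {e}) (minr U {e} (E - {e})) (minr W {} (E - {e})) +
    pcnt (E - {e}) (minr U {} (E - {e})) (minr W {e} (E - {e}))"
    using 1 2 card_Un_disjoint[of T1 T2] disj split by simp
qed

section \<open>Branches through bounded limits\<close>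

definition conv0 :: "(nat \<Rightarrow> ('e \<Rightarrow> complex) \<times> ('e \<Rightarrow> complex)) \<Rightarrow> ('e \<Rightarrow> complex) \<times> ('e \<Rightarrow> complex) \<Rightarrow> bool" where
  "conv0 xs p \<longleftrightarrow> (\<forall>f\<in>E. (\<lambda>n. fst (xs n) f) \<longlonglongrightarrow> fst p f \<and> (\<lambda>n. snd (xs n) f) \<longlonglongrightarrow> snd p f)"

text \<open>Solutions over \<open>l(e := 0)\<close> are nondegenerate by \<open>sol0_nd\<close>, so
  in the coordinates of \<open>pmap\<close> each of them extends to exactly one branch.\<close>

lemma chart0:
  assumes p: "p \<in> sol0 g" and g: "g \<in> E - {e}" and ts: "ts \<longlonglongrightarrow> 0"
  shows "\<exists>\<beta>. (\<forall>\<^sub>F n in sequentially. \<beta> n \<in> sol E U W g (l(e := ts n))) \<and> conv0 \<beta> p"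
    "(\<And>n. xs n \<in> sol E U W g (l(e := ts n))) \<Longrightarrow> (\<And>n. ys n \<in> sol E U W g (l(e := ts n))) \<Longrightarrow>
      conv0 xs p \<Longrightarrow> conv0 ys p \<Longrightarrow> \<forall>\<^sub>F n in sequentially. xs n = ys n"
proof -
  obtain u w where uw: "p = (u, w)" "u \<in> U" "w \<in> W" "u g = 1" using p by (cases p) (auto simp: sol_def)
  have gE: "g \<in> E" using g by simp
  obtain I where I: "I \<subseteq> E" "g \<in> I" "is_basis U I"
    using basis_containing[OF finE U(1) gE uw(2), of "{}"] minr_self[OF U(2)] uw(4) by auto
  obtain J where J: "J \<subseteq> E" "is_basis W J" using basis_existsE[OF finE W] .
  have fin: "finite I" "finite J" using I J by (auto simp: is_basis_finite)
  let ?K = "pvars I g J" and ?F = "pmap U W I g J"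
  have K: "finite ?K" "card ?K = card E"
    using finite_pvars[OF fin] card_pvars[OF fin I(2)] rkUW I J U W card_gt_0_iff[of I] fin
    by (auto simp: rk_eq_card)
  define x0 where "x0 = pcoord I g J (u, w)"
  have x0: "uvec U I g x0 = u" "wvec W J x0 = w"
    unfolding x0_def by (rule uvec_pcoord[OF U(1) I(3,2) uw(2,4)], rule wvec_pcoord[OF W(1) J(2) uw(3)])
  have nd0: "nondeg ?K E ?F x0"
    unfolding pmap_nondeg_iff[OF U(1) I(3,2) W(1) J(2)] x0 using sol0_nd p uw(1) by blast
  have F0: "?F f x0 = (l(e := 0)) f" if "f \<in> E" for f
    using p that unfolding pmap_def x0 by (simp add: uw(1) sol_def)
  have lsim: "(\<lambda>n. (l(e := ts n)) f) \<longlonglongrightarrow> ?F f x0" if "f \<in> E" for f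
    unfolding F0[OF that] using ts by (cases "f = e") auto
  have "\<exists>zs. (\<forall>n. zs n \<in> cvec ?K) \<and> (\<forall>k\<in>?K. (\<lambda>n. zs n k) \<longlonglongrightarrow> x0 k) \<and>
      (\<forall>\<^sub>F n in sequentially. \<forall>f\<in>E. ?F f (zs n) = (l(e := ts n)) f)"
    by (rule nondeg_lift[OF K(1) finE K(2) polyf_pmap nd0 lsim])
  then obtain zs where zs: "\<And>n. zs n \<in> cvec ?K" "\<forall>k\<in>?K. (\<lambda>n. zs n k) \<longlonglongrightarrow> x0 k"
    "\<forall>\<^sub>F n in sequentially. \<forall>f\<in>E. ?F f (zs n) = (l(e := ts n)) f" by blast
  define \<beta> where "\<beta> n = (uvec U I g (zs n), wvec W J (zs n))" for n
  have "\<forall>\<^sub>F n in sequentially. \<beta> n \<in> sol E U W g (l(e := ts n))"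
    using zs(3)
  proof eventually_elim
    case (elim n)
    then have "zs n \<in> fib ?K E ?F (l(e := ts n))" using zs(1) by (simp add: fib_def)
    then show ?case using pmap_bij[OF U(1) I(3,2) W(1) J(2), of E] unfolding bij_betw_def \<beta>_def by blast
  qed
  moreover have "(\<lambda>n. uvec U I g (zs n) f) \<longlonglongrightarrow> u f" for f
    using polyf_tendsto[OF polyf_uvec[of I g ?K U f], of zs x0] zs(2) unfolding x0 by (auto simp: pvars_def)
  moreover have "(\<lambda>n. wvec W J (zs n) f) \<longlonglongrightarrow> w f" for f
    using polyf_tendsto[OF polyf_wvec[of J ?K W f], of zs x0] zs(2) unfolding x0 by (auto simp: pvars_def)
  ultimately show "\<exists>\<beta>. (\<forall>\<^sub>F n in sequentially. \<beta> n \<in> sol E U W g (l(e := ts n))) \<and> conv0 \<beta> p"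
    unfolding conv0_def by (intro exI[of _ \<beta>]) (simp add: \<beta>_def uw(1))
  assume xs: "\<And>n. xs n \<in> sol E U W g (l(e := ts n))" and ys: "\<And>n. ys n \<in> sol E U W g (l(e := ts n))"
    and cx: "conv0 xs p" and cy: "conv0 ys p"
  have inv: "(uvec U I g (pcoord I g J q), wvec W J (pcoord I g J q)) = q" if "q \<in> sol E U W g l'" for q l'
    using that uvec_pcoord[OF U(1) I(3,2)] wvec_pcoord[OF W(1) J(2)] by (cases q) (auto simp: sol_def)
  have lim: "(\<lambda>n. pcoord I g J (zs n) k) \<longlonglongrightarrow> x0 k" if "conv0 zs p" "k \<in> ?K" for zs k
    using that I(1) J(1) unfolding conv0_def x0_def uw(1) by (auto simp: pcoord_def pvars_def split: sum.splits)
  have F: "?F f (pcoord I g J q) = l' f" if "q \<in> sol E U W g l'" "f \<in> E" for q l' f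
    using inv[OF that(1)] that by (cases q) (auto simp: sol_def pmap_def)
  have "\<forall>\<^sub>F n in sequentially. \<forall>k\<in>?K. pcoord I g J (xs n) k = pcoord I g J (ys n) k"
    by (rule nondeg_eventually_unique[OF K(1) finE K(2) polyf_pmap nd0 lim[OF cx] lim[OF cy]])
       (simp_all add: F[OF xs] F[OF ys])
  then show "\<forall>\<^sub>F n in sequentially. xs n = ys n"
  proof eventually_elim
    case (elim n)
    then have "pcoord I g J (xs n) = pcoord I g J (ys n)"
      by (intro cvec_eqI[OF pcoord_cvec pcoord_cvec]) auto
    then show ?case using inv[OF xs] inv[OF ys] by metis
  qed
qed

end

section \<open>A chart around the limits at infinity\<close>

definition cmb :: "('e \<Rightarrow> complex) set \<Rightarrow> 'e set \<Rightarrow> ('e \<Rightarrow> complex) \<Rightarrow> 'e \<Rightarrow> complex" where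
  "cmb V L x f = (\<Sum>i\<in>L. x i * dualb V L i f)"

lemma cmb_in: "subsp V \<Longrightarrow> is_basis V L \<Longrightarrow> cmb V L x \<in> V"
  using dualb_sum_in[of V L x] by (simp add: cmb_def[abs_def])

lemma cmb_coord: "is_basis V L \<Longrightarrow> i \<in> L \<Longrightarrow> cmb V L x i = x i"
  unfolding cmb_def by (rule dualb_sum_coord)

lemma cmb_linear: "cmb V L (\<lambda>i. x i + s * y i) f = cmb V L x f + s * cmb V L y f"
  unfolding cmb_def by (simp add: sum.distrib distrib_right sum_distrib_left mult.assoc)

text \<open>The limits at infinity belonging to a partition \<open>A \<union> B\<close> of \<open>E - {e}\<close>: after scaling,
  \<open>u\<close> is of size \<open>1\<close> on \<open>A\<close> and of size \<open>s\<close> on \<open>B\<close>, \<open>w\<close> is of size \<open>1\<close> on \<open>A\<close> and of size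
  \<open>1 / s\<close> on \<open>B\<close>.\<close>

locale chart3 = generic_pair +
  fixes A B :: "'a set" and g h :: 'a and uA wA uB wB :: "'a \<Rightarrow> complex"
  assumes AB: "A \<union> B = E - {e}" "A \<inter> B = {}" and gA: "g \<in> A" and hB: "h \<in> B"
    and rA: "rk (minr U (insert e B) A) + rk (minr W {} A) = card A + 1"
    and rB: "rk (minr U {} B) + rk (minr W (insert e A) B) = card B + 1"
    and pA: "(uA, wA) \<in> sol A (minr U (insert e B) A) (minr W {} A) g l"
    and pB: "(uB, wB) \<in> sol B (minr U {} B) (minr W (insert e A) B) h l"
begin

lemma AB_sub: "A \<subseteq> E - {e}" "B \<subseteq> E - {e}" "A \<subseteq> E" "B \<subseteq> E" "insert e A \<subseteq> E" "insert e B \<subseteq> E"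
  using AB eE by auto

lemma AB_fin: "finite A" "finite B"
  using AB_sub finE finite_subset by blast+

lemma AB_e: "e \<notin> A" "e \<notin> B"
  using AB_sub by auto

text \<open>The total rank \<open>card A + card B + 2\<close> is already used up by the two exact
  minors. So \<open>e\<close> has rank 0 in \<open>U\<close> after contraction of \<open>B\<close>,
  and in \<open>W\<close> after contraction of \<open>A\<close>.\<close>

lemma closed: "u \<in> U \<Longrightarrow> (\<And>f. f \<in> B \<Longrightarrow> u f = 0) \<Longrightarrow> u e = 0"
  "w \<in> W \<Longrightarrow> (\<And>f. f \<in> A \<Longrightarrow> w f = 0) \<Longrightarrow> w e = 0"
proof -
  have E1: "A \<union> insert e B = E" "B \<union> insert e A = E" using AB(1) eE by auto
  have E2: "{e} \<union> B = insert e B" "{e} \<union> A = insert e A" by auto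
  have "rk U = rk (minr U (insert e B) A) + (rk (minr U B {e}) + rk (minr U {} B))"
    using rk_minr_add[of A "insert e B" U "{}"] rk_minr_add[of "{e}" B U "{}"] AB_fin AB AB_e U(1)
      minr_self[OF U(2)] unfolding E1 E2 by auto
  moreover have "rk W = rk (minr W (insert e A) B) + (rk (minr W A {e}) + rk (minr W {} A))"
    using rk_minr_add[of B "insert e A" W "{}"] rk_minr_add[of "{e}" A W "{}"] AB_fin AB AB_e W(1)
      minr_self[OF W(2)] unfolding E1 E2 by auto
  moreover have "card E = card A + card B + 1"
    using card_Un_disjoint[OF AB_fin AB(2)] AB(1) card_E' by simp
  ultimately have z: "rk (minr U B {e}) = 0" "rk (minr W A {e}) = 0"
    using rA rB rkUW by linarith+
  show "u e = 0" if "u \<in> U" "\<And>f. f \<in> B \<Longrightarrow> u f = 0"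
    using z(1) rk_minr_single[OF U(1), of B e] that by (auto split: if_splits)
  show "w e = 0" if "w \<in> W" "\<And>f. f \<in> A \<Longrightarrow> w f = 0"
    using z(2) rk_minr_single[OF W(1), of A e] that by (auto split: if_splits)
qed

lemma contract_eq: "minr U (insert e B) A = minr U B A" "minr W (insert e A) B = minr W A B"
proof -
  have "{u \<in> U. \<forall>f\<in>insert e B. u f = 0} = {u \<in> U. \<forall>f\<in>B. u f = 0}" using closed(1) by auto
  then show "minr U (insert e B) A = minr U B A" by (simp add: minr_def)
  have "{u \<in> W. \<forall>f\<in>insert e A. u f = 0} = {u \<in> W. \<forall>f\<in>A. u f = 0}" using closed(2) by auto
  then show "minr W (insert e A) B = minr W A B" by (simp add: minr_def)
qed

text \<open>If \<open>u e = 0\<close>, then \<open>uB\<close> solves the equations in the minor with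
  \<open>e\<close> contracted as well, whose rank is one too small for \<open>nosol\<close>;
  similarly for \<open>w\<close>. The product of these two values is the first-order coefficient of
  the equation at \<open>e\<close>.\<close>

lemma limit_e:
  assumes "u \<in> U" "rst B u = uB" "w \<in> W" "rst A w = wA"
  shows "u e \<noteq> 0" "w e \<noteq> 0"
proof -
  have A: "uA \<in> minr U (insert e B) A" "wA \<in> minr W {} A" "\<And>f. f \<in> A \<Longrightarrow> uA f * wA f = l f"
    and B: "uB \<in> minr U {} B" "wB \<in> minr W (insert e A) B" "\<And>f. f \<in> B \<Longrightarrow> uB f * wB f = l f"
    using pA pB by (auto simp: sol_def)
  have ne: "A \<noteq> {}" "B \<noteq> {}" using gA hB by auto
  show "u e \<noteq> 0"
  proof
    assume "u e = 0"
    then have "uB \<in> minr U {e} B" using assms(1,2) by (auto simp: minr_def)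
    then have "card B < rk (minr U {e} B) + rk (minr W (insert e A) B)"
      using B AB_sub eE ne by (intro nosol) auto
    moreover have "\<not> (\<exists>u\<in>U. (\<forall>f\<in>{} \<union> B. u f = 0) \<and> u e \<noteq> 0)" using closed(1) by auto
    then have "rk (minr U {e} B) + 1 = rk (minr U {} B)"
      using rk_contract_elem[OF AB_fin(2) U(1) AB_e(2), of "{}"] nlU by auto
    ultimately show False using rB by linarith
  qed
  show "w e \<noteq> 0"
  proof
    assume "w e = 0"
    then have "wA \<in> minr W {e} A" using assms(3,4) by (auto simp: minr_def)
    then have "card A < rk (minr U (insert e B) A) + rk (minr W {e} A)"
      using A AB_sub eE ne by (intro nosol) auto
    moreover have "\<not> (\<exists>u\<in>W. (\<forall>f\<in>{} \<union> A. u f = 0) \<and> u e \<noteq> 0)" using closed(2) by auto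
    then have "rk (minr W {e} A) + 1 = rk (minr W {} A)"
      using rk_contract_elem[OF AB_fin(1) W(1) AB_e(1), of "{}"] nlW by auto
    ultimately show False using rA by linarith
  qed
qed

text \<open>All quantities are invariant under the scaling \<open>(c * u, w / c)\<close>, so the
  solutions may be normalised at any edge.\<close>

definition conv3 :: "(nat \<Rightarrow> ('a \<Rightarrow> complex) \<times> ('a \<Rightarrow> complex)) \<Rightarrow> bool" where
  "conv3 xs \<longleftrightarrow> (\<lambda>n. fst (xs n) h / fst (xs n) g) \<longlonglongrightarrow> 0 \<and>
     (\<forall>f\<in>A. (\<lambda>n. fst (xs n) f / fst (xs n) g) \<longlonglongrightarrow> uA f \<and> (\<lambda>n. snd (xs n) f * fst (xs n) g) \<longlonglongrightarrow> wA f) \<and>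
     (\<forall>f\<in>B. (\<lambda>n. fst (xs n) f / fst (xs n) h) \<longlonglongrightarrow> uB f \<and> (\<lambda>n. snd (xs n) f * fst (xs n) h) \<longlonglongrightarrow> wB f)"

end

text \<open>Bases adapted to the two levels: \<open>IA\<close> and \<open>IB\<close> together
  parametrise \<open>U\<close>, and \<open>JA\<close> and \<open>JB\<close> together parametrise
  \<open>W\<close>.\<close>

locale chart3_bases = chart3 +
  fixes IA IB JA JB :: "'a set"
  assumes IA: "IA \<subseteq> A" "g \<in> IA" "is_basis (minr U (insert e B) A) IA"
    and IB: "IB \<subseteq> B" "h \<in> IB" "is_basis (minr U {} B) IB"
    and JA: "JA \<subseteq> A" "is_basis (minr W {} A) JA"
    and JB: "JB \<subseteq> B" "is_basis (minr W (insert e A) B) JB"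
begin

definition "I = IA \<union> IB"
definition "J = JA \<union> JB"

lemma notin: "i \<in> IA \<Longrightarrow> i \<notin> IB" "i \<in> IB \<Longrightarrow> i \<notin> IA" "i \<in> JA \<Longrightarrow> i \<notin> JB" "i \<in> JB \<Longrightarrow> i \<notin> JA"
  "g \<notin> IB" "h \<notin> IA" "h \<noteq> g" "g \<noteq> h"
  using IA IB JA JB AB by auto

text \<open>No nonzero vector is supported at \<open>e\<close>, so values off \<open>e\<close>
  determine a vector and a basis of the deletion remains one.\<close>

lemma basis_ext: 
  assumes "is_basis (minr V {} (E - {e})) L" "\<And>v. v \<in> V \<Longrightarrow> (\<And>f. f \<in> E - {e} \<Longrightarrow> v f = 0) \<Longrightarrow> v e = 0"
    "L \<subseteq> E - {e}" "V \<subseteq> cvec E"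
  shows "is_basis V L"
  unfolding is_basis_def
proof (intro conjI allI ballI impI)
  show "finite L" using assms(1) by (rule is_basis_finite)
  show "\<exists>u\<in>V. \<forall>i\<in>L. u i = x i" for x
  proof -
    obtain v where "v \<in> minr V {} (E - {e})" "\<forall>i\<in>L. v i = x i"
      using assms(1)[unfolded is_basis_def, THEN conjunct2, THEN conjunct1, rule_format, of x] by blast
    then obtain u where "u \<in> V" "\<forall>i\<in>L. rst (E - {e}) u i = x i" by (auto simp: minr_def)
    moreover have "rst (E - {e}) u i = u i" if "i \<in> L" for i using that assms(3) by (intro rst_in) auto
    ultimately show ?thesis by metis
  qed
  fix v assume v: "v \<in> V" "\<forall>i\<in>L. v i = 0"
  have m: "rst (E - {e}) v \<in> minr V {} (E - {e})" using v by (auto intro: minrI)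
  have "rst (E - {e}) v i = 0" if "i \<in> L" for i
    using v(2) that by (auto simp: rst_def)
  with is_basis_zero[OF assms(1) m] have "rst (E - {e}) v = (\<lambda>_. 0)" by blast
  then have z: "v f = 0" if "f \<in> E - {e}" for f using that by (metis rst_in)
  then have "v e = 0" by (rule assms(2)[OF v(1)])
  then show "v = (\<lambda>_. 0)" using z v(1) assms(4) cvec_zeroI by blast
qed

lemma I_basis: "is_basis U I"
proof (rule basis_ext)
  have "is_basis (minr U {} (A \<union> B)) (IA \<union> IB)"
    by (rule is_basis_union) (use U IA IB AB contract_eq in auto)
  then show "is_basis (minr U {} (E - {e})) I" unfolding I_def AB(1) .
  show "v e = 0" if "v \<in> U" "\<And>f. f \<in> E - {e} \<Longrightarrow> v f = 0" for v
    using closed(1)[OF that(1)] that(2) AB_sub by blast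
  show "I \<subseteq> E - {e}" using IA IB AB_sub unfolding I_def by blast
qed (use U in auto)

lemma J_basis: "is_basis W J"
proof (rule basis_ext)
  have "is_basis (minr W {} (B \<union> A)) (JB \<union> JA)"
    by (rule is_basis_union) (use W JA JB AB contract_eq in auto)
  then show "is_basis (minr W {} (E - {e})) J" unfolding J_def using AB(1) by (simp add: Un_commute)
  show "v e = 0" if "v \<in> W" "\<And>f. f \<in> E - {e} \<Longrightarrow> v f = 0" for v
    using closed(2)[OF that(1)] that(2) AB_sub by blast
  show "J \<subseteq> E - {e}" using JA JB AB_sub unfolding J_def by blast
qed (use W in auto)

text \<open>\<open>IB\<close> controls all of \<open>B\<close>, and \<open>e\<close> lies in the
  closure of \<open>B\<close>. Thus the part of \<open>u\<close> with coordinates in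
  \<open>IA\<close> only does not reach \<open>B\<close> or \<open>e\<close>.\<close>

lemma supU: assumes "u \<in> U" "\<And>i. i \<in> IB \<Longrightarrow> u i = 0" "f \<in> insert e B" shows "u f = 0"
proof -
  have "rst B u = (\<lambda>_. 0)"
    by (rule is_basis_zero[OF IB(3) minrI[OF assms(1)]]) (use assms IB in \<open>auto simp: rst_def\<close>)
  then have "\<And>f. f \<in> B \<Longrightarrow> u f = 0" by (metis rst_in)
  then show ?thesis using closed(1)[OF assms(1)] assms(3) by blast
qed

lemma supW: assumes "w \<in> W" "\<And>j. j \<in> JA \<Longrightarrow> w j = 0" "f \<in> insert e A" shows "w f = 0"
proof -
  have "rst A w = (\<lambda>_. 0)"
    by (rule is_basis_zero[OF JA(2) minrI[OF assms(1)]]) (use assms JA in \<open>auto simp: rst_def\<close>)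
  then have "\<And>f. f \<in> A \<Longrightarrow> w f = 0" by (metis rst_in)
  then show ?thesis using closed(2)[OF assms(1)] assms(3) by blast
qed

text \<open>The two levels of a solution: \<open>u = av + s * bv\<close> and
  \<open>w = cv + (1 / s) * dv\<close>. Here \<open>av\<close> vanishes on \<open>B\<close> and at
  \<open>e\<close>, and \<open>dv\<close> on \<open>A\<close> and at \<open>e\<close>. As
  \<open>av\<close> is 1 at \<open>g\<close> and \<open>bv\<close> is 1 at \<open>h\<close>, the
  coordinate \<open>Inl h\<close> of the chart is free to carry \<open>s\<close>.\<close>

definition "av (x :: 'a + 'a \<Rightarrow> complex) = cmb U I (\<lambda>i. if i \<in> IA then (if i = g then 1 else x (Inl i)) else 0)"
definition "bv (x :: 'a + 'a \<Rightarrow> complex) = cmb U I (\<lambda>i. if i \<in> IB then (if i = h then 1 else x (Inl i)) else 0)"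
definition "cv (x :: 'a + 'a \<Rightarrow> complex) = cmb W J (\<lambda>j. if j \<in> JA then x (Inr j) else 0)"
definition "dv (x :: 'a + 'a \<Rightarrow> complex) = cmb W J (\<lambda>j. if j \<in> JB then x (Inr j) else 0)"

abbreviation K :: "('a + 'a) set" where "K \<equiv> pvars I g J"

text \<open>The products \<open>u f * w f\<close> with the factor \<open>1 / s\<close> cancelled by
  means of the zeros of \<open>av\<close> and \<open>dv\<close>. The result is polynomial also at
  \<open>s = 0\<close>, where the limits are found.\<close>

definition G :: "'a \<Rightarrow> ('a + 'a \<Rightarrow> complex) \<Rightarrow> complex" where
  "G f x = (if f \<in> A then (av x f + x (Inl h) * bv x f) * cv x f
    else if f \<in> B then bv x f * (dv x f + x (Inl h) * cv x f) else x (Inl h) * bv x f * cv x f)"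

lemma fin_IJ: "finite I" "finite J"
  using I_basis J_basis by (auto simp: is_basis_finite)

lemma g_in: "g \<in> I" and h_in: "h \<in> I"
  using IA IB by (auto simp: I_def)

lemma K_fin: "finite K" and K_card: "card K = card E"
proof -
  show "finite K" by (rule finite_pvars[OF fin_IJ])
  have "card I > 0" using g_in fin_IJ card_gt_0_iff by blast
  then show "card K = card E"
    using card_pvars[OF fin_IJ g_in] rkUW rk_eq_card[OF U(1) I_basis] rk_eq_card[OF W(1) J_basis] by simp
qed

lemma polyf_cmb:
  assumes "\<And>i. i \<in> L \<Longrightarrow> polyf K (\<lambda>x. c x i)"
  shows "polyf K (\<lambda>x. cmb V L (c x) f)"
  unfolding cmb_def by (intro polyf_sum polyf_mult assms polyf_const)

lemma polyf_x: "i \<in> I - {g} \<Longrightarrow> polyf K (\<lambda>x. x (Inl i))" "j \<in> J \<Longrightarrow> polyf K (\<lambda>x. x (Inr j))"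
  by (auto intro!: polyf_var simp: pvars_def)

lemma polyf_abcd: "polyf K (\<lambda>x. av x f)" "polyf K (\<lambda>x. bv x f)" "polyf K (\<lambda>x. cv x f)" "polyf K (\<lambda>x. dv x f)"
proof -
  show "polyf K (\<lambda>x. av x f)" unfolding av_def
  proof (rule polyf_cmb)
    fix i assume "i \<in> I"
    then show "polyf K (\<lambda>x. if i \<in> IA then (if i = g then 1 else x (Inl i)) else 0)"
      by (cases "i \<in> IA"; cases "i = g") (auto intro!: polyf_const polyf_x simp: notin)
  qed
  show "polyf K (\<lambda>x. bv x f)" unfolding bv_def
  proof (rule polyf_cmb)
    fix i assume "i \<in> I"
    then show "polyf K (\<lambda>x. if i \<in> IB then (if i = h then 1 else x (Inl i)) else 0)"
      by (cases "i \<in> IB"; cases "i = h") (auto intro!: polyf_const polyf_x simp: notin)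
  qed
  show "polyf K (\<lambda>x. cv x f)" unfolding cv_def
  proof (rule polyf_cmb)
    fix i assume "i \<in> J"
    then show "polyf K (\<lambda>x. if i \<in> JA then x (Inr i) else 0)"
      by (cases "i \<in> JA") (auto intro!: polyf_const polyf_x)
  qed
  show "polyf K (\<lambda>x. dv x f)" unfolding dv_def
  proof (rule polyf_cmb)
    fix i assume "i \<in> J"
    then show "polyf K (\<lambda>x. if i \<in> JB then x (Inr i) else 0)"
      by (cases "i \<in> JB") (auto intro!: polyf_const polyf_x)
  qed
qed

lemma polyf_G: "polyf K (G f)"
proof -
  have h: "polyf K (\<lambda>x. x (Inl h))" using h_in notin by (intro polyf_x) auto
  have "polyf K (\<lambda>x. G f x)"
    unfolding G_def by (cases "f \<in> A"; cases "f \<in> B") (auto intro!: polyf_add polyf_mult polyf_abcd h)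
  then show ?thesis by simp
qed

lemma abcd_in: "av x \<in> U" "bv x \<in> U" "cv x \<in> W" "dv x \<in> W"
  unfolding av_def bv_def cv_def dv_def by (simp_all add: cmb_in U W I_basis J_basis)

lemma abcd_coord:
  "i \<in> I \<Longrightarrow> av x i = (if i \<in> IA then (if i = g then 1 else x (Inl i)) else 0)"
  "i \<in> I \<Longrightarrow> bv x i = (if i \<in> IB then (if i = h then 1 else x (Inl i)) else 0)"
  "j \<in> J \<Longrightarrow> cv x j = (if j \<in> JA then x (Inr j) else 0)"
  "j \<in> J \<Longrightarrow> dv x j = (if j \<in> JB then x (Inr j) else 0)"
  unfolding av_def bv_def cv_def dv_def by (simp_all add: cmb_coord I_basis J_basis)

lemma av_zero: "f \<in> insert e B \<Longrightarrow> av x f = 0"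
  by (rule supU[OF abcd_in(1)]) (auto simp: abcd_coord I_def notin)

lemma dv_zero: "f \<in> insert e A \<Longrightarrow> dv x f = 0"
  by (rule supW[OF abcd_in(4)]) (auto simp: abcd_coord J_def notin)

text \<open>The coordinate \<open>x (Inl h)\<close> is the scale \<open>s\<close>.\<close>

definition "uP (x :: 'a + 'a \<Rightarrow> complex) = (\<lambda>f. av x f + x (Inl h) * bv x f)"
definition "wP (x :: 'a + 'a \<Rightarrow> complex) = (\<lambda>f. cv x f + 1 / x (Inl h) * dv x f)"

lemma P_in: "uP x \<in> U" "wP x \<in> W"
  unfolding uP_def wP_def by (intro subsp_add subsp_scale U W abcd_in)+

lemma P_prod: "f \<in> E \<Longrightarrow> x (Inl h) \<noteq> 0 \<Longrightarrow> uP x f * wP x f = G f x"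
  unfolding uP_def wP_def G_def using AB(1) AB(2) AB_e av_zero[of f x] dv_zero[of f x]
  by (auto simp: field_simps)

text \<open>The inverse of the chart, written in the scale-invariant ratios of
  \<open>conv3\<close>.\<close>

definition kap :: "('a \<Rightarrow> complex) \<times> ('a \<Rightarrow> complex) \<Rightarrow> 'a + 'a \<Rightarrow> complex" where
  "kap p = (\<lambda>k. case k of
     Inl i \<Rightarrow> if i \<in> IA - {g} then fst p i / fst p g else if i = h then fst p h / fst p g
       else if i \<in> IB then fst p i / fst p h else 0
   | Inr j \<Rightarrow> if j \<in> JA then snd p j * fst p g else if j \<in> JB then snd p j * fst p h else 0)"

lemma kap_P:
  assumes "u \<in> U" "w \<in> W" "u g \<noteq> 0" "u h \<noteq> 0"
  shows "uP (kap (u, w)) f = u f / u g" "wP (kap (u, w)) f = w f * u g" "kap (u, w) (Inl h) = u h / u g"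
proof -
  show s: "kap (u, w) (Inl h) = u h / u g" using notin by (simp add: kap_def)
  have uP: "uP (kap (u, w)) = (\<lambda>f. 1 / u g * u f)"
    by (rule is_basis_eqI[OF U(1) I_basis P_in(1) subsp_scale[OF U(1) assms(1)]])
       (use assms notin in \<open>auto simp: uP_def abcd_coord s I_def kap_def\<close>)
  have wP: "wP (kap (u, w)) = (\<lambda>f. u g * w f)"
    by (rule is_basis_eqI[OF W(1) J_basis P_in(2) subsp_scale[OF W(1) assms(2)]])
       (use assms notin in \<open>auto simp: wP_def abcd_coord s J_def kap_def\<close>)
  show "uP (kap (u, w)) f = u f / u g" "wP (kap (u, w)) f = w f * u g"
    unfolding uP wP by simp_all
qed

text \<open>The point of the chart with \<open>s = 0\<close> whose levels are the two given
  solutions.\<close>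

definition x0 :: "'a + 'a \<Rightarrow> complex" where
  "x0 = (\<lambda>k. case k of
     Inl i \<Rightarrow> if i \<in> IA - {g} then uA i else if i = h then 0 else if i \<in> IB then uB i else 0
   | Inr j \<Rightarrow> if j \<in> JA then wA j else if j \<in> JB then wB j else 0)"

lemma AB_sol: "uA \<in> minr U (insert e B) A" "wA \<in> minr W {} A" "uA g = 1" "\<And>f. f \<in> A \<Longrightarrow> uA f * wA f = l f"
  "uB \<in> minr U {} B" "wB \<in> minr W (insert e A) B" "uB h = 1" "\<And>f. f \<in> B \<Longrightarrow> uB f * wB f = l f"
  using pA pB by (auto simp: sol_def)

lemma x0_lim: "rst A (av x0) = uA" "rst B (bv x0) = uB" "rst A (cv x0) = wA" "rst B (dv x0) = wB"
proof -
  show "rst A (av x0) = uA"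
    by (rule is_basis_eqI[OF subsp_minr[OF U(1)] IA(3) minrI[OF abcd_in(1) av_zero] AB_sol(1)])
       (use IA AB_sol in \<open>auto simp: rst_def abcd_coord I_def x0_def\<close>)
  show "rst B (bv x0) = uB"
    by (rule is_basis_eqI[OF subsp_minr[OF U(1)] IB(3) minrI[OF abcd_in(2)] AB_sol(5)])
       (use IB AB_sol notin in \<open>auto simp: rst_def abcd_coord I_def x0_def\<close>)
  show "rst A (cv x0) = wA"
    by (rule is_basis_eqI[OF subsp_minr[OF W(1)] JA(2) minrI[OF abcd_in(3)] AB_sol(2)])
       (use JA AB_sol in \<open>auto simp: rst_def abcd_coord J_def x0_def\<close>)
  show "rst B (dv x0) = wB"
    by (rule is_basis_eqI[OF subsp_minr[OF W(1)] JB(2) minrI[OF abcd_in(4) dv_zero] AB_sol(6)])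
       (use JB AB_sol notin in \<open>auto simp: rst_def abcd_coord J_def x0_def\<close>)
qed

lemma x0_lim': "f \<in> A \<Longrightarrow> av x0 f = uA f" "f \<in> B \<Longrightarrow> bv x0 f = uB f"
  "f \<in> A \<Longrightarrow> cv x0 f = wA f" "f \<in> B \<Longrightarrow> dv x0 f = wB f"
  using x0_lim by (metis rst_in)+

lemma x0_h: "x0 (Inl h) = 0"
  using notin by (simp add: x0_def)

lemma x0_e: "bv x0 e \<noteq> 0" "cv x0 e \<noteq> 0"
  using limit_e[OF abcd_in(2) x0_lim(2) abcd_in(3) x0_lim(3)] .

lemma G_x0: "f \<in> E \<Longrightarrow> G f x0 = (l(e := 0)) f"
  using AB AB_e AB_sol(4)[of f] AB_sol(8)[of f] x0_h x0_lim'[of f] unfolding G_def by auto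

text \<open>At \<open>s = 0\<close> the equation at \<open>e\<close> involves only the derivative of
  \<open>s\<close> to first order, with nonzero coefficient by \<open>x0_e\<close>. Once that
  derivative is 0, the equations on \<open>A\<close> and on \<open>B\<close> decouple into the
  linearised equations of the two minors, which are nondegenerate; the normalisations at
  \<open>g\<close> and \<open>h\<close> exclude the scaling directions.\<close>

lemma nondeg_x0: "nondeg K E G x0"
  unfolding nondeg_def
proof (intro allI impI)
  fix v assume z: "\<forall>f\<in>E. ((\<lambda>s. G f (\<lambda>a. x0 a + s * v a)) has_field_derivative 0) (at 0)"
  define da where "da = cmb U I (\<lambda>i. if i \<in> IA - {g} then v (Inl i) else 0)"
  define db where "db = cmb U I (\<lambda>i. if i \<in> IB - {h} then v (Inl i) else 0)"
  define dc where "dc = cmb W J (\<lambda>j. if j \<in> JA then v (Inr j) else 0)"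
  define dd where "dd = cmb W J (\<lambda>j. if j \<in> JB then v (Inr j) else 0)"
  define ds where "ds = v (Inl h)"
  have din: "da \<in> U" "db \<in> U" "dc \<in> W" "dd \<in> W"
    unfolding da_def db_def dc_def dd_def by (simp_all add: cmb_in U W I_basis J_basis)
  have dco: "i \<in> I \<Longrightarrow> da i = (if i \<in> IA - {g} then v (Inl i) else 0)"
    "i \<in> I \<Longrightarrow> db i = (if i \<in> IB - {h} then v (Inl i) else 0)"
    "i \<in> J \<Longrightarrow> dc i = (if i \<in> JA then v (Inr i) else 0)"
    "i \<in> J \<Longrightarrow> dd i = (if i \<in> JB then v (Inr i) else 0)" for i
    unfolding da_def db_def dc_def dd_def by (simp_all add: cmb_coord I_basis J_basis)
  have lins: "av (\<lambda>a. x0 a + s * v a) f = av x0 f + s * da f"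
    "bv (\<lambda>a. x0 a + s * v a) f = bv x0 f + s * db f"
    "cv (\<lambda>a. x0 a + s * v a) f = cv x0 f + s * dc f"
    "dv (\<lambda>a. x0 a + s * v a) f = dv x0 f + s * dd f" for s f
    unfolding av_def bv_def cv_def dv_def da_def db_def dc_def dd_def cmb_linear[symmetric]
    by (auto intro!: arg_cong[where f = "\<lambda>c. cmb _ _ c f"] simp: fun_eq_iff)
  have ds0: "ds = 0"
  proof -
    \<comment> \<open>As \<open>s\<close> vanishes at \<open>x0\<close>, the derivatives of
      \<open>bv\<close> and \<open>cv\<close> do not contribute.\<close>
    have "((\<lambda>s. G e (\<lambda>a. x0 a + s * v a)) has_field_derivative ds * bv x0 e * cv x0 e) (at 0)"
      unfolding G_def lins using AB_e x0_h by (auto intro!: derivative_eq_intros simp: ds_def)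
    moreover have "((\<lambda>s. G e (\<lambda>a. x0 a + s * v a)) has_field_derivative 0) (at 0)" using z eE by blast
    ultimately have "ds * bv x0 e * cv x0 e = 0" by (rule DERIV_unique)
    then show ?thesis using x0_e by simp
  qed
  have eqA: "uA f * dc f + wA f * da f = 0" if f: "f \<in> A" for f
  proof -
    have "((\<lambda>s. G f (\<lambda>a. x0 a + s * v a)) has_field_derivative av x0 f * dc f + cv x0 f * da f) (at 0)"
      unfolding G_def lins using f x0_h ds0 by (auto intro!: derivative_eq_intros simp: ds_def algebra_simps)
    moreover have "((\<lambda>s. G f (\<lambda>a. x0 a + s * v a)) has_field_derivative 0) (at 0)" using z f AB_sub by blast
    ultimately have "av x0 f * dc f + cv x0 f * da f = 0" by (rule DERIV_unique)
    then show ?thesis using x0_lim'[of f] f by simp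
  qed
  have eqB: "uB f * dd f + wB f * db f = 0" if f: "f \<in> B" for f
  proof -
    have "f \<notin> A" using f AB by auto
    then have "((\<lambda>s. G f (\<lambda>a. x0 a + s * v a)) has_field_derivative bv x0 f * dd f + dv x0 f * db f) (at 0)"
      unfolding G_def lins using f x0_h ds0 by (auto intro!: derivative_eq_intros simp: ds_def algebra_simps)
    moreover have "((\<lambda>s. G f (\<lambda>a. x0 a + s * v a)) has_field_derivative 0) (at 0)" using z f AB_sub by blast
    ultimately have "bv x0 f * dd f + dv x0 f * db f = 0" by (rule DERIV_unique)
    then show ?thesis using x0_lim'[of f] f by simp
  qed
  have ne: "A \<noteq> {}" "B \<noteq> {}" using gA hB by auto
  have da0: "da f = 0" if "f \<in> insert e B" for f
    by (rule supU[OF din(1) _ that]) (auto simp: dco I_def notin)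
  have dd0: "dd f = 0" if "f \<in> insert e A" for f
    by (rule supW[OF din(4) _ that]) (auto simp: dco J_def notin)
  have "nd A (minr U (insert e B) A) (minr W {} A) uA wA"
    by (rule pnd) (use AB_sub ne rA AB_sol in auto)
  moreover have "\<forall>f\<in>A. uA f * rst A dc f + wA f * rst A da f = 0" using eqA by simp
  ultimately obtain c where c: "rst A da = (\<lambda>a. c * uA a)" "rst A dc = (\<lambda>a. - c * wA a)"
    using minrI[OF din(1) da0, of "insert e B" A] minrI[OF din(3), of "{}" A] unfolding nd_def by blast
  have "c = 0" using fun_cong[OF c(1), of g] AB_sol(3) dco(1)[OF g_in] gA by simp
  then have zA: "da f = 0" "dc f = 0" if "f \<in> A" for f
    using fun_cong[OF c(1), of f] fun_cong[OF c(2), of f] that by auto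
  have "nd B (minr U {} B) (minr W (insert e A) B) uB wB"
    by (rule pnd) (use AB_sub ne rB AB_sol in auto)
  moreover have "\<forall>f\<in>B. uB f * rst B dd f + wB f * rst B db f = 0" using eqB by simp
  ultimately obtain c' where c': "rst B db = (\<lambda>a. c' * uB a)" "rst B dd = (\<lambda>a. - c' * wB a)"
    using minrI[OF din(2), of "{}" B] minrI[OF din(4) dd0, of "insert e A" B] unfolding nd_def by blast
  have "c' = 0" using fun_cong[OF c'(1), of h] AB_sol(7) dco(2)[OF h_in] hB by simp
  then have zB: "db f = 0" "dd f = 0" if "f \<in> B" for f
    using fun_cong[OF c'(1), of f] fun_cong[OF c'(2), of f] that by auto
  have "v (Inl i) = 0" if i: "i \<in> I - {g}" for i
  proof -
    consider "i \<in> IA - {g}" | "i = h" | "i \<in> IB - {h}" using i unfolding I_def by blast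
    then show ?thesis
    proof cases
      case 1
      then show ?thesis using dco(1)[of i] zA(1)[of i] IA(1) by (auto simp: I_def)
    next
      case 2
      then show ?thesis using ds0 by (simp add: ds_def)
    next
      case 3
      then show ?thesis using dco(2)[of i] zB(1)[of i] IB(1) by (auto simp: I_def)
    qed
  qed
  moreover have "v (Inr j) = 0" if "j \<in> J" for j
  proof (cases "j \<in> JA")
    case True
    then show ?thesis using dco(3)[of j] zA(2)[of j] JA(1) by (auto simp: J_def)
  next
    case False
    then show ?thesis using dco(4)[of j] zB(2)[of j] JB(1) that by (auto simp: J_def)
  qed
  ultimately show "\<forall>k\<in>K. v k = 0" by (auto simp: pvars_def)
qed

text \<open>The branch is lifted through \<open>x0\<close> in the chart, converted to vectors by
  \<open>uP\<close> and \<open>wP\<close>, and rescaled to be 1 at \<open>g0\<close>.\<close>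

lemma branch_exists:
  assumes ts: "ts \<longlonglongrightarrow> 0" "\<And>n. ts n \<noteq> 0" and g0: "g0 \<in> E - {e}"
  shows "\<exists>\<beta>. (\<forall>\<^sub>F n in sequentially. \<beta> n \<in> sol E U W g0 (l(e := ts n))) \<and> conv3 \<beta>"
proof -
  have lsim: "(\<lambda>n. (l(e := ts n)) f) \<longlonglongrightarrow> G f x0" if "f \<in> E" for f
    unfolding G_x0[OF that] using ts by (cases "f = e") auto
  have "\<exists>zs. (\<forall>n. zs n \<in> cvec K) \<and> (\<forall>k\<in>K. (\<lambda>n. zs n k) \<longlonglongrightarrow> x0 k) \<and>
      (\<forall>\<^sub>F n in sequentially. \<forall>f\<in>E. G f (zs n) = (l(e := ts n)) f)"
    by (rule nondeg_lift[OF K_fin finE K_card, where f = G, OF polyf_G nondeg_x0])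
       (rule lsim)
  then obtain zs where zs: "\<forall>k\<in>K. (\<lambda>n. zs n k) \<longlonglongrightarrow> x0 k"
    "\<forall>\<^sub>F n in sequentially. \<forall>f\<in>E. G f (zs n) = (l(e := ts n)) f" by blast
  define u w where "u n = uP (zs n)" and "w n = wP (zs n)" for n
  define \<beta> where "\<beta> n = (\<lambda>a. 1 / u n g0 * u n a, \<lambda>a. u n g0 * w n a)" for n
  have gE: "g \<in> E" "h \<in> E" using gA hB AB_sub by auto
  have ug: "u n g = 1" for n
    unfolding u_def uP_def using abcd_coord(1,2)[OF g_in] IA(2) notin by simp
  have uh: "u n h = zs n (Inl h)" for n
    unfolding u_def uP_def using abcd_coord(1,2)[OF h_in] IB(2) notin by simp
  note pt = polyf_tendsto[where xs = zs and x = x0 and F = sequentially]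
  have lim: "(\<lambda>n. av (zs n) f) \<longlonglongrightarrow> av x0 f" "(\<lambda>n. bv (zs n) f) \<longlonglongrightarrow> bv x0 f"
    "(\<lambda>n. cv (zs n) f) \<longlonglongrightarrow> cv x0 f" "(\<lambda>n. dv (zs n) f) \<longlonglongrightarrow> dv x0 f" for f
    using zs(1) by (auto intro: pt[OF polyf_abcd(1)] pt[OF polyf_abcd(2)] pt[OF polyf_abcd(3)] pt[OF polyf_abcd(4)])
  have "Inl h \<in> K" using h_in notin by (auto simp: pvars_def)
  then have limh: "(\<lambda>n. zs n (Inl h)) \<longlonglongrightarrow> 0" using zs(1) x0_h by metis
  have ev: "\<forall>\<^sub>F n in sequentially. zs n (Inl h) \<noteq> 0 \<and> (\<forall>f\<in>E. u n f * w n f = (l(e := ts n)) f) \<and> u n g0 \<noteq> 0"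
    using zs(2)
  proof eventually_elim
    case (elim n)
    have "G e (zs n) = ts n" using elim eE by auto
    \<comment> \<open>The product at \<open>e\<close> contains the factor \<open>s\<close>, so
      \<open>ts n\<close> being nonzero makes \<open>s\<close> nonzero and division by it
      legitimate.\<close>
    then have nz: "zs n (Inl h) \<noteq> 0" using ts(2)[of n] AB_e unfolding G_def by auto
    then have p: "\<forall>f\<in>E. u n f * w n f = (l(e := ts n)) f"
      using elim unfolding u_def w_def by (simp add: P_prod)
    then have "u n g0 * w n g0 = l g0" using g0 by auto
    then have "u n g0 \<noteq> 0" using l0[OF g0] by auto
    then show ?case using nz p by blast
  qed
  have "\<forall>\<^sub>F n in sequentially. \<beta> n \<in> sol E U W g0 (l(e := ts n))"
    using ev
  proof eventually_elim
    case (elim n)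
    have "(\<lambda>a. 1 / u n g0 * u n a) \<in> U" "(\<lambda>a. u n g0 * w n a) \<in> W"
      unfolding u_def w_def by (intro subsp_scale U W P_in)+
    then show ?case using elim by (auto simp: \<beta>_def sol_def)
  qed
  moreover have "conv3 \<beta>"
    unfolding conv3_def
  proof (intro conjI ballI)
    show "(\<lambda>n. fst (\<beta> n) h / fst (\<beta> n) g) \<longlonglongrightarrow> 0"
      by (rule Lim_transform_eventually[OF limh]) (use ev in eventually_elim, auto simp: \<beta>_def uh ug)
  next
    fix f assume f: "f \<in> A"
    have "(\<lambda>n. av (zs n) f + zs n (Inl h) * bv (zs n) f) \<longlonglongrightarrow> av x0 f + 0 * bv x0 f"
      by (intro tendsto_add tendsto_mult lim limh)
    then have "(\<lambda>n. u n f) \<longlonglongrightarrow> uA f" using x0_lim'(1)[OF f] by (simp add: u_def uP_def)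
    then show "(\<lambda>n. fst (\<beta> n) f / fst (\<beta> n) g) \<longlonglongrightarrow> uA f"
      by (rule Lim_transform_eventually) (use ev in eventually_elim, auto simp: \<beta>_def ug)
    have "(\<lambda>n. cv (zs n) f) \<longlonglongrightarrow> wA f" using lim(3)[of f] x0_lim'(3)[OF f] by simp
    moreover have "cv (zs n) f = w n f" for n unfolding w_def wP_def using dv_zero[of f "zs n"] f by simp
    ultimately have "(\<lambda>n. w n f) \<longlonglongrightarrow> wA f" by simp
    then show "(\<lambda>n. snd (\<beta> n) f * fst (\<beta> n) g) \<longlonglongrightarrow> wA f"
      by (rule Lim_transform_eventually) (use ev in eventually_elim, auto simp: \<beta>_def ug)
  next
    fix f assume f: "f \<in> B"
    have uf: "u n f = zs n (Inl h) * bv (zs n) f" for n unfolding u_def uP_def using av_zero[of f] f by simp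
    have "(\<lambda>n. bv (zs n) f) \<longlonglongrightarrow> uB f" using lim(2)[of f] x0_lim'(2)[OF f] by simp
    then show "(\<lambda>n. fst (\<beta> n) f / fst (\<beta> n) h) \<longlonglongrightarrow> uB f"
      by (rule Lim_transform_eventually) (use ev in eventually_elim, auto simp: \<beta>_def uf uh)
    have "(\<lambda>n. dv (zs n) f + zs n (Inl h) * cv (zs n) f) \<longlonglongrightarrow> dv x0 f + 0 * cv x0 f"
      by (intro tendsto_add tendsto_mult lim limh)
    then have "(\<lambda>n. dv (zs n) f + zs n (Inl h) * cv (zs n) f) \<longlonglongrightarrow> wB f" using x0_lim'(4)[OF f] by simp
    then show "(\<lambda>n. snd (\<beta> n) f * fst (\<beta> n) h) \<longlonglongrightarrow> wB f"
      by (rule Lim_transform_eventually)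
         (use ev in eventually_elim, auto simp: \<beta>_def uh w_def wP_def field_simps)
  qed
  ultimately show ?thesis by blast
qed

text \<open>Both sequences converge to \<open>x0\<close> in the chart, where local uniqueness
  applies; the chart determines a solution up to scaling.\<close>

lemma branch_unique:
  assumes ts0: "\<And>n. ts n \<noteq> 0" and g0: "g0 \<in> E - {e}"
    and xs: "\<And>n. xs n \<in> sol E U W g0 (l(e := ts n))" and ys: "\<And>n. ys n \<in> sol E U W g0 (l(e := ts n))"
    and cx: "conv3 xs" and cy: "conv3 ys"
  shows "\<forall>\<^sub>F n in sequentially. xs n = ys n"
proof -
  have gE: "g \<in> E - {e}" "h \<in> E - {e}" using gA hB AB_sub by auto
  have nz: "fst p f \<noteq> 0" if "p \<in> sol E U W g0 (l(e := ts n))" "f \<in> E - {e}" for p n f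
    using that l0[OF that(2)] by (cases p) (auto simp: sol_def)
  have prod: "G f (kap p) = (l(e := ts n)) f" if p: "p \<in> sol E U W g0 (l(e := ts n))" and f: "f \<in> E" for p n f
  proof -
    obtain u w where uw: "p = (u, w)" by (cases p)
    have s: "u \<in> U" "w \<in> W" "u g \<noteq> 0" "u h \<noteq> 0" "u f * w f = (l(e := ts n)) f"
      using p f nz[OF p] gE by (auto simp: uw sol_def)
    have "uP (kap p) f * wP (kap p) f = G f (kap p)"
      by (rule P_prod[OF f]) (use kap_P(3)[OF s(1-4)] s in \<open>simp add: uw\<close>)
    then show ?thesis using kap_P[OF s(1-4)] s by (simp add: uw)
  qed
  have lim: "(\<lambda>n. kap (zs n) k) \<longlonglongrightarrow> x0 k" if "conv3 zs" "k \<in> K" for zs k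
    using that IA(1) IB(1) JA(1) JB(1) notin unfolding conv3_def
    by (auto simp: kap_def x0_def pvars_def I_def J_def split: sum.splits)
  have "\<forall>\<^sub>F n in sequentially. \<forall>k\<in>K. kap (xs n) k = kap (ys n) k"
    by (rule nondeg_eventually_unique[OF K_fin finE K_card polyf_G nondeg_x0 lim[OF cx] lim[OF cy]])
       (simp_all add: prod[OF xs] prod[OF ys])
  then show ?thesis
  proof eventually_elim
    case (elim n)
    have "kap (xs n) k = kap (ys n) k" for k
    proof (cases "k \<in> K")
      case False
      then show ?thesis using notin h_in by (auto simp: kap_def pvars_def I_def J_def split: sum.splits)
    qed (use elim in blast)
    then have eq: "kap (xs n) = kap (ys n)" by blast
    obtain u w u' w' where uw: "xs n = (u, w)" "ys n = (u', w')" by (cases "xs n", cases "ys n")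
    have s: "u \<in> U" "w \<in> W" "u g \<noteq> 0" "u h \<noteq> 0" "u' \<in> U" "w' \<in> W" "u' g \<noteq> 0" "u' h \<noteq> 0" "u g0 = 1" "u' g0 = 1"
      using xs[of n] ys[of n] nz[OF xs[of n]] nz[OF ys[of n]] gE by (auto simp: uw sol_def)
    have "u f / u g = u' f / u' g" "w f * u g = w' f * u' g" for f
      using kap_P(1,2)[OF s(1-4), of f] kap_P(1,2)[OF s(5-8), of f] eq by (auto simp: uw)
    \<comment> \<open>The normalisation \<open>u g0 = 1\<close> fixes the remaining scale.\<close>
    moreover from this(1)[of g0] have "u g = u' g" using s by (simp add: field_simps)
    ultimately have "u f = u' f" "w f = w' f" for f using s by auto
    then have "u = u'" "w = w'" by auto
    then show ?case by (simp add: uw)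
  qed
qed

end

context chart3
begin

lemma bases_exist: "\<exists>IA IB JA JB. chart3_bases E e U W l A B g h uA wA uB wB IA IB JA JB"
proof -
  have "uA \<in> minr U (insert e B) A" "uA g = 1" "uB \<in> minr U {} B" "uB h = 1"
    using pA pB by (auto simp: sol_def)
  then obtain u v where u': "u \<in> U" "\<forall>f\<in>insert e B. u f = 0" "rst A u g = 1" and v': "v \<in> U" "rst B v h = 1"
    by (auto simp: minr_def)
  then have u: "u \<in> U" "\<And>f. f \<in> insert e B \<Longrightarrow> u f = 0" "u g \<noteq> 0" and v: "v \<in> U" "v h \<noteq> 0"
    using gA hB by auto
  obtain IA where IA: "IA \<subseteq> A" "g \<in> IA" "is_basis (minr U (insert e B) A) IA"
    using basis_containing[OF AB_fin(1) U(1) gA u] by blast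
  obtain IB where IB: "IB \<subseteq> B" "h \<in> IB" "is_basis (minr U {} B) IB"
    using basis_containing[OF AB_fin(2) U(1) hB v(1) _ v(2), of "{}"] by blast
  obtain JA where JA: "JA \<subseteq> A" "is_basis (minr W {} A) JA"
    using basis_exists[OF AB_fin(1) W(1)] by blast
  obtain JB where JB: "JB \<subseteq> B" "is_basis (minr W (insert e A) B) JB"
    using basis_exists[OF AB_fin(2) W(1)] by blast
  have "chart3_bases E e U W l A B g h uA wA uB wB IA IB JA JB"
    by unfold_locales fact+
  then show ?thesis by blast
qed

lemma branch:
  assumes "g0 \<in> E - {e}" "\<And>n. ts n \<noteq> 0"
  shows "ts \<longlonglongrightarrow> 0 \<Longrightarrow> \<exists>\<beta>. (\<forall>\<^sub>F n in sequentially. \<beta> n \<in> sol E U W g0 (l(e := ts n))) \<and> conv3 \<beta>"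
    "(\<And>n. xs n \<in> sol E U W g0 (l(e := ts n))) \<Longrightarrow> (\<And>n. ys n \<in> sol E U W g0 (l(e := ts n))) \<Longrightarrow>
      conv3 xs \<Longrightarrow> conv3 ys \<Longrightarrow> \<forall>\<^sub>F n in sequentially. xs n = ys n"
proof -
  obtain IA IB JA JB where "chart3_bases E e U W l A B g h uA wA uB wB IA IB JA JB"
    using bases_exist by blast
  then interpret b: chart3_bases E e U W l A B g h uA wA uB wB IA IB JA JB .
  show "ts \<longlonglongrightarrow> 0 \<Longrightarrow> \<exists>\<beta>. (\<forall>\<^sub>F n in sequentially. \<beta> n \<in> sol E U W g0 (l(e := ts n))) \<and> conv3 \<beta>"
    using b.branch_exists assms by blast
  show "(\<And>n. xs n \<in> sol E U W g0 (l(e := ts n))) \<Longrightarrow> (\<And>n. ys n \<in> sol E U W g0 (l(e := ts n))) \<Longrightarrow>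
      conv3 xs \<Longrightarrow> conv3 ys \<Longrightarrow> \<forall>\<^sub>F n in sequentially. xs n = ys n"
    by (rule b.branch_unique[OF assms(2,1)])
qed

end

section \<open>The recursion for generic solution counts\<close>

text \<open>Compactness of the Riemann sphere.\<close>

lemma extended_limit_subseq:
  fixes z :: "nat \<Rightarrow> complex"
  shows "\<exists>r. strict_mono (r :: nat \<Rightarrow> nat) \<and> ((\<exists>c. (\<lambda>n. z (r n)) \<longlonglongrightarrow> c) \<or> (\<lambda>n. inverse (z (r n))) \<longlonglongrightarrow> 0)"
proof (cases "\<forall>\<^sub>F n in sequentially. cmod (z n) > 1")
  case False
  from not_eventually_sequentiallyD[OF this] obtain r :: "nat \<Rightarrow> nat" where r: "strict_mono r" "\<And>n. cmod (z (r n)) \<le> 1"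
    by (auto simp: not_less)
  then have "Bseq (\<lambda>n. z (r n))" by (intro BseqI'[of _ 1])
  then have "bounded (range (\<lambda>n. z (r n)))" by (simp add: Bseq_eq_bounded)
  then obtain c r' where "strict_mono (r' :: nat \<Rightarrow> nat)" "((\<lambda>n. z (r n)) \<circ> r') \<longlonglongrightarrow> c"
    using bounded_imp_convergent_subsequence by blast
  then show ?thesis using strict_mono_o[OF r(1)] by (intro exI[of _ "r \<circ> r'"]) (auto simp: o_def)
next
  case True
  then have "\<forall>\<^sub>F n in sequentially. norm (inverse (z n)) \<le> 1"
    by eventually_elim (simp add: norm_inverse inverse_le_1_iff)
  then have "Bseq (\<lambda>n. inverse (z n))" by (rule BfunI)
  then have "bounded (range (\<lambda>n. inverse (z n)))" by (simp add: Bseq_eq_bounded)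
  then obtain c r where r: "strict_mono (r :: nat \<Rightarrow> nat)" "((\<lambda>n. inverse (z n)) \<circ> r) \<longlonglongrightarrow> c"
    using bounded_imp_convergent_subsequence by blast
  show ?thesis
  proof (cases "c = 0")
    case True
    then show ?thesis using r by (auto simp: o_def)
  next
    case False
    then have "(\<lambda>n. inverse (inverse (z (r n)))) \<longlonglongrightarrow> inverse c" using r(2) by (intro tendsto_inverse) (auto simp: o_def)
    then show ?thesis using r(1) by auto
  qed
qed

lemma extended_limit_subseq_finite:
  fixes z :: "nat \<Rightarrow> 'k \<Rightarrow> complex"
  assumes "finite K"
  shows "\<exists>r. strict_mono (r :: nat \<Rightarrow> nat) \<and>
    (\<forall>k\<in>K. (\<exists>c. (\<lambda>n. z (r n) k) \<longlonglongrightarrow> c) \<or> (\<lambda>n. inverse (z (r n) k)) \<longlonglongrightarrow> 0)"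
  using assms
proof (induction K rule: finite_induct)
  case empty
  show ?case by (rule exI[of _ id]) (simp add: strict_mono_def)
next
  case (insert k K)
  then obtain r where r: "strict_mono (r :: nat \<Rightarrow> nat)"
    "\<forall>k\<in>K. (\<exists>c. (\<lambda>n. z (r n) k) \<longlonglongrightarrow> c) \<or> (\<lambda>n. inverse (z (r n) k)) \<longlonglongrightarrow> 0" by blast
  obtain r' where r': "strict_mono (r' :: nat \<Rightarrow> nat)"
    "(\<exists>c. (\<lambda>n. z (r (r' n)) k) \<longlonglongrightarrow> c) \<or> (\<lambda>n. inverse (z (r (r' n)) k)) \<longlonglongrightarrow> 0"
    using extended_limit_subseq[of "\<lambda>n. z (r n) k"] by blast
  have "(\<exists>c. (\<lambda>n. z ((r \<circ> r') n) j) \<longlonglongrightarrow> c) \<or> (\<lambda>n. inverse (z ((r \<circ> r') n) j)) \<longlonglongrightarrow> 0" if j: "j \<in> insert k K" for j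
  proof (cases "j = k")
    case True
    then show ?thesis using r'(2) by simp
  next
    case False
    then consider c where "(\<lambda>n. z (r n) j) \<longlonglongrightarrow> c" | "(\<lambda>n. inverse (z (r n) j)) \<longlonglongrightarrow> 0"
      using r(2) j by blast
    then show ?thesis
    proof cases
      case 1
      from LIMSEQ_subseq_LIMSEQ[OF this r'(1)] show ?thesis by (auto simp: o_def)
    next
      case 2
      from LIMSEQ_subseq_LIMSEQ[OF this r'(1)] show ?thesis by (auto simp: o_def)
    qed
  qed
  then show ?case using strict_mono_o[OF r(1) r'(1)] by blast
qed

text \<open>All ratios of both sequences are finitely many points moving on the Riemann sphere;
  their limits 0, finite nonzero and infinity are the three cases.\<close>

lemma ratio_trichotomy_subseq:
  fixes a b :: "nat \<Rightarrow> 'e \<Rightarrow> complex"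
  assumes "finite E"
  shows "\<exists>r. strict_mono (r :: nat \<Rightarrow> nat) \<and> (\<forall>f\<in>E. \<forall>g\<in>E.
    (lt (\<lambda>n. a (r n)) f g \<or> eqv (\<lambda>n. a (r n)) f g \<or> lt (\<lambda>n. a (r n)) g f) \<and>
    (lt (\<lambda>n. b (r n)) f g \<or> eqv (\<lambda>n. b (r n)) f g \<or> lt (\<lambda>n. b (r n)) g f))"
proof -
  define z where "z n k = (case k of (c, f, g) \<Rightarrow> if c then a n f / a n g else b n f / b n g)" for n and k :: "bool \<times> 'e \<times> 'e"
  have "finite ((UNIV :: bool set) \<times> E \<times> E)" using assms by simp
  from extended_limit_subseq_finite[OF this, of z] obtain r where r: "strict_mono (r :: nat \<Rightarrow> nat)"
    "\<And>c f g. f \<in> E \<Longrightarrow> g \<in> E \<Longrightarrow> (\<exists>d. (\<lambda>n. z (r n) (c, f, g)) \<longlonglongrightarrow> d) \<or> (\<lambda>n. inverse (z (r n) (c, f, g))) \<longlonglongrightarrow> 0"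
    by (auto simp: mem_Times_iff)
  have "lt (\<lambda>n. a (r n)) f g \<or> eqv (\<lambda>n. a (r n)) f g \<or> lt (\<lambda>n. a (r n)) g f" if "f \<in> E" "g \<in> E" for f g
    using r(2)[OF that, of True] unfolding lt_def eqv_def z_def by (auto, metis)
  moreover have "lt (\<lambda>n. b (r n)) f g \<or> eqv (\<lambda>n. b (r n)) f g \<or> lt (\<lambda>n. b (r n)) g f" if "f \<in> E" "g \<in> E" for f g
    using r(2)[OF that, of False] unfolding lt_def eqv_def z_def by (auto, metis)
  ultimately show ?thesis using r(1) by blast
qed

section \<open>Counting the limits of solutions\<close>

context generic_pair
begin

definition pairs :: "('e set \<times> 'e set) set" where
  "pairs = {(A, B). A \<union> B = E - {e} \<and> A \<inter> B = {} \<and> A \<noteq> {} \<and> B \<noteq> {} \<and>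
     rk (minr U (insert e B) A) + rk (minr W {} A) = card A + 1 \<and>
     rk (minr U {} B) + rk (minr W (insert e A) B) = card B + 1}"

definition pick :: "'e set \<Rightarrow> 'e" where
  "pick A = (SOME g. g \<in> A)"

lemma pick: "A \<noteq> {} \<Longrightarrow> pick A \<in> A"
  unfolding pick_def by (simp add: some_in_eq)

abbreviation "solA A B \<equiv> sol A (minr U (insert e B) A) (minr W {} A) (pick A) l"
abbreviation "solB A B \<equiv> sol B (minr U {} B) (minr W (insert e A) B) (pick B) l"

lemma chart3I:
  assumes "(A, B) \<in> pairs" "(uA, wA) \<in> solA A B" "(uB, wB) \<in> solB A B"
  shows "chart3 E e U W l A B (pick A) (pick B) uA wA uB wB"
  by unfold_locales (use assms pick[of A] pick[of B] in \<open>auto simp: pairs_def\<close>)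

text \<open>\<open>Inl\<close> collects the bounded limits, \<open>Inr\<close> the limits at
  infinity: an exact partition with a solution in each of its two minors.\<close>

definition lims :: "'e \<Rightarrow> (('e \<Rightarrow> complex) \<times> ('e \<Rightarrow> complex) +
    (('e set \<times> 'e set) \<times> ((('e \<Rightarrow> complex) \<times> ('e \<Rightarrow> complex)) \<times> (('e \<Rightarrow> complex) \<times> ('e \<Rightarrow> complex))))) set" where
  "lims g0 = Inl ` sol0 g0 \<union> Inr ` (SIGMA p:pairs. solA (fst p) (snd p) \<times> solB (fst p) (snd p))"

definition conv where
  "conv xs \<tau> = (case \<tau> of Inl p \<Rightarrow> conv0 xs p
     | Inr ((A, B), ((uA, wA), (uB, wB))) \<Rightarrow> chart3.conv3 A B (pick A) (pick B) uA wA uB wB xs)"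

lemma limsE:
  assumes "\<tau> \<in> lims g0"
  obtains u w where "\<tau> = Inl (u, w)" "(u, w) \<in> sol0 g0"
  | A B uA wA uB wB where "\<tau> = Inr ((A, B), ((uA, wA), (uB, wB)))"
    "(A, B) \<in> pairs" "(uA, wA) \<in> solA A B" "(uB, wB) \<in> solB A B"
    "chart3 E e U W l A B (pick A) (pick B) uA wA uB wB"
  using assms chart3I unfolding lims_def by fastforce

lemma conv_Inr:
  assumes "chart3 E e U W l A B (pick A) (pick B) uA wA uB wB"
  shows "conv xs (Inr ((A, B), ((uA, wA), (uB, wB)))) \<longleftrightarrow>
    (\<lambda>n. fst (xs n) (pick B) / fst (xs n) (pick A)) \<longlonglongrightarrow> 0 \<and>
     (\<forall>f\<in>A. (\<lambda>n. fst (xs n) f / fst (xs n) (pick A)) \<longlonglongrightarrow> uA f \<and> (\<lambda>n. snd (xs n) f * fst (xs n) (pick A)) \<longlonglongrightarrow> wA f) \<and>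
     (\<forall>f\<in>B. (\<lambda>n. fst (xs n) f / fst (xs n) (pick B)) \<longlonglongrightarrow> uB f \<and> (\<lambda>n. snd (xs n) f * fst (xs n) (pick B)) \<longlonglongrightarrow> wB f)"
  unfolding conv_def using chart3.conv3_def[OF assms] by simp

lemma pairs_sol_card:
  assumes "(A, B) \<in> pairs"
  shows "finite (solA A B)" "card (solA A B) = pcnt A (minr U (insert e B) A) (minr W {} A)"
    "finite (solB A B)" "card (solB A B) = pcnt B (minr U {} B) (minr W (insert e A) B)"
proof -
  have *: "A \<subseteq> E - {e}" "B \<subseteq> E - {e}" "A \<noteq> {}" "B \<noteq> {}" "insert e A \<subseteq> E" "insert e B \<subseteq> E"
    "rk (minr U (insert e B) A) + rk (minr W {} A) \<le> card A + 1"
    "rk (minr U {} B) + rk (minr W (insert e A) B) \<le> card B + 1"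
    using assms eE by (auto simp: pairs_def)
  show "finite (solA A B)" "card (solA A B) = pcnt A (minr U (insert e B) A) (minr W {} A)"
    using lgood[OF *(1,3,6) empty_subsetI *(7)] pick[OF *(3)] unfolding good_def by blast+
  show "finite (solB A B)" "card (solB A B) = pcnt B (minr U {} B) (minr W (insert e A) B)"
    using lgood[OF *(2,4) empty_subsetI *(5,8)] pick[OF *(4)] unfolding good_def by blast+
qed

lemma finite_pairs: "finite pairs"
  by (rule finite_subset[of _ "Pow E \<times> Pow E"]) (use finE in \<open>auto simp: pairs_def\<close>)

lemma card_lims:
  assumes "g0 \<in> E - {e}"
  shows "finite (lims g0)" "card (lims g0) = card (sol0 g0) +
    (\<Sum>(A, B)\<in>pairs. pcnt A (minr U (insert e B) A) (minr W {} A) * pcnt B (minr U {} B) (minr W (insert e A) B))"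
proof -
  let ?S = "SIGMA p:pairs. solA (fst p) (snd p) \<times> solB (fst p) (snd p)"
  have f: "finite (solA (fst p) (snd p) \<times> solB (fst p) (snd p))" if "p \<in> pairs" for p
    using pairs_sol_card[of "fst p" "snd p"] that by simp
  have fS: "finite ?S" using f finite_pairs by auto
  show "finite (lims g0)" unfolding lims_def using fS card_sol0(1)[OF assms] by simp
  have "card ?S = (\<Sum>p\<in>pairs. card (solA (fst p) (snd p) \<times> solB (fst p) (snd p)))"
    by (rule card_SigmaI[OF finite_pairs]) (use f in blast)
  also have "\<dots> = (\<Sum>(A, B)\<in>pairs. pcnt A (minr U (insert e B) A) (minr W {} A) * pcnt B (minr U {} B) (minr W (insert e A) B))"
    using pairs_sol_card by (intro sum.cong) (auto simp: card_cartesian_product)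
  finally show "card (lims g0) = card (sol0 g0) +
    (\<Sum>(A, B)\<in>pairs. pcnt A (minr U (insert e B) A) (minr W {} A) * pcnt B (minr U {} B) (minr W (insert e A) B))"
    unfolding lims_def using fS card_sol0(1)[OF assms]
    by (subst card_Un_disjoint) (auto simp: card_image)
qed

context
  fixes ts :: "nat \<Rightarrow> complex" and g0 :: 'e
  assumes ts: "ts \<longlonglongrightarrow> 0" "\<And>n. ts n \<noteq> 0" and g0: "g0 \<in> E - {e}"
begin

abbreviation "Sn n \<equiv> sol E U W g0 (l(e := ts n))"

lemma Sn_nz: "xs \<in> Sn n \<Longrightarrow> f \<in> E - {e} \<Longrightarrow> fst xs f \<noteq> 0"
  using l0[of f] by (cases xs) (auto simp: sol_def)

text \<open>As \<open>l\<close> is nonzero on \<open>A\<close> and \<open>B\<close>, the limits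
  \<open>uA\<close> and \<open>uB\<close> vanish nowhere on their groups. Hence the partition can be
  read off the growth of the sequence.\<close>

lemma conv_levels:
  assumes c: "chart3 E e U W l A B (pick A) (pick B) uA wA uB wB"
    and xs: "\<And>n. xs n \<in> Sn (r n)" and conv: "conv xs (Inr ((A, B), ((uA, wA), (uB, wB))))"
  shows "f \<in> A \<Longrightarrow> f' \<in> A \<Longrightarrow> eqv (\<lambda>n. fst (xs n)) f f'" "f \<in> B \<Longrightarrow> f' \<in> A \<Longrightarrow> lt (\<lambda>n. fst (xs n)) f f'"
proof -
  interpret c: chart3 E e U W l A B "pick A" "pick B" uA wA uB wB by fact
  have sub: "A \<subseteq> E - {e}" "B \<subseteq> E - {e}" "pick A \<in> E - {e}" "pick B \<in> E - {e}"
    using c.AB_sub c.gA c.hB by auto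
  have uA: "uA f \<noteq> 0" if "f \<in> A" for f
  proof -
    have "uA f * wA f = l f" using c.pA that by (auto simp: sol_def)
    moreover have "l f \<noteq> 0" using l0 that sub by blast
    ultimately show ?thesis by auto
  qed
  have uB: "uB f \<noteq> 0" if "f \<in> B" for f
  proof -
    have "uB f * wB f = l f" using c.pB that by (auto simp: sol_def)
    moreover have "l f \<noteq> 0" using l0 that sub by blast
    ultimately show ?thesis by auto
  qed
  have a: "eqv (\<lambda>n. fst (xs n)) f (pick A)" if "f \<in> A" for f
    using conv uA that unfolding conv_Inr[OF c] eqv_def by blast
  have b: "eqv (\<lambda>n. fst (xs n)) f (pick B)" if "f \<in> B" for f
    using conv uB that unfolding conv_Inr[OF c] eqv_def by blast
  have ba: "lt (\<lambda>n. fst (xs n)) (pick B) (pick A)" using conv unfolding conv_Inr[OF c] lt_def by blast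
  note nzA = Sn_nz[OF xs sub(3)] and nzB = Sn_nz[OF xs sub(4)]
  show "eqv (\<lambda>n. fst (xs n)) f f'" if "f \<in> A" "f' \<in> A"
    using eqv_trans[of "\<lambda>n. fst (xs n)", OF nzA a[OF that(1)] eqv_sym[OF a[OF that(2)]]] .
  show "lt (\<lambda>n. fst (xs n)) f f'" if "f \<in> B" "f' \<in> A"
    using lt_eqv_trans[of "\<lambda>n. fst (xs n)", OF nzA eqv_lt_trans[of "\<lambda>n. fst (xs n)", OF nzB b[OF that(1)] ba] eqv_sym[OF a[OF that(2)]]] .
qed

text \<open>At a bounded limit \<open>u\<close> is nonzero off \<open>e\<close>, so no ratio of its
  coordinates there can tend to 0.\<close>

lemma conv_bounded_not_Inr:
  assumes c: "chart3 E e U W l A B (pick A) (pick B) uA wA uB wB" and p: "(u, w) \<in> sol0 g0"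
    and conv: "conv xs (Inr ((A, B), ((uA, wA), (uB, wB))))" "conv xs (Inl (u, w))"
  shows False
proof -
  interpret c: chart3 E e U W l A B "pick A" "pick B" uA wA uB wB by fact
  have sub: "pick A \<in> E - {e}" "pick B \<in> E - {e}" using c.AB_sub c.gA c.hB by auto
  have nz: "u (pick A) \<noteq> 0" "u (pick B) \<noteq> 0" using p sub l0[OF sub(1)] l0[OF sub(2)] by (auto simp: sol_def)
  have "(\<lambda>n. fst (xs n) (pick B) / fst (xs n) (pick A)) \<longlonglongrightarrow> u (pick B) / u (pick A)"
    using conv(2) sub nz unfolding conv_def conv0_def by (intro tendsto_divide) auto
  then have "u (pick B) / u (pick A) = 0" using conv(1) LIMSEQ_unique unfolding conv_Inr[OF c] by blast
  then show False using nz by simp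
qed

text \<open>Two limits at infinity of one sequence have the same partition, since both describe its
  growth; the remaining data are then limits of the same sequences.\<close>

lemma conv_unique:
  assumes xs: "\<And>n. xs n \<in> Sn (r n)" and t: "\<tau> \<in> lims g0" "\<tau>' \<in> lims g0" and conv: "conv xs \<tau>" "conv xs \<tau>'"
  shows "\<tau> = \<tau>'"
  using t(1)
proof (cases rule: limsE)
  case (1 u w)
  show ?thesis
    using t(2)
  proof (cases rule: limsE)
    case (1 u' w')
    have "u f = u' f \<and> w f = w' f" if "f \<in> E" for f
      using conv that LIMSEQ_unique unfolding \<open>\<tau> = Inl (u, w)\<close> \<open>\<tau>' = Inl (u', w')\<close> conv_def conv0_def
      by (simp, blast)
    moreover have "u \<in> cvec E" "u' \<in> cvec E" "w \<in> cvec E" "w' \<in> cvec E"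
      using \<open>(u, w) \<in> sol0 g0\<close> \<open>(u', w') \<in> sol0 g0\<close> U W by (auto simp: sol_def)
    ultimately have "u = u'" "w = w'" using cvec_eqI by blast+
    then show ?thesis using 1 \<open>\<tau> = Inl (u, w)\<close> by simp
  next
    case (2 A B uA wA uB wB)
    then show ?thesis using conv_bounded_not_Inr conv 1 by blast
  qed
next
  case (2 A B uA wA uB wB)
  show ?thesis
    using t(2)
  proof (cases rule: limsE)
    case (1 u w)
    then show ?thesis using conv_bounded_not_Inr conv 2 by blast
  next
    case (2 A' B' uA' wA' uB' wB')
    note t = \<open>\<tau> = Inr ((A, B), ((uA, wA), (uB, wB)))\<close> \<open>\<tau>' = Inr ((A', B'), ((uA', wA'), (uB', wB')))\<close>
    note c = \<open>chart3 E e U W l A B (pick A) (pick B) uA wA uB wB\<close>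
      and c' = \<open>chart3 E e U W l A' B' (pick A') (pick B') uA' wA' uB' wB'\<close>
    interpret c: chart3 E e U W l A B "pick A" "pick B" uA wA uB wB by fact
    interpret c': chart3 E e U W l A' B' "pick A'" "pick B'" uA' wA' uB' wB' by fact
    note lev = conv_levels[OF c xs conv(1)[unfolded t(1)]]
    note lev' = conv_levels[OF c' xs conv(2)[unfolded t(2)]]
    have nz: "fst (xs n) f \<noteq> 0" if "f \<in> E - {e}" for f n using Sn_nz[OF xs that] .
    \<comment> \<open>An \<open>f\<close> in \<open>A\<close> and \<open>B'\<close> is dominated by
      \<open>pick A'\<close>. If \<open>pick A'\<close> lies in \<open>A\<close>, it grows like
      \<open>f\<close>; if it lies in \<open>B\<close>, it is dominated by \<open>f\<close>. Both
      are contradictory.\<close>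
    have no: False if "f \<in> A" "f \<in> B'" for f
    proof (cases "pick A' \<in> A")
      case True
      then show False using lev(1)[OF that(1) True] not_lt_eqv[OF lev'(2)[OF that(2) c'.gA]] by blast
    next
      case False
      then have "pick A' \<in> B" using c'.gA c'.AB c.AB by auto
      from lev(2)[OF this that(1)] lev'(2)[OF that(2) c'.gA] show False
        using lt_asym[of "\<lambda>n. fst (xs n)"] nz that c'.gA c.AB_sub c'.AB_sub by (metis subsetD)
    qed
    have no': False if "f \<in> A'" "f \<in> B" for f
    proof (cases "pick A \<in> A'")
      case True
      then show False using lev'(1)[OF that(1) True] not_lt_eqv[OF lev(2)[OF that(2) c.gA]] by blast
    next
      case False
      then have "pick A \<in> B'" using c.gA c'.AB c.AB by auto
      from lev'(2)[OF this that(1)] lev(2)[OF that(2) c.gA] show False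
        using lt_asym[of "\<lambda>n. fst (xs n)"] nz that c.gA c.AB_sub c'.AB_sub by (metis subsetD)
    qed
    have eq: "A = A'" "B = B'" using no no' c.AB c'.AB by blast+
    note v = conv(1)[unfolded t(1) conv_Inr[OF c], unfolded eq, THEN conjunct2]
      and v' = conv(2)[unfolded t(2) conv_Inr[OF c'], THEN conjunct2]
    note vA = bspec[OF conjunct1[OF v]] bspec[OF conjunct1[OF v']]
      and vB = bspec[OF conjunct2[OF v]] bspec[OF conjunct2[OF v']]
    have "uA f = uA' f \<and> wA f = wA' f" if "f \<in> A" for f
    proof -
      have "f \<in> A'" using that eq by simp
      note a = vA[OF this]
      show ?thesis
        using LIMSEQ_unique[OF conjunct1[OF a(1)] conjunct1[OF a(2)]] LIMSEQ_unique[OF conjunct2[OF a(1)] conjunct2[OF a(2)]] ..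
    qed
    moreover have "uB f = uB' f \<and> wB f = wB' f" if "f \<in> B" for f
    proof -
      have "f \<in> B'" using that eq by simp
      note b = vB[OF this]
      show ?thesis
        using LIMSEQ_unique[OF conjunct1[OF b(1)] conjunct1[OF b(2)]] LIMSEQ_unique[OF conjunct2[OF b(1)] conjunct2[OF b(2)]] ..
    qed
    moreover have "uA \<in> cvec A" "wA \<in> cvec A" "uB \<in> cvec B" "wB \<in> cvec B"
      "uA' \<in> cvec A" "wA' \<in> cvec A" "uB' \<in> cvec B" "wB' \<in> cvec B"
      using c.pA c.pB c'.pA c'.pB minr_cvec eq unfolding sol_def by blast+
    ultimately have "uA = uA'" "wA = wA'" "uB = uB'" "wB = wB'" by (metis cvec_eqI)+
    then show ?thesis using t eq by simp
  qed
qed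

lemma conv_subseq:
  assumes "\<tau> \<in> lims g0" "conv xs \<tau>" "strict_mono (r :: nat \<Rightarrow> nat)"
  shows "conv (\<lambda>n. xs (r n)) \<tau>"
proof -
  have sub: "(\<lambda>n. a (r n)) \<longlonglongrightarrow> c" if "a \<longlonglongrightarrow> c" for a and c :: complex
    using LIMSEQ_subseq_LIMSEQ[OF that assms(3)] by (simp add: o_def)
  show ?thesis
    using assms(1)
  proof (cases rule: limsE)
    case (1 u w)
    then show ?thesis using assms(2) unfolding conv_def conv0_def by (auto intro: sub)
  next
    case (2 A B uA wA uB wB)
    have "conv xs (Inr ((A, B), ((uA, wA), (uB, wB))))" using assms(2) 2(1) by simp
    then show ?thesis unfolding 2(1) conv_Inr[OF 2(5)]
      by (elim conjE) (intro conjI ballI; (rule sub)?; blast)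
  qed
qed

text \<open>Along a subsequence the solutions form a \<open>degeneration\<close>. Its
  \<open>dichotomy\<close> gives a bounded limit or two levels, and in the latter case
  \<open>level_solution\<close> on each group supplies the pair of limit solutions.\<close>

lemma conv_exists:
  assumes r: "strict_mono (r :: nat \<Rightarrow> nat)" and xs: "\<And>n. xs n \<in> Sn (r n)"
  shows "\<exists>r' \<tau>. strict_mono (r' :: nat \<Rightarrow> nat) \<and> \<tau> \<in> lims g0 \<and> conv (\<lambda>n. xs (r' n)) \<tau>"
proof -
  obtain r' where r': "strict_mono (r' :: nat \<Rightarrow> nat)" "\<forall>f\<in>E. \<forall>g\<in>E.
    (lt (\<lambda>n. fst (xs (r' n))) f g \<or> eqv (\<lambda>n. fst (xs (r' n))) f g \<or> lt (\<lambda>n. fst (xs (r' n))) g f) \<and>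
    (lt (\<lambda>n. snd (xs (r' n))) f g \<or> eqv (\<lambda>n. snd (xs (r' n))) f g \<or> lt (\<lambda>n. snd (xs (r' n))) g f)"
    using ratio_trichotomy_subseq[OF finE, of "\<lambda>n. fst (xs n)" "\<lambda>n. snd (xs n)"] by blast
  define us ws ts' where "us n = fst (xs (r' n))" and "ws n = snd (xs (r' n))" and "ts' n = ts (r (r' n))" for n
  have mem: "us n \<in> U" "ws n \<in> W" "us n g0 = 1" "\<And>f. f \<in> E \<Longrightarrow> us n f * ws n f = (l(e := ts' n)) f" for n
    using xs[of "r' n"] unfolding us_def ws_def ts'_def by (auto simp: sol_def)
  have ts': "ts' \<longlonglongrightarrow> 0"
    using LIMSEQ_subseq_LIMSEQ[OF ts(1) strict_mono_o[OF r r'(1)]] by (simp add: o_def ts'_def[abs_def])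
  have deg: "degeneration E e U W l us ws ts'"
  proof
    show "us n f * ws n f = l f" if "f \<in> E - {e}" for n f using mem(4)[of f n] that by simp
    show "us n e * ws n e = ts' n" for n using mem(4)[of e n] eE by simp
    show "lt us f g \<or> eqv us f g \<or> lt us g f" "lt ws f g \<or> eqv ws f g \<or> lt ws g f" if "f \<in> E" "g \<in> E" for f g
      using r'(2) that unfolding us_def[abs_def] ws_def[abs_def] by blast+
  qed (use finE eE E' U W rkUW nlU nlW l0 nosol mem ts' ts in \<open>auto simp: ts'_def\<close>)
  then interpret d: degeneration E e U W l us ws ts' .
  from d.dichotomy[OF g0] show ?thesis
  proof (elim disjE)
    assume "\<exists>u\<in>U. \<exists>w\<in>W. \<forall>f\<in>E. (\<lambda>n. us n f / us n g0) \<longlonglongrightarrow> u f \<and> (\<lambda>n. us n g0 * ws n f) \<longlonglongrightarrow> w f"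
    then obtain u w where uw: "u \<in> U" "w \<in> W" "\<And>f. f \<in> E \<Longrightarrow> (\<lambda>n. us n f) \<longlonglongrightarrow> u f" "\<And>f. f \<in> E \<Longrightarrow> (\<lambda>n. ws n f) \<longlonglongrightarrow> w f"
      by (auto simp: mem)
    have "u f * w f = (l(e := 0)) f" if f: "f \<in> E" for f
    proof -
      have "(\<lambda>n. us n f * ws n f) \<longlonglongrightarrow> u f * w f" by (intro tendsto_mult uw f)
      moreover have "(\<lambda>n. us n f * ws n f) \<longlonglongrightarrow> (l(e := 0)) f" using mem(4)[OF f] ts' by (cases "f = e") auto
      ultimately show ?thesis by (rule LIMSEQ_unique)
    qed
    moreover have "u g0 = 1" using uw(3)[of g0] g0 mem(3) by (simp add: LIMSEQ_const_iff)
    ultimately have "(u, w) \<in> sol0 g0" using uw by (simp add: sol_def)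
    then have "Inl (u, w) \<in> lims g0" by (simp add: lims_def)
    moreover have "conv (\<lambda>n. xs (r' n)) (Inl (u, w))"
      using uw unfolding conv_def conv0_def us_def ws_def by simp
    ultimately show ?thesis using r'(1) by blast
  next
    assume "\<exists>A B g h. two_levels E e U W l us ws ts' A B g h"
    then obtain A B g h where "two_levels E e U W l us ws ts' A B g h" by blast
    then interpret t: two_levels E e U W l us ws ts' A B g h .
    have sub: "A \<subseteq> E - {e}" "B \<subseteq> E - {e}" "A \<subseteq> E" "B \<subseteq> E" using t.AB by auto
    have AB: "(A, B) \<in> pairs"
      using t.AB t.gA t.hB t.rA t.rB by (auto simp: pairs_def t.contract_eq)
    have pk: "pick A \<in> A" "pick B \<in> B" using pick t.gA t.hB by blast+
    have nz: "g \<in> E" "h \<in> E" using t.gA t.hB sub by auto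
    have eA: "eqv us f (pick A)" if "f \<in> A" for f
      using eqv_trans[of us g, OF d.usn0[OF nz(1)] t.lA[OF that] eqv_sym[OF t.lA[OF pk(1)]]] .
    have eB: "eqv us f (pick B)" if "f \<in> B" for f
      using eqv_trans[of us h, OF d.usn0[OF nz(2)] t.lB[OF that] eqv_sym[OF t.lB[OF pk(2)]]] .
    have BA: "lt us f f'" if "f \<in> B" "f' \<in> A" for f f'
      using lt_eqv_trans[of us g, OF d.usn0[OF nz(1)] eqv_lt_trans[of us h, OF d.usn0[OF nz(2)] t.lB[OF that(1)] t.hg]
          eqv_sym[OF t.lA[OF that(2)]]] .
    have wAB: "lt ws f f'" if "f \<in> A" "f' \<in> B" for f f'
      using d.lt_w[of f' f] BA[OF that(2,1)] sub that by blast
    have "\<exists>(u, w)\<in>sol A (minr U B A) (minr W {} A) (pick A) l.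
      \<forall>f\<in>A. (\<lambda>n. us n f / us n (pick A)) \<longlonglongrightarrow> u f \<and> (\<lambda>n. ws n f * us n (pick A)) \<longlonglongrightarrow> w f"
      by (rule d.level_solution[OF sub(1) pk(1) eA sub(4)]) (use BA pk in auto)
    then obtain uA wA where A: "(uA, wA) \<in> solA A B"
      "\<forall>f\<in>A. (\<lambda>n. us n f / us n (pick A)) \<longlonglongrightarrow> uA f \<and> (\<lambda>n. ws n f * us n (pick A)) \<longlonglongrightarrow> wA f"
      unfolding t.contract_eq by blast
    have "\<exists>(u, w)\<in>sol B (minr U {} B) (minr W A B) (pick B) l.
      \<forall>f\<in>B. (\<lambda>n. us n f / us n (pick B)) \<longlonglongrightarrow> u f \<and> (\<lambda>n. ws n f * us n (pick B)) \<longlonglongrightarrow> w f"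
      by (rule d.level_solution[OF sub(2) pk(2) eB empty_subsetI]) (use wAB pk sub in auto)
    then obtain uB wB where B: "(uB, wB) \<in> solB A B"
      "\<forall>f\<in>B. (\<lambda>n. us n f / us n (pick B)) \<longlonglongrightarrow> uB f \<and> (\<lambda>n. ws n f * us n (pick B)) \<longlonglongrightarrow> wB f"
      unfolding t.contract_eq by blast
    have "Inr ((A, B), ((uA, wA), (uB, wB))) \<in> lims g0" using AB A(1) B(1) by (auto simp: lims_def)
    moreover have "conv (\<lambda>n. xs (r' n)) (Inr ((A, B), ((uA, wA), (uB, wB))))"
      unfolding conv_Inr[OF chart3I[OF AB A(1) B(1)]]
      using A(2) B(2) BA[OF pk(2,1)] unfolding us_def[abs_def] ws_def[abs_def] lt_def by blast
    ultimately show ?thesis using r'(1) by blast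
  qed
qed

lemma eventually_card_Sn: "\<forall>\<^sub>F n in sequentially. finite (Sn n) \<and> card (Sn n) = card (lims g0)"
proof (rule count_limits[where conv = conv])
  show "finite (lims g0)" by (rule card_lims(1)[OF g0])
  show "\<tau> = \<tau>'" if "strict_mono r" "\<And>n. x n \<in> Sn (r n)" "\<tau> \<in> lims g0" "\<tau>' \<in> lims g0" "conv x \<tau>" "conv x \<tau>'"
    for x \<tau> \<tau>' and r :: "nat \<Rightarrow> nat" by (rule conv_unique[OF that(2-)])
  show "conv (\<lambda>n. x (r n)) \<tau>" if "\<tau> \<in> lims g0" "conv x \<tau>" "strict_mono r" for x \<tau> and r :: "nat \<Rightarrow> nat"
    by (rule conv_subseq[OF that])
  show "\<exists>r' \<tau>. strict_mono (r' :: nat \<Rightarrow> nat) \<and> \<tau> \<in> lims g0 \<and> conv (\<lambda>n. x (r' n)) \<tau>"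
    if "strict_mono r" "\<And>n. x n \<in> Sn (r n)" for x and r :: "nat \<Rightarrow> nat" by (rule conv_exists[OF that])
  show "\<exists>\<beta>. (\<forall>\<^sub>F n in sequentially. \<beta> n \<in> Sn n) \<and> conv \<beta> \<tau>" if "\<tau> \<in> lims g0" for \<tau>
    using that
  proof (cases rule: limsE)
    case (1 u w)
    then show ?thesis using chart0(1)[OF 1(2) g0 ts(1)] by (simp add: conv_def)
  next
    case (2 A B uA wA uB wB)
    interpret c: chart3 E e U W l A B "pick A" "pick B" uA wA uB wB by fact
    show ?thesis using c.branch(1)[OF g0 ts(2,1)] 2(1) by (simp add: conv_def)
  qed
  show "\<forall>\<^sub>F n in sequentially. x n = y n" if r: "strict_mono r" and t: "\<tau> \<in> lims g0" and c: "conv x \<tau>" "conv y \<tau>"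
      and m: "\<And>n. x n \<in> Sn (r n)" "\<And>n. y n \<in> Sn (r n)" for x y \<tau> and r :: "nat \<Rightarrow> nat"
    using t
  proof (cases rule: limsE)
    case (1 u w)
    have "(\<lambda>n. ts (r n)) \<longlonglongrightarrow> 0" using LIMSEQ_subseq_LIMSEQ[OF ts(1) r] by (simp add: o_def)
    from chart0(2)[OF 1(2) g0 this m] show ?thesis using c 1(1) by (simp add: conv_def)
  next
    case (2 A B uA wA uB wB)
    interpret c: chart3 E e U W l A B "pick A" "pick B" uA wA uB wB by fact
    show ?thesis using c.branch(2)[OF g0 ts(2) m] c 2(1) by (simp add: conv_def)
  qed
qed

end

end

text \<open>Along \<open>t n\<close> the number of solutions is eventually both the generic count
  for \<open>U\<close> and \<open>W\<close>, since only finitely many values at \<open>e\<close> are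
  exceptional, and the number of limits.\<close>

theorem pcnt_recursion:
  assumes finE: "finite E" and eE: "e \<in> E" and E': "E - {e} \<noteq> {}"
    and U: "subsp U" "U \<subseteq> cvec E" and W: "subsp W" "W \<subseteq> cvec E"
    and rkUW: "rk U + rk W = card E + 1"
    and nlU: "\<exists>u\<in>U. u e \<noteq> 0" and nlW: "\<exists>w\<in>W. w e \<noteq> 0"
  shows "pcnt E U W =
    pcnt (E - {e}) (minr U {e} (E - {e})) (minr W {} (E - {e})) +
    pcnt (E - {e}) (minr U {} (E - {e})) (minr W {e} (E - {e})) +
    (\<Sum>(A, B)\<in>{(A, B). A \<union> B = E - {e} \<and> A \<inter> B = {} \<and> A \<noteq> {} \<and> B \<noteq> {} \<and>
       rk (minr U (insert e B) A) + rk (minr W {} A) = card A + 1 \<and>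
       rk (minr U {} B) + rk (minr W (insert e A) B) = card B + 1}.
      pcnt A (minr U (insert e B) A) (minr W {} A) * pcnt B (minr U {} B) (minr W (insert e A) B))"
proof -
  define good' where "good' Y Z X = good Y (minr U Z Y) (minr W X Y) (pcnt Y (minr U Z Y) (minr W X Y))" for Y Z X
  \<comment> \<open>All pairs of minors that may occur, a finite set. Those of deficient rank are
    included: their count is 0, which is what excludes solutions in \<open>nosol\<close>.\<close>
  define I where "I = {(Y, Z, X) \<in> Pow (E - {e}) \<times> Pow E \<times> Pow E. Y \<noteq> {} \<and> rk (minr U Z Y) + rk (minr W X Y) \<le> card Y + 1}"
  have "finite I" by (rule finite_subset[of _ "Pow (E - {e}) \<times> Pow E \<times> Pow E"]) (use finE in \<open>auto simp: I_def\<close>)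
  have "gen (E - {e}) (\<lambda>l. \<forall>i\<in>I. (case i of (Y, Z, X) \<Rightarrow> good' Y Z X) l)"
  proof (rule gen_ball[OF \<open>finite I\<close>])
    fix i assume "i \<in> I"
    then obtain Y Z X where i: "i = (Y, Z, X)" "Y \<subseteq> E - {e}" "Y \<noteq> {}" "rk (minr U Z Y) + rk (minr W X Y) \<le> card Y + 1"
      by (auto simp: I_def)
    have "finite Y" using i(2) finE finite_subset by blast
    from gen_pcnt(1)[OF this i(3) subsp_minr[OF U(1)] minr_cvec subsp_minr[OF W(1)] minr_cvec i(4)]
    have "gen Y (good' Y Z X)" by (simp add: good'_def)
    then have "gen (E - {e}) (good' Y Z X)" by (rule gen_superset[OF _ i(2)])
    then show "gen (E - {e}) ((case i of (Y, Z, X) \<Rightarrow> good' Y Z X))" by (simp add: i)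
  qed
  moreover have "gen (E - {e}) (\<lambda>l. \<forall>f\<in>E-{e}. l f \<noteq> 0)" using finE by (intro gen_nonzero) simp
  moreover have "gen (E - {e}) (\<lambda>l. finite {t. \<not> good E U W (pcnt E U W) (l(e := t))})"
    by (intro gen_remove gen_pcnt(1) finE U W) (use eE rkUW in auto)
  ultimately obtain l where l: "\<forall>i\<in>I. (case i of (Y, Z, X) \<Rightarrow> good' Y Z X) l" "\<forall>f\<in>E-{e}. l f \<noteq> 0"
    and bad: "finite {t. \<not> good E U W (pcnt E U W) (l(e := t))}"
    using gen_ex[OF gen_conj[OF gen_conj]] by blast
  interpret generic_pair E e U W l
  proof
    show "good Y (minr U Z Y) (minr W X Y) (pcnt Y (minr U Z Y) (minr W X Y)) l"
      if "Y \<subseteq> E - {e}" "Y \<noteq> {}" "Z \<subseteq> E" "X \<subseteq> E" "rk (minr U Z Y) + rk (minr W X Y) \<le> card Y + 1" for Y Z X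
      using l(1) that by (force simp: I_def good'_def)
  qed (use assms l in auto)
  \<comment> \<open>A null sequence avoids every nonzero exceptional value eventually, and it avoids
    0 because no \<open>t n\<close> is 0.\<close>
  define t where "t n = inverse (complex_of_real (real (Suc n)))" for n
  have t0: "t n \<noteq> 0" for n by (simp add: t_def del: of_nat_Suc)
  have "(\<lambda>n. complex_of_real (inverse (real (Suc n)))) \<longlonglongrightarrow> complex_of_real 0"
    by (intro tendsto_of_real LIMSEQ_inverse_real_of_nat)
  then have tlim: "t \<longlonglongrightarrow> 0" by (simp add: t_def[abs_def] del: of_nat_Suc)
  have "\<forall>\<^sub>F n in sequentially. \<forall>b\<in>{t. \<not> good E U W (pcnt E U W) (l(e := t))}. t n \<noteq> b"
  proof (intro eventually_ball_finite[OF bad] ballI)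
    show "\<forall>\<^sub>F n in sequentially. t n \<noteq> b" for b
    proof (cases "b = 0")
      case False
      then show ?thesis using tendsto_imp_eventually_ne[OF tlim, of b] by simp
    qed (simp add: t0)
  qed
  note ev = this
  obtain g0 where g0: "g0 \<in> E - {e}" using E' by blast
  from ev have "\<forall>\<^sub>F n in sequentially. pcnt E U W = card (lims g0)"
    using eventually_card_Sn[OF tlim t0 g0]
  proof eventually_elim
    case (elim n)
    then have "good E U W (pcnt E U W) (l(e := t n))" by blast
    then have "card (sol E U W g0 (l(e := t n))) = pcnt E U W" using g0 by (auto simp: good_def)
    then show ?case using elim by simp
  qed
  then have "pcnt E U W = card (lims g0)" by simp
  then show ?thesis unfolding card_lims(2)[OF g0] card_sol0(2)[OF g0] pairs_def by simp
qed

section \<open>Cut spaces of multigraphs\<close>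

text \<open>A self-loop gets \<open>p e = q e\<close>, so coboundaries vanish on it, in agreement
  with \<open>edge_diff\<close>.\<close>

definition orient :: "('v, 'e) mgraph \<Rightarrow> ('e \<Rightarrow> 'v) \<Rightarrow> ('e \<Rightarrow> 'v) \<Rightarrow> bool" where
  "orient G p q \<longleftrightarrow> (\<forall>e\<in>edges G. ends G e = {p e, q e})"

text \<open>The coboundary of the potential \<open>x\<close>.\<close>

definition tens :: "'e set \<Rightarrow> ('e \<Rightarrow> 'v) \<Rightarrow> ('e \<Rightarrow> 'v) \<Rightarrow> ('v \<Rightarrow> complex) \<Rightarrow> 'e \<Rightarrow> complex" where
  "tens E p q x = (\<lambda>e. if e \<in> E then x (p e) - x (q e) else 0)"

definition cutsp :: "'e set \<Rightarrow> ('e \<Rightarrow> 'v) \<Rightarrow> ('e \<Rightarrow> 'v) \<Rightarrow> ('e \<Rightarrow> complex) set" where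
  "cutsp E p q = range (tens E p q)"

lemma lin_tens: "lin (tens E p q)"
  by (auto simp: lin_def tens_def algebra_simps)

lemma subsp_cutsp: "subsp (cutsp E p q)"
proof -
  have "(\<lambda>_. 0) = tens E p q (\<lambda>_. 0)" by (simp add: lin_zero[OF lin_tens])
  moreover have "(\<lambda>a. tens E p q x a + tens E p q y a) = tens E p q (\<lambda>a. x a + y a)" for x y
    using lin_tens[of E p q] by (simp add: lin_def)
  moreover have "(\<lambda>a. c * tens E p q x a) = tens E p q (\<lambda>a. c * x a)" for c x
    using lin_tens[of E p q] by (simp add: lin_def)
  ultimately show ?thesis unfolding subsp_def cutsp_def by auto
qed

lemma cutsp_cvec: "cutsp E p q \<subseteq> cvec E"
  by (auto simp: cutsp_def tens_def cvec_def)

lemma orient_exists: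
  assumes "wf_mgraph G" "strict_linear_order_on (verts G) r"
  shows "\<exists>p q. orient G p q \<and> (\<forall>e\<in>edges G. \<forall>x. edge_diff G r x e = x (p e) - x (q e))"
proof -
  have tr: "trans r" "irrefl r" "total_on (verts G) r" using assms(2) by (auto simp: strict_linear_order_on_def)
  have "\<exists>pq. ends G e = {fst pq, snd pq} \<and> (\<forall>x. edge_diff G r x e = x (fst pq) - x (snd pq))" if e: "e \<in> edges G" for e
  proof -
    have c: "ends G e \<subseteq> verts G" "card (ends G e) \<in> {1, 2}" using assms(1) e by (auto simp: wf_mgraph_def)
    show ?thesis
    proof (cases "card (ends G e) = 1")
      case True
      then obtain a where "ends G e = {a}" by (auto simp: card_1_singleton_iff)
      then show ?thesis using True by (intro exI[of _ "(a, a)"]) (simp add: edge_diff_def self_loop_def)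
    next
      case False
      then have "card (ends G e) = 2" using c by auto
      then obtain a b where ab: "ends G e = {a, b}" "a \<noteq> b" by (auto simp: card_2_iff)
      then have "(a, b) \<in> r \<or> (b, a) \<in> r" using tr(3) c(1) by (auto simp: total_on_def)
      then obtain u v where uv: "ends G e = {u, v}" "u \<noteq> v" "(u, v) \<in> r" using ab by (metis insert_commute)
      have "(v, u) \<notin> r" using uv(3) tr(1,2) by (meson irrefl_def transE)
      then have "(THE (u, v). ends G e = {u, v} \<and> (u, v) \<in> r) = (u, v)"
        using uv by (intro the_equality) (auto simp: doubleton_eq_iff)
      then show ?thesis using False uv by (intro exI[of _ "(u, v)"]) (simp add: edge_diff_def self_loop_def)
    qed
  qed
  then have "\<forall>e\<in>edges G. \<exists>pq. ends G e = {fst pq, snd pq} \<and> (\<forall>x. edge_diff G r x e = x (fst pq) - x (snd pq))" by blast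
  from bchoice[OF this] obtain pq where "\<forall>e\<in>edges G. ends G e = {fst (pq e), snd (pq e)} \<and>
    (\<forall>x. edge_diff G r x e = x (fst (pq e)) - x (snd (pq e)))" by blast
  then show ?thesis unfolding orient_def by (intro exI[of _ "\<lambda>e. fst (pq e)"] exI[of _ "\<lambda>e. snd (pq e)"]) auto
qed

lemma path_rel_equiv: "equiv (verts G) (path_rel G F)"
proof (rule equivI)
  let ?R = "{(u, v). \<exists>e\<in>F. ends G e = {u, v}}"
  have "sym ?R" by (auto simp: sym_def insert_commute)
  then have "sym (?R\<^sup>*)" by (rule sym_rtrancl)
  then show "sym (path_rel G F)" unfolding path_rel_def by (auto simp: sym_def)
  show "trans (path_rel G F)" unfolding path_rel_def by (auto simp: trans_def)
  show "refl_on (verts G) (path_rel G F)" unfolding path_rel_def by (auto simp: refl_on_def)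
qed (auto simp: path_rel_def)

lemma path_rel_pq:
  assumes "wf_mgraph G" "orient G p q" "F \<subseteq> edges G" "e \<in> F"
  shows "(p e, q e) \<in> path_rel G F"
proof -
  have "ends G e = {p e, q e}" "p e \<in> verts G" "q e \<in> verts G"
    using assms by (auto simp: orient_def wf_mgraph_def)
  then show ?thesis using assms(4) by (auto simp: path_rel_def intro!: r_into_rtrancl)
qed

lemma path_rel_constant_iff:
  assumes "wf_mgraph G" "orient G p q" "F \<subseteq> edges G"
  shows "(\<forall>e\<in>F. x (p e) = x (q e)) \<longleftrightarrow> (\<forall>(u, v)\<in>path_rel G F. x u = x v)"
proof
  assume eq: "\<forall>e\<in>F. x (p e) = x (q e)"
  have "x u = x v" if "(u, v) \<in> {(u, v). \<exists>e\<in>F. ends G e = {u, v}}\<^sup>*" for u v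
    using that
  proof (induction rule: rtrancl_induct)
    case (step v w)
    then obtain e where e: "e \<in> F" "ends G e = {v, w}" by auto
    then have "{p e, q e} = {v, w}" using assms by (auto simp: orient_def)
    then have "x v = x w" using eq e(1) by (auto simp: doubleton_eq_iff)
    then show ?case using step by simp
  qed simp
  then show "\<forall>(u, v)\<in>path_rel G F. x u = x v" by (auto simp: path_rel_def)
next
  assume "\<forall>(u, v)\<in>path_rel G F. x u = x v"
  then show "\<forall>e\<in>F. x (p e) = x (q e)" using path_rel_pq[OF assms] by blast
qed

lemma is_basis_cvec: "finite A \<Longrightarrow> is_basis (cvec A) A"
proof -
  have "\<exists>u\<in>cvec A. \<forall>i\<in>A. u i = x i" for x by (rule bexI[of _ "rst A x"]) (auto simp: rst_in_cvec)
  then show "finite A \<Longrightarrow> is_basis (cvec A) A" unfolding is_basis_def by (auto simp: cvec_def fun_eq_iff)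
qed

text \<open>A cut vector has a unique potential vanishing at one chosen vertex of each component.\<close>

lemma rk_cutsp:
  assumes wf: "wf_mgraph G" and o: "orient G p q"
  shows "rk (cutsp (edges G) p q) = gdim G"
proof -
  let ?V = "verts G" and ?E = "edges G" and ?P = "path_rel G (edges G)"
  note eqv = path_rel_equiv[of G "edges G"]
  have finV: "finite ?V" and finE: "finite ?E" using wf by (auto simp: wf_mgraph_def)
  have pqV: "p e \<in> ?V" "q e \<in> ?V" if "e \<in> ?E" for e using wf o that by (auto simp: wf_mgraph_def orient_def)
  define rep where "rep C = (SOME v. v \<in> C)" for C :: "'a set"
  have rep: "rep C \<in> C" if "C \<in> components G" for C
    using in_quotient_imp_non_empty[OF eqv] that unfolding rep_def components_def by (meson ex_in_conv someI_ex)
  have sub: "C \<subseteq> ?V" if "C \<in> components G" for C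
    using in_quotient_imp_subset[OF eqv] that unfolding components_def by blast
  define R where "R = rep ` components G"
  have RV: "R \<subseteq> ?V" using rep sub unfolding R_def by blast
  have "inj_on rep (components G)"
  proof (rule inj_onI)
    fix C D assume C: "C \<in> components G" "D \<in> components G" and eq: "rep C = rep D"
    then have "C \<inter> D \<noteq> {}" using rep by (metis disjoint_iff)
    then show "C = D" using quotient_disj[OF eqv] C unfolding components_def by blast
  qed
  then have cR: "card R = card (components G)" unfolding R_def by (rule card_image)
  define r where "r v = rep (?P `` {v})" for v
  have cls: "?P `` {v} \<in> components G" if "v \<in> ?V" for v using that unfolding components_def by (rule quotientI)
  have r: "r v \<in> R" "(v, r v) \<in> ?P" if "v \<in> ?V" for v
    using rep[OF cls[OF that]] cls[OF that] unfolding r_def R_def by auto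
  have rR: "r v = v" if v: "v \<in> R" for v
  proof -
    obtain C where C: "C \<in> components G" "v = rep C" using v unfolding R_def by blast
    obtain w where w: "C = ?P `` {w}" using C(1) unfolding components_def by (auto elim: quotientE)
    have "(w, v) \<in> ?P" using rep[OF C(1)] C(2) w by simp
    then have "?P `` {v} = C" using equiv_class_eq[OF eqv] w by metis
    then show ?thesis unfolding r_def using C(2) by simp
  qed
  have B: "is_basis (cvec (?V - R)) (?V - R)" using finV by (intro is_basis_cvec) simp
  obtain I where I: "is_basis (cutsp ?E p q) I" using basis_existsE[OF finE subsp_cutsp cutsp_cvec] by blast
  have kernel: "x u = x v" if "tens ?E p q x = (\<lambda>_. 0)" "(u, v) \<in> ?P" for x u v
  proof -
    have "x (p e) = x (q e)" if "e \<in> ?E" for e using fun_cong[OF \<open>tens ?E p q x = (\<lambda>_. 0)\<close>, of e] that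
      by (simp add: tens_def)
    then show ?thesis using path_rel_constant_iff[OF wf o order_refl, of x] that(2) by blast
  qed
  have "card (?V - R) \<le> card I"
  proof (rule lin_inj_card_le[OF lin_tens subsp_cvec B subsp_cutsp I])
    fix x assume x: "x \<in> cvec (?V - R)" "tens ?E p q x = (\<lambda>_. 0)"
    have "x v = 0" for v
    proof (cases "v \<in> ?V")
      case True
      then have "x v = x (r v)" using kernel[OF x(2)] r by blast
      then show ?thesis using r(1)[OF True] x(1) by (auto simp: cvec_def)
    next
      case False
      then show ?thesis using x(1) by (auto simp: cvec_def)
    qed
    then show "x = (\<lambda>_. 0)" by auto
  qed (auto simp: cutsp_def)
  moreover have "card I \<le> card (?V - R)"
  proof (rule lin_surj_card_le[OF lin_tens subsp_cvec B I])
    show "cutsp ?E p q \<subseteq> tens ?E p q ` cvec (?V - R)"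
    proof
      fix u assume "u \<in> cutsp ?E p q"
      then obtain x where x: "u = tens ?E p q x" by (auto simp: cutsp_def)
      \<comment> \<open>Subtracting the value at the representative of each component leaves the
        coboundary unchanged, as both ends of an edge have the same representative.\<close>
      define y where "y v = (if v \<in> ?V then x v - x (r v) else 0)" for v
      have "y \<in> cvec (?V - R)" using rR by (auto simp: cvec_def y_def)
      moreover have "tens ?E p q y = u"
      proof
        fix e
        show "tens ?E p q y e = u e"
        proof (cases "e \<in> ?E")
          case True
          have "(p e, q e) \<in> ?P" by (rule path_rel_pq[OF wf o order_refl True])
          from equiv_class_eq[OF eqv this] have "r (p e) = r (q e)" unfolding r_def by (rule arg_cong)
          then show ?thesis using True pqV[OF True] by (simp add: tens_def x y_def)
        qed (simp add: tens_def x)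
      qed
      ultimately show "u \<in> tens ?E p q ` cvec (?V - R)" by blast
    qed
  qed
  ultimately have "rk (cutsp ?E p q) = card (?V - R)" using rk_eq_card[OF subsp_cutsp I] by simp
  also have "\<dots> = card ?V - card R" using RV finV finite_subset by (intro card_Diff_subset) auto
  finally show ?thesis unfolding cR gdim_def .
qed

abbreviation cls :: "('v, 'e) mgraph \<Rightarrow> 'e set \<Rightarrow> 'v \<Rightarrow> 'v set" where
  "cls G M v \<equiv> path_rel G M `` {v}"

lemma wf_quot_graph:
  assumes "wf_mgraph G"
  shows "wf_mgraph (quot_graph G M)"
  unfolding wf_mgraph_def
proof (intro conjI ballI)
  show "finite (verts (quot_graph G M))" "finite (edges (quot_graph G M))"
    using assms by (auto simp: quot_graph_def wf_mgraph_def quotient_def)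
  fix e assume "e \<in> edges (quot_graph G M)"
  then have e: "ends G e \<subseteq> verts G" "card (ends G e) \<in> {1, 2}"
    using assms by (auto simp: quot_graph_def wf_mgraph_def)
  show "ends (quot_graph G M) e \<subseteq> verts (quot_graph G M)"
    using e(1) by (auto simp: quot_graph_def intro: quotientI)
  have f: "finite (ends G e)" "ends G e \<noteq> {}" using e(2) by (auto intro: card_ge_0_finite)
  then have "card ((\<lambda>u. cls G M u) ` ends G e) \<le> 2" "card ((\<lambda>u. cls G M u) ` ends G e) > 0"
    using card_image_le[OF f(1), of "\<lambda>u. cls G M u"] e(2) by (auto simp: card_gt_0_iff)
  then have "card ((\<lambda>u. cls G M u) ` ends G e) = 1 \<or> card ((\<lambda>u. cls G M u) ` ends G e) = 2" by linarith
  then show "card (ends (quot_graph G M) e) \<in> {1, 2}" by (simp add: quot_graph_def)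
qed

lemma wf_del_graph:
  assumes "wf_mgraph G"
  shows "wf_mgraph (del_graph G M)"
proof -
  have "(\<Union>e\<in>edges G - M. ends G e) \<subseteq> verts G" using assms by (auto simp: wf_mgraph_def)
  moreover have "finite (verts G)" using assms by (simp add: wf_mgraph_def)
  ultimately have "finite (\<Union>e\<in>edges G - M. ends G e)" by (rule finite_subset)
  then show ?thesis using assms by (auto simp: del_graph_def wf_mgraph_def)
qed

lemma orient_quot: "orient G p q \<Longrightarrow> orient (quot_graph G M) (\<lambda>e. cls G M (p e)) (\<lambda>e. cls G M (q e))"
  by (auto simp: orient_def quot_graph_def)

lemma orient_del: "orient G p q \<Longrightarrow> orient (del_graph G M) p q"
  by (auto simp: orient_def del_graph_def)

text \<open>Potentials on the quotient are the potentials on \<open>G\<close> that are constant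
  along paths in \<open>M\<close>, that is, whose coboundary vanishes on \<open>M\<close>. Graph
  quotients thus become contractions.\<close>

lemma cutsp_quot:
  assumes wf: "wf_mgraph G" and o: "orient G p q" and M: "M \<subseteq> edges G"
  shows "cutsp (edges G - M) (\<lambda>e. cls G M (p e)) (\<lambda>e. cls G M (q e)) = minr (cutsp (edges G) p q) M (edges G - M)"
proof (intro equalityI subsetI)
  fix u assume "u \<in> cutsp (edges G - M) (\<lambda>e. cls G M (p e)) (\<lambda>e. cls G M (q e))"
  then obtain y where y: "u = tens (edges G - M) (\<lambda>e. cls G M (p e)) (\<lambda>e. cls G M (q e)) y" by (auto simp: cutsp_def)
  have c: "cls G M (p e) = cls G M (q e)" if "e \<in> M" for e
    by (rule equiv_class_eq[OF path_rel_equiv path_rel_pq[OF wf o M that]])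
  have "rst (edges G - M) (tens (edges G) p q (\<lambda>v. y (cls G M v))) \<in> minr (cutsp (edges G) p q) M (edges G - M)"
    by (intro minrI) (auto simp: cutsp_def tens_def c)
  moreover have "rst (edges G - M) (tens (edges G) p q (\<lambda>v. y (cls G M v))) = u"
    by (auto simp: y rst_def tens_def)
  ultimately show "u \<in> minr (cutsp (edges G) p q) M (edges G - M)" by simp
next
  fix u assume "u \<in> minr (cutsp (edges G) p q) M (edges G - M)"
  then obtain x where x: "u = rst (edges G - M) (tens (edges G) p q x)" "\<forall>e\<in>M. tens (edges G) p q x e = 0"
    by (auto simp: minr_def cutsp_def)
  then have "\<forall>e\<in>M. x (p e) = x (q e)" using M by (auto simp: tens_def subset_iff split: if_splits)
  then have con: "\<forall>(u, v)\<in>path_rel G M. x u = x v" using path_rel_constant_iff[OF wf o M, of x] by blast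
  define y where "y C = x (SOME v. v \<in> C)" for C
  have yx: "y (cls G M v) = x v" if "v \<in> verts G" for v
  proof -
    have "v \<in> cls G M v" using path_rel_equiv that by (rule equiv_class_self)
    then have "(SOME w. w \<in> cls G M v) \<in> cls G M v" by (rule someI)
    then show ?thesis using con unfolding y_def by auto
  qed
  have "p e \<in> verts G" "q e \<in> verts G" if "e \<in> edges G" for e using wf o that by (auto simp: wf_mgraph_def orient_def)
  then have "u = tens (edges G - M) (\<lambda>e. cls G M (p e)) (\<lambda>e. cls G M (q e)) y"
    by (auto simp: x(1) rst_def tens_def yx)
  then show "u \<in> cutsp (edges G - M) (\<lambda>e. cls G M (p e)) (\<lambda>e. cls G M (q e))" by (auto simp: cutsp_def)
qed

text \<open>Potentials are functions on the whole vertex type, so discarding vertices without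
  remaining edges does not affect the cut space.\<close>

lemma cutsp_del: "cutsp (E - M) p q = minr (cutsp E p q) {} (E - M)"
proof -
  have "tens (E - M) p q x = rst (E - M) (tens E p q x)" for x by (auto simp: rst_def tens_def)
  then show ?thesis unfolding cutsp_def minr_def by (auto simp: image_image)
qed

subsection \<open>Changing orientations\<close>

text \<open>The counting part of \<open>good\<close>; it is carried through changes of sign in order
  to compare orientations.\<close>

definition cnt :: "'e set \<Rightarrow> ('e \<Rightarrow> complex) set \<Rightarrow> ('e \<Rightarrow> complex) set \<Rightarrow> nat \<Rightarrow> ('e \<Rightarrow> complex) \<Rightarrow> bool" where
  "cnt Y U W N l \<longleftrightarrow> (\<forall>f\<in>Y. l f \<noteq> 0) \<and> (\<forall>g\<in>Y. finite (sol Y U W g l) \<and> card (sol Y U W g l) = N)"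

lemma good_cnt: "good Y U W N l \<Longrightarrow> cnt Y U W N l"
  by (auto simp: good_def cnt_def)

lemma cutsp_reorient:
  assumes "orient G p q" "orient G p' q'"
  shows "\<exists>\<epsilon>. (\<forall>e. \<epsilon> e * \<epsilon> e = 1) \<and> cutsp (edges G) p' q' = (\<lambda>u e. \<epsilon> e * u e) ` cutsp (edges G) p q"
proof -
  define \<epsilon> where "\<epsilon> e = (if p' e = p e \<and> q' e = q e then 1 else -1 :: complex)" for e
  have "tens (edges G) p' q' x = (\<lambda>e. \<epsilon> e * tens (edges G) p q x e)" for x
  proof
    fix e
    show "tens (edges G) p' q' x e = \<epsilon> e * tens (edges G) p q x e"
    proof (cases "e \<in> edges G")
      case True
      then have "{p e, q e} = {p' e, q' e}" using assms by (auto simp: orient_def)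
      then show ?thesis using True by (auto simp: tens_def \<epsilon>_def doubleton_eq_iff)
    qed (simp add: tens_def)
  qed
  then have "cutsp (edges G) p' q' = (\<lambda>u e. \<epsilon> e * u e) ` cutsp (edges G) p q"
    unfolding cutsp_def by (auto simp: image_image)
  then show ?thesis by (intro exI[of _ \<epsilon>]) (auto simp: \<epsilon>_def)
qed

text \<open>Changing signs in both spaces multiplies \<open>l\<close> by the product of the signs.
  The additional factor \<open>\<epsilon> g\<close> on both vectors restores the normalisation at
  \<open>g\<close> and cancels in the products.\<close>

lemma sol_sign:
  assumes e: "\<And>f. \<epsilon> f * \<epsilon> f = (1 :: complex)" and d: "\<And>f. \<delta> f * \<delta> f = (1 :: complex)"
    and U: "subsp U" and W: "subsp W"
  shows "bij_betw (\<lambda>(u, w). (\<lambda>f. \<epsilon> f * (\<epsilon> g * u f), \<lambda>f. \<delta> f * (\<epsilon> g * w f)))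
    (sol Y U W g (\<lambda>f. \<epsilon> f * \<delta> f * l f)) (sol Y ((\<lambda>u f. \<epsilon> f * u f) ` U) ((\<lambda>w f. \<delta> f * w f) ` W) g l)"
proof -
  have ee: "\<epsilon> f * (\<epsilon> f * c) = c" "\<delta> f * (\<delta> f * c) = c" for f c using e d by (simp_all flip: mult.assoc)
  have inv: "\<epsilon> f * (\<epsilon> g * (\<epsilon> f * (\<epsilon> g * c))) = c" "\<delta> f * (\<epsilon> g * (\<delta> f * (\<epsilon> g * c))) = c" for f c
    using ee by (metis mult.left_commute)+
  show ?thesis
  proof (rule bij_betw_byWitness[where f' = "\<lambda>(u, w). (\<lambda>f. \<epsilon> f * (\<epsilon> g * u f), \<lambda>f. \<delta> f * (\<epsilon> g * w f))"])
    show "(\<lambda>(u, w). (\<lambda>f. \<epsilon> f * (\<epsilon> g * u f), \<lambda>f. \<delta> f * (\<epsilon> g * w f))) ` sol Y U W g (\<lambda>f. \<epsilon> f * \<delta> f * l f)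
        \<subseteq> sol Y ((\<lambda>u f. \<epsilon> f * u f) ` U) ((\<lambda>w f. \<delta> f * w f) ` W) g l"
    proof safe
      fix u w assume "(u, w) \<in> sol Y U W g (\<lambda>f. \<epsilon> f * \<delta> f * l f)"
      then have uw: "u \<in> U" "w \<in> W" "u g = 1" "\<And>f. f \<in> Y \<Longrightarrow> u f * w f = \<epsilon> f * \<delta> f * l f" by (auto simp: sol_def)
      have "(\<epsilon> f * (\<epsilon> g * u f)) * (\<delta> f * (\<epsilon> g * w f)) = l f" if "f \<in> Y" for f
      proof -
        have "(\<epsilon> f * (\<epsilon> g * u f)) * (\<delta> f * (\<epsilon> g * w f)) = (\<epsilon> g * \<epsilon> g) * (\<epsilon> f * \<delta> f * (u f * w f))" by (simp add: mult_ac)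
        also have "\<dots> = (\<epsilon> f * \<epsilon> f) * (\<delta> f * \<delta> f) * l f" unfolding uw(4)[OF that] e by (simp add: mult_ac e d ee)
        finally show ?thesis by (simp add: e d)
      qed
      moreover have "(\<lambda>f. \<epsilon> f * (\<epsilon> g * u f)) \<in> (\<lambda>u f. \<epsilon> f * u f) ` U" "(\<lambda>f. \<delta> f * (\<epsilon> g * w f)) \<in> (\<lambda>w f. \<delta> f * w f) ` W"
        using subsp_scale[OF U uw(1), of "\<epsilon> g"] subsp_scale[OF W uw(2), of "\<epsilon> g"] by auto
      ultimately show "(\<lambda>f. \<epsilon> f * (\<epsilon> g * u f), \<lambda>f. \<delta> f * (\<epsilon> g * w f)) \<in> sol Y ((\<lambda>u f. \<epsilon> f * u f) ` U) ((\<lambda>w f. \<delta> f * w f) ` W) g l"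
        using uw(3) e by (simp add: sol_def)
    qed
    show "(\<lambda>(u, w). (\<lambda>f. \<epsilon> f * (\<epsilon> g * u f), \<lambda>f. \<delta> f * (\<epsilon> g * w f))) ` sol Y ((\<lambda>u f. \<epsilon> f * u f) ` U) ((\<lambda>w f. \<delta> f * w f) ` W) g l
        \<subseteq> sol Y U W g (\<lambda>f. \<epsilon> f * \<delta> f * l f)"
    proof safe
      fix u' w' assume "(u', w') \<in> sol Y ((\<lambda>u f. \<epsilon> f * u f) ` U) ((\<lambda>w f. \<delta> f * w f) ` W) g l"
      then obtain u w where uw: "u' = (\<lambda>f. \<epsilon> f * u f)" "w' = (\<lambda>f. \<delta> f * w f)" "u \<in> U" "w \<in> W" "\<epsilon> g * u g = 1"
        "\<And>f. f \<in> Y \<Longrightarrow> (\<epsilon> f * u f) * (\<delta> f * w f) = l f" by (auto simp: sol_def)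
      have "(\<epsilon> g * u f) * (\<epsilon> g * w f) = \<epsilon> f * \<delta> f * l f" if "f \<in> Y" for f
      proof -
        have "\<epsilon> f * \<delta> f * l f = (\<epsilon> f * \<epsilon> f) * (\<delta> f * \<delta> f) * (u f * w f)"
          unfolding uw(6)[OF that, symmetric] by (simp only: mult_ac)
        also have "\<dots> = (\<epsilon> g * \<epsilon> g) * (u f * w f)" by (simp add: e d)
        finally show ?thesis by (simp only: mult_ac)
      qed
      moreover have "\<epsilon> f * (\<epsilon> g * (\<epsilon> f * u f)) = \<epsilon> g * u f" "\<delta> f * (\<epsilon> g * (\<delta> f * w f)) = \<epsilon> g * w f" for f
        using ee by (metis mult.left_commute)+
      ultimately show "(\<lambda>f. \<epsilon> f * (\<epsilon> g * u' f), \<lambda>f. \<delta> f * (\<epsilon> g * w' f)) \<in> sol Y U W g (\<lambda>f. \<epsilon> f * \<delta> f * l f)"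
        unfolding uw(1,2) using uw(5) subsp_scale[OF U uw(3), of "\<epsilon> g"] subsp_scale[OF W uw(4), of "\<epsilon> g"]
        by (simp only: sol_def mem_Collect_eq case_prod_conv) blast
    qed
  qed (auto simp: inv)
qed

lemma gen_cnt_sign:
  assumes e: "\<And>f. \<epsilon> f * \<epsilon> f = (1 :: complex)" and d: "\<And>f. \<delta> f * \<delta> f = (1 :: complex)"
    and U: "subsp U" and W: "subsp W" and gen: "gen Y (cnt Y U W N)"
  shows "gen Y (cnt Y ((\<lambda>u f. \<epsilon> f * u f) ` U) ((\<lambda>w f. \<delta> f * w f) ` W) N)"
proof -
  obtain P l0 where P: "polyf Y P" "P l0 \<noteq> 0" "\<And>l. P l \<noteq> 0 \<Longrightarrow> cnt Y U W N l"
    using gen unfolding gen_def by blast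
  have ed: "(\<epsilon> f * \<delta> f) * (\<epsilon> f * \<delta> f * c) = c" for f c
  proof -
    have "(\<epsilon> f * \<delta> f) * (\<epsilon> f * \<delta> f * c) = (\<epsilon> f * \<epsilon> f) * (\<delta> f * \<delta> f) * c" by (simp only: mult_ac)
    then show ?thesis by (simp add: e d)
  qed
  have "polyf Y (\<lambda>l. P (\<lambda>f. \<epsilon> f * \<delta> f * l f))"
    by (rule polyf_compose[OF P(1)]) (intro polyf_mult polyf_const polyf_var)
  moreover have "(\<lambda>f. \<epsilon> f * \<delta> f * (\<epsilon> f * \<delta> f * l0 f)) = l0" by (rule ext) (rule ed)
  then have "P (\<lambda>f. \<epsilon> f * \<delta> f * (\<epsilon> f * \<delta> f * l0 f)) \<noteq> 0" using P(2) by (simp only:) simp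
  moreover have "cnt Y ((\<lambda>u f. \<epsilon> f * u f) ` U) ((\<lambda>w f. \<delta> f * w f) ` W) N l" if "P (\<lambda>f. \<epsilon> f * \<delta> f * l f) \<noteq> 0" for l
  proof -
    note c = P(3)[OF that]
    have "finite (sol Y ((\<lambda>u f. \<epsilon> f * u f) ` U) ((\<lambda>w f. \<delta> f * w f) ` W) g l) \<and>
        card (sol Y ((\<lambda>u f. \<epsilon> f * u f) ` U) ((\<lambda>w f. \<delta> f * w f) ` W) g l) = N" if "g \<in> Y" for g
    proof -
      note b = sol_sign[where \<epsilon> = \<epsilon> and \<delta> = \<delta> and g = g and Y = Y and l = l, OF e d U W]
      show ?thesis using c that bij_betw_finite[OF b] bij_betw_same_card[OF b] unfolding cnt_def by simp
    qed
    moreover have "\<forall>f\<in>Y. l f \<noteq> 0" using c unfolding cnt_def by auto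
    ultimately show ?thesis unfolding cnt_def by blast
  qed
  ultimately show ?thesis unfolding gen_def
    by (intro exI[of _ "\<lambda>l. P (\<lambda>f. \<epsilon> f * \<delta> f * l f)"] conjI exI[of _ "\<lambda>f. \<epsilon> f * \<delta> f * l0 f"] allI impI)
qed

text \<open>Reorienting an edge changes a sign in the cut space, so the generic count does not
  depend on the vertex orders.\<close>

lemma gen_cnt_reorient:
  assumes "orient G p q" "orient G p' q'" "orient H s t" "orient H s' t'" "edges G = Y" "edges H = Y"
    "gen Y (cnt Y (cutsp Y p q) (cutsp Y s t) N)"
  shows "gen Y (cnt Y (cutsp Y p' q') (cutsp Y s' t') N)"
proof -
  obtain \<epsilon> where e: "\<forall>e. \<epsilon> e * \<epsilon> e = 1" "cutsp Y p' q' = (\<lambda>u e. \<epsilon> e * u e) ` cutsp Y p q"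
    using cutsp_reorient[OF assms(1,2)] assms(5) by blast
  obtain \<delta> where d: "\<forall>e. \<delta> e * \<delta> e = 1" "cutsp Y s' t' = (\<lambda>u e. \<delta> e * u e) ` cutsp Y s t"
    using cutsp_reorient[OF assms(3,4)] assms(6) by blast
  show ?thesis unfolding e(2) d(2)
    by (rule gen_cnt_sign[OF _ _ subsp_cutsp subsp_cutsp assms(7)]) (use e(1) d(1) in auto)
qed

section \<open>Generic points of projective space\<close>

lemma polyf_form: "polyf A (form A d c)"
proof -
  have "polyf A (\<lambda>z. \<Sum>m | (\<forall>a. a \<notin> A \<longrightarrow> m a = 0) \<and> (\<Sum>a\<in>A. m a) = d. c m * (\<Prod>a\<in>A. z a ^ m a))"
    by (intro polyf_sum polyf_mult polyf_const polyf_prod polyf_power polyf_var)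
  then show ?thesis by (simp add: form_def[abs_def])
qed

lemma form_scale: "form A d c (\<lambda>a. s * z a) = s ^ d * form A d c z"
  unfolding form_def sum_distrib_left
proof (intro sum.cong refl)
  fix m assume "m \<in> {m. (\<forall>a. a \<notin> A \<longrightarrow> m a = 0) \<and> (\<Sum>a\<in>A. m a) = d}"
  then have "(\<Prod>a\<in>A. s ^ m a) = s ^ d" by (simp flip: power_sum)
  then show "c m * (\<Prod>a\<in>A. (s * z a) ^ m a) = s ^ d * (c m * (\<Prod>a\<in>A. z a ^ m a))"
    by (simp add: power_mult_distrib prod.distrib)
qed

text \<open>Turns a generic condition on vectors into a Zariski open condition on projective points.\<close>

lemma polyf_homogeneous_component:
  assumes A: "finite A" and P: "polyf A P" and "P z0 \<noteq> 0"
  shows "\<exists>d c. (\<exists>z. form A d c z \<noteq> 0) \<and> (\<forall>z. form A d c z \<noteq> 0 \<longrightarrow> (\<exists>s. s \<noteq> 0 \<and> P (\<lambda>a. s * z a) \<noteq> 0))"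
proof -
  obtain D b where b: "\<And>z. P z = (\<Sum>m\<in>expo A D. b m * pmono A m z)"
    using polyf_has_rep[OF A P] unfolding has_rep_def by blast
  define deg where "deg m = (\<Sum>a\<in>A. m a)" for m :: "'a \<Rightarrow> nat"
  define n where "n = card A * D"
  have degn: "deg m \<le> n" if "m \<in> expo A D" for m
  proof -
    have "deg m \<le> (\<Sum>a\<in>A. D)" unfolding deg_def using that by (intro sum_mono) auto
    then show ?thesis by (simp add: n_def)
  qed
  \<comment> \<open>Converts between extensional exponents, as in \<open>expo\<close>, and exponents
    that are 0 outside \<open>A\<close>, as in \<open>form\<close>.\<close>
  define ext where "ext m = (\<lambda>a. if a \<in> A then m a else 0)" for m :: "'a \<Rightarrow> nat"
  define c where "c m = (if \<forall>a\<in>A. m a \<le> D then b (restrict m A) else 0)" for m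
  have comp: "(\<Sum>m | m \<in> expo A D \<and> deg m = k. b m * pmono A m z) = form A k c z" for k z
  proof -
    let ?S = "{m. (\<forall>a. a \<notin> A \<longrightarrow> m a = 0) \<and> (\<Sum>a\<in>A. m a) = k}"
    have fin: "finite ?S"
    proof (rule finite_subset)
      show "?S \<subseteq> ext ` expo A k"
      proof
        fix m assume m: "m \<in> ?S"
        have "m a \<le> k" if "a \<in> A" for a using m member_le_sum[of a A m] A that by auto
        then have "restrict m A \<in> expo A k" by auto
        moreover have "ext (restrict m A) = m" using m by (auto simp: ext_def)
        ultimately show "m \<in> ext ` expo A k" by (metis imageI)
      qed
    qed (use A in simp)
    have "form A k c z = (\<Sum>m\<in>{m \<in> ?S. \<forall>a\<in>A. m a \<le> D}. c m * (\<Prod>a\<in>A. z a ^ m a))"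
      unfolding form_def by (rule sum.mono_neutral_right[OF fin]) (auto simp: c_def)
    also have "\<dots> = (\<Sum>m | m \<in> expo A D \<and> deg m = k. b m * pmono A m z)"
    proof (rule sum.reindex_bij_witness[where i = ext and j = "\<lambda>m. restrict m A"])
      fix m assume m: "m \<in> {m \<in> ?S. \<forall>a\<in>A. m a \<le> D}"
      show "ext (restrict m A) = m" using m by (auto simp: ext_def)
      show "restrict m A \<in> {m. m \<in> expo A D \<and> deg m = k}" using m by (auto simp: deg_def)
      have "pmono A (restrict m A) z = (\<Prod>a\<in>A. z a ^ m a)" unfolding pmono_def by (intro prod.cong) auto
      then show "b (restrict m A) * pmono A (restrict m A) z = c m * (\<Prod>a\<in>A. z a ^ m a)"
        using m by (simp add: c_def)
    next
      fix m assume m: "m \<in> {m. m \<in> expo A D \<and> deg m = k}"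
      show "restrict (ext m) A = m" using m by (auto simp: ext_def PiE_def extensional_def fun_eq_iff)
      show "ext m \<in> {m \<in> ?S. \<forall>a\<in>A. m a \<le> D}" using m by (auto simp: ext_def deg_def)
    qed
    finally show ?thesis by simp
  qed
  have sum: "P z = (\<Sum>k\<le>n. form A k c z)" for z
  proof -
    have "P z = (\<Sum>k\<le>n. \<Sum>m | m \<in> expo A D \<and> deg m = k. b m * pmono A m z)"
      unfolding b by (rule sum.group[symmetric]) (use A degn in auto)
    then show ?thesis by (simp add: comp)
  qed
  have "\<exists>k\<le>n. form A k c z0 \<noteq> 0"
  proof (rule ccontr)
    assume "\<not> ?thesis"
    then have "P z0 = 0" unfolding sum by (intro sum.neutral) auto
    then show False using assms(3) by simp
  qed
  then obtain k where k: "k \<le> n" "form A k c z0 \<noteq> 0" by blast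
  moreover have "\<exists>s. s \<noteq> 0 \<and> P (\<lambda>a. s * z a) \<noteq> 0" if z: "form A k c z \<noteq> 0" for z
  proof (rule ccontr)
    assume contra: "\<not> ?thesis"
    \<comment> \<open>\<open>P\<close> along the ray through \<open>z\<close>: its coefficients are
      the values at \<open>z\<close> of the homogeneous components. It is not the zero polynomial,
      so it has a nonzero value at some \<open>s \<noteq> 0\<close>.\<close>
    define p where "p = (\<Sum>j\<le>n. monom (form A j c z) j)"
    have val: "poly p s = P (\<lambda>a. s * z a)" for s
      by (simp add: p_def poly_sum poly_monom sum form_scale mult.commute)
    have "coeff p k = form A k c z" using k(1) by (simp add: p_def coeff_sum)
    then have "p \<noteq> 0" using z by auto
    then have "finite (insert 0 {s. poly p s = 0})" using poly_roots_finite by blast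
    then obtain s where "s \<notin> insert 0 {s. poly p s = 0}"
      using ex_new_if_finite[OF infinite_UNIV_char_0[where 'a = complex]] by blast
    then show False using contra val by auto
  qed
  ultimately show ?thesis by blast
qed

lemma proj_zero_iff:
  assumes "z \<in> cvec A - zero_space" "z' \<in> cvec A - zero_space"
  shows "proj_point A zero_space z = proj_point A zero_space z' \<longleftrightarrow> (\<exists>c. c \<noteq> 0 \<and> z' = (\<lambda>a. c * z a))"
    "x \<in> proj_point A zero_space z \<longleftrightarrow> (\<exists>c. c \<noteq> 0 \<and> x = (\<lambda>a. c * z a))"
proof -
  have mem: "x \<in> proj_point A zero_space y \<longleftrightarrow> (\<exists>c. c \<noteq> 0 \<and> x = (\<lambda>a. c * y a))" if "y \<in> cvec A - zero_space" for x y
  proof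
    assume "x \<in> proj_point A zero_space y"
    then obtain c where "c \<noteq> 0" "(\<lambda>a. x a - c * y a) \<in> zero_space"
      unfolding proj_point_def proj_rel_def by auto
    then show "\<exists>c. c \<noteq> 0 \<and> x = (\<lambda>a. c * y a)" by (auto simp: zero_space_def fun_eq_iff)
  next
    assume "\<exists>c. c \<noteq> 0 \<and> x = (\<lambda>a. c * y a)"
    then obtain c where c: "c \<noteq> 0" "x = (\<lambda>a. c * y a)" by blast
    then have "x \<in> cvec A - zero_space" using that by (auto simp: cvec_def zero_space_def fun_eq_iff)
    then show "x \<in> proj_point A zero_space y"
      using that c unfolding proj_point_def proj_rel_def by (auto simp: zero_space_def)
  qed
  show "x \<in> proj_point A zero_space z \<longleftrightarrow> (\<exists>c. c \<noteq> 0 \<and> x = (\<lambda>a. c * z a))" by (rule mem[OF assms(1)])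
  show "proj_point A zero_space z = proj_point A zero_space z' \<longleftrightarrow> (\<exists>c. c \<noteq> 0 \<and> z' = (\<lambda>a. c * z a))"
  proof
    assume eq: "proj_point A zero_space z = proj_point A zero_space z'"
    have "z' \<in> proj_point A zero_space z'" unfolding mem[OF assms(2)] by (intro exI[of _ 1]) simp
    then show "\<exists>c. c \<noteq> 0 \<and> z' = (\<lambda>a. c * z a)" using eq mem[OF assms(1)] by blast
  next
    assume "\<exists>c. c \<noteq> 0 \<and> z' = (\<lambda>a. c * z a)"
    then obtain c where c: "c \<noteq> 0" "z' = (\<lambda>a. c * z a)" by blast
    show "proj_point A zero_space z = proj_point A zero_space z'"
    proof (intro set_eqI iffI)
      fix x assume "x \<in> proj_point A zero_space z"
      then obtain d where "d \<noteq> 0" "x = (\<lambda>a. d * z a)" using mem[OF assms(1)] by blast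
      then show "x \<in> proj_point A zero_space z'"
        unfolding mem[OF assms(2)] using c by (intro exI[of _ "d / c"]) auto
    next
      fix x assume "x \<in> proj_point A zero_space z'"
      then obtain d where "d \<noteq> 0" "x = (\<lambda>a. d * z' a)" using mem[OF assms(2)] by blast
      then show "x \<in> proj_point A zero_space z"
        unfolding mem[OF assms(1)] using c by (intro exI[of _ "d * c"]) auto
    qed
  qed
qed

lemma proj_space_iff: "q \<in> proj_space A zero_space \<longleftrightarrow> (\<exists>z\<in>cvec A - zero_space. q = proj_point A zero_space z)"
  unfolding proj_space_def proj_point_def quotient_def by blast

abbreviation basic_open :: "'a set \<Rightarrow> nat \<Rightarrow> (('a \<Rightarrow> nat) \<Rightarrow> complex) \<Rightarrow> ('a \<Rightarrow> complex) set set" where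
  "basic_open A d c \<equiv> {p \<in> proj_space A zero_space. \<forall>z\<in>p. form A d c z \<noteq> 0}"

lemma basic_open_iff:
  assumes "z \<in> cvec A - zero_space"
  shows "proj_point A zero_space z \<in> basic_open A d c \<longleftrightarrow> form A d c z \<noteq> 0"
proof -
  have "z \<in> proj_point A zero_space z" unfolding proj_zero_iff(2)[OF assms assms] by (intro exI[of _ 1]) simp
  moreover have "form A d c x \<noteq> 0" if nz: "form A d c z \<noteq> 0" and x: "x \<in> proj_point A zero_space z" for x
  proof -
    obtain s where "s \<noteq> 0" "x = (\<lambda>a. s * z a)" using x unfolding proj_zero_iff(2)[OF assms assms] by blast
    then show ?thesis using nz form_scale[of A d c s z] by simp
  qed
  moreover have "proj_point A zero_space z \<in> proj_space A zero_space"
    unfolding proj_space_iff using assms by (rule bexI[rotated]) (rule refl)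
  ultimately show ?thesis by blast
qed

lemma openin_basic: "openin (zariski A) (basic_open A d c)"
  unfolding zariski_def by (rule topology_generated_by_Basis) blast

text \<open>Induction on the generation of the topology; intersections are handled by products of
  polynomials. In the induction the claim is made for each point of the set, which builds in
  nonemptiness.\<close>

lemma open_contains_generic:
  assumes "openin (zariski A) S" "S \<noteq> {}"
  shows "\<exists>F. polyf A F \<and> (\<exists>z. F z \<noteq> 0) \<and> (\<forall>z\<in>cvec A - zero_space. F z \<noteq> 0 \<longrightarrow> proj_point A zero_space z \<in> S)"
proof -
  let ?B = "{basic_open A d c | d c. True}"
  have "generate_topology_on ?B S" using assms(1) by (simp add: zariski_def openin_topology_generated_by_iff)
  then have "\<forall>s\<in>S. \<exists>F. polyf A F \<and> (\<exists>z. F z \<noteq> 0) \<and> (\<forall>z\<in>cvec A - zero_space. F z \<noteq> 0 \<longrightarrow> proj_point A zero_space z \<in> S)"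
  proof (induction rule: generate_topology_on.induct)
    case Empty
    then show ?case by simp
  next
    case (Int a b)
    show ?case
    proof
      fix s assume "s \<in> a \<inter> b"
      then obtain F F' where F: "polyf A F" "\<exists>z. F z \<noteq> 0" "\<forall>z\<in>cvec A - zero_space. F z \<noteq> 0 \<longrightarrow> proj_point A zero_space z \<in> a"
        and F': "polyf A F'" "\<exists>z. F' z \<noteq> 0" "\<forall>z\<in>cvec A - zero_space. F' z \<noteq> 0 \<longrightarrow> proj_point A zero_space z \<in> b"
        using Int.IH by blast
      have "\<exists>z. F z * F' z \<noteq> 0" using polyf_nonzero_mult[OF F(1) F'(1)] F(2) F'(2) by auto
      then show "\<exists>F. polyf A F \<and> (\<exists>z. F z \<noteq> 0) \<and> (\<forall>z\<in>cvec A - zero_space. F z \<noteq> 0 \<longrightarrow> proj_point A zero_space z \<in> a \<inter> b)"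
        using F(3) F'(3) polyf_mult[OF F(1) F'(1)] by (intro exI[of _ "\<lambda>z. F z * F' z"]) auto
    qed
  next
    case (UN K)
    show ?case
    proof
      fix s assume "s \<in> \<Union> K"
      then obtain k where k: "k \<in> K" "s \<in> k" by blast
      from UN.IH[OF k(1)] k(2) obtain F where "polyf A F" "\<exists>z. F z \<noteq> 0"
        "\<forall>z\<in>cvec A - zero_space. F z \<noteq> 0 \<longrightarrow> proj_point A zero_space z \<in> k" by blast
      then show "\<exists>F. polyf A F \<and> (\<exists>z. F z \<noteq> 0) \<and> (\<forall>z\<in>cvec A - zero_space. F z \<noteq> 0 \<longrightarrow> proj_point A zero_space z \<in> \<Union> K)"
        using k(1) by (intro exI[of _ F]) blast
    qed
  next
    case (Basis s)
    then obtain d c where s: "s = basic_open A d c" by blast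
    show ?case
    proof
      fix p assume p: "p \<in> s"
      then obtain z where z: "z \<in> cvec A - zero_space" "p = proj_point A zero_space z" using s proj_space_iff by blast
      then have "form A d c z \<noteq> 0" using p s basic_open_iff[OF z(1)] by simp
      then show "\<exists>F. polyf A F \<and> (\<exists>z. F z \<noteq> 0) \<and> (\<forall>z\<in>cvec A - zero_space. F z \<noteq> 0 \<longrightarrow> proj_point A zero_space z \<in> s)"
        using s basic_open_iff polyf_form by blast
    qed
  qed
  then show ?thesis using assms(2) by blast
qed

lemma polyf_nonzero_cvec:
  assumes "polyf A F" "F z \<noteq> 0" "polyf A F'" "F' z' \<noteq> 0" "A \<noteq> {}"
  shows "\<exists>w\<in>cvec A - zero_space. F w \<noteq> 0 \<and> F' w \<noteq> 0"
proof -
  obtain a where a: "a \<in> A" using assms(5) by blast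
  obtain w where w: "F w \<noteq> 0" "F' w \<noteq> 0" using polyf_nonzero_mult[of A F F' z z'] assms(1-4) by blast
  have "\<exists>w. F w * F' w \<noteq> 0 \<and> w a \<noteq> 0"
    using polyf_nonzero_mult[of A "\<lambda>x. F x * F' x" "\<lambda>x. x a" w "\<lambda>_. 1", OF polyf_mult[OF assms(1,3)] polyf_var[OF a]] w
    by auto
  then obtain w where w: "F w \<noteq> 0" "F' w \<noteq> 0" "w a \<noteq> 0" by auto
  have "F (rst A w) = F w" "F' (rst A w) = F' w"
    using polyf_cong[OF assms(1), of "rst A w" w] polyf_cong[OF assms(3), of "rst A w" w] by auto
  moreover have "rst A w \<in> cvec A - zero_space"
    using w(3) a rst_in_cvec[of A w] by (auto simp: zero_space_def rst_def fun_eq_iff)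
  ultimately show ?thesis using w by (intro bexI[of _ "rst A w"]) auto
qed

section \<open>The Laman number as a generic solution count\<close>

text \<open>\<open>const_space G\<close> is the kernel of the coboundary, so points of the
  projective space are nonzero cut vectors up to a scalar.\<close>

lemma graph_proj_eq:
  assumes wf: "wf_mgraph G" and o: "orient G p q"
    and x: "x \<in> cvec (verts G) - const_space G" "x' \<in> cvec (verts G) - const_space G"
  shows "proj_point (verts G) (const_space G) x = proj_point (verts G) (const_space G) x' \<longleftrightarrow>
    (\<exists>c. c \<noteq> 0 \<and> tens (edges G) p q x' = (\<lambda>e. c * tens (edges G) p q x e))"
proof -
  let ?d = "tens (edges G) p q" and ?X = "cvec (verts G) - const_space G"
  have const: "y \<in> const_space G \<longleftrightarrow> ?d y = (\<lambda>_. 0)" if "y \<in> cvec (verts G)" for y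
  proof -
    have "y \<in> const_space G \<longleftrightarrow> (\<forall>e\<in>edges G. y (p e) = y (q e))"
      using that path_rel_constant_iff[OF wf o order_refl, of y] by (simp add: const_space_def)
    also have "\<dots> \<longleftrightarrow> ?d y = (\<lambda>_. 0)" by (auto simp: tens_def fun_eq_iff)
    finally show ?thesis .
  qed
  have "(\<lambda>a. y' a - c * y a) \<in> const_space G \<longleftrightarrow> ?d y' = (\<lambda>e. c * ?d y e)"
    if "y \<in> cvec (verts G)" "y' \<in> cvec (verts G)" for y y' c
  proof -
    have "(\<lambda>a. y' a - c * y a) \<in> cvec (verts G)" using that by (simp add: cvec_def)
    then show ?thesis using const[of "\<lambda>a. y' a - c * y a"] by (auto simp: tens_def fun_eq_iff algebra_simps)
  qed
  then have rel: "(y, y') \<in> proj_rel (verts G) (const_space G) \<longleftrightarrow>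
      y \<in> ?X \<and> y' \<in> ?X \<and> (\<exists>c. c \<noteq> 0 \<and> ?d y' = (\<lambda>e. c * ?d y e))" for y y'
    unfolding proj_rel_def by auto
  show ?thesis
  proof
    assume "proj_point (verts G) (const_space G) x = proj_point (verts G) (const_space G) x'"
    moreover have "(x', x') \<in> proj_rel (verts G) (const_space G)"
      unfolding rel using x by (intro conjI exI[of _ 1]) auto
    ultimately have "(x, x') \<in> proj_rel (verts G) (const_space G)" unfolding proj_point_def by blast
    then show "\<exists>c. c \<noteq> 0 \<and> ?d x' = (\<lambda>e. c * ?d x e)" unfolding rel by blast
  next
    assume "\<exists>c. c \<noteq> 0 \<and> ?d x' = (\<lambda>e. c * ?d x e)"
    then obtain c where c: "c \<noteq> 0" "?d x' = (\<lambda>e. c * ?d x e)" by blast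
    have "(x, y) \<in> proj_rel (verts G) (const_space G) \<longleftrightarrow> (x', y) \<in> proj_rel (verts G) (const_space G)" for y
    proof
      assume "(x, y) \<in> proj_rel (verts G) (const_space G)"
      then obtain d where d: "d \<noteq> 0" "y \<in> ?X" "?d y = (\<lambda>e. d * ?d x e)" unfolding rel by blast
      have "\<exists>b. b \<noteq> 0 \<and> ?d y = (\<lambda>e. b * ?d x' e)"
        unfolding c(2) d(3) using c(1) d(1) by (intro exI[of _ "d / c"]) auto
      then show "(x', y) \<in> proj_rel (verts G) (const_space G)" unfolding rel using x d(2) by blast
    next
      assume "(x', y) \<in> proj_rel (verts G) (const_space G)"
      then obtain d where d: "d \<noteq> 0" "y \<in> ?X" "?d y = (\<lambda>e. d * ?d x' e)" unfolding rel by blast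
      have "\<exists>b. b \<noteq> 0 \<and> ?d y = (\<lambda>e. b * ?d x e)"
        unfolding d(3) c(2) using c(1) d(1) by (intro exI[of _ "d * c"]) auto
      then show "(x, y) \<in> proj_rel (verts G) (const_space G)" unfolding rel using x d(2) by blast
    qed
    then show "proj_point (verts G) (const_space G) x = proj_point (verts G) (const_space G) x'"
      unfolding proj_point_def by blast
  qed
qed

lemma tens_rst:
  assumes "wf_mgraph G" "orient G p q"
  shows "tens (edges G) p q (rst (verts G) x) = tens (edges G) p q x"
  using assms by (auto simp: tens_def fun_eq_iff wf_mgraph_def orient_def)

lemma not_const_space:
  assumes "wf_mgraph G" "orient G p q" "x \<in> cvec (verts G)" "tens (edges G) p q x g \<noteq> 0"
  shows "x \<in> cvec (verts G) - const_space G"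
  using assms path_rel_constant_iff[OF assms(1,2) order_refl, of x]
  by (auto simp: const_space_def tens_def split: if_splits)

text \<open>A point of the fiber is a pair of cut vectors, each up to a scalar, whose products are
  proportional to \<open>l\<close>. The two scalars are used up by the requirements
  \<open>u g = 1\<close> and that the products equal \<open>l\<close>.\<close>

lemma fiber_bij:
  assumes G: "wf_mgraph (lgraph B)" "orient (lgraph B) p q" and H: "wf_mgraph (rgraph B)" "orient (rgraph B) p' q'"
    and E: "edges (lgraph B) = Y" "edges (rgraph B) = Y"
    and dG: "\<And>e x. e \<in> Y \<Longrightarrow> edge_diff (lgraph B) (lord B) x e = x (p e) - x (q e)"
    and dH: "\<And>e x. e \<in> Y \<Longrightarrow> edge_diff (rgraph B) (rord B) x e = x (p' e) - x (q' e)"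
    and g: "g \<in> Y" and l: "l \<in> cvec Y" "\<forall>f\<in>Y. l f \<noteq> 0"
  shows "\<exists>\<phi>. bij_betw \<phi> (sol Y (cutsp Y p q) (cutsp Y p' q') g l) (fiber (laman_map B) (proj_point Y zero_space l))"
proof -
  let ?V = "verts (lgraph B)" and ?W = "verts (rgraph B)"
  let ?PG = "proj_point ?V (const_space (lgraph B))" and ?PH = "proj_point ?W (const_space (rgraph B))"
  let ?S = "sol Y (cutsp Y p q) (cutsp Y p' q') g l"
  let ?d = "tens Y p q" and ?d' = "tens Y p' q'"
  let ?X = "cvec ?V - const_space (lgraph B)" and ?X' = "cvec ?W - const_space (rgraph B)"
  have bi: "biedges B = Y" using E by (simp add: biedges_def)
  have ep: "edge_products B x y = (\<lambda>e. ?d x e * ?d' y e)" for x y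
    by (auto simp: edge_products_def bi tens_def dG dH fun_eq_iff)
  have lz: "l \<in> cvec Y - zero_space" using l g by (auto simp: zero_space_def)
  have fib: "(P, Q) \<in> fiber (laman_map B) (proj_point Y zero_space l) \<longleftrightarrow>
      (\<exists>x y. P = ?PG x \<and> Q = ?PH y \<and> x \<in> ?X \<and> y \<in> ?X' \<and> (\<exists>c. c \<noteq> 0 \<and> (\<forall>e\<in>Y. ?d x e * ?d' y e = c * l e)))" for P Q
  proof -
    have "(edge_products B x y \<notin> zero_space \<and> proj_point Y zero_space l = proj_point Y zero_space (edge_products B x y))
        \<longleftrightarrow> (\<exists>c. c \<noteq> 0 \<and> (\<forall>e\<in>Y. ?d x e * ?d' y e = c * l e))" for x y
    proof
      assume *: "edge_products B x y \<notin> zero_space \<and> proj_point Y zero_space l = proj_point Y zero_space (edge_products B x y)"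
      then have "edge_products B x y \<in> cvec Y - zero_space" by (auto simp: ep cvec_def tens_def)
      then show "\<exists>c. c \<noteq> 0 \<and> (\<forall>e\<in>Y. ?d x e * ?d' y e = c * l e)"
        using * proj_zero_iff(1)[OF lz, of "edge_products B x y"] by (auto simp: ep fun_eq_iff)
    next
      assume "\<exists>c. c \<noteq> 0 \<and> (\<forall>e\<in>Y. ?d x e * ?d' y e = c * l e)"
      then obtain c where c: "c \<noteq> 0" "\<forall>e\<in>Y. ?d x e * ?d' y e = c * l e" by blast
      have eq: "edge_products B x y = (\<lambda>e. c * l e)"
      proof
        show "edge_products B x y e = c * l e" for e
          using c(2) l(1) by (cases "e \<in> Y") (auto simp: ep tens_def cvec_def)
      qed
      then have "edge_products B x y \<in> cvec Y - zero_space"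
        using lz c(1) by (auto simp: cvec_def zero_space_def fun_eq_iff)
      then show "edge_products B x y \<notin> zero_space \<and> proj_point Y zero_space l = proj_point Y zero_space (edge_products B x y)"
        using proj_zero_iff(1)[OF lz, of "edge_products B x y"] eq c(1) by blast
    qed
    then show ?thesis unfolding fiber_def laman_map_def bi by blast
  qed
  define x where "x u = (SOME x. x \<in> cvec ?V \<and> ?d x = u)" for u
  define y where "y w = (SOME y. y \<in> cvec ?W \<and> ?d' y = w)" for w
  have x: "x u \<in> cvec ?V" "?d (x u) = u" if u: "u \<in> cutsp Y p q" for u
  proof -
    obtain z where "u = ?d z" using u by (auto simp: cutsp_def)
    then have "rst ?V z \<in> cvec ?V \<and> ?d (rst ?V z) = u" using tens_rst[OF G, of z] by (simp add: rst_in_cvec E)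
    then have "\<exists>x. x \<in> cvec ?V \<and> ?d x = u" by blast
    from someI_ex[OF this] have "x u \<in> cvec ?V \<and> ?d (x u) = u" by (simp only: x_def)
    then show "x u \<in> cvec ?V" "?d (x u) = u" by auto
  qed
  have y: "y w \<in> cvec ?W" "?d' (y w) = w" if w: "w \<in> cutsp Y p' q'" for w
  proof -
    obtain z where "w = ?d' z" using w by (auto simp: cutsp_def)
    then have "rst ?W z \<in> cvec ?W \<and> ?d' (rst ?W z) = w" using tens_rst[OF H, of z] by (simp add: rst_in_cvec E)
    then have "\<exists>y. y \<in> cvec ?W \<and> ?d' y = w" by blast
    from someI_ex[OF this] have "y w \<in> cvec ?W \<and> ?d' (y w) = w" by (simp only: y_def)
    then show "y w \<in> cvec ?W" "?d' (y w) = w" by auto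
  qed
  have S: "u \<in> cutsp Y p q" "w \<in> cutsp Y p' q'" "u g = 1" "\<And>f. f \<in> Y \<Longrightarrow> u f * w f = l f" "w g \<noteq> 0"
      "x u \<in> ?X" "y w \<in> ?X'" if "(u, w) \<in> ?S" for u w
  proof -
    show *: "u \<in> cutsp Y p q" "w \<in> cutsp Y p' q'" "u g = 1" "\<And>f. f \<in> Y \<Longrightarrow> u f * w f = l f"
      using that by (auto simp: sol_def)
    show wg: "w g \<noteq> 0" using *(3) *(4)[OF g] l(2) g by auto
    show "x u \<in> ?X" using not_const_space[OF G x(1)[OF *(1)], of g] x(2)[OF *(1)] *(3) by (simp add: E)
    show "y w \<in> ?X'" using not_const_space[OF H y(1)[OF *(2)], of g] y(2)[OF *(2)] wg by (simp add: E)
  qed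
  have "bij_betw (\<lambda>(u, w). (?PG (x u), ?PH (y w))) ?S (fiber (laman_map B) (proj_point Y zero_space l))"
    unfolding bij_betw_def
  proof (intro conjI)
    show "inj_on (\<lambda>(u, w). (?PG (x u), ?PH (y w))) ?S"
    proof (rule inj_onI, clarify)
      fix u w u' w' assume uw: "(u, w) \<in> ?S" "(u', w') \<in> ?S"
        and eq: "?PG (x u) = ?PG (x u')" "?PH (y w) = ?PH (y w')"
      obtain c where "u' = (\<lambda>e. c * u e)"
        using eq(1) graph_proj_eq[OF G S(6)[OF uw(1)] S(6)[OF uw(2)]] x(2) S(1)[OF uw(1)] S(1)[OF uw(2)] E by auto
      then have "u = u'" using S(3)[OF uw(1)] S(3)[OF uw(2)] by (auto simp: fun_eq_iff dest: spec[of _ g])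
      moreover have "w = w'"
      proof (rule cvec_eqI[of _ Y])
        show "w \<in> cvec Y" "w' \<in> cvec Y" using S(2)[OF uw(1)] S(2)[OF uw(2)] cutsp_cvec by blast+
        fix f assume f: "f \<in> Y"
        have "u f * w f = u f * w' f" using S(4)[OF uw(1) f] S(4)[OF uw(2) f] \<open>u = u'\<close> by simp
        moreover have "u f \<noteq> 0" using S(4)[OF uw(1) f] l(2) f by auto
        ultimately show "w f = w' f" by simp
      qed
      ultimately show "u = u' \<and> w = w'" by blast
    qed
    show "(\<lambda>(u, w). (?PG (x u), ?PH (y w))) ` ?S = fiber (laman_map B) (proj_point Y zero_space l)"
    proof (intro equalityI subsetI)
      fix P assume "P \<in> (\<lambda>(u, w). (?PG (x u), ?PH (y w))) ` ?S"
      then obtain u w where uw: "(u, w) \<in> ?S" "P = (?PG (x u), ?PH (y w))" by auto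
      have "\<forall>e\<in>Y. ?d (x u) e * ?d' (y w) e = 1 * l e"
        using S(4)[OF uw(1)] x(2)[OF S(1)[OF uw(1)]] y(2)[OF S(2)[OF uw(1)]] by simp
      then show "P \<in> fiber (laman_map B) (proj_point Y zero_space l)"
        unfolding uw(2) fib using S(6,7)[OF uw(1)] zero_neq_one by metis
    next
      fix P assume P: "P \<in> fiber (laman_map B) (proj_point Y zero_space l)"
      obtain P1 P2 where P12: "P = (P1, P2)" by (cases P)
      obtain x' y' c where xy: "P1 = ?PG x'" "P2 = ?PH y'" "x' \<in> ?X" "y' \<in> ?X'" "c \<noteq> 0"
        "\<forall>e\<in>Y. ?d x' e * ?d' y' e = c * l e" using P unfolding P12 fib by blast
      define k where "k = ?d x' g"
      have k: "k \<noteq> 0" using xy(5,6) g l(2) unfolding k_def by (metis mult_eq_0_iff)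
      \<comment> \<open>The factors \<open>1 / k\<close> and \<open>k / c\<close> normalise
        \<open>u\<close> at \<open>g\<close> and turn the products \<open>c * l\<close> into
        \<open>l\<close>.\<close>
      define u where "u = (\<lambda>e. 1 / k * ?d x' e)"
      define w where "w = (\<lambda>e. k / c * ?d' y' e)"
      have uw: "(u, w) \<in> ?S"
      proof -
        have "u \<in> cutsp Y p q" "w \<in> cutsp Y p' q'"
          unfolding u_def w_def by (intro subsp_scale subsp_cutsp; simp add: cutsp_def)+
        moreover have "u g = 1" using k by (simp add: u_def k_def)
        moreover have "u f * w f = l f" if "f \<in> Y" for f
        proof -
          have "u f * w f = (?d x' f * ?d' y' f) / c" using k by (simp add: u_def w_def)
          then show ?thesis using xy(5,6) that by simp
        qed
        ultimately show ?thesis by (simp add: sol_def)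
      qed
      have "?PG x' = ?PG (x u)"
        unfolding graph_proj_eq[OF G xy(3) S(6)[OF uw]] E x(2)[OF S(1)[OF uw]]
        using k by (intro exI[of _ "1 / k"]) (simp add: u_def)
      moreover have "?PH y' = ?PH (y w)"
        unfolding graph_proj_eq[OF H xy(4) S(7)[OF uw]] E y(2)[OF S(2)[OF uw]]
        using k xy(5) by (intro exI[of _ "k / c"]) (simp add: w_def)
      ultimately show "P \<in> (\<lambda>(u, w). (?PG (x u), ?PH (y w))) ` ?S"
        unfolding P12 xy(1,2) using uw by (intro image_eqI[of _ _ "(u, w)"]) auto
    qed
  qed
  then show ?thesis by blast
qed

text \<open>A homogeneous component turns the generic condition on \<open>l\<close> into a nonempty
  Zariski open set of points with \<open>N\<close> preimages. Any other nonempty open set shares a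
  generic vector with it, which makes the degree unique. For \<open>N = 0\<close> the image misses
  this set; otherwise it meets every nonempty open set and is dense.\<close>

theorem Lam_eq_generic_count:
  assumes wf: "wf_bigraph B" and Y: "biedges B = Y" "Y \<noteq> {}"
    and o: "orient (lgraph B) s t" "orient (rgraph B) s' t'"
    and gen: "gen Y (cnt Y (cutsp Y s t) (cutsp Y s' t') N)"
  shows "Lam B = enat N"
proof -
  have G: "wf_mgraph (lgraph B)" and H: "wf_mgraph (rgraph B)"
    and E: "edges (lgraph B) = Y" "edges (rgraph B) = Y"
    using wf Y(1) by (auto simp: wf_bigraph_def biedges_def)
  have finY: "finite Y" using G E by (auto simp: wf_mgraph_def)
  obtain p q where pq: "orient (lgraph B) p q" "\<And>e x. e \<in> Y \<Longrightarrow> edge_diff (lgraph B) (lord B) x e = x (p e) - x (q e)"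
    using orient_exists[OF G, of "lord B"] wf E by (auto simp: wf_bigraph_def)
  obtain p' q' where pq': "orient (rgraph B) p' q'" "\<And>e x. e \<in> Y \<Longrightarrow> edge_diff (rgraph B) (rord B) x e = x (p' e) - x (q' e)"
    using orient_exists[OF H, of "rord B"] wf E by (auto simp: wf_bigraph_def)
  have gen': "gen Y (cnt Y (cutsp Y p q) (cutsp Y p' q') N)"
    by (rule gen_cnt_reorient[OF o(1) pq(1) o(2) pq'(1) E gen])
  obtain P l0 where P: "polyf Y P" "P l0 \<noteq> 0" "\<And>l. P l \<noteq> 0 \<Longrightarrow> cnt Y (cutsp Y p q) (cutsp Y p' q') N l"
    using gen' unfolding gen_def by blast
  have fib: "ecard (fiber (laman_map B) (proj_point Y zero_space l)) = enat N"
    if "P l \<noteq> 0" "l \<in> cvec Y" for l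
  proof -
    have c: "cnt Y (cutsp Y p q) (cutsp Y p' q') N l" by (rule P(3)[OF that(1)])
    obtain g where g: "g \<in> Y" using Y(2) by blast
    have "\<forall>f\<in>Y. l f \<noteq> 0" using c by (simp add: cnt_def)
    from fiber_bij[OF G pq(1) H pq'(1) E pq(2) pq'(2) g that(2) this]
    obtain \<phi> where "bij_betw \<phi> (sol Y (cutsp Y p q) (cutsp Y p' q') g l) (fiber (laman_map B) (proj_point Y zero_space l))"
      by blast
    from bij_betw_finite[OF this] bij_betw_same_card[OF this] show ?thesis
      using c g by (simp add: cnt_def ecard_def)
  qed
  obtain d c where dc: "\<exists>z. form Y d c z \<noteq> 0" "\<And>z. form Y d c z \<noteq> 0 \<Longrightarrow> \<exists>s. s \<noteq> 0 \<and> P (\<lambda>a. s * z a) \<noteq> 0"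
    using polyf_homogeneous_component[OF finY P(1,2)] by blast
  define D where "D = basic_open Y d c"
  have D: "openin (zariski Y) D" unfolding D_def by (rule openin_basic)
  have fibD: "ecard (fiber (laman_map B) r) = enat N" if r: "r \<in> D" for r
  proof -
    obtain z where z: "z \<in> cvec Y - zero_space" "r = proj_point Y zero_space z"
      using r proj_space_iff[of r Y] unfolding D_def by auto
    then have "form Y d c z \<noteq> 0" using r basic_open_iff[OF z(1), of d c] unfolding D_def z(2) by blast
    then obtain s where s: "s \<noteq> 0" "P (\<lambda>a. s * z a) \<noteq> 0" using dc(2) by blast
    have sz: "(\<lambda>a. s * z a) \<in> cvec Y - zero_space"
      using z(1) s(1) by (auto simp: cvec_def zero_space_def fun_eq_iff)
    have "r = proj_point Y zero_space (\<lambda>a. s * z a)" unfolding z(2) proj_zero_iff(1)[OF z(1) sz] using s(1) by blast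
    then show ?thesis using fib[OF s(2)] sz by simp
  qed
  have Dne: "D \<noteq> {}"
  proof -
    obtain z where "form Y d c z \<noteq> 0" using dc(1) by blast
    then obtain w where "w \<in> cvec Y - zero_space" "form Y d c w \<noteq> 0"
      using polyf_nonzero_cvec[OF polyf_form _ polyf_form, of Y d c z d c z] Y(2) by blast
    then have "proj_point Y zero_space w \<in> D" unfolding D_def using basic_open_iff[of w Y d c] by blast
    then show ?thesis by blast
  qed
  have deg: "map_degree B = enat N"
    unfolding map_degree_def Y(1)
  proof (rule the_equality)
    show "\<exists>U. openin (zariski Y) U \<and> U \<noteq> {} \<and> (\<forall>q\<in>U. ecard (fiber (laman_map B) q) = enat N)"
      using D Dne fibD by blast
    fix n assume "\<exists>U. openin (zariski Y) U \<and> U \<noteq> {} \<and> (\<forall>q\<in>U. ecard (fiber (laman_map B) q) = n)"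
    then obtain U where U: "openin (zariski Y) U" "U \<noteq> {}" "\<forall>q\<in>U. ecard (fiber (laman_map B) q) = n" by blast
    obtain F z where F: "polyf Y F" "F z \<noteq> 0" "\<forall>z\<in>cvec Y - zero_space. F z \<noteq> 0 \<longrightarrow> proj_point Y zero_space z \<in> U"
      using open_contains_generic[OF U(1,2)] by blast
    obtain w where "w \<in> cvec Y - zero_space" "F w \<noteq> 0" "P w \<noteq> 0"
      using polyf_nonzero_cvec[OF F(1,2) P(1,2) Y(2)] by blast
    then show "n = enat N" using F(3) U(3) fib[of w] by auto
  qed
  show ?thesis
  proof (cases "N = 0")
    case True
    have "fiber (laman_map B) r = {}" if "r \<in> D" for r
      using fibD[OF that] True by (auto simp: ecard_def zero_enat_def split: if_splits)
    then have "Range (laman_map B) \<inter> D = {}" by (auto simp: fiber_def)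
    then have "\<not> dominant B"
      unfolding dominant_def Y(1) dense_intersects_open using D Dne by blast
    then show ?thesis using True by (simp add: Lam_def zero_enat_def)
  next
    case False
    have "dominant B"
      unfolding dominant_def Y(1) dense_intersects_open
    proof (intro conjI allI impI)
      have ne: "r \<in> Range (laman_map B)" if "ecard (fiber (laman_map B) r) = enat N" for r
      proof -
        have "fiber (laman_map B) r \<noteq> {}" using that False by (auto simp: ecard_def)
        then show ?thesis by (auto simp: fiber_def)
      qed
      obtain r where "r \<in> D" using Dne by blast
      from ne[OF fibD[OF this]] show "laman_map B \<noteq> {}" by auto
      fix T assume "openin (zariski Y) T \<and> T \<noteq> {}"
      then obtain F z where F: "polyf Y F" "F z \<noteq> 0" "\<forall>z\<in>cvec Y - zero_space. F z \<noteq> 0 \<longrightarrow> proj_point Y zero_space z \<in> T"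
        using open_contains_generic by blast
      obtain w where "w \<in> cvec Y - zero_space" "F w \<noteq> 0" "P w \<noteq> 0"
        using polyf_nonzero_cvec[OF F(1,2) P(1,2) Y(2)] by blast
      then show "Range (laman_map B) \<inter> T \<noteq> {}" using F(3) ne fib[of w] by blast
    qed
    then show ?thesis using deg by (simp add: Lam_def)
  qed
qed

section \<open>The recursion for Laman numbers\<close>

lemma bigraph_via_cutsp:
  assumes wf: "wf_bigraph B" and Y: "biedges B = Y"
    and o: "orient (lgraph B) p q" "orient (rgraph B) p' q'"
    and U: "cutsp Y p q = U" and W: "cutsp Y p' q' = W"
  shows "pseudo_Laman B \<longleftrightarrow> rk U + rk W = card Y + 1"
    and "Y \<noteq> {} \<Longrightarrow> rk U + rk W \<le> card Y + 1 \<Longrightarrow> Lam B = enat (pcnt Y U W)"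
proof -
  have G: "wf_mgraph (lgraph B)" and H: "wf_mgraph (rgraph B)"
    and E: "edges (lgraph B) = Y" "edges (rgraph B) = Y"
    using wf Y by (auto simp: wf_bigraph_def biedges_def)
  have fin: "finite Y" using G E by (simp add: wf_mgraph_def)
  show "pseudo_Laman B \<longleftrightarrow> rk U + rk W = card Y + 1"
    using rk_cutsp[OF G o(1)] rk_cutsp[OF H o(2)] by (simp add: pseudo_Laman_def Y E U W)
  assume ne: "Y \<noteq> {}" and r: "rk U + rk W \<le> card Y + 1"
  have sub: "subsp U" "U \<subseteq> cvec Y" "subsp W" "W \<subseteq> cvec Y"
    using subsp_cutsp cutsp_cvec U W by blast+
  have "gen Y (good Y U W (pcnt Y U W))" by (rule gen_pcnt(1)[OF fin ne sub r])
  then have "gen Y (cnt Y U W (pcnt Y U W))" by (rule gen_mp) (rule good_cnt)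
  then show "Lam B = enat (pcnt Y U W)"
    using Lam_eq_generic_count[OF wf Y ne o, of "pcnt Y U W"] by (simp add: U W)
qed

lemma left_quot_via_cutsp:
  assumes wf: "wf_bigraph B" and o: "orient (lgraph B) p q" "orient (rgraph B) p' q'"
    and M: "M \<subseteq> biedges B" and Y: "Y = biedges B - M"
    and U: "U = cutsp (biedges B) p q" and W: "W = cutsp (biedges B) p' q'"
    and ord: "strict_linear_order_on (verts (quot_graph (lgraph B) M)) r"
      "strict_linear_order_on (verts (del_graph (rgraph B) M)) s"
  shows "pseudo_Laman (left_quot B M r s) \<longleftrightarrow> rk (minr U M Y) + rk (minr W {} Y) = card Y + 1"
    and "Y \<noteq> {} \<Longrightarrow> rk (minr U M Y) + rk (minr W {} Y) \<le> card Y + 1 \<Longrightarrow>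
      Lam (left_quot B M r s) = enat (pcnt Y (minr U M Y) (minr W {} Y))"
proof -
  let ?L = "left_quot B M r s"
  have G: "wf_mgraph (lgraph B)" and H: "wf_mgraph (rgraph B)"
    and E: "edges (lgraph B) = biedges B" "edges (rgraph B) = biedges B"
    using wf by (auto simp: wf_bigraph_def biedges_def)
  have wf': "wf_bigraph ?L"
    using wf_quot_graph[OF G, of M] wf_del_graph[OF H, of M] ord E
    by (simp add: wf_bigraph_def left_quot_def quot_graph_def del_graph_def)
  have Y': "biedges ?L = Y" by (simp add: biedges_def left_quot_def quot_graph_def Y)
  have o': "orient (lgraph ?L) (\<lambda>e. cls (lgraph B) M (p e)) (\<lambda>e. cls (lgraph B) M (q e))" "orient (rgraph ?L) p' q'"
    using orient_quot[OF o(1)] orient_del[OF o(2)] by (simp_all add: left_quot_def)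
  have U': "cutsp Y (\<lambda>e. cls (lgraph B) M (p e)) (\<lambda>e. cls (lgraph B) M (q e)) = minr U M Y"
    using cutsp_quot[OF G o(1), of M] M by (simp add: E Y U)
  have W': "cutsp Y p' q' = minr W {} Y" by (simp add: Y W cutsp_del)
  show "pseudo_Laman ?L \<longleftrightarrow> rk (minr U M Y) + rk (minr W {} Y) = card Y + 1"
    by (rule bigraph_via_cutsp(1)[OF wf' Y' o' U' W'])
  show "Y \<noteq> {} \<Longrightarrow> rk (minr U M Y) + rk (minr W {} Y) \<le> card Y + 1 \<Longrightarrow>
      Lam ?L = enat (pcnt Y (minr U M Y) (minr W {} Y))"
    by (rule bigraph_via_cutsp(2)[OF wf' Y' o' U' W'])
qed

lemma right_quot_via_cutsp:
  assumes wf: "wf_bigraph B" and o: "orient (lgraph B) p q" "orient (rgraph B) p' q'"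
    and M: "M \<subseteq> biedges B" and Y: "Y = biedges B - M"
    and U: "U = cutsp (biedges B) p q" and W: "W = cutsp (biedges B) p' q'"
    and ord: "strict_linear_order_on (verts (del_graph (lgraph B) M)) r"
      "strict_linear_order_on (verts (quot_graph (rgraph B) M)) s"
  shows "pseudo_Laman (right_quot B M r s) \<longleftrightarrow> rk (minr U {} Y) + rk (minr W M Y) = card Y + 1"
    and "Y \<noteq> {} \<Longrightarrow> rk (minr U {} Y) + rk (minr W M Y) \<le> card Y + 1 \<Longrightarrow>
      Lam (right_quot B M r s) = enat (pcnt Y (minr U {} Y) (minr W M Y))"
proof -
  let ?R = "right_quot B M r s"
  have G: "wf_mgraph (lgraph B)" and H: "wf_mgraph (rgraph B)"
    and E: "edges (lgraph B) = biedges B" "edges (rgraph B) = biedges B"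
    using wf by (auto simp: wf_bigraph_def biedges_def)
  have wf': "wf_bigraph ?R"
    using wf_del_graph[OF G, of M] wf_quot_graph[OF H, of M] ord E
    by (simp add: wf_bigraph_def right_quot_def quot_graph_def del_graph_def)
  have Y': "biedges ?R = Y" by (simp add: biedges_def right_quot_def del_graph_def Y)
  have o': "orient (lgraph ?R) p q" "orient (rgraph ?R) (\<lambda>e. cls (rgraph B) M (p' e)) (\<lambda>e. cls (rgraph B) M (q' e))"
    using orient_del[OF o(1)] orient_quot[OF o(2)] by (simp_all add: right_quot_def)
  have U': "cutsp Y p q = minr U {} Y" by (simp add: Y U cutsp_del)
  have W': "cutsp Y (\<lambda>e. cls (rgraph B) M (p' e)) (\<lambda>e. cls (rgraph B) M (q' e)) = minr W M Y"
    using cutsp_quot[OF H o(2), of M] M by (simp add: E Y W)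
  show "pseudo_Laman ?R \<longleftrightarrow> rk (minr U {} Y) + rk (minr W M Y) = card Y + 1"
    by (rule bigraph_via_cutsp(1)[OF wf' Y' o' U' W'])
  show "Y \<noteq> {} \<Longrightarrow> rk (minr U {} Y) + rk (minr W M Y) \<le> card Y + 1 \<Longrightarrow>
      Lam ?R = enat (pcnt Y (minr U {} Y) (minr W M Y))"
    by (rule bigraph_via_cutsp(2)[OF wf' Y' o' U' W'])
qed

lemma cutsp_nonzero:
  assumes "orient G p q" "e \<in> edges G" "\<not> self_loop G e"
  shows "\<exists>u\<in>cutsp (edges G) p q. u e \<noteq> 0"
proof -
  have "p e \<noteq> q e" using assms by (auto simp: orient_def self_loop_def)
  then have "tens (edges G) p q (\<lambda>v. if v = p e then 1 else 0) e \<noteq> 0" using assms(2) by (simp add: tens_def)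
  then show ?thesis unfolding cutsp_def by blast
qed

lemma rk_minr_remove:
  assumes "finite E" "e \<in> E" "subsp U" "U \<subseteq> cvec E" "\<exists>u\<in>U. u e \<noteq> 0"
  shows "rk (minr U {e} (E - {e})) + 1 = rk U" "rk (minr U {} (E - {e})) \<le> rk U"
proof -
  have E: "E = (E - {e}) \<union> {e}" "E = {e} \<union> (E - {e})" using assms(2) by blast+
  have "rk U = rk (minr U {} ((E - {e}) \<union> {e}))" using minr_self[OF assms(4)] E(1) by simp
  also have "\<dots> = rk (minr U ({} \<union> {e}) (E - {e})) + rk (minr U {} {e})"
    by (rule rk_minr_add) (use assms in auto)
  finally show "rk (minr U {e} (E - {e})) + 1 = rk U" using rk_minr_single[OF assms(3), of "{}" e] assms(5) by simp
  have "rk U = rk (minr U {} ({e} \<union> (E - {e})))" using minr_self[OF assms(4)] E(2) by simp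
  also have "\<dots> = rk (minr U ({} \<union> (E - {e})) {e}) + rk (minr U {} (E - {e}))"
    by (rule rk_minr_add) (use assms in auto)
  finally show "rk (minr U {} (E - {e})) \<le> rk U" by simp
qed

text \<open>\<open>lq\<close>, \<open>ld\<close>, \<open>rd\<close> and \<open>rq\<close> supply
  arbitrary vertex orders for the quotients and deletions. At least two biedges are assumed because
  for a single one the left side is 1, while the minors on the right have no biedges and Laman
  number 0.\<close>

theorem theorem4p7:
  fixes B :: "('v, 'w, 'e) bigraph" and ebar :: 'e
    and lq :: "'e set \<Rightarrow> 'v set rel" and ld :: "'e set \<Rightarrow> 'w rel"
    and rd :: "'e set \<Rightarrow> 'v rel" and rq :: "'e set \<Rightarrow> 'w set rel"
  assumes "wf_bigraph B" and "pseudo_Laman B"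
    and "\<forall>e\<in>biedges B. \<not> self_loop (lgraph B) e \<and> \<not> self_loop (rgraph B) e"
    and "ebar \<in> biedges B"
    and "card (biedges B) \<ge> 2"
    and "\<forall>M \<subseteq> biedges B.
           strict_linear_order_on (verts (quot_graph (lgraph B) M)) (lq M) \<and>
           strict_linear_order_on (verts (del_graph (rgraph B) M)) (ld M) \<and>
           strict_linear_order_on (verts (del_graph (lgraph B) M)) (rd M) \<and>
           strict_linear_order_on (verts (quot_graph (rgraph B) M)) (rq M)"
  shows "Lam B =
      Lam (left_quot B {ebar} (lq {ebar}) (ld {ebar})) +
      Lam (right_quot B {ebar} (rd {ebar}) (rq {ebar})) +
      (\<Sum>(M, N) \<in> {(M, N). M \<subseteq> biedges B \<and> N \<subseteq> biedges B \<and>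
                       M \<union> N = biedges B \<and> M \<inter> N = {ebar} \<and>
                       card M \<ge> 2 \<and> card N \<ge> 2 \<and>
                       pseudo_Laman (left_quot B M (lq M) (ld M)) \<and>
                       pseudo_Laman (right_quot B N (rd N) (rq N))}.
         Lam (left_quot B M (lq M) (ld M)) * Lam (right_quot B N (rd N) (rq N)))"
proof -
  let ?E = "biedges B" and ?L = "\<lambda>M. left_quot B M (lq M) (ld M)" and ?R = "\<lambda>N. right_quot B N (rd N) (rq N)"
  let ?Y = "?E - {ebar}"
  have G: "wf_mgraph (lgraph B)" and H: "wf_mgraph (rgraph B)"
    and E: "edges (lgraph B) = ?E" "edges (rgraph B) = ?E"
    using assms(1) by (auto simp: wf_bigraph_def biedges_def)
  have finE: "finite ?E" using G E by (simp add: wf_mgraph_def)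
  obtain p q where pq: "orient (lgraph B) p q"
    using orient_exists[OF G, of "lord B"] assms(1) by (auto simp: wf_bigraph_def)
  obtain p' q' where pq': "orient (rgraph B) p' q'"
    using orient_exists[OF H, of "rord B"] assms(1) by (auto simp: wf_bigraph_def)
  define U where "U = cutsp ?E p q"
  define W where "W = cutsp ?E p' q'"
  have U: "subsp U" "U \<subseteq> cvec ?E" and W: "subsp W" "W \<subseteq> cvec ?E"
    unfolding U_def W_def using subsp_cutsp cutsp_cvec by blast+
  have nl: "\<exists>u\<in>U. u ebar \<noteq> 0" "\<exists>w\<in>W. w ebar \<noteq> 0"
    using cutsp_nonzero[OF pq, of ebar] cutsp_nonzero[OF pq', of ebar] assms(3,4) by (auto simp: U_def W_def E)
  note B = bigraph_via_cutsp[OF assms(1) refl pq pq' U_def[symmetric] W_def[symmetric]]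
  have rk: "rk U + rk W = card ?E + 1" using B(1) assms(2) by simp
  have ne: "?Y \<noteq> {}"
  proof
    assume "?Y = {}"
    then have "?E \<subseteq> {ebar}" by blast
    from card_mono[OF _ this] show False using assms(5) by simp
  qed
  have cY: "card ?Y + 1 = card ?E" using assms(4,5) by (simp add: card_Diff_singleton)
  have L: "pseudo_Laman (?L M) \<longleftrightarrow> rk (minr U M (?E - M)) + rk (minr W {} (?E - M)) = card (?E - M) + 1"
    "?E - M \<noteq> {} \<Longrightarrow> rk (minr U M (?E - M)) + rk (minr W {} (?E - M)) \<le> card (?E - M) + 1 \<Longrightarrow>
      Lam (?L M) = enat (pcnt (?E - M) (minr U M (?E - M)) (minr W {} (?E - M)))" if "M \<subseteq> ?E" for M
    using left_quot_via_cutsp[OF assms(1) pq pq' that refl U_def W_def] assms(6) that by blast+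
  have R: "pseudo_Laman (?R M) \<longleftrightarrow> rk (minr U {} (?E - M)) + rk (minr W M (?E - M)) = card (?E - M) + 1"
    "?E - M \<noteq> {} \<Longrightarrow> rk (minr U {} (?E - M)) + rk (minr W M (?E - M)) \<le> card (?E - M) + 1 \<Longrightarrow>
      Lam (?R M) = enat (pcnt (?E - M) (minr U {} (?E - M)) (minr W M (?E - M)))" if "M \<subseteq> ?E" for M
    using right_quot_via_cutsp[OF assms(1) pq pq' that refl U_def W_def] assms(6) that by blast+
  let ?S = "{(M, N). M \<subseteq> ?E \<and> N \<subseteq> ?E \<and> M \<union> N = ?E \<and> M \<inter> N = {ebar} \<and> card M \<ge> 2 \<and> card N \<ge> 2 \<and>
    pseudo_Laman (?L M) \<and> pseudo_Laman (?R N)}"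
  let ?T = "{(A, B). A \<union> B = ?Y \<and> A \<inter> B = {} \<and> A \<noteq> {} \<and> B \<noteq> {} \<and>
       rk (minr U (insert ebar B) A) + rk (minr W {} A) = card A + 1 \<and>
       rk (minr U {} B) + rk (minr W (insert ebar A) B) = card B + 1}"
  define cA where "cA = (\<lambda>A B. pcnt A (minr U (insert ebar B) A) (minr W {} A))"
  define cB where "cB = (\<lambda>A B. pcnt B (minr U {} B) (minr W (insert ebar A) B))"
  \<comment> \<open>Translates the cardinality conditions on \<M> and \<N>, both of which contain
    \<open>ebar\<close>, into nonemptiness of the two groups.\<close>
  have two: "2 \<le> card (insert ebar A) \<longleftrightarrow> A \<noteq> {}" if "A \<subseteq> ?Y" for A
  proof -
    have "finite A" "ebar \<notin> A" using that finE finite_subset[of A ?E] by blast+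
    then show ?thesis by (auto simp: card_gt_0_iff Suc_le_eq)
  qed
  \<comment> \<open>The correspondence is by complements: \<M> is contracted in \<open>G\<close> and
    its complement is the group \<open>A\<close>, while the complement of \<N> is \<open>B\<close>.
    Thus \<M> is \<open>insert ebar B\<close> and \<N> is \<open>insert ebar A\<close>.\<close>
  have sum: "(\<Sum>(M, N)\<in>?S. Lam (?L M) * Lam (?R N)) = (\<Sum>(A, B)\<in>?T. enat (cA A B * cB A B))"
  proof (rule sum.reindex_bij_witness[where i = "\<lambda>(A, B). (insert ebar B, insert ebar A)" and j = "\<lambda>(M, N). (?E - M, ?E - N)"])
    fix x assume x: "x \<in> ?S"
    obtain M N where MN: "x = (M, N)" by (cases x)
    have s: "M \<subseteq> ?E" "N \<subseteq> ?E" "M \<union> N = ?E" "M \<inter> N = {ebar}" "card M \<ge> 2" "card N \<ge> 2"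
      "pseudo_Laman (?L M)" "pseudo_Laman (?R N)" using x MN by auto
    have i: "insert ebar (?E - N) = M" "insert ebar (?E - M) = N" using s(3,4) by blast+
    then show "(case (case x of (M, N) \<Rightarrow> (?E - M, ?E - N)) of (A, B) \<Rightarrow> (insert ebar B, insert ebar A)) = x"
      by (simp add: MN)
    have "X \<noteq> {}" if "2 \<le> card (insert ebar X)" for X using that by (cases "X = {}") auto
    from this[of "?E - M"] this[of "?E - N"] have n: "?E - M \<noteq> {}" "?E - N \<noteq> {}"
      using s(5,6) unfolding i by blast+
    note l = s(7)[unfolded L(1)[OF s(1)]] and r = s(8)[unfolded R(1)[OF s(2)]]
    have "(?E - M) \<union> (?E - N) = ?Y" "(?E - M) \<inter> (?E - N) = {}" using s(3,4) by blast+
    then show "(case x of (M, N) \<Rightarrow> (?E - M, ?E - N)) \<in> ?T" using n l r by (simp add: MN i)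
    have "Lam (?L M) = enat (cA (?E - M) (?E - N))" "Lam (?R N) = enat (cB (?E - M) (?E - N))"
      using L(2)[OF s(1) n(1)] R(2)[OF s(2) n(2)] l r by (simp_all add: cA_def cB_def i)
    then show "(case case x of (M, N) \<Rightarrow> (?E - M, ?E - N) of (A, B) \<Rightarrow> enat (cA A B * cB A B)) =
        (case x of (M, N) \<Rightarrow> Lam (?L M) * Lam (?R N))" by (simp add: MN)
  next
    fix x assume x: "x \<in> ?T"
    obtain A B' where AB: "x = (A, B')" by (cases x)
    have t: "A \<union> B' = ?Y" "A \<inter> B' = {}" "A \<noteq> {}" "B' \<noteq> {}"
       "rk (minr U (insert ebar B') A) + rk (minr W {} A) = card A + 1"
       "rk (minr U {} B') + rk (minr W (insert ebar A) B') = card B' + 1" using x AB by auto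
    have i: "?E - insert ebar B' = A" "?E - insert ebar A = B'" using t(1,2) by blast+
    then show "(case (case x of (A, B) \<Rightarrow> (insert ebar B, insert ebar A)) of (M, N) \<Rightarrow> (?E - M, ?E - N)) = x"
      by (simp add: AB)
    have sub: "insert ebar B' \<subseteq> ?E" "insert ebar A \<subseteq> ?E" using t(1) assms(4) by blast+
    have ab: "A \<subseteq> ?Y" "B' \<subseteq> ?Y" using t(1) by blast+
    have c: "2 \<le> card (insert ebar B')" "2 \<le> card (insert ebar A)" using two[OF ab(1)] two[OF ab(2)] t(3,4) by blast+
    have u: "insert ebar B' \<union> insert ebar A = ?E" "insert ebar B' \<inter> insert ebar A = {ebar}"
      using t(1,2) assms(4) by blast+
    have "pseudo_Laman (?L (insert ebar B'))" "pseudo_Laman (?R (insert ebar A))"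
      using L(1)[OF sub(1)] R(1)[OF sub(2)] t(5,6) by (simp_all only: i)
    then show "(case x of (A, B) \<Rightarrow> (insert ebar B, insert ebar A)) \<in> ?S"
      unfolding AB prod.case mem_Collect_eq using sub u c by (intro conjI)
  qed
  \<comment> \<open>The contraction loses exactly one rank because \<open>ebar\<close> is no
    self-loop, and the deletion gains none. Equality may fail; then the single term is 0, which
    \<open>pcnt\<close> records as well.\<close>
  have "rk (minr U {ebar} ?Y) + rk (minr W {} ?Y) \<le> card ?Y + 1" "rk (minr U {} ?Y) + rk (minr W {ebar} ?Y) \<le> card ?Y + 1"
    using rk_minr_remove[OF finE assms(4) U nl(1)] rk_minr_remove[OF finE assms(4) W nl(2)] rk cY by linarith+
  then have LR: "Lam (?L {ebar}) = enat (pcnt ?Y (minr U {ebar} ?Y) (minr W {} ?Y))"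
      "Lam (?R {ebar}) = enat (pcnt ?Y (minr U {} ?Y) (minr W {ebar} ?Y))"
    using L(2)[of "{ebar}"] R(2)[of "{ebar}"] ne assms(4) by auto
  have "(\<Sum>(A, B)\<in>?T. enat (cA A B * cB A B)) = enat (\<Sum>(A, B)\<in>?T. cA A B * cB A B)"
    by (simp add: case_prod_unfold flip: of_nat_eq_enat)
  moreover have "Lam B = enat (pcnt ?E U W)" by (rule B(2)) (use rk assms(4) in auto)
  ultimately show ?thesis
    unfolding sum LR using pcnt_recursion[OF finE assms(4) ne U W rk nl] by (simp add: cA_def cB_def)
qed

end
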